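(* Let $d\in\{1,2,3\}$, $L>0$, $\Omega=[0,L]^d$, $Y=[0,1]^d$, and let $p,q$ be nonnegative integers and $K\in\mathbb{K}^{p,q}$ an averaging kernel (see context). Let $a\in C^\infty$ be a $Y$-periodic, positive and bounded scalar function on $\mathbb{R}^d$, and set $A^{\varepsilon}(\mathbf{x})=a(\mathbf{x}/\varepsilon)I$. Then there is a constant $C$, independent of $\varepsilon$ and $\eta$ but possibly depending on $K,p,q$ or $a$, such that for all $\eta>\varepsilon>0$, with $\tau=\eta$, and every quadratic polynomial $\hat u$ on $\mathbb{R}^d$, $$\sup_{\mathbf{x}_0\in\overline{\Omega}}\left|F(\mathbf{x}_0,\triangle\hat u)-\hat F(\mathbf{x}_0,\triangle\hat u)\right|\le C\left(\frac{\varepsilon}{\eta}\right)^{q+2}\left|\triangle\hat u\right|_\infty .$$ Here, for each $\mathbf{x}_0\in\overline{\Omega}$, $u^{\varepsilon,\eta}$ denotes the solution of $$\begin{cases}\partial_{tt}u^{\varepsilon,\eta}(t,\mathbf{x})=a(\mathbf{x}/\varepsilon)\,\triangle u^{\varepsilon,\eta}(t,\mathbf{x}) & \text{in }(0,\tau/2]\times\Omega_{\mathbf{x}_0,\eta},\\ u^{\varepsilon,\eta}(0,\mathbf{x})=\hat u(\mathbf{x}),\quad \partial_t u^{\varepsilon,\eta}(0,\mathbf{x})=0 & \text{on }\Omega_{\mathbf{x}_0,\eta},\\ u^{\varepsilon,\eta}(t,\cdot)-\hat u\ \text{ is periodic on }\Omega_{\mathbf{x}_0,\eta},\end{cases}$$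 extended to $t\in[-\tau/2,0)$ by $u^{\varepsilon,\eta}(-t,\mathbf{x})=u^{\varepsilon,\eta}(t,\mathbf{x})$, where $\Omega_{\mathbf{x}_0,\eta}=\mathbf{x}_0+[-\ell_\eta,\ell_\eta]^d$ with $\ell_\eta\ge\frac{\eta}{2}+\frac{\tau}{2}\sqrt{|a|_\infty}$; the upscaled quantity is $$F(\mathbf{x}_0,\triangle\hat u)=\int_{-\tau/2}^{\tau/2}\int_{\Omega_{\mathbf{x}_0,\eta}}K_\eta(\mathbf{x}-\mathbf{x}_0)\,K_\tau(t)\,a(\mathbf{x}/\varepsilon)\,\triangle u^{\varepsilon,\eta}(t,\mathbf{x})\,d\mathbf{x}\,dt;$$ and the homogenized quantity is $$\hat F(\mathbf{x}_0,\triangle\hat u)=a^0\,\triangle\hat u(\mathbf{x}_0),\qquad a^0=\left(\int_Y\frac{1}{a(\mathbf{y})}\,d\mathbf{y}\right)^{-1}.$$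
   Context: Kernels: $\mathbb{K}^{p,q}$ is the set of functions $K\in C^q(\mathbb{R})$ that are compactly supported in $[-1/2,1/2]$, with $K^{(q+1)}\in BV(\mathbb{R})$ (weak derivative; $BV$ = functions of bounded variation on $\mathbb{R}$), and satisfying $\int_{\mathbb{R}}K(t)\,dt=1$ and $\int_{\mathbb{R}}K(t)t^r\,dt=0$ for $1\le r\le p$. Scaled kernels: $K_\eta(x)=\frac1\eta K(x/\eta)$ for $x\in\mathbb{R}$, and $K_\eta(\mathbf{x})=K_\eta(x_1)\cdots K_\eta(x_d)$ for $\mathbf{x}\in\mathbb{R}^d$. A function is $Y$-periodic if it is periodic with period $1$ in each coordinate. "Periodic on $\Omega_{\mathbf{x}_0,\eta}$" means periodic boundary conditions on this box (period $2\ell_\eta$ in each coordinate). $|\cdot|_\infty$ denotes the supremum norm; $I$ is the $d\times d$ identity matrix. A quadratic polynomial is a polynomial of degree at most two. *)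

theory Defs
  imports "HOL-Analysis.Analysis"
begin

definition partial :: "'a::euclidean_space \<Rightarrow> ('a \<Rightarrow> real) \<Rightarrow> 'a \<Rightarrow> real" where
  "partial b f x = frechet_derivative f (at x) b"

fun Ck :: "nat \<Rightarrow> ('a::euclidean_space \<Rightarrow> real) \<Rightarrow> bool" where
  "Ck 0 f \<longleftrightarrow> continuous_on UNIV f"
| "Ck (Suc k) f \<longleftrightarrow> f differentiable_on UNIV \<and> (\<forall>b\<in>Basis. Ck k (partial b f))"

definition smooth :: "('a::euclidean_space \<Rightarrow> real) \<Rightarrow> bool" where
  "smooth f \<longleftrightarrow> (\<forall>k. Ck k f)"

definition laplacian :: "('a::euclidean_space \<Rightarrow> real) \<Rightarrow> 'a \<Rightarrow> real" where
  "laplacian f x = (\<Sum>b\<in>Basis. partial b (partial b f) x)"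

definition sup_norm :: "('a \<Rightarrow> real) \<Rightarrow> real" where
  "sup_norm f = (SUP x. \<bar>f x\<bar>)"

definition quadratic_polynomial :: "(real^'n \<Rightarrow> real) \<Rightarrow> bool" where
  "quadratic_polynomial f \<longleftrightarrow>
     (\<exists>c b (M :: real^'n^'n). \<forall>x. f x = c + b \<bullet> x + x \<bullet> (M *v x))"

definition periodic_with :: "real \<Rightarrow> (real^'n \<Rightarrow> real) \<Rightarrow> bool" where
  "periodic_with P f \<longleftrightarrow> (\<forall>i x. f (x + axis i P) = f x)"

definition test_function :: "('a::euclidean_space \<Rightarrow> real) \<Rightarrow> bool" where
  "test_function \<phi> \<longleftrightarrow> smooth \<phi> \<and> compact (closure (support_on UNIV \<phi>))"

definition locally_integrable :: "('a::euclidean_space \<Rightarrow> real) \<Rightarrow> bool" where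
  "locally_integrable f \<longleftrightarrow> (\<forall>S. compact S \<longrightarrow> set_integrable lebesgue S f)"

definition has_weak_derivative :: "(real \<Rightarrow> real) \<Rightarrow> (real \<Rightarrow> real) \<Rightarrow> bool" where
  "has_weak_derivative f g \<longleftrightarrow> locally_integrable f \<and> locally_integrable g \<and>
     (\<forall>\<phi>. test_function \<phi> \<longrightarrow>
        (LINT x|lebesgue. f x * deriv \<phi> x) = - (LINT x|lebesgue. g x * \<phi> x))"

definition has_weak_laplacian ::
    "('a::euclidean_space \<Rightarrow> real) \<Rightarrow> ('a \<Rightarrow> real) \<Rightarrow> bool" where
  "has_weak_laplacian f g \<longleftrightarrow> locally_integrable f \<and> locally_integrable g \<and>
     (\<forall>\<phi>. test_function \<phi> \<longrightarrow>
        (LINT x|lebesgue. f x * laplacian \<phi> x) = (LINT x|lebesgue. g x * \<phi> x))"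

text \<open>A weak Laplacian is unique up to a null set; the choice of representative is irrelevant
  below, since it only occurs under spatial integrals and in almost-everywhere statements.\<close>

definition weak_laplacian :: "('a::euclidean_space \<Rightarrow> real) \<Rightarrow> 'a \<Rightarrow> real" where
  "weak_laplacian f = (SOME g. has_weak_laplacian f g)"

definition bounded_variation :: "(real \<Rightarrow> real) \<Rightarrow> bool" where
  "bounded_variation f \<longleftrightarrow>
     (\<exists>B. \<forall>s n. mono s \<longrightarrow> (\<Sum>i<n. \<bar>f (s (Suc i)) - f (s i)\<bar>) \<le> B)"

definition kernel_space :: "nat \<Rightarrow> nat \<Rightarrow> (real \<Rightarrow> real) set" where
  "kernel_space p q = {K.
     Ck q K \<and>
     closure (support_on UNIV K) \<subseteq> {-1/2..1/2} \<and>
     (\<exists>g. has_weak_derivative ((deriv ^^ q) K) g \<and> bounded_variation g) \<and>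
     (LINT t|lebesgue. K t) = 1 \<and>
     (\<forall>r\<in>{1..p}. (LINT t|lebesgue. K t * t ^ r) = 0)}"

definition scaled_kernel :: "(real \<Rightarrow> real) \<Rightarrow> real \<Rightarrow> real \<Rightarrow> real" where
  "scaled_kernel K \<eta> t = 1 / \<eta> * K (t / \<eta>)"

definition scaled_kernel_vec :: "(real \<Rightarrow> real) \<Rightarrow> real \<Rightarrow> real^'n \<Rightarrow> real" where
  "scaled_kernel_vec K \<eta> x = (\<Prod>i\<in>UNIV. scaled_kernel K \<eta> (x $ i))"

definition square_integrable_on :: "(real^'n \<Rightarrow> real) \<Rightarrow> (real^'n) set \<Rightarrow> bool" where
  "square_integrable_on f B \<longleftrightarrow>
     f \<in> borel_measurable (lebesgue_on B) \<and> integrable (lebesgue_on B) (\<lambda>x. (f x)\<^sup>2)"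

definition norm_L2_on :: "(real^'n) set \<Rightarrow> (real^'n \<Rightarrow> real) \<Rightarrow> real" where
  "norm_L2_on B f = sqrt (LINT x|lebesgue_on B. (f x)\<^sup>2)"

definition L2_continuous ::
    "real set \<Rightarrow> (real^'n) set \<Rightarrow> (real \<Rightarrow> real^'n \<Rightarrow> real) \<Rightarrow> bool" where
  "L2_continuous I B U \<longleftrightarrow>
     (\<forall>t\<in>I. square_integrable_on (U t) B) \<and>
     (\<forall>t\<in>I. ((\<lambda>s. norm_L2_on B (\<lambda>x. U s x - U t x)) \<longlongrightarrow> 0) (at t within I))"

definition has_L2_derivative ::
    "real set \<Rightarrow> (real^'n) set \<Rightarrow> (real \<Rightarrow> real^'n \<Rightarrow> real) \<Rightarrow> (real \<Rightarrow> real^'n \<Rightarrow> real) \<Rightarrow> bool" where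
  "has_L2_derivative I B U V \<longleftrightarrow>
     (\<forall>t\<in>I. square_integrable_on (U t) B \<and> square_integrable_on (V t) B) \<and>
     (\<forall>t\<in>I. ((\<lambda>s. norm_L2_on B (\<lambda>x. (U s x - U t x) / (s - t) - V t x)) \<longlongrightarrow> 0) (at t within I))"

definition cube :: "real \<Rightarrow> (real^'n) set" where
  "cube L = cbox 0 (\<chi> i. L)"

definition micro_box :: "real^'n \<Rightarrow> real \<Rightarrow> (real^'n) set" where
  "micro_box x0 l = cbox (x0 - (\<chi> i. l)) (x0 + (\<chi> i. l))"

text \<open>The coefficient \<open>a (x / \<epsilon>)\<close> need not be \<open>2 l\<close>-periodic, so the problem on the
  torus has a discontinuous coefficient and in general no classical solution. Solutions are
  therefore strong solutions: twice continuously differentiable in time with values in the square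
  integrable functions on the box, the equation holding almost everywhere on the box.

  The boundary condition is expressed by taking \<open>u t\<close> to be defined on the whole space,
  with \<open>u t - uhat\<close> periodic there, and by asking for a weak Laplacian on the whole space
  (test functions may cross the faces of the box). By elliptic regularity this puts
  \<open>u t - uhat\<close> in the periodic Sobolev space of order two.\<close>

definition solves_micro ::
    "(real^'n \<Rightarrow> real) \<Rightarrow> real \<Rightarrow> real \<Rightarrow> real \<Rightarrow> real^'n \<Rightarrow> (real^'n \<Rightarrow> real)
      \<Rightarrow> (real \<Rightarrow> real^'n \<Rightarrow> real) \<Rightarrow> bool" where
  "solves_micro a \<epsilon> \<tau> l x0 uhat u \<longleftrightarrow>
     (\<exists>v w.
        has_L2_derivative {0..\<tau>/2} (micro_box x0 l) u v \<and>
        has_L2_derivative {0..\<tau>/2} (micro_box x0 l) v w \<and>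
        L2_continuous {0..\<tau>/2} (micro_box x0 l) w \<and>
        (\<forall>t\<in>{0..\<tau>/2}. periodic_with (2 * l) (\<lambda>x. u t x - uhat x)) \<and>
        (\<forall>t\<in>{0..\<tau>/2}. \<exists>g. has_weak_laplacian (u t) g) \<and>
        (\<forall>t\<in>{0<..\<tau>/2}. AE x in lebesgue_on (micro_box x0 l).
           w t x = a (x /\<^sub>R \<epsilon>) * weak_laplacian (u t) x) \<and>
        (AE x in lebesgue_on (micro_box x0 l). u 0 x = uhat x) \<and>
        (AE x in lebesgue_on (micro_box x0 l). v 0 x = 0))"

definition even_extension :: "(real \<Rightarrow> 'b) \<Rightarrow> real \<Rightarrow> 'b" where
  "even_extension u t = u \<bar>t\<bar>"

definition upscaled ::
    "(real \<Rightarrow> real) \<Rightarrow> (real^'n \<Rightarrow> real) \<Rightarrow> real \<Rightarrow> real \<Rightarrow> real \<Rightarrow> real \<Rightarrow> real^'n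
      \<Rightarrow> (real \<Rightarrow> real^'n \<Rightarrow> real) \<Rightarrow> real" where
  "upscaled K a \<epsilon> \<eta> \<tau> l x0 u =
     (LINT t|lebesgue_on {-\<tau>/2..\<tau>/2}. LINT x|lebesgue_on (micro_box x0 l).
        scaled_kernel_vec K \<eta> (x - x0) * scaled_kernel K \<tau> t *
        a (x /\<^sub>R \<epsilon>) * weak_laplacian (even_extension u t) x)"

definition homogenized_coeff :: "(real^'n \<Rightarrow> real) \<Rightarrow> real" where
  "homogenized_coeff a = inverse (LINT y|lebesgue_on (cube 1). 1 / a y)"

definition homogenized :: "(real^'n \<Rightarrow> real) \<Rightarrow> real^'n \<Rightarrow> (real^'n \<Rightarrow> real) \<Rightarrow> real" where
  "homogenized a x0 uhat = homogenized_coeff a * laplacian uhat x0"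

end

theory Submission
  imports Defs "HOL-Analysis.Analysis"
begin

text \<open>The error is a time average against \<open>K\<close> of an even function of \<open>t\<close>, so with
  \<open>q + 2\<close> integrations by parts (the last one against the variation of the weak derivative of order
  \<open>q + 1\<close>) it is at most \<open>\<eta> powr -(q + 2)\<close> times a bound for the iterated antiderivative
  of order \<open>q + 2\<close> of the error integrand \<open>w - a\<^sup>0 \<triangle>uhat\<close>, where \<open>w\<close>
  is the second time derivative of the solution.

  Constants of integration are chosen so that the antiderivatives solve the wave equation again: the
  initial values are multiples of the correctors \<open>\<epsilon> ^ (2 j) \<psi>\<^sub>j (x / \<epsilon>)\<close>, \<open>j > 0\<close>, with
  \<open>\<psi>\<^sub>0 = a - a\<^sup>0\<close> and \<open>a \<triangle>\<psi>\<^sub>j\<^sub>+\<^sub>1 = \<psi>\<^sub>j\<close>. Since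
  \<open>a\<close> is a scalar, \<open>\<integral> \<psi>\<^sub>0 / a = 0\<close>, and this solvability
  condition propagates along the chain. An energy estimate in the backward light cone of the support of
  the kernel, which does not meet the boundary of the box, then bounds the antiderivative of even order
  \<open>2 n\<close> by a multiple of \<open>\<epsilon> ^ (2 n)\<close>; odd orders follow by interpolation.

  No regularity theory is needed: the cell problems are only solved approximately, by trigonometric
  polynomials, and the solution is mollified in space. Both errors, however large their prefactors in
  \<open>\<epsilon>\<close>, \<open>\<eta>\<close> and the solution, vanish in the limit.\<close>

section \<open>Smooth functions and cutoffs\<close>

text \<open>The obstacle in space is the lack of room: \<open>l\<close> may equal the smallest
  admissible value, so the backward cone of the kernel's support just reaches the faces of the box,
  while a smooth cutoff and a mollifier both need a margin. The kernel is therefore contracted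
  slightly, at a uniformly small cost. In time, evenness forces antiderivatives of odd order to
  vanish at 0, so only even orders carry correctors. This fits the wave equation, which links the
  orders j and j + 2. The energy controls velocities, so order 2 n is bounded as the velocity of the
  wave of order 2 n + 1, whose gradient starts at zero. The constant must not see the
  approximations: corrector bounds are fixed before their accuracy, Gronwall runs at rate 1 / T over
  time T and costs only a factor e, and the volume of the cone cancels the factor \<eta>^(-d) of the
  kernel. The dimension enters through the lattice sum of |k|^(-4), finite only for d below 4, which
  turns L2 control of the Fourier coefficients into sup bounds for correctors.\<close>

lemma partial_eq: "(f has_derivative f') (at x) \<Longrightarrow> partial b f x = f' b"
  by (simp add: partial_def frechet_derivative_at[symmetric])

lemma Ck_const: "Ck k (\<lambda>x. c)"
proof (induction k arbitrary: c)
  case (Suc k)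
  have "partial b (\<lambda>x. c) = (\<lambda>x. 0)" for b :: 'a
    by (rule ext) (simp add: partial_eq[OF has_derivative_const])
  then show ?case using Suc by simp
qed simp

lemma Ck_SucD: "Ck (Suc k) f \<Longrightarrow> Ck k f"
proof (induction k arbitrary: f)
  case 0
  then show ?case by (simp add: differentiable_imp_continuous_on)
qed auto

lemma Ck_le: "Ck k f \<Longrightarrow> j \<le> k \<Longrightarrow> Ck j f"
  by (induction k) (auto simp: le_Suc_eq simp del: Ck.simps dest: Ck_SucD)

lemma Ck_differentiable: "Ck (Suc k) f \<Longrightarrow> f differentiable (at x)"
  by (simp add: differentiable_on_def)

lemma Ck_add:
  assumes "Ck k f" "Ck k g" shows "Ck k (\<lambda>x. f x + g x)"
  using assms
proof (induction k arbitrary: f g)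
  case 0
  then show ?case by (simp add: continuous_on_add)
next
  case (Suc k)
  have d: "f differentiable (at x)" "g differentiable (at x)" for x
    using Suc.prems by (auto intro: Ck_differentiable simp del: Ck.simps)
  have "partial b (\<lambda>x. f x + g x) = (\<lambda>x. partial b f x + partial b g x)" for b
    by (rule ext, rule trans, rule partial_eq)
      (rule has_derivative_add[OF d(1)[THEN frechet_derivative_works[THEN iffD1]] d(2)[THEN frechet_derivative_works[THEN iffD1]]],
       simp add: partial_def)
  then show ?case using Suc d
    by (auto simp: differentiable_on_def intro!: differentiable_add differentiable_at_imp_differentiable_on)
qed

lemma Ck_mult:
  assumes "Ck k f" "Ck k g" shows "Ck k (\<lambda>x. f x * g x)"
  using assms
proof (induction k arbitrary: f g)
  case 0
  then show ?case by (simp add: continuous_on_mult)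
next
  case (Suc k)
  have d: "f differentiable (at x)" "g differentiable (at x)" for x
    using Suc.prems by (auto intro: Ck_differentiable simp del: Ck.simps)
  have p: "partial b (\<lambda>x. f x * g x) = (\<lambda>x. f x * partial b g x + partial b f x * g x)" for b
    by (rule ext, rule trans, rule partial_eq)
      (rule has_derivative_mult[OF d(1)[THEN frechet_derivative_works[THEN iffD1]] d(2)[THEN frechet_derivative_works[THEN iffD1]]],
       simp add: partial_def)
  have "Ck k f" "Ck k g" using Suc.prems Ck_SucD by blast+
  then have "Ck k (\<lambda>x. f x * partial b g x + partial b f x * g x)" if "b \<in> Basis" for b
    using Suc that by (auto intro!: Ck_add)
  with p d show ?case
    by (auto simp: differentiable_on_def intro!: differentiable_mult)
qed

lemma smooth_const: "smooth (\<lambda>x. c)"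
  by (simp add: smooth_def Ck_const)

lemma smooth_mult: "smooth f \<Longrightarrow> smooth g \<Longrightarrow> smooth (\<lambda>x. f x * g x)"
  by (simp add: smooth_def Ck_mult)

lemma smooth_prod:
  "finite I \<Longrightarrow> (\<And>i. i \<in> I \<Longrightarrow> smooth (f i)) \<Longrightarrow> smooth (\<lambda>x. \<Prod>i\<in>I. f i x)"
  by (induction I rule: finite_induct) (auto intro: smooth_const smooth_mult)

lemma smooth_differentiable: "smooth f \<Longrightarrow> f differentiable (at x)"
  unfolding smooth_def by (rule Ck_differentiable) blast

lemma smooth_continuous: "smooth f \<Longrightarrow> continuous_on S f"
  unfolding smooth_def using Ck.simps(1)[of f] continuous_on_subset by blast

lemma partial_one: "partial 1 f = deriv f" if "\<And>x. f differentiable (at x)"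
proof
  fix x
  from that obtain D where D: "(f has_field_derivative D) (at x)"
    using real_differentiable_def by blast
  then show "partial 1 f x = deriv f x"
    using partial_eq[of f "(*) D" x 1] D DERIV_imp_deriv[OF D]
    by (simp add: has_field_derivative_def)
qed

lemma Ck_SucI_real:
  fixes f :: "real \<Rightarrow> real"
  assumes "\<And>x. (f has_real_derivative f' x) (at x)" "Ck k f'"
  shows "Ck (Suc k) f"
proof -
  have d: "f differentiable (at x)" for x using assms(1) real_differentiable_def by blast
  have "deriv f = f'" using assms(1) DERIV_imp_deriv by blast
  with d assms(2) show ?thesis
    by (simp add: differentiable_on_def partial_one[OF d])
qed

lemma Ck_deriv:
  fixes f :: "real \<Rightarrow> real"
  assumes "Ck (Suc k) f" 
  shows "Ck k (deriv f)" "(f has_real_derivative deriv f x) (at x)"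
proof -
  have d: "f differentiable (at x)" for x using assms by (rule Ck_differentiable)
  show "Ck k (deriv f)" using assms by (simp add: partial_one[OF d])
  show "(f has_real_derivative deriv f x) (at x)" using d[of x]
    by (metis DERIV_imp_deriv real_differentiable_def)
qed

lemma smooth_deriv:
  fixes f :: "real \<Rightarrow> real"
  assumes "smooth f" 
  shows "smooth (deriv f)" "(f has_real_derivative deriv f x) (at x)"
  using assms Ck_deriv unfolding smooth_def by blast+

text \<open>A whole tower of derivatives is given in advance. For \<open>poly\<close> and
  \<open>flat\<close> it comes from iterating a map on polynomials, so no derivative of high order
  is ever computed.\<close>

lemma smoothI_real:
  fixes f :: "nat \<Rightarrow> real \<Rightarrow> real"
  assumes "\<And>j x. (f j has_real_derivative f (Suc j) x) (at x)"
  shows "smooth (f j)"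
proof -
  have "Ck k (f j)" for k j
  proof (induction k arbitrary: j)
    case 0
    have "continuous_on UNIV (f j)"
      by (rule DERIV_continuous_on) (use assms in auto)
    then show ?case by simp
  next
    case (Suc k)
    then show ?case using Ck_SucI_real[OF assms] by blast
  qed
  then show ?thesis by (simp add: smooth_def)
qed

lemma Ck_compose_affine:
  assumes "Ck k (f :: real \<Rightarrow> real)" and L: "bounded_linear (L :: 'a::euclidean_space \<Rightarrow> real)"
  shows "Ck k (\<lambda>y. f (L y + c))"
  using assms(1)
proof (induction k arbitrary: f)
  case 0
  have "continuous_on UNIV (\<lambda>y. L y + c)"
    by (intro continuous_on_add continuous_on_const linear_continuous_on L)
  with 0 show ?case
    using continuous_on_compose2[of UNIV f UNIV "\<lambda>y. L y + c"] by simp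
next
  case (Suc k)
  have h: "((\<lambda>y. f (L y + c)) has_derivative (\<lambda>b. deriv f (L y + c) * L b)) (at y)" for y
  proof -
    have "((\<lambda>y. L y + c) has_derivative L) (at y)"
      using bounded_linear_imp_has_derivative[OF L] by (auto intro!: derivative_eq_intros)
    from has_derivative_compose[OF this Ck_deriv(2)[OF Suc.prems, unfolded has_field_derivative_def]]
    show ?thesis by simp
  qed
  have "partial b (\<lambda>y. f (L y + c)) = (\<lambda>y. deriv f (L y + c) * L b)" for b
    using partial_eq[OF h] by blast
  moreover have "Ck k (\<lambda>y. deriv f (L y + c) * L b)" for b
    by (intro Ck_mult Ck_const Suc.IH Ck_deriv(1)[OF Suc.prems])
  ultimately show ?case
    using h by (auto simp: differentiable_on_def differentiable_def)
qed

lemma smooth_compose_affine: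
  assumes "smooth (f :: real \<Rightarrow> real)" "bounded_linear L"
  shows "smooth (\<lambda>y. f (L y + c))"
  using Ck_compose_affine[OF _ assms(2)] assms(1) by (auto simp: smooth_def)

lemma smooth_poly: "smooth (poly (p :: real poly))"
proof -
  have "smooth ((\<lambda>j. poly ((pderiv ^^ j) p)) 0)"
    by (rule smoothI_real) (simp add: poly_DERIV)
  then show ?thesis by simp
qed

section \<open>A smooth bump and a smooth step built from exp(-1/s)\<close>

definition flat :: "real poly \<Rightarrow> real \<Rightarrow> real" where
  "flat p s = (if s > 0 then poly p (1 / s) * exp (- 1 / s) else 0)"

lemma flat_lim: "((\<lambda>s. poly p (1 / s) * exp (- 1 / s)) \<longlongrightarrow> 0) (at_right (0::real))"
proof -
  have "((\<lambda>x. poly p x * exp (- x)) \<longlongrightarrow> 0) (at_top :: real filter)"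
  proof -
    have "((\<lambda>x. \<Sum>i\<le>degree p. coeff p i * (x ^ i / exp x)) \<longlongrightarrow> (\<Sum>i\<le>degree p. coeff p i * 0)) (at_top :: real filter)"
      by (intro tendsto_intros tendsto_power_div_exp_0)
    moreover have "(\<lambda>x. \<Sum>i\<le>degree p. coeff p i * (x ^ i / exp x)) = (\<lambda>x. poly p x * exp (- x))"
      by (auto simp: poly_altdef sum_distrib_right exp_minus divide_inverse mult.assoc)
    ultimately show ?thesis by simp
  qed
  from filterlim_compose[OF this filterlim_inverse_at_top_right] show ?thesis
    by (simp add: inverse_eq_divide)
qed

text \<open>With x = 1/s the chain rule gives x^2 (p(x) - p'(x)) exp(-x): the family is closed under
  differentiation, which is the reason for carrying a polynomial as parameter.\<close>

lemma flat_DERIV: "(flat p has_real_derivative flat (monom 1 2 * (p - pderiv p)) s) (at s)"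
proof -
  consider "s > 0" | "s < 0" | "s = 0" by linarith
  then show ?thesis
  proof cases
    case 1
    have "((\<lambda>s. poly p (1 / s) * exp (- 1 / s)) has_real_derivative
        flat (monom 1 2 * (p - pderiv p)) s) (at s)"
      using 1 by (auto intro!: derivative_eq_intros DERIV_chain2[OF poly_DERIV]
          simp: flat_def poly_monom field_simps power2_eq_square)
    then show ?thesis
      by (rule has_field_derivative_transform_within_open[of _ _ _ "{0<..}"]) (use 1 in \<open>auto simp: flat_def\<close>)
  next
    case 2
    then show ?thesis
      using has_field_derivative_transform_within_open[of "\<lambda>_. 0" 0 s "{..<0}" "flat p"]
      by (auto simp: flat_def)
  next
    case 3
    \<comment> \<open>Division by \<open>h\<close> multiplies the polynomial by its variable, so the
      right difference quotient is again of the form treated in \<open>flat_lim\<close>.\<close>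
    have "((\<lambda>h. flat p h / h) \<longlongrightarrow> 0) (at_right 0)"
    proof (rule Lim_transform_eventually[OF flat_lim[of "monom 1 1 * p"]])
      show "\<forall>\<^sub>F x in at_right 0. poly (monom 1 1 * p) (1 / x) * exp (- 1 / x) = flat p x / x"
        unfolding eventually_at_filter by (auto simp: flat_def poly_monom intro!: always_eventually)
    qed
    moreover have "((\<lambda>h. flat p h / h) \<longlongrightarrow> 0) (at_left 0)"
    proof (rule Lim_transform_eventually[OF tendsto_const])
      show "\<forall>\<^sub>F x in at_left 0. 0 = flat p x / x"
        unfolding eventually_at_filter by (auto simp: flat_def intro!: always_eventually)
    qed
    ultimately have "((\<lambda>h. flat p h / h) \<longlongrightarrow> 0) (at 0)"
      by (simp add: filterlim_split_at)
    then show ?thesis using 3 by (simp add: DERIV_def flat_def)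
  qed
qed

lemma smooth_flat: "smooth (flat p)"
proof -
  have "smooth ((\<lambda>j. flat (((\<lambda>p. monom 1 2 * (p - pderiv p)) ^^ j) p)) 0)"
    by (rule smoothI_real) (simp add: flat_DERIV)
  then show ?thesis by simp
qed

text \<open>A bridge between three integrals: the definitions use \<open>lebesgue\<close>, products
  over coordinates use \<open>lborel\<close>, and calculus uses the Henstock-Kurzweil
  integral.\<close>

lemma compact_support_integrable:
  fixes f :: "'a::euclidean_space \<Rightarrow> real"
  assumes "continuous_on UNIV f" "\<And>x. x \<notin> cbox a b \<Longrightarrow> f x = 0"
  shows "integrable lborel f" "integral\<^sup>L lborel f = integral (cbox a b) f"
    "integral\<^sup>L lebesgue f = integral (cbox a b) f" "integrable lebesgue f"
proof -
  have i: "set_integrable lborel (cbox a b) f"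
    unfolding set_integrable_def by (rule borel_integrable_compact) (auto intro: continuous_on_subset[OF assms(1)])
  have e: "(\<lambda>x. indicator (cbox a b) x *\<^sub>R f x) = f"
    by (rule ext) (use assms(2) in \<open>auto simp: indicator_def\<close>)
  show I: "integrable lborel f" using i unfolding set_integrable_def e .
  have "(LINT x : cbox a b | lborel. f x) = integral (cbox a b) f"
    using set_borel_integral_eq_integral[OF i] by simp
  then show J: "integral\<^sup>L lborel f = integral (cbox a b) f"
    unfolding set_lebesgue_integral_def e .
  show "integral\<^sup>L lebesgue f = integral (cbox a b) f"
    using J integral_completion[of f lborel] assms(1) borel_measurable_continuous_onI by auto
  show "integrable lebesgue f" using I integrable_completion[of f lborel] assms(1) borel_measurable_continuous_onI by auto
qed

lemma bump_exists:
  obtains b :: "real \<Rightarrow> real" where "smooth b" "\<And>t. 0 \<le> b t" "\<And>t. \<bar>t\<bar> \<ge> 1 \<Longrightarrow> b t = 0"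
    "integral {-1..1} b = 1"
proof -
  define g where "g t = flat 1 (t + 1) * flat 1 (- t + 1)" for t
  have g: "smooth g" unfolding g_def
    by (intro smooth_mult smooth_compose_affine smooth_flat bounded_linear_ident bounded_linear_minus)
  have nn: "g t \<ge> 0" for t by (simp add: g_def flat_def)
  have z: "g t = 0" if "\<bar>t\<bar> \<ge> 1" for t using that by (auto simp: g_def flat_def abs_if split: if_splits)
  have p: "g 0 > 0" by (simp add: g_def flat_def)
  define I where "I = integral {-1..1} g"
  \<comment> \<open>A continuous nonnegative function with zero integral vanishes on the interval,
    whereas \<open>g 0\<close> is positive.\<close>
  have "I \<noteq> 0"
  proof
    assume "I = 0"
    then have "g 0 = 0" 
      using integral_eq_0_iff[of "-1" 1 g] smooth_continuous[OF g] nn by (auto simp: I_def)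
    with p show False by simp
  qed
  moreover have "I \<ge> 0" unfolding I_def by (rule integral_nonneg) (auto intro!: integrable_continuous_interval smooth_continuous g nn)
  ultimately have I: "I > 0" by simp
  show thesis
  proof
    show "smooth (\<lambda>t. g t * (1 / I))" by (intro smooth_mult g smooth_const)
    show "integral {-1..1} (\<lambda>t. g t * (1 / I)) = 1"
      using I by (simp add: I_def[symmetric])
  qed (use I nn z in auto)
qed

text \<open>The step is the antiderivative of a bump, rescaled from [-1, 1] to [0, 1]. Its
  monotonicity is recorded as the sign of the derivative, which later makes the space-time cutoff
  decrease in time.\<close>

lemma smooth_step_exists:
  obtains S :: "real \<Rightarrow> real" where "smooth S" "\<And>t. 0 \<le> S t" "\<And>t. S t \<le> 1"
    "\<And>t. t \<le> 0 \<Longrightarrow> S t = 0" "\<And>t. t \<ge> 1 \<Longrightarrow> S t = 1"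
    "\<And>t. 0 \<le> deriv S t"
proof -
  obtain b :: "real \<Rightarrow> real" where b: "smooth b" "\<And>t. 0 \<le> b t" "\<And>t. \<bar>t\<bar> \<ge> 1 \<Longrightarrow> b t = 0"
    "integral {-1..1} b = 1" using bump_exists by blast
  define S where "S t = integral {-1..t} b" for t
  have int: "b integrable_on {x..y}" for x y
    by (intro integrable_continuous_interval smooth_continuous b)
  have S0: "S t = 0" if "t \<le> -1" for t
    using that by (cases "t = -1") (auto simp: S_def)
  have S1: "S t = 1" if "t \<ge> 1" for t
  proof -
    have "S t = integral {-1..1} b + integral {1..t} b" unfolding S_def
      using that by (intro Henstock_Kurzweil_Integration.integral_combine[symmetric] int) auto
    also have "integral {1..t} b = integral {1..t} (\<lambda>_. 0)"
      by (rule integral_cong) (use b(3) in auto)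
    finally show ?thesis using b(4) by simp
  qed
  have mono: "S x \<le> S y" if "x \<le> y" for x y
    unfolding S_def by (rule integral_subset_le) (use that int b(2) in auto)
  have der: "(S has_real_derivative b t) (at t)" for t
  proof -
    \<comment> \<open>A lower limit strictly below \<open>t\<close> makes \<open>t\<close> an
      interior point, so that the derivative within an interval becomes two-sided.\<close>
    define m where "m = min (-1) (t - 1)"
    have e: "S x = integral {m..x} b" for x
    proof (cases "x \<ge> -1")
      case True
      have "integral {m..x} b = integral {m..-1} b + S x" unfolding S_def
        using True by (intro Henstock_Kurzweil_Integration.integral_combine[symmetric] int) (auto simp: m_def)
      also have "integral {m..-1} b = integral {m..-1} (\<lambda>_. 0)"
        by (rule integral_cong) (use b(3) in auto)
      finally show ?thesis by simp
    next
      case False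
      then have "integral {m..x} b = integral {m..x} (\<lambda>_. 0)"
        by (intro integral_cong) (use b(3) in auto)
      then show ?thesis using False S0 by simp
    qed
    have "((\<lambda>x. integral {m..x} b) has_real_derivative b t) (at t within {m..t+1})"
      by (rule integral_has_real_derivative) (auto intro!: smooth_continuous b simp: m_def)
    then have "((\<lambda>x. integral {m..x} b) has_real_derivative b t) (at t)"
      using at_within_interior[of t "{m..t+1}"] by (auto simp: m_def)
    then show ?thesis using e by presburger
  qed
  have smS: "smooth S"
    unfolding smooth_def
  proof
    fix k show "Ck k S"
      using Ck_SucI_real[OF der] b(1) by (cases k) (auto simp: smooth_def simp del: Ck.simps intro: Ck_SucD)
  qed
  show thesis
  proof
    show "smooth (\<lambda>t. S (2 * t + (- 1)))"
      by (rule smooth_compose_affine[OF smS]) (rule bounded_linear_mult_right)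
    show "0 \<le> S (2 * t + - 1)" for t using mono[of "min (2*t-1) (-1)" "2*t-1"] S0[of "min (2*t-1) (-1)"] by simp
    show "S (2 * t + - 1) \<le> 1" for t using mono[of "2*t-1" "max (2*t-1) 1"] S1[of "max (2*t-1) 1"] by simp
    have "((\<lambda>t. S (2 * t + - 1)) has_real_derivative b (2 * t + - 1) * 2) (at t)" for t
      by (rule DERIV_chain2[OF der]) (auto intro!: derivative_eq_intros)
    from DERIV_imp_deriv[OF this] show "0 \<le> deriv (\<lambda>t. S (2 * t + - 1)) t" for t
      using b(2) by simp
  qed (auto intro: S0 S1)
qed

lemma test_functionI:
  assumes "smooth f" "\<And>x. x \<notin> cbox a b \<Longrightarrow> f x = 0"
  shows "test_function f"
proof -
  have "support_on UNIV f \<subseteq> cbox a b" using assms(2) by (auto simp: support_on_def)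
  then have "closure (support_on UNIV f) \<subseteq> cbox a b" by (rule closure_minimal) (rule closed_cbox)
  then have "compact (closure (support_on UNIV f))"
    by (meson bounded_cbox bounded_subset closed_closure compact_eq_bounded_closed)
  with assms show ?thesis by (simp add: test_function_def)
qed

lemma integral_abs_le:
  fixes f g :: "'a::euclidean_space \<Rightarrow> real"
  assumes "f integrable_on S" "g integrable_on S" "\<And>x. x \<in> S \<Longrightarrow> \<bar>f x\<bar> \<le> g x"
  shows "\<bar>integral S f\<bar> \<le> integral S g"
  using integral_norm_bound_integral[OF assms(1,2)] assms(3) by simp

lemma integral_zero_outside:
  fixes F :: "'a::euclidean_space \<Rightarrow> real"
  assumes "\<And>x. x \<notin> S \<inter> T \<Longrightarrow> F x = 0"
  shows "integral S F = integral T F"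
proof -
  have "(\<lambda>x. if x \<in> S then F x else 0) = (\<lambda>x. if x \<in> T then F x else 0)"
    using assms by auto
  then show ?thesis by (metis integral_restrict_UNIV)
qed

text \<open>Differentiability along one coordinate line only. Mollifications and parameter integrals
  inherit it from one-dimensional theorems, and integration by parts asks for nothing more;
  \<open>partial\<close>, based on the Frechet derivative, remains for test functions and for the
  Laplacian of \<open>uhat\<close>.\<close>

definition has_partial :: "'n \<Rightarrow> (real^'n \<Rightarrow> real) \<Rightarrow> (real^'n \<Rightarrow> real) \<Rightarrow> bool" where
  "has_partial i f f' \<longleftrightarrow> (\<forall>x. ((\<lambda>s. f (x + s *\<^sub>R axis i 1)) has_real_derivative f' x) (at 0))"

text \<open>\<open>lborel\<close> on vectors is the image of a product measure indexed by
  \<open>Basis\<close>; the work is the passage from \<open>Basis\<close> to the index type. The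
  values lie in a general field because real kernels and complex characters are both integrated this
  way.\<close>

lemma integral_prod_vec:
  fixes g :: "'n::finite \<Rightarrow> real \<Rightarrow> 'a::{real_normed_field,banach,second_countable_topology}"
  assumes "\<And>i. integrable lborel (g i)"
  shows "(LINT x|(lborel :: (real^'n) measure). (\<Prod>i\<in>UNIV. g i (x $ i))) = (\<Prod>i\<in>UNIV. (LINT t|lborel. g i t))"
proof -
  interpret product_sigma_finite "\<lambda>_ :: real^'n. lborel :: real measure" ..
  have [measurable]: "g i \<in> borel_measurable borel" for i
    using borel_measurable_integrable[OF assms[of i]] by simp
  define ix where "ix = (inv (\<lambda>i::'n. axis i (1::real)))"
  have inj: "inj (\<lambda>i::'n. axis i (1::real))" by (auto simp: inj_on_def axis_eq_axis)
  have ix: "ix (axis i 1) = i" for i unfolding ix_def by (rule inv_f_f[OF inj])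
  have B: "(Basis :: (real^'n) set) = (\<lambda>i. axis i 1) ` UNIV" by (auto simp: Basis_vec_def)
  have comp: "(\<Sum>b\<in>Basis. f b *\<^sub>R b) $ i = f (axis i 1)" for f :: "real^'n \<Rightarrow> real" and i
    unfolding B by (subst sum.reindex[OF inj]) (simp add: axis_def if_distrib sum.delta cong: if_cong)
  have "(LINT x|(lborel :: (real^'n) measure). (\<Prod>i\<in>UNIV. g i (x $ i))) =
      (LINT f|(\<Pi>\<^sub>M b\<in>(Basis::(real^'n) set). lborel). (\<Prod>i\<in>UNIV. g i ((\<Sum>b\<in>Basis. f b *\<^sub>R b) $ i)))"
  proof (subst lborel_eq, rule integral_distr)
    show "(\<lambda>f. \<Sum>b\<in>Basis. f b *\<^sub>R b) \<in> (\<Pi>\<^sub>M b\<in>Basis. lborel) \<rightarrow>\<^sub>M (borel :: (real^'n) measure)"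
      by (intro borel_measurable_sum borel_measurable_scaleR borel_measurable_const) simp
    have [measurable]: "(\<lambda>x::real^'n. x $ i) \<in> borel_measurable borel" for i
      by (intro borel_measurable_continuous_onI continuous_intros)
    show "(\<lambda>x::real^'n. \<Prod>i\<in>UNIV. g i (x $ i)) \<in> borel_measurable borel" by measurable
  qed
  also have "\<dots> = (LINT f|(\<Pi>\<^sub>M b\<in>(Basis::(real^'n) set). lborel). (\<Prod>b\<in>Basis. g (ix b) (f b)))"
    unfolding comp unfolding B by (subst prod.reindex[OF inj]) (simp add: ix)
  also have "\<dots> = (\<Prod>b\<in>(Basis::(real^'n) set). LINT t|lborel. g (ix b) t)"
    by (rule product_integral_prod) (auto simp: assms)
  also have "\<dots> = (\<Prod>i\<in>UNIV. (LINT t|lborel. g i t))"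
    unfolding B by (subst prod.reindex[OF inj]) (simp add: ix)
  finally show ?thesis .
qed

section \<open>Averages against a kernel\<close>

lemma lebesgue_integral_supported:
  fixes f :: "'a::euclidean_space \<Rightarrow> real"
  assumes "f absolutely_integrable_on S" "\<And>x. x \<notin> S \<Longrightarrow> f x = 0"
  shows "(LINT x|lebesgue. f x) = integral S f"
proof -
  have "(\<lambda>x. indicator S x *\<^sub>R f x) = f"
    by (rule ext) (use assms(2) in \<open>auto simp: indicator_def\<close>)
  then show ?thesis
    using set_lebesgue_integral_eq_integral(2)[OF assms(1)] by (simp add: set_lebesgue_integral_def)
qed

lemma absolutely_integrable_mult_continuous:
  fixes f g :: "'a::euclidean_space \<Rightarrow> real"
  assumes f: "f absolutely_integrable_on cbox a b" and g: "continuous_on (cbox a b) g"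
  shows "(\<lambda>x. g x * f x) absolutely_integrable_on cbox a b"
proof -
  have "g \<in> borel_measurable (lebesgue_on (cbox a b))"
    by (rule continuous_imp_measurable_on_sets_lebesgue[OF g]) simp
  moreover have "bounded (g ` cbox a b)"
    by (intro compact_imp_bounded compact_continuous_image g compact_cbox)
  ultimately show ?thesis
    using absolutely_integrable_bounded_measurable_product[OF bilinear_times, of g "cbox a b" f] f
    by simp
qed

lemma absolutely_integrable_shift_real_ivl:
  fixes f :: "real \<Rightarrow> real"
  assumes "f absolutely_integrable_on {a..b}"
  shows "(\<lambda>x. f (x + c)) absolutely_integrable_on {a - c..b - c}"
  using assms integrable_shift_real_ivl[of f a b c] integrable_shift_real_ivl[of "\<lambda>x. norm (f x)" a b c]
  by (simp add: absolutely_integrable_on_def)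

text \<open>All subintervals of length \<open>h\<close> are translated onto [0, h]. For fixed
  \<open>t\<close> the integrand there becomes a sum of increments of \<open>g\<close> along an
  arithmetic progression, at most the variation.\<close>

lemma bounded_variation_integral_diff:
  fixes g :: "real \<Rightarrow> real"
  assumes g: "\<And>a b. g absolutely_integrable_on {a..b}"
    and B: "\<And>s n. mono s \<Longrightarrow> (\<Sum>i<n. \<bar>g (s (Suc i)) - g (s i)\<bar>) \<le> B"
    and h: "0 < h"
  shows "integral {a..a + real n * h} (\<lambda>t. \<bar>g (t + h) - g t\<bar>) \<le> h * B"
proof -
  have gs: "(\<lambda>t. g (t + c)) absolutely_integrable_on {x..y}" for c x y
    using absolutely_integrable_shift_real_ivl[OF g[of "x + c" "y + c"], of c] by simp
  have int: "(\<lambda>t. \<bar>g (t + c) - g (t + d)\<bar>) integrable_on {x..y}" for c d x y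
    using set_lebesgue_integral_eq_integral(1)[OF absolutely_integrable_norm[OF set_integral_diff(1)[OF gs[of x y c] gs[of x y d]]]]
    by (simp add: o_def)
  have int0: "(\<lambda>t. \<bar>g (t + c) - g t\<bar>) integrable_on {x..y}" for c x y
    using int[of c 0] by simp
  have "integral {a..a + real n * h} (\<lambda>t. \<bar>g (t + h) - g t\<bar>) =
      integral {0..h} (\<lambda>t. \<Sum>i<n. \<bar>g (t + (a + real (Suc i) * h)) - g (t + (a + real i * h))\<bar>)"
  proof (induction n)
    case (Suc n)
    have "integral {a..a + real (Suc n) * h} (\<lambda>t. \<bar>g (t + h) - g t\<bar>) =
        integral {a..a + real n * h} (\<lambda>t. \<bar>g (t + h) - g t\<bar>) +
        integral {a + real n * h..a + real (Suc n) * h} (\<lambda>t. \<bar>g (t + h) - g t\<bar>)"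
      using h by (intro Henstock_Kurzweil_Integration.integral_combine[symmetric] int0)
        (auto simp: algebra_simps)
    also have "integral {a + real n * h..a + real (Suc n) * h} (\<lambda>t. \<bar>g (t + h) - g t\<bar>) =
        integral {0..h} (\<lambda>t. \<bar>g (t + (a + real (Suc n) * h)) - g (t + (a + real n * h))\<bar>)"
      using integral_shift_real_ivl[of "a + real n * h" "a + real n * h" "a + real (Suc n) * h" "\<lambda>t. \<bar>g (t + h) - g t\<bar>"]
      by (simp add: algebra_simps)
    finally show ?case using Suc
      by (simp add: Henstock_Kurzweil_Integration.integral_add int integrable_sum del: of_nat_Suc)
  qed simp
  also have "\<dots> \<le> integral {0..h} (\<lambda>_. B)"
  proof (rule integral_le)
    fix t assume "t \<in> {0..h}"
    have "mono (\<lambda>i. t + (a + real i * h))"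
      using h by (intro monoI) (auto intro: mult_right_mono)
    from B[OF this, of n] show "(\<Sum>i<n. \<bar>g (t + (a + real (Suc i) * h)) - g (t + (a + real i * h))\<bar>) \<le> B" .
  qed (auto intro!: integrable_sum int)
  finally show ?thesis using h by simp
qed

lemma test_deriv:
  fixes \<phi> :: "real \<Rightarrow> real"
  assumes "\<And>t. R < \<bar>t\<bar> \<Longrightarrow> \<phi> t = 0" "R < \<bar>t\<bar>"
  shows "deriv \<phi> t = 0"
proof -
  have "open {x::real. R < \<bar>x\<bar>}" by (intro open_Collect_less continuous_intros)
  from has_field_derivative_transform_within_open[OF DERIV_const this]
  have "(\<phi> has_real_derivative 0) (at t)" using assms by (metis mem_Collect_eq)
  then show ?thesis by (rule DERIV_imp_deriv)
qed

text \<open>One more integration by parts without a Stieltjes measure: the derivative is replaced by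
  a difference quotient, the difference is moved onto \<open>g\<close> by a translation, and
  \<open>bounded_variation_integral_diff\<close> bounds the result by the variation uniformly in the
  step.\<close>

lemma bounded_variation_weak_bound:
  fixes g :: "real \<Rightarrow> real"
  assumes g: "\<And>a b. g absolutely_integrable_on {a..b}"
    and B: "\<And>s n. mono s \<Longrightarrow> (\<Sum>i<n. \<bar>g (s (Suc i)) - g (s i)\<bar>) \<le> B"
    and \<phi>: "smooth \<phi>" "\<And>t. R < \<bar>t\<bar> \<Longrightarrow> \<phi> t = 0" "\<And>t. \<bar>\<phi> t\<bar> \<le> H"
  shows "\<bar>LINT t|lebesgue. g t * deriv \<phi> t\<bar> \<le> B * H"
proof -
  \<comment> \<open>One unit of room beyond the support: translations by \<open>h n\<close>, which
    is at most 1, keep the support inside the interval \<open>I\<close>.\<close>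
  obtain N :: nat where N: "R + 1 \<le> real N" using real_arch_simple by blast
  define I where "I = {-real N..real N}"
  have R0: "\<phi> t = 0" if "real N - 1 < \<bar>t\<bar>" for t using that \<phi>(2) N by auto
  have d0: "deriv \<phi> t = 0" if "real N - 1 < \<bar>t\<bar>" for t by (rule test_deriv[OF R0 that])
  have H0: "H \<ge> 0" using \<phi>(3)[of 0] by linarith
  have B0: "B \<ge> 0" using B[of "\<lambda>_. 0" 0] by (simp add: mono_def)
  \<comment> \<open>Steps of length 1 / (n + 1) divide an interval of length 2 N into a whole number
    of steps, as \<open>bounded_variation_integral_diff\<close> requires.\<close>
  define h where "h n = 1 / real (Suc n)" for n
  have h: "0 < h n" "h n \<le> 1" for n by (auto simp: h_def)
  define D where "D n t = (\<phi> (t + h n) - \<phi> t) / h n" for n t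
  have cphi: "continuous_on S \<phi>" "continuous_on S (deriv \<phi>)" for S
    using \<phi>(1) smooth_continuous smooth_deriv(1) by blast+
  have "continuous_on I (\<lambda>t. \<bar>deriv \<phi> t\<bar>)" by (intro continuous_intros cphi)
  then have "bounded ((\<lambda>t. \<bar>deriv \<phi> t\<bar>) ` I)"
    by (intro compact_imp_bounded compact_continuous_image) (auto simp: I_def)
  then obtain M0 where M0: "\<bar>deriv \<phi> t\<bar> \<le> M0" if "t \<in> I" for t
    by (auto simp: bounded_iff)
  define M where "M = max M0 0"
  have M: "\<bar>deriv \<phi> t\<bar> \<le> M" for t
    using M0[of t] d0[of t] by (cases "t \<in> I") (auto simp: I_def M_def)
  have DM: "\<bar>D n t\<bar> \<le> M" for n t
  proof -
    have "norm (\<phi> (t + h n) - \<phi> t) \<le> M * norm (t + h n - t)"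
      by (rule field_differentiable_bound[of UNIV _ "deriv \<phi>"])
        (use smooth_deriv(2)[OF \<phi>(1)] M in auto)
    then show ?thesis using h[of n] by (simp add: D_def abs_div field_simps)
  qed
  have ai: "(\<lambda>t. F t * g t) absolutely_integrable_on I" if "continuous_on UNIV F" for F
    unfolding I_def box_real(2)[symmetric] using that g
    by (intro absolutely_integrable_mult_continuous) (auto intro: continuous_on_subset)
  have cD: "continuous_on UNIV (D n)" for n
    unfolding D_def by (intro continuous_intros continuous_on_compose2[OF cphi(1)[of UNIV]])
      (use h[of n] in auto)
  have "(\<lambda>n. integral I (\<lambda>t. D n t * g t)) \<longlonglongrightarrow> integral I (\<lambda>t. deriv \<phi> t * g t)"
  proof (rule dominated_convergence(2))
    show "(\<lambda>t. D n t * g t) integrable_on I" for n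
      using ai[OF cD] set_lebesgue_integral_eq_integral(1) by blast
    show "(\<lambda>t. M * \<bar>g t\<bar>) integrable_on I"
      using absolutely_integrable_norm[OF g[of "-real N" "real N"]]
      by (intro integrable_on_mult_right) (auto simp: I_def o_def dest: set_lebesgue_integral_eq_integral(1))
    show "norm (D n t * g t) \<le> M * \<bar>g t\<bar>" for n t
      using DM[of n t] by (auto simp: abs_mult intro!: mult_right_mono)
    fix t assume "t \<in> I"
    have "(\<lambda>n. D n t) \<longlonglongrightarrow> deriv \<phi> t"
    proof -
      have "filterlim h (at 0) sequentially"
        unfolding filterlim_at h_def using LIMSEQ_inverse_real_of_nat by (auto simp: inverse_eq_divide)
      from filterlim_compose[OF smooth_deriv(2)[OF \<phi>(1), of t, unfolded DERIV_def] this]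
      show ?thesis by (simp add: D_def[abs_def])
    qed
    then show "(\<lambda>n. D n t * g t) \<longlonglongrightarrow> deriv \<phi> t * g t" by (intro tendsto_intros)
  qed
  moreover have "\<bar>integral I (\<lambda>t. D n t * g t)\<bar> \<le> B * H" for n
  proof -
    have gs: "(\<lambda>t. g (t + c)) absolutely_integrable_on {x..y}" for c x y
      using absolutely_integrable_shift_real_ivl[OF g[of "x + c" "y + c"], of c] by simp
    have ais: "(\<lambda>t. F t * g (t + c)) absolutely_integrable_on {x..y}" if "continuous_on UNIV F" for F c x y
      unfolding box_real(2)[symmetric] using that gs
      by (intro absolutely_integrable_mult_continuous) (auto intro: continuous_on_subset)
    note ai_int = set_lebesgue_integral_eq_integral(1)
    have cs: "continuous_on UNIV (\<lambda>t. \<phi> (t + h n))"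
      by (intro continuous_on_compose2[OF cphi(1)[of UNIV]] continuous_intros) auto
    have int1: "(\<lambda>t. \<phi> t * g (t - h n)) integrable_on I" "(\<lambda>t. \<phi> t * g t) integrable_on I"
      "(\<lambda>t. \<phi> (t + h n) * g t) integrable_on I"
      "(\<lambda>t. \<phi> t * (g (t - h n) - g t)) integrable_on I"
      using ai_int[OF ais[OF cphi(1), of "- real N" "real N" "- h n"]] ai_int[OF ai[OF cphi(1)]] ai_int[OF ai[OF cs]]
        Henstock_Kurzweil_Integration.integrable_diff[OF ai_int[OF ais[OF cphi(1), of "- real N" "real N" "- h n"]] ai_int[OF ai[OF cphi(1), unfolded I_def]]]
      by (auto simp: I_def right_diff_distrib)
    have int2: "(\<lambda>t. \<bar>g (t - h n) - g t\<bar>) integrable_on I"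
      using absolutely_integrable_norm[OF set_integral_diff(1)[OF gs[of "- real N" "real N" "- h n"] g]]
      by (auto simp: I_def o_def dest: ai_int)
    \<comment> \<open>Discrete integration by parts: a change of variables puts the shift on
      \<open>g\<close>.\<close>
    have "integral I (\<lambda>t. \<phi> (t + h n) * g t) = integral {-real N + h n - h n..real N + h n - h n} (\<lambda>t. \<phi> (t + h n) * g (t + h n - h n))"
      by (simp add: I_def)
    also have "\<dots> = integral {-real N + h n..real N + h n} (\<lambda>t. \<phi> t * g (t - h n))"
      by (rule integral_shift_real_ivl)
    also have "\<dots> = integral I (\<lambda>t. \<phi> t * g (t - h n))"
    proof (rule integral_zero_outside)
      fix t assume t: "t \<notin> {- real N + h n..real N + h n} \<inter> I"
      have "\<phi> t = 0" by (rule R0) (use h[of n] t in \<open>auto simp: I_def abs_if split: if_splits\<close>)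
      then show "\<phi> t * g (t - h n) = 0" by simp
    qed
    finally have sh: "integral I (\<lambda>t. \<phi> (t + h n) * g t) = integral I (\<lambda>t. \<phi> t * g (t - h n))" .
    have "integral I (\<lambda>t. D n t * g t) = integral I (\<lambda>t. (1 / h n) * (\<phi> (t + h n) * g t - \<phi> t * g t))"
      using h[of n] by (intro integral_cong) (simp add: D_def field_simps)
    also have "\<dots> = (1 / h n) * (integral I (\<lambda>t. \<phi> (t + h n) * g t) - integral I (\<lambda>t. \<phi> t * g t))"
      by (simp only: integral_mult_right Henstock_Kurzweil_Integration.integral_diff[OF int1(3,2)])
    also have "\<dots> = (1 / h n) * integral I (\<lambda>t. \<phi> t * (g (t - h n) - g t))"
      by (simp only: sh right_diff_distrib[of "\<phi> _"] Henstock_Kurzweil_Integration.integral_diff[OF int1(1,2)])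
    finally have e: "integral I (\<lambda>t. D n t * g t) = (1 / h n) * integral I (\<lambda>t. \<phi> t * (g (t - h n) - g t))" .
    have "\<bar>integral I (\<lambda>t. \<phi> t * (g (t - h n) - g t))\<bar> \<le> integral I (\<lambda>t. H * \<bar>g (t - h n) - g t\<bar>)"
      by (rule integral_abs_le) (use int1 int2 \<phi>(3) in \<open>auto simp: abs_mult intro: mult_right_mono integrable_on_mult_right\<close>)
    also have "\<dots> = H * integral I (\<lambda>t. \<bar>g (t - h n) - g t\<bar>)" by simp
    also have "integral I (\<lambda>t. \<bar>g (t - h n) - g t\<bar>) =
        integral {- real N - h n..- real N - h n + real (2 * N * Suc n) * h n} (\<lambda>t. \<bar>g (t + h n) - g t\<bar>)"
    proof -
      have "- real N - h n + real (2 * N * Suc n) * h n = real N - h n"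
        unfolding h_def of_nat_mult by (simp del: of_nat_Suc mult_Suc_right)
      then show ?thesis
        using integral_shift_real_ivl[of "- real N" "h n" "real N" "\<lambda>t. \<bar>g (t - h n) - g t\<bar>"]
        by (simp add: I_def abs_minus_commute)
    qed
    also have "\<dots> \<le> h n * B" by (rule bounded_variation_integral_diff[OF g B h(1)])
    finally have "\<bar>integral I (\<lambda>t. \<phi> t * (g (t - h n) - g t))\<bar> \<le> h n * (B * H)"
      using mult_left_mono[OF _ H0] by (simp only: mult_ac)
    then have "(1 / h n) * \<bar>integral I (\<lambda>t. \<phi> t * (g (t - h n) - g t))\<bar> \<le> B * H"
      using h[of n] by (simp add: pos_divide_le_eq mult.commute)
    then show ?thesis using h[of n] unfolding e abs_mult by simp
  qed
  ultimately have "\<bar>integral I (\<lambda>t. deriv \<phi> t * g t)\<bar> \<le> B * H"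
    by (intro LIMSEQ_le_const2[OF tendsto_rabs]) auto
  moreover have "(LINT t|lebesgue. g t * deriv \<phi> t) = integral I (\<lambda>t. deriv \<phi> t * g t)"
  proof (subst lebesgue_integral_supported[where S = I])
    show "(\<lambda>t. g t * deriv \<phi> t) absolutely_integrable_on I" using ai[OF cphi(2)] by (simp add: mult.commute)
  qed (use d0 in \<open>auto simp: I_def mult.commute\<close>)
  ultimately show ?thesis by simp
qed

section \<open>Integration by parts against an averaging kernel\<close>

lemma poly_antiderivative: "\<exists>P'. pderiv P' = P \<and> poly P' 0 = (c :: real)"
proof -
  define R where "R = (\<Sum>i\<le>degree P. monom (coeff P i / real (Suc i)) (Suc i))"
  have "pderiv R = (\<Sum>i\<le>degree P. monom (coeff P i) i)"
  proof -
    have "pderiv (\<Sum>i\<in>A. f i) = (\<Sum>i\<in>A. pderiv (f i))" if "finite A" for A and f :: "nat \<Rightarrow> real poly"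
      using that by induction (simp_all add: pderiv_add)
    then show ?thesis unfolding R_def by (simp add: pderiv_monom del: of_nat_Suc)
  qed
  then have "pderiv (R + [:c:]) = P" by (simp add: pderiv_add pderiv_pCons poly_as_sum_of_monoms)
  moreover have "poly (R + [:c:]) 0 = c" by (simp add: R_def poly_sum poly_monom)
  ultimately show ?thesis by blast
qed

lemma deriv_eq_on_open:
  assumes "open U" "t \<in> U" "\<And>x. x \<in> U \<Longrightarrow> f x = g x" "(f has_real_derivative D) (at t)"
  shows "deriv g t = D"
  by (rule DERIV_imp_deriv, rule has_field_derivative_transform_within_open[OF assms(4,1,2)]) (use assms(3) in auto)

lemma kernel_space_supp:
  assumes "K \<in> kernel_space p q" "1 / 2 < \<bar>t\<bar>"
  shows "K t = 0" "(deriv ^^ j) K t = 0"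
proof -
  have *: "K t = 0" if "1 / 2 < \<bar>t\<bar>" for t
  proof -
    have "support_on UNIV K \<subseteq> {-1/2..1/2}"
      using assms(1) closure_subset unfolding kernel_space_def by blast
    then show ?thesis using that by (force simp: support_on_def)
  qed
  then show "K t = 0" using assms by blast
  have "\<forall>t. 1 / 2 < \<bar>t\<bar> \<longrightarrow> (deriv ^^ j) K t = 0"
  proof (induction j)
    case (Suc j)
    then show ?case using test_deriv[of "1/2" "(deriv ^^ j) K"] by auto
  qed (use * in auto)
  then show "(deriv ^^ j) K t = 0" using assms by blast
qed

lemma Ck_funpow_deriv: "Ck k (f :: real \<Rightarrow> real) \<Longrightarrow> j \<le> k \<Longrightarrow> Ck (k - j) ((deriv ^^ j) f)"
proof (induction j)
  case (Suc j)
  then have "Ck (Suc (k - Suc j)) ((deriv ^^ j) f)" by (simp add: Suc_diff_Suc del: Ck.simps)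
  then show ?case using Ck_deriv(1) by simp
qed simp

lemma kernel_space_continuous:
  assumes "K \<in> kernel_space p q" "j \<le> q"
  shows "continuous_on S ((deriv ^^ j) K)"
proof -
  have "Ck (q - j) ((deriv ^^ j) K)" using assms by (intro Ck_funpow_deriv) (auto simp: kernel_space_def)
  from Ck_le[OF this, of 0] show ?thesis using continuous_on_subset by auto
qed

lemma kernel_space_by_parts:
  assumes K: "K \<in> kernel_space p q" and \<phi>: "smooth \<phi>" "\<And>t. 1 < \<bar>t\<bar> \<Longrightarrow> \<phi> t = 0" and j: "j \<le> q"
  shows "integral {-2..2} (\<lambda>t. K t * (deriv ^^ j) \<phi> t) =
    (-1) ^ j * integral {-2..2} (\<lambda>t. (deriv ^^ j) K t * \<phi> t)"
  using \<phi> j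
proof (induction j arbitrary: \<phi>)
  case (Suc j)
  have d0: "deriv \<phi> t = 0" if "1 < \<bar>t\<bar>" for t using test_deriv[OF Suc.prems(2) that] .
  have "integral {-2..2} (\<lambda>t. K t * (deriv ^^ j) (deriv \<phi>) t) =
     (-1) ^ j * integral {-2..2} (\<lambda>t. (deriv ^^ j) K t * deriv \<phi> t)"
    using Suc d0 smooth_deriv(1) by auto
  moreover have "((\<lambda>t. deriv \<phi> t * (deriv ^^ j) K t) has_integral
      - integral {-2..2} (\<lambda>t. \<phi> t * (deriv ^^ Suc j) K t)) {-2..2}"
  proof (rule integration_by_parts[OF bounded_bilinear_mult, where f = \<phi> and g = "(deriv ^^ j) K" and g' = "(deriv ^^ Suc j) K"])
    have ck: "Ck (Suc (q - Suc j)) ((deriv ^^ j) K)"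
      using Ck_funpow_deriv[of q K j] K Suc.prems(3) by (simp add: kernel_space_def Suc_diff_Suc del: Ck.simps)
    show "((deriv ^^ j) K has_vector_derivative (deriv ^^ Suc j) K t) (at t)" for t
      using Ck_deriv(2)[OF ck] by (simp add: has_real_derivative_iff_has_vector_derivative)
    show "(\<phi> has_vector_derivative deriv \<phi> t) (at t)" for t
      using smooth_deriv(2)[OF Suc.prems(1)] by (simp add: has_real_derivative_iff_has_vector_derivative)
    show "continuous_on {-2..2} ((deriv ^^ j) K)" "continuous_on {-2..2} \<phi>"
      using kernel_space_continuous[OF K] smooth_continuous Suc.prems by auto
    have "((\<lambda>t. \<phi> t * (deriv ^^ Suc j) K t) has_integral
      integral {-2..2} (\<lambda>t. \<phi> t * (deriv ^^ Suc j) K t)) {-2..2}"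
      using kernel_space_continuous[OF K, of "Suc j"] smooth_continuous[OF Suc.prems(1)] Suc.prems
      by (intro integrable_integral integrable_continuous_interval continuous_on_mult) auto
    then show "((\<lambda>t. \<phi> t * (deriv ^^ Suc j) K t) has_integral
      \<phi> 2 * (deriv ^^ j) K 2 - \<phi> (-2) * (deriv ^^ j) K (-2) - - integral {-2..2} (\<lambda>t. \<phi> t * (deriv ^^ Suc j) K t)) {-2..2}"
      using Suc.prems(2) by simp
  qed auto
  then have "integral {-2..2} (\<lambda>t. (deriv ^^ j) K t * deriv \<phi> t) =
    - integral {-2..2} (\<lambda>t. (deriv ^^ Suc j) K t * \<phi> t)"
    using integral_unique by (force simp: mult.commute)
  ultimately show ?case by (simp add: funpow_swap1)
qed simp

text \<open>The count q + 2 arises as q classical integrations by parts, one from the definition of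
  the weak derivative \<open>g\<close> (tested with the derivative of \<phi>), and a last one
  against the variation of \<open>g\<close>.\<close>

lemma kernel_space_weak_bound:
  assumes K: "K \<in> kernel_space p q"
  shows "\<exists>B\<ge>0. \<forall>\<phi> H. smooth \<phi> \<longrightarrow> (\<forall>t. 1 < \<bar>t\<bar> \<longrightarrow> \<phi> t = 0) \<longrightarrow> (\<forall>t. \<bar>\<phi> t\<bar> \<le> H) \<longrightarrow>
    \<bar>integral {-2..2} (\<lambda>t. K t * (deriv ^^ (q + 2)) \<phi> t)\<bar> \<le> B * H"
proof -
  obtain g B where g: "has_weak_derivative ((deriv ^^ q) K) g"
    and B: "\<And>s n. mono s \<Longrightarrow> (\<Sum>i<n. \<bar>g (s (Suc i)) - g (s i)\<bar>) \<le> B"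
    using K unfolding kernel_space_def bounded_variation_def by blast
  have B0: "B \<ge> 0" using B[of "\<lambda>_. 0" 0] by (simp add: mono_def)
  have ga: "g absolutely_integrable_on {a..b}" for a b
    using g by (simp add: has_weak_derivative_def locally_integrable_def)
  have "\<bar>integral {-2..2} (\<lambda>t. K t * (deriv ^^ (q + 2)) \<phi> t)\<bar> \<le> B * H"
    if \<phi>: "smooth \<phi>" "\<And>t. 1 < \<bar>t\<bar> \<Longrightarrow> \<phi> t = 0" "\<And>t. \<bar>\<phi> t\<bar> \<le> H" for \<phi> H
  proof -
    have s1: "smooth (deriv \<phi>)" "smooth (deriv (deriv \<phi>))" using smooth_deriv \<phi> by blast+
    have z1: "deriv \<phi> t = 0" if "1 < \<bar>t\<bar>" for t using test_deriv[OF \<phi>(2) that] .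
    have z2: "deriv (deriv \<phi>) t = 0" if "1 < \<bar>t\<bar>" for t using test_deriv[OF z1 that] .
    have "test_function (deriv \<phi>)"
      by (rule test_functionI[of _ "-1" 1]) (use s1 z1 in auto)
    then have w: "(LINT x|lebesgue. (deriv ^^ q) K x * deriv (deriv \<phi>) x) = - (LINT x|lebesgue. g x * deriv \<phi> x)"
      using g by (auto simp: has_weak_derivative_def)
    have "(LINT x|lebesgue. (deriv ^^ q) K x * deriv (deriv \<phi>) x) =
      integral {-2..2} (\<lambda>x. (deriv ^^ q) K x * deriv (deriv \<phi>) x)"
      using compact_support_integrable(3)[of "\<lambda>x. (deriv ^^ q) K x * deriv (deriv \<phi>) x" "-2" 2] z2
        continuous_on_mult[OF kernel_space_continuous[OF K, of q] smooth_continuous[OF s1(2)]]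
      by (force simp: box_real)
    also have "(-1) ^ q * \<dots> = integral {-2..2} (\<lambda>t. K t * (deriv ^^ q) (deriv (deriv \<phi>)) t)"
      using kernel_space_by_parts[OF K s1(2) z2, of q] by simp
    finally have e1: "(-1) ^ q * (LINT x|lebesgue. (deriv ^^ q) K x * deriv (deriv \<phi>) x) =
      integral {-2..2} (\<lambda>t. K t * (deriv ^^ q) (deriv (deriv \<phi>)) t)" .
    have "integral {-2..2} (\<lambda>t. K t * (deriv ^^ (q + 2)) \<phi> t) =
        (-1) ^ q * - (LINT x|lebesgue. g x * deriv \<phi> x)"
      by (simp only: e1[symmetric] w[symmetric] funpow_swap1 funpow_add o_apply numeral_2_eq_2 funpow.simps id_apply)
    then have "\<bar>integral {-2..2} (\<lambda>t. K t * (deriv ^^ (q + 2)) \<phi> t)\<bar> = \<bar>LINT x|lebesgue. g x * deriv \<phi> x\<bar>"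
      by (simp only: abs_mult abs_minus_cancel power_abs abs_one power_one mult_1)
    then show ?thesis using bounded_variation_weak_bound[OF ga B \<phi>] by simp
  qed
  with B0 show ?thesis by blast
qed

text \<open>\<open>f\<close> is a chain of antiderivatives on [0, 1/2]. Since odd orders vanish at
  0, the extensions by (-1)^j \<open>f j\<close> to negative times form a chain for the even
  extension of \<open>f 0\<close>, so q + 2 integrations by parts apply. The chain is not smooth,
  hence it is replaced by polynomials and cut off outside the support of \<open>K\<close> before
  \<open>kernel_space_weak_bound\<close> is used.\<close>

lemma kernel_space_time_average:
  assumes K: "K \<in> kernel_space p q"
  shows "\<exists>B\<ge>0. \<forall>f H. continuous_on {0..1/2} (f 0) \<longrightarrow>
      (\<forall>j t. j < q + 2 \<longrightarrow> t \<in> {0..1/2} \<longrightarrow> (f (Suc j) has_real_derivative f j t) (at t within {0..1/2})) \<longrightarrow>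
      (\<forall>j. odd j \<longrightarrow> f j 0 = 0) \<longrightarrow>
      (\<forall>t. t \<in> {0..1/2} \<longrightarrow> \<bar>f (q + 2) t\<bar> \<le> H) \<longrightarrow>
      \<bar>integral {-1/2..1/2} (\<lambda>t. K t * f 0 \<bar>t\<bar>)\<bar> \<le> B * H"
proof -
  obtain B where B0: "B \<ge> 0" and B': "\<forall>\<phi> H. smooth \<phi> \<longrightarrow> (\<forall>t. 1 < \<bar>t\<bar> \<longrightarrow> \<phi> t = 0) \<longrightarrow> (\<forall>t. \<bar>\<phi> t\<bar> \<le> H) \<longrightarrow>
    \<bar>integral {-2..2} (\<lambda>t. K t * (deriv ^^ (q + 2)) \<phi> t)\<bar> \<le> B * H"
    using kernel_space_weak_bound[OF K] by blast
  note B = B'[rule_format]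
  have cK: "continuous_on S K" for S using kernel_space_continuous[OF K, of 0] by simp
  have "\<bar>integral {-1/2..1/2} (\<lambda>t. K t * f 0 \<bar>t\<bar>)\<bar> \<le> B * H"
    if f0: "continuous_on {0..1/2} (f 0)"
      and f: "\<And>j t. j < q + 2 \<Longrightarrow> t \<in> {0..1/2} \<Longrightarrow> (f (Suc j) has_real_derivative f j t) (at t within {0..1/2})"
      and odd: "\<And>j. odd j \<Longrightarrow> f j 0 = 0"
      and H: "\<And>t. t \<in> {0..1/2} \<Longrightarrow> \<bar>f (q + 2) t\<bar> \<le> H" for f H
  proof -
    have "\<bar>integral {-1/2..1/2} (\<lambda>t. K t * f 0 \<bar>t\<bar>)\<bar> \<le> B * (H + 2 * d) + d * integral {-1/2..1/2} (\<lambda>t. \<bar>K t\<bar>)"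
      if d: "d > 0" for d
    proof -
      \<comment> \<open>Approximation in the variable t^2 yields an even polynomial, so one
        polynomial is close to the even extension on both sides of 0.\<close>
      have "continuous_on {0..1/4} (\<lambda>s. f 0 (sqrt s))"
        using real_sqrt_le_mono[of _ "1/4"]
        by (intro continuous_on_compose2[OF f0] continuous_intros) (auto simp: real_sqrt_divide)
      then obtain r where r: "real_polynomial_function r" "\<And>s. s \<in> {0..1/4} \<Longrightarrow> \<bar>f 0 (sqrt s) - r s\<bar> < d"
        using Stone_Weierstrass_real_polynomial_function[of "{0..1/4}" "\<lambda>s. f 0 (sqrt s)" d] d by auto
      obtain a n where "r = (\<lambda>x. \<Sum>i\<le>n. a i * x ^ i)"
        using r(1) real_polynomial_function_iff_sum by auto
      then have rp: "r = poly (\<Sum>i\<le>n. monom (a i) i)" by (auto simp: poly_sum poly_monom)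
      define P0 where "P0 = pcompose (\<Sum>i\<le>n. monom (a i) i) (monom 1 2)"
      have P0: "poly P0 t = r (t\<^sup>2)" for t by (simp add: P0_def poly_pcompose poly_monom rp)
      \<comment> \<open>Exact antiderivatives with the initial values of \<open>f\<close>: the error
        at each order is then the integral of the preceding error over a length of at most 1/2 and
        stays below \<open>d\<close>.\<close>
      define P where "P = rec_nat P0 (\<lambda>j P. SOME P'. pderiv P' = P \<and> poly P' 0 = f (Suc j) 0)"
      have P00: "P 0 = P0" by (simp add: P_def)
      have PS: "pderiv (P (Suc j)) = P j" "poly (P (Suc j)) 0 = f (Suc j) 0" for j
        using someI_ex[OF poly_antiderivative[of "P j" "f (Suc j) 0"]] by (auto simp: P_def)
      \<comment> \<open>Both half-intervals are treated together. On the negative side the chain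
        carries the sign (-1)^j, and the two sides match at 0 because \<open>f j 0\<close> is zero
        for odd j.\<close>
      have near: "\<bar>poly (P j) t - f j t\<bar> \<le> d \<and> \<bar>poly (P j) (- t) - (-1) ^ j * f j t\<bar> \<le> d"
        if "j \<le> q + 2" "t \<in> {0..1/2}" for j t
        using that
      proof (induction j arbitrary: t)
        case 0
        then have "t\<^sup>2 \<in> {0..1/4}" using power_mono[of t "1/2" 2] by (auto simp: power_divide)
        from r(2)[OF this] show ?case using 0 by (auto simp: P00 P0 abs_minus_commute)
      next
        case (Suc j)
        have bd: "\<bar>D t\<bar> \<le> d" if D: "\<And>s. s \<in> {0..1/2} \<Longrightarrow> (D has_real_derivative D' s) (at s within {0..1/2})"
          "\<And>s. s \<in> {0..1/2} \<Longrightarrow> \<bar>D' s\<bar> \<le> d" "D 0 = 0" for D D'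
        proof -
          have "norm (D t - D 0) \<le> d * norm (t - 0)"
            by (rule field_differentiable_bound[of "{0..1/2}" _ D']) (use D Suc.prems in auto)
          also have "\<dots> \<le> d * 1" using Suc.prems d by (intro mult_left_mono) auto
          finally show ?thesis using D(3) by simp
        qed
        have p: "((\<lambda>s. poly (P (Suc j)) s) has_real_derivative poly (P j) s) (at s within S)" for s S
          using poly_DERIV[of "P (Suc j)" s] by (auto simp: PS intro: DERIV_subset)
        have fj: "(f (Suc j) has_real_derivative f j s) (at s within {0..1/2})" if "s \<in> {0..1/2}" for s
          using f[OF _ that] Suc.prems by simp
        have "\<bar>poly (P (Suc j)) t - f (Suc j) t\<bar> \<le> d"
          by (rule bd[of "\<lambda>s. poly (P (Suc j)) s - f (Suc j) s" "\<lambda>s. poly (P j) s - f j s"])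
            (use Suc PS fj p in \<open>auto intro!: DERIV_diff\<close>)
        moreover have "\<bar>poly (P (Suc j)) (- t) - (-1) ^ Suc j * f (Suc j) t\<bar> \<le> d"
        proof (rule bd[of "\<lambda>s. poly (P (Suc j)) (- s) - (-1) ^ Suc j * f (Suc j) s" "\<lambda>s. - (poly (P j) (- s) - (-1) ^ j * f j s)"])
          show "((\<lambda>s. poly (P (Suc j)) (- s) - (-1) ^ Suc j * f (Suc j) s) has_real_derivative
              - (poly (P j) (- s) - (-1) ^ j * f j s)) (at s within {0..1/2})" if "s \<in> {0..1/2}" for s
            using fj[OF that]
            by (auto intro!: derivative_eq_intros simp: PS)
          show "\<bar>- (poly (P j) (- s) - (-1) ^ j * f j s)\<bar> \<le> d" if "s \<in> {0..1/2}" for s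
            using Suc.IH[OF _ that] Suc.prems by (simp add: abs_minus_commute)
          show "poly (P (Suc j)) (- 0) - (-1) ^ Suc j * f (Suc j) 0 = 0"
            using odd[of "Suc j"] PS(2)[of j] by (cases "odd (Suc j)") auto
        qed
        ultimately show ?case by blast
      qed
      define Q where "Q = poly (P (q + 2))"
      have Qb: "\<bar>Q t\<bar> \<le> H + d" if "\<bar>t\<bar> \<le> 1/2" for t
      proof (cases "t \<ge> 0")
        case True
        then show ?thesis using near[of "q+2" t] H[of t] that by (auto simp: Q_def)
      next
        case False
        then have "\<bar>(-1) ^ (q+2) * f (q+2) (-t)\<bar> \<le> H" using H[of "-t"] that by (simp add: abs_mult)
        then show ?thesis using near[of "q+2" "-t"] that False by (auto simp: Q_def)
      qed
      have "uniformly_continuous_on {-1..1} Q"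
        unfolding Q_def by (intro compact_uniformly_continuous continuous_intros) auto
      then obtain e where e: "e > 0" "\<And>x y. x \<in> {-1..1} \<Longrightarrow> y \<in> {-1..1} \<Longrightarrow> dist y x < e \<Longrightarrow> dist (Q y) (Q x) < d"
        using d unfolding uniformly_continuous_on_def by metis
      \<comment> \<open>The collar of width 2 \<theta> around [-1/2, 1/2] is shorter than the
        modulus of continuity \<open>e\<close> of \<open>Q\<close> and stays inside [-1, 1]. Cutting
        off in the collar thus raises the bound only from H + d to H + 2 d.\<close>
      define \<theta> where "\<theta> = min (e / 4) (1 / 8)"
      have \<theta>: "\<theta> > 0" "2 * \<theta> < e" "2 * \<theta> < 1 / 2" using e by (auto simp: \<theta>_def)
      have Qb2: "\<bar>Q t\<bar> \<le> H + 2 * d" if "\<bar>t\<bar> \<le> 1/2 + 2 * \<theta>" for t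
      proof -
        define s where "s = max (-1/2) (min (1/2) t)"
        have "\<bar>s\<bar> \<le> 1/2" "dist t s < e" "s \<in> {-1..1}" "t \<in> {-1..1}"
          using that \<theta> by (auto simp: s_def dist_real_def)
        then show ?thesis using Qb[of s] e(2)[of s t] by (auto simp: dist_real_def)
      qed
      obtain S :: "real \<Rightarrow> real" where S: "smooth S" "\<And>t. 0 \<le> S t" "\<And>t. S t \<le> 1"
        "\<And>t. t \<le> 0 \<Longrightarrow> S t = 0" "\<And>t. t \<ge> 1 \<Longrightarrow> S t = 1" using smooth_step_exists by metis
      \<comment> \<open>The cutoff equals 1 on a neighbourhood of [-1/2, 1/2]; where it changes the
        function, \<open>K\<close> is zero and the integral does not notice.\<close>
      define cut where "cut t = S (t / \<theta> + (1/2 + 2 * \<theta>) / \<theta>) * S (- t / \<theta> + (1/2 + 2 * \<theta>) / \<theta>)" for t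
      have cut: "smooth cut" unfolding cut_def
        by (intro smooth_mult smooth_compose_affine S(1)) (auto intro!: bounded_linear_divide bounded_linear_minus)
      have cut1: "cut t = 1" if "\<bar>t\<bar> < 1/2 + \<theta>" for t
      proof -
        have "t / \<theta> + (1/2 + 2 * \<theta>) / \<theta> \<ge> 1" "- t / \<theta> + (1/2 + 2 * \<theta>) / \<theta> \<ge> 1"
          using that \<theta>(1) unfolding add_divide_distrib[symmetric]
          by (auto simp: pos_le_divide_eq abs_if split: if_splits)
        then show ?thesis using S(5) by (simp add: cut_def)
      qed
      have cut0: "cut t = 0" if "\<bar>t\<bar> > 1/2 + 2 * \<theta>" for t
      proof (cases "t > 0")
        case True
        then have "- t / \<theta> + (1/2 + 2 * \<theta>) / \<theta> \<le> 0"
          using that \<theta>(1) unfolding add_divide_distrib[symmetric] by (simp add: pos_divide_le_eq)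
        then show ?thesis using S(4) by (simp add: cut_def)
      next
        case False
        then have "t / \<theta> + (1/2 + 2 * \<theta>) / \<theta> \<le> 0"
          using that \<theta>(1) unfolding add_divide_distrib[symmetric] by (simp add: pos_divide_le_eq)
        then show ?thesis using S(4) by (simp add: cut_def)
      qed
      have cutb: "\<bar>cut t\<bar> \<le> 1" for t
        unfolding cut_def abs_mult using S(2,3) by (intro mult_le_one) auto
      define \<phi> where "\<phi> t = Q t * cut t" for t
      have sm: "smooth \<phi>" unfolding \<phi>_def Q_def by (intro smooth_mult smooth_poly cut)
      have supp: "\<phi> t = 0" if "1 < \<bar>t\<bar>" for t using cut0[of t] that \<theta> by (simp add: \<phi>_def)
      have H0: "H \<ge> 0" using H[of 0] by simp
      have bnd: "\<bar>\<phi> t\<bar> \<le> H + 2 * d" for t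
      proof (cases "\<bar>t\<bar> \<le> 1/2 + 2 * \<theta>")
        case True
        have "\<bar>Q t\<bar> * \<bar>cut t\<bar> \<le> (H + 2 * d) * 1"
          using Qb2[OF True] cutb[of t] d H0 by (intro mult_mono) auto
        then show ?thesis by (simp add: \<phi>_def abs_mult)
      next
        case False
        then show ?thesis using cut0[of t] d H0 by (simp add: \<phi>_def)
      qed
      have der: "(deriv ^^ n) \<phi> t = poly (P (q + 2 - n)) t" if "n \<le> q + 2" "\<bar>t\<bar> < 1/2 + \<theta>" for n t
        using that
      proof (induction n arbitrary: t)
        case 0
        then show ?case by (simp add: \<phi>_def Q_def cut1)
      next
        case (Suc n)
        have "deriv ((deriv ^^ n) \<phi>) t = poly (P (q + 2 - Suc n)) t"
        proof (rule deriv_eq_on_open[of "{t. \<bar>t\<bar> < 1/2 + \<theta>}" t "poly (P (q + 2 - n))"])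
          show "open {t. \<bar>t\<bar> < 1/2 + \<theta>}" by (intro open_Collect_less continuous_intros)
          have "q + 2 - n = Suc (q + 2 - Suc n)" using Suc.prems by simp
          then show "(poly (P (q + 2 - n)) has_real_derivative poly (P (q + 2 - Suc n)) t) (at t)"
            using poly_DERIV[of "P (q + 2 - n)" t] PS(1)[of "q + 2 - Suc n"] by metis
        qed (use Suc in auto)
        then show ?case by simp
      qed
      have "integral {-2..2} (\<lambda>t. K t * (deriv ^^ (q + 2)) \<phi> t) =
        integral {-1/2..1/2} (\<lambda>t. K t * (deriv ^^ (q + 2)) \<phi> t)"
        by (rule integral_zero_outside) (use kernel_space_supp(1)[OF K] in \<open>force simp: abs_if\<close>)
      also have "\<dots> = integral {-1/2..1/2} (\<lambda>t. K t * poly P0 t)"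
      proof (rule integral_cong)
        fix t :: real assume "t \<in> {-1/2..1/2}"
        then have "\<bar>t\<bar> < 1/2 + \<theta>" using \<theta> by auto
        then show "K t * (deriv ^^ (q + 2)) \<phi> t = K t * poly P0 t" using der[of "q+2" t] P00 by simp
      qed
      finally have main: "\<bar>integral {-1/2..1/2} (\<lambda>t. K t * poly P0 t)\<bar> \<le> B * (H + 2 * d)"
        using B[OF sm supp bnd] by simp
      have cf: "continuous_on {-1/2..1/2} (\<lambda>t. f 0 \<bar>t\<bar>)"
        by (intro continuous_on_compose2[OF f0] continuous_intros) auto
      have "\<bar>integral {-1/2..1/2} (\<lambda>t. K t * f 0 \<bar>t\<bar> - K t * poly P0 t)\<bar> \<le> integral {-1/2..1/2} (\<lambda>t. d * \<bar>K t\<bar>)"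
      proof (rule integral_abs_le)
        fix t :: real assume t: "t \<in> {-1/2..1/2}"
        have "\<bar>f 0 \<bar>t\<bar> - poly P0 t\<bar> \<le> d" using near[of 0 "\<bar>t\<bar>"] t by (auto simp: P00 P0 abs_minus_commute)
        then have "\<bar>K t\<bar> * \<bar>f 0 \<bar>t\<bar> - poly P0 t\<bar> \<le> \<bar>K t\<bar> * d" by (intro mult_left_mono) auto
        then show "\<bar>K t * f 0 \<bar>t\<bar> - K t * poly P0 t\<bar> \<le> d * \<bar>K t\<bar>"
          by (simp add: abs_mult mult.commute flip: right_diff_distrib)
      qed (intro integrable_continuous_interval continuous_intros cK cf)+
      also have "integral {-1/2..1/2} (\<lambda>t. K t * f 0 \<bar>t\<bar> - K t * poly P0 t) =
        integral {-1/2..1/2} (\<lambda>t. K t * f 0 \<bar>t\<bar>) - integral {-1/2..1/2} (\<lambda>t. K t * poly P0 t)"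
        by (intro Henstock_Kurzweil_Integration.integral_diff integrable_continuous_interval continuous_intros cK cf)
      finally show ?thesis using main by simp
    qed
    note * = this
    define c where "c = 2 * B + integral {-1/2..1/2} (\<lambda>t. \<bar>K t\<bar>)"
    \<comment> \<open>Every error term is linear in the accuracy \<open>d\<close>, which now tends
      to 0.\<close>
    have "((\<lambda>d. B * H + d * c) \<longlongrightarrow> B * H + 0 * c) (at_right 0)"
      by (intro tendsto_intros)
    moreover have "eventually (\<lambda>d. \<bar>integral {-1/2..1/2} (\<lambda>t. K t * f 0 \<bar>t\<bar>)\<bar> \<le> B * H + d * c) (at_right 0)"
      unfolding eventually_at_right_field using * by (intro exI[of _ 1]) (auto simp: c_def algebra_simps)
    ultimately show ?thesis by (intro tendsto_lowerbound) auto
  qed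
  then show ?thesis using B0 by (intro exI[of _ B]) simp
qed

section \<open>Approximate correctors on the torus\<close>

definition chr :: "int^'n \<Rightarrow> real^'n \<Rightarrow> complex" where
  "chr k x = cis (2 * pi * (\<Sum>j\<in>UNIV. real_of_int (k $ j) * x $ j))"

lemma chr_add: "chr (k + l) x = chr k x * chr l x"
  by (simp add: chr_def cis_mult distrib_right sum.distrib distrib_left)

lemma chr_0 [simp]: "chr 0 x = 1"
  by (simp add: chr_def)

lemma cnj_chr: "cnj (chr k x) = chr (- k) x"
  by (simp add: chr_def cis_cnj sum_negf)

lemma norm_chr [simp]: "norm (chr k x) = 1"
  by (simp add: chr_def)

lemma continuous_on_chr [continuous_intros]: "continuous_on S (chr k)"
  unfolding chr_def by (intro continuous_intros)

text \<open>Terms are added one at a time and frequencies may repeat, so closure under sums and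
  products is a plain induction; \<open>trig_repr\<close> collects equal frequencies
  afterwards.\<close>

inductive trig :: "(real^'n \<Rightarrow> complex) \<Rightarrow> bool" where
  trig_zero: "trig (\<lambda>x. 0)"
| trig_step: "trig P \<Longrightarrow> trig (\<lambda>x. c * chr k x + P x)"

lemma trig_monom: "trig (\<lambda>x. c * chr k x)"
  using trig_step[OF trig_zero, of c k] by simp

lemma trig_add: "trig P \<Longrightarrow> trig Q \<Longrightarrow> trig (\<lambda>x. P x + Q x)"
  by (induction rule: trig.induct) (auto simp: add.assoc intro: trig_step)

lemma trig_monom_mult: "trig P \<Longrightarrow> trig (\<lambda>x. c * chr k x * P x)"
proof (induction rule: trig.induct)
  case trig_zero
  then show ?case by (simp add: trig.trig_zero)
next
  case (trig_step P d l)
  have "(\<lambda>x. c * chr k x * (d * chr l x + P x)) = (\<lambda>x. (c * d) * chr (k + l) x + c * chr k x * P x)"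
    by (simp add: chr_add algebra_simps)
  then show ?case using trig.trig_step[OF trig_step.IH, of "c * d" "k + l"] by simp
qed

lemma trig_mult: "trig P \<Longrightarrow> trig Q \<Longrightarrow> trig (\<lambda>x. P x * Q x)"
proof (induction rule: trig.induct)
  case trig_zero
  then show ?case by (simp add: trig.trig_zero)
next
  case (trig_step P c k)
  then show ?case using trig_add[OF trig_monom_mult[of Q c k]] by (simp add: distrib_right)
qed

lemma trig_const: "trig (\<lambda>x. c)"
  using trig_monom[of c 0] by simp

lemma trig_sum: "finite A \<Longrightarrow> (\<And>a. a \<in> A \<Longrightarrow> trig (P a)) \<Longrightarrow> trig (\<lambda>x. \<Sum>a\<in>A. P a x)"
  by (induction A rule: finite_induct) (auto intro: trig_zero trig_add)

lemma trig_cos_sin: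
  "trig (\<lambda>x. complex_of_real (cos (2 * pi * x $ i)))" "trig (\<lambda>x. complex_of_real (sin (2 * pi * x $ i)))"
proof -
  have c: "chr (axis i 1) x = cis (2 * pi * x $ i)" "chr (axis i (-1)) x = cis (- (2 * pi * x $ i))" for x
    by (simp_all add: chr_def axis_def if_distrib if_distribR sum.delta cong: if_cong)
  have e: "(\<lambda>x. complex_of_real (cos (2 * pi * x $ i))) = (\<lambda>x. (1/2) * chr (axis i 1) x + (1/2) * chr (axis i (-1)) x)"
    by (rule ext) (simp add: c complex_eq_iff)
  show "trig (\<lambda>x. complex_of_real (cos (2 * pi * x $ i)))"
    by (subst e) (intro trig_add trig_monom)
  have e: "(\<lambda>x. complex_of_real (sin (2 * pi * x $ i))) = (\<lambda>x. (-\<i>/2) * chr (axis i 1) x + (\<i>/2) * chr (axis i (-1)) x)"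
    by (rule ext) (simp add: c complex_eq_iff)
  show "trig (\<lambda>x. complex_of_real (sin (2 * pi * x $ i)))"
    by (subst e) (intro trig_add trig_monom)
qed

text \<open>Realizes the torus as a compact subset of a Euclidean space, where the Stone-Weierstrass
  theorem for polynomials applies. Polynomials on the image are polynomials in cosines and sines,
  hence trigonometric.\<close>

definition torus_map :: "real^'n \<Rightarrow> complex^'n" where
  "torus_map x = (\<chi> i. cis (2 * pi * x $ i))"

lemma continuous_on_torus_map: "continuous_on S torus_map"
  unfolding torus_map_def by (intro continuous_intros)

lemma trig_polynomial:
  "real_polynomial_function r \<Longrightarrow> trig (\<lambda>x. complex_of_real (r (torus_map x)))"
proof (induction rule: real_polynomial_function.induct)
  case (linear f)
  \<comment> \<open>A real linear functional is determined by its values on the real basis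
    \<open>axis i 1\<close>, \<open>axis i \<i>\<close>.\<close>
  have e: "torus_map x = (\<Sum>i\<in>UNIV. cos (2 * pi * x $ i) *\<^sub>R axis i 1 + sin (2 * pi * x $ i) *\<^sub>R axis i \<i>)" for x
    by (simp add: torus_map_def vec_eq_iff axis_def if_distrib if_distribR sum.delta complex_eq_iff cong: if_cong)
  interpret f: bounded_linear f by fact
  have "complex_of_real (f (torus_map x)) = (\<Sum>i\<in>UNIV. complex_of_real (f (axis i 1)) * complex_of_real (cos (2 * pi * x $ i))
     + complex_of_real (f (axis i \<i>)) * complex_of_real (sin (2 * pi * x $ i)))" for x
    by (simp add: e f.sum f.add f.scaleR mult.commute)
  moreover have "trig (\<lambda>x. \<Sum>i\<in>UNIV. complex_of_real (f (axis i 1)) * complex_of_real (cos (2 * pi * x $ i))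
     + complex_of_real (f (axis i \<i>)) * complex_of_real (sin (2 * pi * x $ i)))"
    by (intro trig_sum trig_add trig_mult trig_const trig_cos_sin) auto
  ultimately show ?case by simp
qed (auto intro: trig_const trig_add trig_mult)

lemma trig_repr: "trig P \<Longrightarrow> \<exists>F c. finite F \<and> P = (\<lambda>x. \<Sum>k\<in>F. c k * chr k x)"
proof (induction rule: trig.induct)
  case trig_zero
  then show ?case by (intro exI[of _ "{}"]) auto
next
  case (trig_step P d l)
  then obtain F c where F: "finite F" "P = (\<lambda>x. \<Sum>k\<in>F. c k * chr k x)" by blast
  define c' where "c' k = (if k \<in> F then c k else 0) + (if k = l then d else 0)" for k
  have "(\<Sum>k\<in>insert l F. c' k * chr k x) = d * chr l x + P x" for x
  proof -
    have "(\<Sum>k\<in>insert l F. c' k * chr k x) = (\<Sum>k\<in>insert l F. (if k \<in> F then c k * chr k x else 0)) +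
       (\<Sum>k\<in>insert l F. (if k = l then d * chr k x else 0))"
      unfolding sum.distrib[symmetric] by (rule sum.cong) (auto simp: c'_def distrib_right)
    also have "(\<Sum>k\<in>insert l F. (if k \<in> F then c k * chr k x else 0)) = P x"
      unfolding F(2) using F(1) by (intro sum.mono_neutral_cong_right) auto
    also have "(\<Sum>k\<in>insert l F. (if k = l then d * chr k x else 0)) = d * chr l x"
      using F(1) by (simp add: sum.delta)
    finally show ?thesis by simp
  qed
  then show ?case using F(1) by (intro exI[of _ "insert l F"] exI[of _ c']) auto
qed

section \<open>Orthogonality of the characters and Parseval\<close>

lemma integral_cis: "integral {0..1} (\<lambda>t. cis (2 * pi * (real_of_int m * t))) = (if m = 0 then 1 else 0)"
proof (cases "m = 0")
  case False
  define w where "w = 2 * pi * real_of_int m"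
  have w: "w \<noteq> 0" using False by (simp add: w_def)
  have "((\<lambda>t. cis (w * t)) has_integral cis (w * 1) / (\<i> * w) - cis (w * 0) / (\<i> * w)) {0..1}"
  proof (rule fundamental_theorem_of_calculus)
    fix t :: real
    have "((\<lambda>t. exp (\<i> * w * complex_of_real t) / (\<i> * w)) has_vector_derivative exp (\<i> * w * complex_of_real t)) (at t within {0..1})"
      by (rule has_vector_derivative_real_field) (use w in \<open>auto intro!: derivative_eq_intros\<close>)
    then show "((\<lambda>t. cis (w * t) / (\<i> * w)) has_vector_derivative cis (w * t)) (at t within {0..1})"
      by (simp add: cis_conv_exp mult_ac)
  qed auto
  moreover have "cis w = 1" using cos_int_2pin[of m] sin_int_2pin[of m] by (simp add: w_def complex_eq_iff)
  ultimately show ?thesis using False by (auto simp: w_def mult_ac dest: integral_unique)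
qed simp

lemma cis_sum: "finite A \<Longrightarrow> cis (\<Sum>a\<in>A. f a) = (\<Prod>a\<in>A. cis (f a))"
  by (induction A rule: finite_induct) (auto simp: cis_mult[symmetric])

lemma cube_mem: "x \<in> cube L \<longleftrightarrow> (\<forall>i. 0 \<le> x $ i \<and> x $ i \<le> L)"
  by (simp add: cube_def mem_box_cart)

lemma integral_chr: "integral (cube 1) (chr (k :: int^'n)) = (if k = 0 then 1 else 0)"
proof -
  define g where "g j t = indicator {0..1} t *\<^sub>R cis (2 * pi * (real_of_int (k $ j) * t))" for j t
  have ig: "set_integrable lborel {0..1::real} (\<lambda>t. cis (2 * pi * (real_of_int m * t)))" for m
    unfolding set_integrable_def by (intro borel_integrable_compact continuous_intros) auto
  have g: "integrable lborel (g j)" for j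
    using ig unfolding g_def set_integrable_def .
  have gi: "(LINT t|lborel. g j t) = (if k $ j = 0 then 1 else 0)" for j
    using set_borel_integral_eq_integral(2)[OF ig, of "k $ j"] integral_cis[of "k $ j"]
    by (simp add: g_def set_lebesgue_integral_def)
  have "indicator (cube 1) x *\<^sub>R chr k x = (\<Prod>j\<in>UNIV. g j (x $ j))" for x :: "real^'n"
  proof (cases "x \<in> cube 1")
    case True
    then have "(\<Prod>j\<in>UNIV. g j (x $ j)) = (\<Prod>j\<in>UNIV. cis (2 * pi * (real_of_int (k $ j) * x $ j)))"
      by (intro prod.cong) (auto simp: g_def cube_mem)
    then show ?thesis using True by (simp add: chr_def sum_distrib_left cis_sum)
  next
    case False
    then obtain j where "x $ j \<notin> {0..1}" by (auto simp: cube_mem)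
    then have "g j (x $ j) = 0" by (simp add: g_def)
    then have "(\<Prod>j\<in>UNIV. g j (x $ j)) = 0" by (meson UNIV_I finite prod_zero)
    then show ?thesis using False by simp
  qed
  then have "(LINT x : cube 1|lborel. chr k x) = (\<Prod>j\<in>UNIV. (LINT t|lborel. g j t))"
    unfolding set_lebesgue_integral_def using integral_prod_vec[OF g] by simp
  moreover have "set_integrable lborel (cube 1) (chr k)"
    unfolding set_integrable_def cube_def by (intro borel_integrable_compact continuous_intros) auto
  ultimately have "integral (cube 1) (chr k) = (\<Prod>j\<in>UNIV. if k $ j = 0 then 1 else 0)"
    using set_borel_integral_eq_integral(2)[of "cube 1" "chr k"] gi by simp
  also have "\<dots> = (if k = 0 then 1 else 0)"
    by (auto simp: vec_eq_iff prod_zero_iff)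
  finally show ?thesis .
qed

lemma integrable_cube: "continuous_on UNIV f \<Longrightarrow> f integrable_on cube L" for f :: "real^'n \<Rightarrow> 'b::banach"
  unfolding cube_def by (rule integrable_continuous) (rule continuous_on_subset, auto)

lemma measure_cube_1 [simp]: "measure lborel (cube 1 :: (real^'n) set) = 1"
  unfolding cube_def by (subst content_cbox_cart) (auto simp: interval_ne_empty_cart)

text \<open>By orthogonality the left side is the integral of the squared modulus over a cube of
  volume 1. It converts a sup bound on a trigonometric polynomial into an l2 bound on its
  coefficients.\<close>

lemma parseval_le:
  fixes c :: "int^'n \<Rightarrow> complex"
  assumes F: "finite F" and b: "\<And>x. norm (\<Sum>k\<in>F. c k * chr k x) \<le> M"
  shows "(\<Sum>k\<in>F. (norm (c k))\<^sup>2) \<le> M\<^sup>2"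
proof -
  define P where "P x = (\<Sum>k\<in>F. c k * chr k x)" for x
  have "P x * cnj (P x) = (\<Sum>k\<in>F. \<Sum>l\<in>F. (c k * cnj (c l)) * chr (k - l) x)" for x
    unfolding P_def cnj_sum sum_product
    by (intro sum.cong refl) (simp add: cnj_chr chr_add[of _ "- _", simplified] mult_ac)
  then have "integral (cube 1) (\<lambda>x. P x * cnj (P x)) =
      (\<Sum>k\<in>F. \<Sum>l\<in>F. (c k * cnj (c l)) * integral (cube 1) (chr (k - l)))"
    using F by (simp add: integral_sum integrable_cube continuous_intros)
  also have "\<dots> = (\<Sum>k\<in>F. \<Sum>l\<in>F. if l = k then c k * cnj (c l) else 0)"
    by (intro sum.cong refl) (auto simp: integral_chr)
  also have "\<dots> = (\<Sum>k\<in>F. complex_of_real ((norm (c k))\<^sup>2))"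
    using F by (simp add: sum.delta) (intro sum.cong refl, metis complex_norm_square of_real_power)
  finally have "complex_of_real (\<Sum>k\<in>F. (norm (c k))\<^sup>2) = integral (cube 1) (\<lambda>x. P x * cnj (P x))" by simp
  moreover have "norm (integral (cube 1) (\<lambda>x. P x * cnj (P x))) \<le> M\<^sup>2 * measure lborel (cube 1 :: (real^'n) set)"
    unfolding cube_def
  proof (rule integrable_bound)
    show "(\<lambda>x. P x * cnj (P x)) integrable_on cbox 0 (\<chi> i. 1)"
      unfolding P_def by (intro integrable_continuous continuous_intros)
    show "norm (P x * cnj (P x)) \<le> M\<^sup>2" for x
    proof -
      have "norm (P x) \<le> M" using b[of x] by (simp add: P_def)
      then have "norm (P x) * norm (P x) \<le> M * M" 
        by (intro mult_mono) (auto intro: order_trans[OF norm_ge_zero])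
      then show ?thesis by (simp add: norm_mult power2_eq_square)
    qed
  qed simp
  ultimately have "norm (complex_of_real (\<Sum>k\<in>F. (norm (c k))\<^sup>2)) \<le> M\<^sup>2" by simp
  then show ?thesis by (metis norm_of_real abs_le_D1)
qed

section \<open>The lattice sum of |k|^(-4) in dimension at most three\<close>

definition nsq :: "int^'n \<Rightarrow> real" where
  "nsq k = (\<Sum>j\<in>UNIV. (real_of_int (k $ j))\<^sup>2)"

lemma nsq_ge_1: "k \<noteq> 0 \<Longrightarrow> 1 \<le> nsq k"
proof -
  assume "k \<noteq> 0"
  then obtain j where "k $ j \<noteq> 0" by (auto simp: vec_eq_iff)
  then have "1 \<le> (real_of_int (k $ j))\<^sup>2"
    by (metis one_le_power of_int_1_le_iff of_int_power power2_abs int_one_le_iff_zero_less zero_less_abs_iff)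
  also have "\<dots> \<le> nsq k" unfolding nsq_def by (rule member_le_sum) auto
  finally show ?thesis .
qed

text \<open>The exponent is chosen for three factors: each decays like |m|^(-4/3), which is still
  summable, and three of them together account for |k|^(-4).\<close>

lemma int_sum_bound: "\<exists>S\<ge>0. \<forall>A::int set. finite A \<longrightarrow> (\<Sum>m\<in>A. (1 + (real_of_int m)\<^sup>2) powr (-(2/3))) \<le> S"
proof -
  define h where "h n = (1 + (real n)\<^sup>2) powr (-(2/3))" for n :: nat
  have h0: "h n \<ge> 0" for n by (simp add: h_def)
  have "summable (\<lambda>n. real n powr (-(4/3)))" by (simp add: summable_real_powr_iff)
  moreover have "norm (h n) \<le> real n powr (-(4/3))" if "n \<ge> 1" for n
  proof -
    have "h n \<le> ((real n)\<^sup>2) powr (-(2/3))"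
      unfolding h_def using that by (intro powr_mono2') auto
    also have "\<dots> = real n powr (-(4/3))"
      using that by (simp add: powr_powr flip: powr_numeral)
    finally show ?thesis using h0 by simp
  qed
  ultimately have s: "summable h" by (rule summable_comparison_test')
  have "(\<Sum>m\<in>A. (1 + (real_of_int m)\<^sup>2) powr (-(2/3))) \<le> 2 * suminf h" if A: "finite A" for A :: "int set"
  proof -
    have part: "(\<Sum>m\<in>B. (1 + (real_of_int m)\<^sup>2) powr (-(2/3))) \<le> suminf h" if "finite B" "inj_on (\<lambda>m. nat \<bar>m\<bar>) B" for B
    proof -
      have "(\<Sum>m\<in>B. (1 + (real_of_int m)\<^sup>2) powr (-(2/3))) = (\<Sum>n\<in>(\<lambda>m. nat \<bar>m\<bar>) ` B. h n)"
        using that by (subst sum.reindex) (auto simp: h_def)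
      also have "\<dots> \<le> suminf h" using that s h0 by (intro sum_le_suminf) auto
      finally show ?thesis .
    qed
    have "(\<Sum>m\<in>A. (1 + (real_of_int m)\<^sup>2) powr (-(2/3))) =
      (\<Sum>m\<in>{m\<in>A. m \<ge> 0}. (1 + (real_of_int m)\<^sup>2) powr (-(2/3))) + (\<Sum>m\<in>{m\<in>A. m < 0}. (1 + (real_of_int m)\<^sup>2) powr (-(2/3)))"
      by (subst sum.union_disjoint[symmetric]) (use A in \<open>auto intro!: sum.cong\<close>)
    also have "\<dots> \<le> suminf h + suminf h"
      using A by (intro add_mono part) (auto simp: inj_on_def)
    finally show ?thesis by simp
  qed
  then show ?thesis using suminf_nonneg[OF s h0] by (intro exI[of _ "2 * suminf h"]) auto
qed

text \<open>Each one-dimensional weight at k_j is at least (1 + |k|^2)^(-2/3), so the product over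
  at most three coordinates dominates a multiple of |k|^(-4), and the sum of products factorizes. In
  dimension 4 the sum diverges logarithmically.\<close>

lemma lattice_sum_bound:
  assumes "CARD('n) \<le> 3"
  shows "\<exists>S\<ge>0. \<forall>F::(int^'n) set. finite F \<longrightarrow> 0 \<notin> F \<longrightarrow> (\<Sum>k\<in>F. 1 / (nsq k)\<^sup>2) \<le> S"
proof -
  define w where "w m = (1 + (real_of_int m)\<^sup>2) powr (-(2/3))" for m
  obtain S where S: "S \<ge> 0" "\<And>A. finite A \<Longrightarrow> (\<Sum>m\<in>A. w m) \<le> S"
    using int_sum_bound unfolding w_def by blast
  have w0: "w m \<ge> 0" for m by (simp add: w_def)
  have bd: "1 / (nsq k)\<^sup>2 \<le> 4 * (\<Prod>j\<in>UNIV. w (k $ j))" if "k \<noteq> 0" for k :: "int^'n"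
  proof -
    define N where "N = 1 + nsq k"
    have N: "N \<ge> 1" "nsq k \<ge> 1" "N \<le> 2 * nsq k" using nsq_ge_1[OF that] by (auto simp: N_def)
    have "N powr (-(2/3)) \<le> w (k $ j)" for j
    proof -
      have "(real_of_int (k $ j))\<^sup>2 \<le> nsq k" unfolding nsq_def by (rule member_le_sum) auto
      then show ?thesis unfolding w_def N_def
        by (intro powr_mono2') (auto intro: add_pos_nonneg)
    qed
    then have "(\<Prod>j\<in>(UNIV::'n set). N powr (-(2/3))) \<le> (\<Prod>j\<in>UNIV. w (k $ j))"
      by (intro prod_mono) auto
    \<comment> \<open>Below dimension 3 there are fewer factors, each at most 1, and the product
      only grows.\<close>
    moreover have "(N powr (-(2/3))) ^ 3 \<le> (N powr (-(2/3))) ^ CARD('n)"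
      using powr_mono[of "-(2/3)" 0 N] N(1) assms by (intro power_decreasing) auto
    moreover have "(N powr (-(2/3))) ^ 3 = 1 / N\<^sup>2"
    proof -
      have "(N powr (-(2/3))) ^ 3 = N powr (-2)"
        using N(1) by (simp add: powr_powr flip: powr_numeral)
      also have "\<dots> = 1 / N\<^sup>2" using N(1) by (simp add: powr_minus_divide)
      finally show ?thesis .
    qed
    ultimately have "1 / N\<^sup>2 \<le> (\<Prod>j\<in>UNIV. w (k $ j))" by simp
    moreover have "1 / (nsq k)\<^sup>2 \<le> 4 / N\<^sup>2"
    proof -
      have "N\<^sup>2 \<le> (2 * nsq k)\<^sup>2" using N by (intro power_mono) auto
      then show ?thesis using N by (simp add: field_simps power_mult_distrib)
    qed
    ultimately show ?thesis by simp
  qed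
  have "(\<Sum>k\<in>F. 1 / (nsq k)\<^sup>2) \<le> 4 * S ^ CARD('n)" if F: "finite F" "0 \<notin> F" for F :: "(int^'n) set"
  proof -
    \<comment> \<open>All coordinates of all frequencies in \<open>F\<close>: the sum is enlarged to
      a full finite box of frequencies, over which it becomes a product of sums.\<close>
    define A where "A = (\<Union>k\<in>F. range (\<lambda>j. k $ j))"
    have A: "finite A" unfolding A_def using F by auto
    have "(\<Sum>k\<in>F. 1 / (nsq k)\<^sup>2) \<le> (\<Sum>k\<in>F. 4 * (\<Prod>j\<in>UNIV. w (k $ j)))"
      using F bd by (intro sum_mono) metis
    also have "\<dots> = 4 * (\<Sum>g\<in>(\<lambda>k. vec_nth k) ` F. \<Prod>j\<in>UNIV. w (g j))"
      by (subst sum.reindex) (auto simp: inj_on_def vec_eq_iff sum_distrib_left)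
    also have "(\<Sum>g\<in>(\<lambda>k. vec_nth k) ` F. \<Prod>j\<in>UNIV. w (g j)) \<le> (\<Sum>g\<in>PiE (UNIV::'n set) (\<lambda>_. A). \<Prod>j\<in>UNIV. w (g j))"
    proof (rule sum_mono2)
      show "finite (PiE (UNIV::'n set) (\<lambda>_. A))" by (intro finite_PiE A) simp
      show "(\<lambda>k. vec_nth k) ` F \<subseteq> PiE UNIV (\<lambda>_. A)" by (auto simp: A_def PiE_iff)
    qed (auto intro!: prod_nonneg w0)
    also have "\<dots> = (\<Prod>j\<in>(UNIV::'n set). \<Sum>m\<in>A. w m)"
      by (subst prod_sum_PiE) (auto simp: A)
    also have "\<dots> \<le> (\<Prod>j\<in>(UNIV::'n set). S)"
      by (intro prod_mono) (auto intro: S A sum_nonneg w0)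
    finally show ?thesis by simp
  qed
  then show ?thesis using S(1) by (intro exI[of _ "4 * S ^ CARD('n)"]) auto
qed

section \<open>Poisson's equation on the torus up to a small error\<close>

definition wave :: "complex \<Rightarrow> int^'n \<Rightarrow> real^'n \<Rightarrow> real" where
  "wave c k x = Re (c * chr k x)"

lemma has_partial_wave: "has_partial i (wave c k) (wave (2 * pi * \<i> * of_int (k $ i) * c) k)"
proof -
  define \<theta> where "\<theta> x = 2 * pi * (\<Sum>j\<in>UNIV. real_of_int (k $ j) * x $ j)" for x
  have e: "wave c k x = Re c * cos (\<theta> x) - Im c * sin (\<theta> x)" for c x
    by (simp add: wave_def chr_def \<theta>_def)
  have \<theta>: "\<theta> (x + s *\<^sub>R axis i 1) = \<theta> x + (2 * pi * k $ i) * s" for x s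
  proof -
    have "(\<Sum>j\<in>UNIV. real_of_int (k $ j) * (x + s *\<^sub>R axis i 1) $ j) =
        (\<Sum>j\<in>UNIV. real_of_int (k $ j) * x $ j + (if j = i then k $ i * s else 0))"
      by (intro sum.cong) (auto simp: axis_def distrib_left)
    also have "\<dots> = (\<Sum>j\<in>UNIV. real_of_int (k $ j) * x $ j) + k $ i * s"
      by (simp add: sum.distrib sum.delta)
    finally show ?thesis by (simp add: \<theta>_def distrib_left)
  qed
  show ?thesis unfolding has_partial_def e \<theta>
    by (auto intro!: derivative_eq_intros simp: algebra_simps)
qed

lemma has_partial_sum:
  assumes "\<And>a. a \<in> A \<Longrightarrow> has_partial i (f a) (f' a)"
  shows "has_partial i (\<lambda>x. \<Sum>a\<in>A. f a x) (\<lambda>x. \<Sum>a\<in>A. f' a x)"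
  using assms unfolding has_partial_def by (auto intro!: DERIV_sum)

lemma periodic_with_int:
  fixes f :: "real^'n \<Rightarrow> real"
  assumes "periodic_with P f" 
  shows "f (x + (\<chi> i. P * of_int (m i))) = f x"
proof -
  have one: "f (x + axis i (P * of_int n)) = f x" for x i and n :: int
  proof (induction n rule: int_induct[of _ 0])
    case (step1 n)
    have "x + axis i (P * of_int (n + 1)) = (x + axis i (P * of_int n)) + axis i P"
      by (simp add: vec_eq_iff axis_def algebra_simps)
    moreover have "f ((x + axis i (P * of_int n)) + axis i P) = f (x + axis i (P * of_int n))"
      using assms unfolding periodic_with_def by blast
    ultimately show ?case using step1 by (simp only:)
  next
    case (step2 n)
    have "x + axis i (P * of_int n) = (x + axis i (P * of_int (n - 1))) + axis i P"
      by (simp add: vec_eq_iff axis_def algebra_simps)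
    moreover have "f ((x + axis i (P * of_int (n - 1))) + axis i P) = f (x + axis i (P * of_int (n - 1)))"
      using assms unfolding periodic_with_def by blast
    ultimately show ?case using step2 by (simp only:)
  qed (simp add: axis_def zero_vec_def[symmetric])
  have "f (x + (\<Sum>i\<in>A. axis i (P * of_int (m i)))) = f x" if "finite A" for A
    using that
  proof induction
    case (insert i A)
    then show ?case using one[of "x + (\<Sum>i\<in>A. axis i (P * of_int (m i)))" i "m i"] by (simp add: add_ac)
  qed simp
  moreover have "(\<Sum>i\<in>UNIV. axis i (P * of_int (m i))) = (\<chi> i. P * of_int (m i))"
    by (simp add: vec_eq_iff axis_def if_distrib sum.delta cong: if_cong)
  ultimately show ?thesis by (metis finite)
qed

lemma torus_map_eqD:
  assumes "periodic_with 1 f" "torus_map x = torus_map y"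
  shows "f x = f y"
proof -
  have "\<exists>n::int. y $ i = x $ i + of_int n" for i
  proof -
    have "cis (2 * pi * x $ i) = cis (2 * pi * y $ i)"
      using assms(2) by (simp add: torus_map_def vec_eq_iff)
    then have "sin (2 * pi * y $ i) = sin (2 * pi * x $ i) \<and> cos (2 * pi * y $ i) = cos (2 * pi * x $ i)"
      by (simp add: complex_eq_iff)
    then obtain n :: int where "2 * pi * y $ i = 2 * pi * x $ i + 2 * pi * of_int n"
      using sin_cos_eq_iff by blast
    then have "2 * pi * y $ i = 2 * pi * (x $ i + of_int n)" by (simp add: distrib_left)
    then show ?thesis by auto
  qed
  then obtain m where "y $ i = x $ i + of_int (m i :: int)" for i by metis
  then have "y = x + (\<chi> i. 1 * of_int (m i))" by (simp add: vec_eq_iff)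
  then show ?thesis using periodic_with_int[OF assms(1)] by metis
qed

lemma torus_map_cube: "\<exists>y\<in>cube 1. torus_map y = torus_map x"
proof
  show "(\<chi> i. frac (x $ i)) \<in> cube 1" by (auto simp: cube_mem intro: less_imp_le frac_lt_1)
  show "torus_map (\<chi> i. frac (x $ i)) = torus_map x"
  proof -
    have "cis (2 * pi * frac t) = cis (2 * pi * t)" for t
    proof -
      have "cis (2 * pi * t) = cis (2 * pi * frac t) * cis (2 * pi * of_int \<lfloor>t\<rfloor>)"
        by (simp add: cis_mult frac_def algebra_simps)
      then show ?thesis by (simp add: complex_eq_iff cos_int_2pin sin_int_2pin)
    qed
    then show ?thesis by (simp add: torus_map_def)
  qed
qed

text \<open>A periodic function descends to a function \<open>g\<close> on the image of
  \<open>torus_map\<close>. Its continuity there comes from compactness: the preimage of a closed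
  set is the image of a compact part of the cube, hence closed. Stone-Weierstrass then applies to
  \<open>g\<close>.\<close>

lemma periodic_approx:
  fixes f :: "real^'n \<Rightarrow> real"
  assumes f: "continuous_on UNIV f" "periodic_with 1 f" and d: "d > 0"
  shows "\<exists>F c. finite F \<and> (\<forall>x. norm (complex_of_real (f x) - (\<Sum>k\<in>F. c k * chr k x)) < d)"
proof -
  define g where "g z = f (SOME x. torus_map x = z)" for z
  have g: "g (torus_map x) = f x" for x
    unfolding g_def by (rule torus_map_eqD[OF f(2)]) (rule someI[of "\<lambda>y. torus_map y = torus_map x" x], simp)
  define S where "S = torus_map ` (cube 1 :: (real^'n) set)"
  have cK: "compact (cube 1 :: (real^'n) set)" by (simp add: cube_def)
  have cS: "compact S" unfolding S_def by (intro compact_continuous_image continuous_on_torus_map cK)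
  have "continuous_on S g"
    unfolding continuous_on_closed_vimage[OF compact_imp_closed[OF cS]]
  proof (intro allI impI)
    fix B :: "real set" assume "closed B"
    then have "closed (f -` B)" using continuous_closed_vimage[OF _ f(1)[unfolded continuous_on_eq_continuous_at[OF open_UNIV], rule_format]] by auto
    then have "compact (cube 1 \<inter> f -` B)" using cK by blast
    then have "closed (torus_map ` (cube 1 \<inter> f -` B))"
      by (intro compact_imp_closed compact_continuous_image continuous_on_torus_map)
    moreover have "g -` B \<inter> S = torus_map ` (cube 1 \<inter> f -` B)"
      using g by (auto simp: S_def)
    ultimately show "closed (g -` B \<inter> S)" by simp
  qed
  then obtain r where r: "real_polynomial_function r" "\<And>z. z \<in> S \<Longrightarrow> \<bar>g z - r z\<bar> < d"
    using Stone_Weierstrass_real_polynomial_function[OF cS] d by blast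
  have "\<bar>f x - r (torus_map x)\<bar> < d" for x
  proof -
    obtain y where "y \<in> cube 1" "torus_map y = torus_map x" using torus_map_cube by blast
    then have "torus_map x \<in> S" unfolding S_def by (metis imageI)
    then show ?thesis using r(2) g by metis
  qed
  moreover obtain F c where "finite F" "(\<lambda>x. complex_of_real (r (torus_map x))) = (\<lambda>x. \<Sum>k\<in>F. c k * chr k x)"
    using trig_repr[OF trig_polynomial[OF r(1)]] by blast
  ultimately have "norm (complex_of_real (f x) - (\<Sum>k\<in>F. c k * chr k x)) < d" for x
    by (metis (mono_tags, lifting) norm_of_real of_real_diff)
  with \<open>finite F\<close> show ?thesis by blast
qed

text \<open>The right side is approximated by a trigonometric polynomial, for which the Laplacian is
  inverted termwise. What matters is the order of quantifiers: the sup bound of the solution is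
  independent of the accuracy \<open>d\<close>, although nothing is known about the size of the
  approximating polynomial's frequencies. The 1 in \<open>M + 1\<close> pays for the approximation
  error, as \<open>d\<close> is at most 1.\<close>

lemma poisson_approx:
  assumes "CARD('n) \<le> 3"
  shows "\<exists>S\<ge>0. \<forall>(f :: real^'n \<Rightarrow> real) M d. continuous_on UNIV f \<longrightarrow> periodic_with 1 f \<longrightarrow> integral (cube 1) f = 0 \<longrightarrow>
    (\<forall>x. \<bar>f x\<bar> \<le> M) \<longrightarrow> 0 < d \<longrightarrow> d \<le> 1 \<longrightarrow>
    (\<exists>\<psi> D1 D2. continuous_on UNIV \<psi> \<and> periodic_with 1 \<psi> \<and>
      (\<forall>i. continuous_on UNIV (D1 i) \<and> continuous_on UNIV (D2 i) \<and> has_partial i \<psi> (D1 i) \<and> has_partial i (D1 i) (D2 i)) \<and>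
      (\<forall>x. \<bar>\<psi> x\<bar> \<le> S * (M + 1)) \<and> (\<forall>x. \<bar>(\<Sum>i\<in>UNIV. D2 i x) - f x\<bar> \<le> d))"
proof -
  obtain S where S: "S \<ge> 0" "\<And>F::(int^'n) set. finite F \<Longrightarrow> 0 \<notin> F \<Longrightarrow> (\<Sum>k\<in>F. 1 / (nsq k)\<^sup>2) \<le> S"
    using lattice_sum_bound[OF assms] by blast
  have "\<exists>\<psi> D1 D2. continuous_on UNIV \<psi> \<and> periodic_with 1 \<psi> \<and>
      (\<forall>i. continuous_on UNIV (D1 i) \<and> continuous_on UNIV (D2 i) \<and> has_partial i \<psi> (D1 i) \<and> has_partial i (D1 i) (D2 i)) \<and>
      (\<forall>x. \<bar>\<psi> x\<bar> \<le> sqrt S * (M + 1)) \<and> (\<forall>x. \<bar>(\<Sum>i\<in>UNIV. D2 i x) - f x\<bar> \<le> d)"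
    if f: "continuous_on UNIV f" "periodic_with 1 f" "integral (cube 1) f = 0" "\<And>x. \<bar>f x\<bar> \<le> M" and d: "0 < d" "d \<le> 1"
    for f :: "real^'n \<Rightarrow> real" and M d
  proof -
    obtain F c where F: "finite F" and P: "\<And>x. norm (complex_of_real (f x) - (\<Sum>k\<in>F. c k * chr k x)) < d / 2"
      using periodic_approx[OF f(1,2), of "d / 2"] d by auto
    define G where "G = F - {0}"
    \<comment> \<open>The Laplacian multiplies the character of frequency k by -4 pi^2 |k|^2; the
      frequency 0, where this vanishes, is absent from \<open>G\<close>.\<close>
    define c' where "c' k = - c k / complex_of_real (4 * pi\<^sup>2 * nsq k)" for k
    define \<psi> where "\<psi> x = (\<Sum>k\<in>G. wave (c' k) k x)" for x
    define D1 where "D1 i x = (\<Sum>k\<in>G. wave (2 * pi * \<i> * of_int (k $ i) * c' k) k x)" for i x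
    define D2 where "D2 i x = (\<Sum>k\<in>G. wave (2 * pi * \<i> * of_int (k $ i) * (2 * pi * \<i> * of_int (k $ i) * c' k)) k x)" for i x
    define c0 where "c0 = (if 0 \<in> F then c 0 else 0)"
    have G: "finite G" "0 \<notin> G" using F by (auto simp: G_def)
    have split: "(\<Sum>k\<in>F. c k * chr k x) = c0 + (\<Sum>k\<in>G. c k * chr k x)" for x
      using F by (auto simp: G_def c0_def sum.remove)
    have M0: "M \<ge> 0" using f(4)[of 0] by linarith
    have Pb: "norm (\<Sum>k\<in>F. c k * chr k x) \<le> M + 1" for x
    proof -
      have "norm (\<Sum>k\<in>F. c k * chr k x) \<le> norm (complex_of_real (f x)) + norm (complex_of_real (f x) - (\<Sum>k\<in>F. c k * chr k x))"
        using norm_triangle_sub[of "\<Sum>k\<in>F. c k * chr k x" "complex_of_real (f x)"]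
        by (simp add: norm_minus_commute)
      moreover have "norm (complex_of_real (f x)) \<le> M" using f(4)[of x] by simp
      ultimately show ?thesis using P[of x] d by linarith
    qed
    have cont: "continuous_on UNIV (wave c k)" for c and k :: "int^'n"
      unfolding wave_def by (intro continuous_intros)
    \<comment> \<open>Since \<open>f\<close> has mean zero, the constant mode is the mean of the
      approximation error, so dropping it costs at most another \<open>d / 2\<close>.\<close>
    have c0: "norm c0 \<le> d / 2"
    proof -
      have i1: "integral (cube 1) (\<lambda>x. \<Sum>k\<in>F. c k * chr k x) = c0"
      proof -
        have "integral (cube 1) (\<lambda>x. \<Sum>k\<in>F. c k * chr k x) = (\<Sum>k\<in>F. c k * integral (cube 1) (chr k))"
          using F by (simp add: integral_sum integrable_cube continuous_intros)
        also have "\<dots> = (\<Sum>k\<in>F. if k = 0 then c k else 0)" by (intro sum.cong) (auto simp: integral_chr)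
        finally show ?thesis using F by (simp add: sum.delta c0_def)
      qed
      have i2: "integral (cube 1) (\<lambda>x. complex_of_real (f x)) = 0"
        using integral_linear[OF integrable_cube[OF f(1)] bounded_linear_of_real, of 1] f(3) by (simp add: o_def)
      have "c0 = integral (cube 1) (\<lambda>x. (\<Sum>k\<in>F. c k * chr k x) - complex_of_real (f x))"
        using i1 i2 f(1) by (subst Henstock_Kurzweil_Integration.integral_diff) (auto intro!: integrable_cube continuous_intros)
      moreover have "norm (integral (cube 1) (\<lambda>x. (\<Sum>k\<in>F. c k * chr k x) - complex_of_real (f x))) \<le> d / 2 * measure lborel (cube 1 :: (real^'n) set)"
        unfolding cube_def
      proof (rule integrable_bound)
        show "(\<lambda>x. (\<Sum>k\<in>F. c k * chr k x) - complex_of_real (f x)) integrable_on cbox 0 (\<chi> i. 1)"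
          by (intro integrable_continuous continuous_intros continuous_on_subset[OF f(1)]) auto
        show "norm ((\<Sum>k\<in>F. c k * chr k x) - complex_of_real (f x)) \<le> d / 2" for x
          using P[of x] by (simp add: norm_minus_commute)
      qed (use d in auto)
      ultimately show ?thesis by simp
    qed
    have lap: "(\<Sum>i\<in>UNIV. D2 i x) = Re (\<Sum>k\<in>G. c k * chr k x)" for x
    proof -
      have "(\<Sum>i\<in>UNIV. D2 i x) = (\<Sum>k\<in>G. \<Sum>i\<in>UNIV. Re (2 * pi * \<i> * of_int (k $ i) * (2 * pi * \<i> * of_int (k $ i) * c' k) * chr k x))"
        unfolding D2_def wave_def by (rule sum.swap)
      also have "\<dots> = (\<Sum>k\<in>G. Re (c k * chr k x))"
      proof (rule sum.cong[OF refl])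
        fix k assume "k \<in> G"
        then have n: "nsq k > 0" using nsq_ge_1[of k] G by force
        have "(\<Sum>i\<in>UNIV. 2 * pi * \<i> * of_int (k $ i) * (2 * pi * \<i> * of_int (k $ i) * c' k) * chr k x) =
           (\<Sum>i\<in>UNIV. complex_of_real ((real_of_int (k $ i))\<^sup>2) * (- 4 * complex_of_real (pi\<^sup>2) * (c' k * chr k x)))"
          by (intro sum.cong refl) (simp add: power2_eq_square algebra_simps)
        also have "\<dots> = complex_of_real (nsq k) * (- 4 * complex_of_real (pi\<^sup>2) * (c' k * chr k x))"
          unfolding nsq_def of_real_sum by (rule sum_distrib_right[symmetric])
        also have "\<dots> = c k * chr k x"
          using n by (simp add: c'_def field_simps)
        finally show "(\<Sum>i\<in>UNIV. Re (2 * pi * \<i> * of_int (k $ i) * (2 * pi * \<i> * of_int (k $ i) * c' k) * chr k x)) = Re (c k * chr k x)"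
          by (simp only: Re_sum[symmetric])
      qed
      finally show ?thesis by (simp only: Re_sum)
    qed
    have near: "\<bar>(\<Sum>i\<in>UNIV. D2 i x) - f x\<bar> \<le> d" for x
    proof -
      have "(\<Sum>i\<in>UNIV. D2 i x) - f x = Re (- (complex_of_real (f x) - (\<Sum>k\<in>F. c k * chr k x)) - c0)"
        by (simp add: lap split)
      also have "\<bar>\<dots>\<bar> \<le> norm (- (complex_of_real (f x) - (\<Sum>k\<in>F. c k * chr k x)) - c0)" by (rule abs_Re_le_cmod)
      also have "\<dots> \<le> norm (complex_of_real (f x) - (\<Sum>k\<in>F. c k * chr k x)) + norm c0"
        by (rule order_trans[OF norm_triangle_ineq4]) (simp only: norm_minus_cancel order_refl)
      finally show ?thesis using P[of x] c0 by linarith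
    qed
    have bound: "\<bar>\<psi> x\<bar> \<le> sqrt S * (M + 1)" for x
    proof -
      have "\<bar>\<psi> x\<bar> \<le> (\<Sum>k\<in>G. \<bar>wave (c' k) k x\<bar>)" unfolding \<psi>_def by (rule sum_abs)
      also have "\<dots> \<le> (\<Sum>k\<in>G. \<bar>norm (c k)\<bar> * \<bar>1 / nsq k\<bar>)"
      proof (rule sum_mono)
        fix k assume "k \<in> G"
        then have n: "nsq k \<ge> 1" using nsq_ge_1[of k] G by force
        have "\<bar>wave (c' k) k x\<bar> \<le> norm (c' k)"
          unfolding wave_def using abs_Re_le_cmod[of "c' k * chr k x"] by (simp add: norm_mult)
        also have "\<dots> = norm (c k) / (4 * pi\<^sup>2 * nsq k)"
          using n by (simp only: c'_def norm_divide norm_minus_cancel norm_of_real) (simp add: abs_mult)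
        also have "\<dots> \<le> norm (c k) / (1 * nsq k)"
        proof (rule divide_left_mono)
          have "1 \<le> pi\<^sup>2" using pi_ge_two by (intro one_le_power) linarith
          then show "1 * nsq k \<le> 4 * pi\<^sup>2 * nsq k" using n by (intro mult_right_mono) auto
        qed (use n in \<open>auto intro!: mult_pos_pos\<close>)
        finally show "\<bar>wave (c' k) k x\<bar> \<le> \<bar>norm (c k)\<bar> * \<bar>1 / nsq k\<bar>" using n by simp
      qed
      \<comment> \<open>Cauchy-Schwarz: one factor is bounded by Parseval, independently of
        \<open>F\<close>, the other by the lattice sum.\<close>
      also have "\<dots> \<le> L2_set (\<lambda>k. norm (c k)) G * L2_set (\<lambda>k. 1 / nsq k) G" by (rule L2_set_mult_ineq)
      also have "\<dots> \<le> (M + 1) * sqrt S"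
      proof (rule mult_mono)
        have "(\<Sum>k\<in>G. (norm (c k))\<^sup>2) \<le> (\<Sum>k\<in>F. (norm (c k))\<^sup>2)"
          using F by (intro sum_mono2) (auto simp: G_def)
        also have "\<dots> \<le> (M + 1)\<^sup>2" by (rule parseval_le[OF F Pb])
        finally show "L2_set (\<lambda>k. norm (c k)) G \<le> M + 1"
          unfolding L2_set_def using M0 by (intro real_le_lsqrt) (auto intro: sum_nonneg)
        show "L2_set (\<lambda>k. 1 / nsq k) G \<le> sqrt S"
          unfolding L2_set_def using S(2)[OF G] by (simp add: power_divide)
      qed (use M0 in \<open>auto simp: L2_set_nonneg\<close>)
      finally show ?thesis by (simp add: mult.commute)
    qed
    have per: "periodic_with 1 \<psi>"
    proof -
      have "chr k (x + axis i 1) = chr k x" for k and x :: "real^'n" and i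
      proof -
        have "(\<Sum>j\<in>UNIV. real_of_int (k $ j) * (x + axis i 1) $ j) =
          (\<Sum>j\<in>UNIV. real_of_int (k $ j) * x $ j + (if j = i then real_of_int (k $ i) else 0))"
          by (intro sum.cong) (auto simp: axis_def distrib_left)
        also have "\<dots> = (\<Sum>j\<in>UNIV. real_of_int (k $ j) * x $ j) + real_of_int (k $ i)"
          by (simp add: sum.distrib sum.delta)
        finally have "chr k (x + axis i 1) =
            cis (2 * pi * ((\<Sum>j\<in>UNIV. real_of_int (k $ j) * x $ j) + real_of_int (k $ i)))"
          by (simp only: chr_def)
        also have "\<dots> = chr k x * cis (2 * pi * of_int (k $ i))"
          by (simp only: chr_def cis_mult distrib_left)
        also have "cis (2 * pi * of_int (k $ i)) = 1"
          using cos_int_2pin[of "k $ i"] sin_int_2pin[of "k $ i"] by (simp add: complex_eq_iff)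
        finally show ?thesis by simp
      qed
      then show ?thesis by (simp add: periodic_with_def \<psi>_def wave_def)
    qed
    have hp: "has_partial i \<psi> (D1 i)" "has_partial i (D1 i) (D2 i)" for i
      unfolding \<psi>_def D1_def D2_def by (intro has_partial_sum has_partial_wave)+
    have cs: "continuous_on UNIV \<psi>" "continuous_on UNIV (D1 i)" "continuous_on UNIV (D2 i)" for i
      unfolding \<psi>_def D1_def D2_def by (intro continuous_on_sum cont)+
    show ?thesis using hp cs per bound near by blast
  qed
  then show ?thesis using S(1) by (intro exI[of _ "sqrt S"]) simp
qed

text \<open>A solution of the Poisson equation may be shifted by a constant. The constant \<mu>, the
  mean of \<psi> with weight 1/a, is chosen so that the new function divided by \<open>a\<close> has
  mean zero, which makes the next step solvable. As a weighted mean, \<mu> obeys the same bound as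
  \<psi>, whence the factor 2.\<close>

lemma corrector_step:
  fixes a f :: "real^'n \<Rightarrow> real"
  assumes S: "S \<ge> 0" "\<forall>(f :: real^'n \<Rightarrow> real) M d. continuous_on UNIV f \<longrightarrow> periodic_with 1 f \<longrightarrow> integral (cube 1) f = 0 \<longrightarrow>
    (\<forall>x. \<bar>f x\<bar> \<le> M) \<longrightarrow> 0 < d \<longrightarrow> d \<le> 1 \<longrightarrow>
    (\<exists>\<psi> D1 D2. continuous_on UNIV \<psi> \<and> periodic_with 1 \<psi> \<and>
      (\<forall>i. continuous_on UNIV (D1 i) \<and> continuous_on UNIV (D2 i) \<and> has_partial i \<psi> (D1 i) \<and> has_partial i (D1 i) (D2 i)) \<and>
      (\<forall>x. \<bar>\<psi> x\<bar> \<le> S * (M + 1)) \<and> (\<forall>x. \<bar>(\<Sum>i\<in>UNIV. D2 i x) - f x\<bar> \<le> d))"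
    and a: "continuous_on UNIV a" "periodic_with 1 a" "\<And>x. m \<le> a x" "0 < m" "0 < integral (cube 1) (\<lambda>x. 1 / a x)"
    and f: "continuous_on UNIV f" "periodic_with 1 f" "integral (cube 1) (\<lambda>x. f x / a x) = 0" "\<And>x. \<bar>f x\<bar> \<le> M"
    and d: "0 < d" "d \<le> 1"
  shows "\<exists>\<psi> D1 D2. continuous_on UNIV \<psi> \<and> periodic_with 1 \<psi> \<and> integral (cube 1) (\<lambda>x. \<psi> x / a x) = 0 \<and>
      (\<forall>x. \<bar>\<psi> x\<bar> \<le> 2 * (S * (M / m + 1))) \<and>
      (\<forall>i. continuous_on UNIV (D1 i) \<and> continuous_on UNIV (D2 i) \<and> has_partial i \<psi> (D1 i) \<and> has_partial i (D1 i) (D2 i)) \<and>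
      (\<forall>x. \<bar>(\<Sum>i\<in>UNIV. D2 i x) - f x / a x\<bar> \<le> d)"
proof -
  have ap: "a x > 0" "a x \<noteq> 0" for x using a(3)[of x] a(4) by auto
  have "continuous_on UNIV (\<lambda>x. f x / a x)" by (intro continuous_intros f a) (use ap in auto)
  moreover have "periodic_with 1 (\<lambda>x. f x / a x)" using f(2) a(2) by (simp add: periodic_with_def)
  moreover have "\<bar>f x / a x\<bar> \<le> M / m" for x
    using f(4)[of x] a(3)[of x] a(4) ap[of x] by (simp add: abs_div frac_le)
  ultimately obtain \<psi> D1 D2 where p: "continuous_on UNIV \<psi>" "periodic_with 1 \<psi>"
    "\<And>i. continuous_on UNIV (D1 i)" "\<And>i. continuous_on UNIV (D2 i)" "\<And>i. has_partial i \<psi> (D1 i)" "\<And>i. has_partial i (D1 i) (D2 i)"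
    "\<And>x. \<bar>\<psi> x\<bar> \<le> S * (M / m + 1)" "\<And>x. \<bar>(\<Sum>i\<in>UNIV. D2 i x) - f x / a x\<bar> \<le> d"
    using S(2)[rule_format, of "\<lambda>x. f x / a x" "M / m" d] f(3) d by blast
  define J where "J = integral (cube 1) (\<lambda>x. 1 / a x)"
  define \<mu> where "\<mu> = integral (cube 1) (\<lambda>x. \<psi> x / a x) / J"
  have J: "J > 0" using a(5) by (simp add: J_def)
  have i1: "(\<lambda>x. \<psi> x / a x) integrable_on cube 1" "(\<lambda>x. 1 / a x) integrable_on cube 1"
    by (intro integrable_cube continuous_intros p a; use ap in auto)+
  have "\<bar>integral (cube 1) (\<lambda>x. \<psi> x / a x)\<bar> \<le> integral (cube 1) (\<lambda>x. S * (M / m + 1) * (1 / a x))"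
  proof (rule integral_abs_le)
    show "(\<lambda>x. S * (M / m + 1) * (1 / a x)) integrable_on cube 1" by (rule integrable_on_mult_right[OF i1(2)])
    show "\<bar>\<psi> x / a x\<bar> \<le> S * (M / m + 1) * (1 / a x)" for x
      using p(7)[of x] ap[of x] by (simp add: abs_div divide_right_mono)
  qed (rule i1)
  also have "\<dots> = S * (M / m + 1) * J" unfolding J_def by (rule integral_mult_right)
  finally have \<mu>: "\<bar>\<mu>\<bar> \<le> S * (M / m + 1)" using J by (simp add: \<mu>_def abs_div pos_divide_le_eq)
  have "integral (cube 1) (\<lambda>x. (\<psi> x - \<mu>) / a x) = integral (cube 1) (\<lambda>x. \<psi> x / a x - \<mu> * (1 / a x))"
    by (simp add: diff_divide_distrib)
  also have "\<dots> = integral (cube 1) (\<lambda>x. \<psi> x / a x) - \<mu> * J"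
    unfolding J_def integral_mult_right[symmetric]
    by (intro Henstock_Kurzweil_Integration.integral_diff i1 integrable_on_mult_right)
  also have "\<dots> = 0" using J by (simp add: \<mu>_def)
  finally have z: "integral (cube 1) (\<lambda>x. (\<psi> x - \<mu>) / a x) = 0" .
  have "has_partial i (\<lambda>x. \<psi> x - \<mu>) (D1 i)" for i
    using p(5)[of i] unfolding has_partial_def by (auto intro!: derivative_eq_intros)
  moreover have "\<bar>\<psi> x - \<mu>\<bar> \<le> 2 * (S * (M / m + 1))" for x using p(7)[of x] \<mu> by linarith
  moreover have "continuous_on UNIV (\<lambda>x. \<psi> x - \<mu>)" by (intro continuous_intros p)
  moreover have "periodic_with 1 (\<lambda>x. \<psi> x - \<mu>)" using p(2) by (simp add: periodic_with_def)
  ultimately show ?thesis using z p(3,4,6,8) by blast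
qed

text \<open>Dependent choice along \<open>corrector_step\<close>, at a fixed accuracy for all
  orders. \<open>C\<close> precedes \<open>d\<close> in the statement, so later limits in the
  accuracy leave the bounds of the correctors untouched.\<close>

lemma corrector_chain:
  fixes a :: "real^'n \<Rightarrow> real"
  assumes dim: "CARD('n) \<le> 3"
    and a: "continuous_on UNIV a" "periodic_with 1 a" "\<And>x. m \<le> a x" "0 < m" "\<And>x. a x \<le> A"
    and a0: "a0 = inverse (integral (cube 1) (\<lambda>x. 1 / a x))"
  shows "\<exists>C. \<forall>d. 0 < d \<longrightarrow> d \<le> 1 \<longrightarrow> (\<exists>\<psi> D1 D2. \<psi> 0 = (\<lambda>x. a x - a0) \<and>
    (\<forall>j. continuous_on UNIV (\<psi> j) \<and> (\<forall>x. \<bar>\<psi> j x\<bar> \<le> C j) \<and>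
      (\<forall>i. continuous_on UNIV (D1 (Suc j) i) \<and> continuous_on UNIV (D2 (Suc j) i) \<and>
        has_partial i (\<psi> (Suc j)) (D1 (Suc j) i) \<and> has_partial i (D1 (Suc j) i) (D2 (Suc j) i)) \<and>
      (\<forall>x. \<bar>(\<Sum>i\<in>UNIV. D2 (Suc j) i x) - \<psi> j x / a x\<bar> \<le> d)))"
proof -
  note P = poisson_approx[where 'n = 'n, OF dim]
  then obtain S where S: "S \<ge> 0" "\<forall>(f :: real^'n \<Rightarrow> real) M d. continuous_on UNIV f \<longrightarrow> periodic_with 1 f \<longrightarrow> integral (cube 1) f = 0 \<longrightarrow>
    (\<forall>x. \<bar>f x\<bar> \<le> M) \<longrightarrow> 0 < d \<longrightarrow> d \<le> 1 \<longrightarrow>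
    (\<exists>\<psi> D1 D2. continuous_on UNIV \<psi> \<and> periodic_with 1 \<psi> \<and>
      (\<forall>i. continuous_on UNIV (D1 i) \<and> continuous_on UNIV (D2 i) \<and> has_partial i \<psi> (D1 i) \<and> has_partial i (D1 i) (D2 i)) \<and>
      (\<forall>x. \<bar>\<psi> x\<bar> \<le> S * (M + 1)) \<and> (\<forall>x. \<bar>(\<Sum>i\<in>UNIV. D2 i x) - f x\<bar> \<le> d))"
    by (elim exE conjE) (rule that)
  have ap: "a x > 0" "a x \<noteq> 0" for x using a(3)[of x] a(4) by auto
  have A: "A > 0" using ap(1)[of 0] a(5)[of 0] by linarith
  define J where "J = integral (cube 1) (\<lambda>x. 1 / a x)"
  have i1: "(\<lambda>x. 1 / a x) integrable_on cube 1"
    by (intro integrable_cube continuous_intros a) (use ap in auto)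
  have "integral (cube 1 :: (real^'n) set) (\<lambda>x. 1 / A) \<le> J"
    unfolding J_def
    by (rule integral_le) (use i1 ap a(5) in \<open>auto intro!: integrable_cube continuous_intros frac_le\<close>)
  also have "integral (cube 1 :: (real^'n) set) (\<lambda>x. 1 / A) = 1 / A"
    unfolding cube_def integral_const using measure_cube_1[where 'n = 'n] by (simp add: cube_def)
  finally have J: "J > 0" using A by (auto intro: less_le_trans[rotated])
  have a0J: "a0 * J = 1" using J by (simp add: a0 J_def[symmetric])
  \<comment> \<open>The recursion repeats the bound of \<open>corrector_step\<close> and involves
    \<open>a\<close> and the dimension alone, not \<open>d\<close>.\<close>
  define C where "C = rec_nat (A + \<bar>a0\<bar>) (\<lambda>_ M. 2 * (S * (M / m + 1)))"
  have C: "C 0 = A + \<bar>a0\<bar>" "C (Suc j) = 2 * (S * (C j / m + 1))" for j by (simp_all add: C_def)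
  have "\<exists>\<psi> D1 D2. \<psi> 0 = (\<lambda>x. a x - a0) \<and>
    (\<forall>j. continuous_on UNIV (\<psi> j) \<and> (\<forall>x. \<bar>\<psi> j x\<bar> \<le> C j) \<and>
      (\<forall>i. continuous_on UNIV (D1 (Suc j) i) \<and> continuous_on UNIV (D2 (Suc j) i) \<and>
        has_partial i (\<psi> (Suc j)) (D1 (Suc j) i) \<and> has_partial i (D1 (Suc j) i) (D2 (Suc j) i)) \<and>
      (\<forall>x. \<bar>(\<Sum>i\<in>UNIV. D2 (Suc j) i x) - \<psi> j x / a x\<bar> \<le> d))"
    if d: "0 < d" "d \<le> 1" for d
  proof -
    define good where "good = (\<lambda>n (T :: (real^'n \<Rightarrow> real) \<times> ('n \<Rightarrow> real^'n \<Rightarrow> real) \<times> ('n \<Rightarrow> real^'n \<Rightarrow> real)).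
      continuous_on UNIV (fst T) \<and> periodic_with 1 (fst T) \<and> integral (cube 1) (\<lambda>x. fst T x / a x) = 0 \<and>
      (\<forall>x. \<bar>fst T x\<bar> \<le> C n) \<and> (n = 0 \<longrightarrow> fst T = (\<lambda>x. a x - a0)))"
    define nxt where "nxt = (\<lambda>(n::nat) (T :: (real^'n \<Rightarrow> real) \<times> ('n \<Rightarrow> real^'n \<Rightarrow> real) \<times> ('n \<Rightarrow> real^'n \<Rightarrow> real))
      (T' :: (real^'n \<Rightarrow> real) \<times> ('n \<Rightarrow> real^'n \<Rightarrow> real) \<times> ('n \<Rightarrow> real^'n \<Rightarrow> real)).
      (\<forall>i. continuous_on UNIV (fst (snd T') i) \<and> continuous_on UNIV (snd (snd T') i) \<and>
        has_partial i (fst T') (fst (snd T') i) \<and> has_partial i (fst (snd T') i) (snd (snd T') i)) \<and>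
      (\<forall>x. \<bar>(\<Sum>i\<in>UNIV. snd (snd T') i x) - fst T x / a x\<bar> \<le> d))"
    have "\<exists>f. \<forall>n. good n (f n) \<and> nxt n (f n) (f (Suc n))"
    proof (rule dependent_nat_choice)
      \<comment> \<open>The harmonic mean is exactly the constant for which the first cell problem
        is solvable.\<close>
      have "integral (cube 1) (\<lambda>x. (a x - a0) / a x) = integral (cube 1) (\<lambda>x. 1 - a0 * (1 / a x))"
        using ap by (simp add: diff_divide_distrib)
      also have "\<dots> = integral (cube 1 :: (real^'n) set) (\<lambda>x. 1) - a0 * J"
        unfolding J_def integral_mult_right[symmetric]
        by (intro Henstock_Kurzweil_Integration.integral_diff integrable_on_mult_right i1 integrable_cube continuous_intros)
      also have "integral (cube 1 :: (real^'n) set) (\<lambda>x. 1::real) = 1"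
        unfolding cube_def integral_const using measure_cube_1[where 'n = 'n] by (simp add: cube_def)
      finally have "integral (cube 1) (\<lambda>x. (a x - a0) / a x) = 0" using a0J by simp
      moreover have "\<bar>a x - a0\<bar> \<le> C 0" for x using ap[of x] a(5)[of x] by (simp add: C)
      \<comment> \<open>The zero functions are placeholders: derivatives are claimed from index 1
        on.\<close>
      ultimately have "good 0 (\<lambda>x. a x - a0, \<lambda>_ _. 0, \<lambda>_ _. 0)"
        using a(1,2) by (auto simp: good_def periodic_with_def intro!: continuous_intros)
      then show "\<exists>T. good 0 T" by blast
    next
      fix T n assume "good n T"
      then have g: "continuous_on UNIV (fst T)" "periodic_with 1 (fst T)" "integral (cube 1) (\<lambda>x. fst T x / a x) = 0"
        "\<And>x. \<bar>fst T x\<bar> \<le> C n" by (auto simp: good_def)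
      obtain \<psi> D1 D2 where "continuous_on UNIV \<psi> \<and> periodic_with 1 \<psi> \<and> integral (cube 1) (\<lambda>x. \<psi> x / a x) = 0 \<and>
        (\<forall>x. \<bar>\<psi> x\<bar> \<le> 2 * (S * (C n / m + 1))) \<and>
        (\<forall>i. continuous_on UNIV (D1 i) \<and> continuous_on UNIV (D2 i) \<and> has_partial i \<psi> (D1 i) \<and> has_partial i (D1 i) (D2 i)) \<and>
        (\<forall>x. \<bar>(\<Sum>i\<in>UNIV. D2 i x) - fst T x / a x\<bar> \<le> d)"
        using corrector_step[OF S a(1-4) J[unfolded J_def] g d] by blast
      then show "\<exists>T'. good (Suc n) T' \<and> nxt n T T'"
        by (intro exI[of _ "(\<psi>, D1, D2)"]) (simp add: good_def nxt_def C)
    qed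
    then obtain f where f: "good n (f n)" "nxt n (f n) (f (Suc n))" for n by blast
    show ?thesis
      by (rule exI[of _ "\<lambda>n. fst (f n)"], rule exI[of _ "\<lambda>n. fst (snd (f n))"], rule exI[of _ "\<lambda>n. snd (snd (f n))"])
        (use f in \<open>auto simp: good_def nxt_def\<close>)
  qed
  then show ?thesis by blast
qed

section \<open>Local energy estimate\<close>

definition jointly_continuous :: "real \<Rightarrow> (real \<Rightarrow> real^'n \<Rightarrow> real) \<Rightarrow> bool" where
  "jointly_continuous T f \<longleftrightarrow> continuous_on ({0..T} \<times> UNIV) (\<lambda>p. f (fst p) (snd p))"

lemma jointly_continuous_space:
  assumes "jointly_continuous T f" "t \<in> {0..T}"
  shows "continuous_on S (f t)"
proof -
  have "continuous_on S (\<lambda>x. (\<lambda>p. f (fst p) (snd p)) (t, x))"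
    by (rule continuous_on_compose2[OF assms(1)[unfolded jointly_continuous_def]])
      (use assms(2) in \<open>auto intro!: continuous_intros\<close>)
  then show ?thesis by simp
qed

lemma jointly_continuous_time:
  assumes "jointly_continuous T f"
  shows "continuous_on {0..T} (\<lambda>t. f t x)"
proof -
  have "continuous_on {0..T} (\<lambda>t. (\<lambda>p. f (fst p) (snd p)) (t, x))"
    by (rule continuous_on_compose2[OF assms(1)[unfolded jointly_continuous_def]])
      (auto intro!: continuous_intros)
  then show ?thesis by simp
qed

lemma jointly_continuous_const: "continuous_on UNIV g \<Longrightarrow> jointly_continuous T (\<lambda>t. g)"
  unfolding jointly_continuous_def
  by (rule continuous_on_compose2[of UNIV g]) (auto intro!: continuous_intros)

lemma has_partial_at:
  assumes "has_partial i f f'"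
  shows "((\<lambda>s. f (x + s *\<^sub>R axis i 1)) has_real_derivative f' (x + s *\<^sub>R axis i 1)) (at s)"
proof -
  have "((\<lambda>r. f ((x + s *\<^sub>R axis i 1) + r *\<^sub>R axis i 1)) has_real_derivative f' (x + s *\<^sub>R axis i 1)) (at 0)"
    using assms by (simp add: has_partial_def)
  then have "((\<lambda>r. f (x + (s + r) *\<^sub>R axis i 1)) has_real_derivative f' (x + s *\<^sub>R axis i 1)) (at 0)"
    by (simp add: scaleR_add_left add.assoc)
  then show ?thesis 
    using DERIV_shift[of "\<lambda>s. f (x + s *\<^sub>R axis i 1)" _ 0 s] by (simp add: add.commute)
qed

lemma has_partial_mult:
  assumes "has_partial i f f'" "has_partial i g g'"
  shows "has_partial i (\<lambda>x. f x * g x) (\<lambda>x. f' x * g x + f x * g' x)"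
  unfolding has_partial_def
proof
  fix x
  show "((\<lambda>s. f (x + s *\<^sub>R axis i 1) * g (x + s *\<^sub>R axis i 1)) has_real_derivative f' x * g x + f x * g' x) (at 0)"
    using DERIV_mult[OF assms[unfolded has_partial_def, rule_format, of x]] by (simp add: add.commute mult.commute)
qed

text \<open>The integral over a translate of \<open>G\<close> does not depend on the translation;
  differentiating under the integral gives the claim. This is the only form of the divergence
  theorem in use.\<close>

lemma integral_partial_zero:
  fixes G :: "real^'n \<Rightarrow> real"
  assumes G: "continuous_on UNIV G" "continuous_on UNIV G'" "has_partial i G G'"
    and supp: "\<And>x. x \<notin> cbox a b \<Longrightarrow> G x = 0"
  shows "integral (cbox a b) G' = 0"
proof -
  \<comment> \<open>One unit of room on every side, so that translates by \<open>s\<close> in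
    [-1, 1] keep the support in the box.\<close>
  define a' b' where "a' = a - (\<chi> i. 1)" and "b' = b + (\<chi> i. 1)"
  have G'0: "G' x = 0" if "x \<notin> cbox a b" for x
  proof -
    define U where "U = (\<lambda>s. x + s *\<^sub>R axis i (1::real)) -` (- cbox a b)"
    have "open U" unfolding U_def
      by (rule open_vimage) (auto intro!: continuous_intros closed_cbox simp: open_Compl)
    moreover have "0 \<in> U" using that by (simp add: U_def)
    ultimately have "((\<lambda>s. G (x + s *\<^sub>R axis i 1)) has_real_derivative 0) (at 0)"
      by (rule has_field_derivative_transform_within_open[OF DERIV_const]) (auto simp: U_def supp)
    then show ?thesis using G(3) DERIV_unique unfolding has_partial_def by blast
  qed
  define \<Phi> where "\<Phi> s = integral (cbox a' b') (\<lambda>x. G (x + s *\<^sub>R axis i 1))" for s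
  have "\<Phi> s = integral (cbox a b) G" if "s \<in> {-1..1}" for s
  proof -
    have "\<Phi> s = integral (cbox ((a' + s *\<^sub>R axis i 1) - s *\<^sub>R axis i 1) ((b' + s *\<^sub>R axis i 1) - s *\<^sub>R axis i 1)) (\<lambda>x. G (x + s *\<^sub>R axis i 1))"
      by (simp add: \<Phi>_def)
    also have "\<dots> = integral (cbox (a' + s *\<^sub>R axis i 1) (b' + s *\<^sub>R axis i 1)) G"
      by (rule integral_shift_cbox)
    also have "\<dots> = integral (cbox a b) G"
    proof (rule integral_zero_outside)
      fix x assume x: "x \<notin> cbox (a' + s *\<^sub>R axis i 1) (b' + s *\<^sub>R axis i 1) \<inter> cbox a b"
      have "cbox a b \<subseteq> cbox (a' + s *\<^sub>R axis i 1) (b' + s *\<^sub>R axis i 1)"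
      proof
        fix y assume y: "y \<in> cbox a b"
        have "(s *\<^sub>R axis i (1::real)) $ j \<le> 1 \<and> -1 \<le> (s *\<^sub>R axis i (1::real)) $ j" for j
          using that by (simp add: axis_def)
        moreover have "a $ j \<le> y $ j \<and> y $ j \<le> b $ j" for j using y by (simp add: mem_box_cart)
        ultimately show "y \<in> cbox (a' + s *\<^sub>R axis i 1) (b' + s *\<^sub>R axis i 1)"
          unfolding mem_box_cart a'_def b'_def vector_add_component vector_minus_component vec_lambda_beta
          by (smt (verit))
      qed
      with x show "G x = 0" using supp by blast
    qed
    finally show ?thesis .
  qed
  note const = this
  have "(\<Phi> has_real_derivative integral (cbox a' b') (\<lambda>x. G' (x + 0 *\<^sub>R axis i 1))) (at 0 within {-1..1})"
    unfolding \<Phi>_def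
  proof (rule leibniz_rule_field_derivative[where U = "{-1..1}" and fx = "\<lambda>s x. G' (x + s *\<^sub>R axis i 1)"])
    show "((\<lambda>s. G (x + s *\<^sub>R axis i 1)) has_real_derivative G' (x + s *\<^sub>R axis i 1)) (at s within {-1..1})" for s x
      by (rule has_field_derivative_at_within[OF has_partial_at[OF G(3)]])
    show "(\<lambda>x. G (x + s *\<^sub>R axis i 1)) integrable_on cbox a' b'" for s
      by (intro integrable_continuous continuous_on_compose2[OF G(1)] continuous_intros) auto
    show "continuous_on ({-1..1} \<times> cbox a' b') (\<lambda>(s, x). G' (x + s *\<^sub>R axis i 1))"
      unfolding split_beta by (intro continuous_on_compose2[OF G(2)] continuous_intros) auto
  qed auto
  then have 1: "(\<Phi> has_real_derivative integral (cbox a' b') G') (at 0)"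
    using at_within_interior[of "0::real" "{-1..1}"] by simp
  have "(\<Phi> has_real_derivative 0) (at 0)"
    by (rule has_field_derivative_transform_within_open[OF DERIV_const, where S = "{-1<..<1}"]) (use const in auto)
  with 1 have "integral (cbox a' b') G' = 0" using DERIV_unique by blast
  moreover have "integral (cbox a b) G' = integral (cbox a' b') G'"
  proof (rule integral_zero_outside)
    fix x assume x: "x \<notin> cbox a b \<inter> cbox a' b'"
    have "cbox a b \<subseteq> cbox a' b'"
      by (auto simp: mem_box_cart a'_def b'_def) (smt (verit))+
    with x show "G' x = 0" using G'0 by blast
  qed
  ultimately show ?thesis by simp
qed

text \<open>With \<open>X\<close> and \<open>ct\<close> the space and time derivatives of the
  cutoff, the flux of energy through its level sets is dominated by the loss from shrinking at speed
  \<open>c0\<close>. Young's inequality is weighted with \<open>c0\<close>, and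
  \<open>1 \<le> c0\<^sup>2 * b\<close> turns the flux into the energy density. The gradient of the
  cutoff appears in the l1 norm because the cone has box-shaped sections.\<close>

lemma energy_pointwise:
  fixes D X :: "'n::finite \<Rightarrow> real"
  assumes c0: "c0 > 0" "1 \<le> c0\<^sup>2 * b" and b: "0 \<le> b"
    and cone: "c0 * (\<Sum>i\<in>UNIV. \<bar>X i\<bar>) \<le> - ct"
  shows "ct * (b * Z\<^sup>2 + (\<Sum>i\<in>UNIV. (D i)\<^sup>2)) / 2 - (\<Sum>i\<in>UNIV. X i * Z * D i) \<le> 0"
proof -
  define E where "E = b * Z\<^sup>2 + (\<Sum>i\<in>UNIV. (D i)\<^sup>2)"
  have E0: "E \<ge> 0" unfolding E_def using b by (intro add_nonneg_nonneg sum_nonneg mult_nonneg_nonneg) auto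
  have "- (X i * Z * D i) \<le> \<bar>X i\<bar> * (c0 / 2 * E)" for i
  proof -
    have "\<bar>Z * D i\<bar> \<le> (Z\<^sup>2 / c0 + c0 * (D i)\<^sup>2) / 2"
    proof -
      have "0 \<le> (\<bar>Z\<bar> - c0 * \<bar>D i\<bar>)\<^sup>2" by simp
      then have "2 * c0 * \<bar>Z * D i\<bar> \<le> Z\<^sup>2 + c0\<^sup>2 * (D i)\<^sup>2"
        by (simp add: power2_diff power_mult_distrib abs_mult algebra_simps)
      then show ?thesis using c0(1) by (simp add: field_simps power2_eq_square)
    qed
    also have "Z\<^sup>2 / c0 \<le> c0 * (b * Z\<^sup>2)"
    proof -
      have "1 * Z\<^sup>2 \<le> (c0\<^sup>2 * b) * Z\<^sup>2" using c0 by (intro mult_right_mono) auto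
      then show ?thesis using c0(1) by (simp add: field_simps power2_eq_square)
    qed
    also have "(c0 * (b * Z\<^sup>2) + c0 * (D i)\<^sup>2) / 2 = c0 / 2 * (b * Z\<^sup>2 + (D i)\<^sup>2)"
      by (simp add: algebra_simps)
    also have "\<dots> \<le> c0 / 2 * E"
      using c0(1) unfolding E_def by (intro mult_left_mono add_left_mono member_le_sum) auto
    finally have "\<bar>Z * D i\<bar> \<le> c0 / 2 * E" by simp
    then have "\<bar>X i\<bar> * \<bar>Z * D i\<bar> \<le> \<bar>X i\<bar> * (c0 / 2 * E)" by (intro mult_left_mono) auto
    moreover have "- (X i * Z * D i) \<le> \<bar>X i\<bar> * \<bar>Z * D i\<bar>"
      by (metis abs_ge_minus_self abs_mult mult.assoc)
    ultimately show ?thesis by linarith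
  qed
  then have "(\<Sum>i\<in>UNIV. - (X i * Z * D i)) \<le> (\<Sum>i\<in>UNIV. \<bar>X i\<bar> * (c0 / 2 * E))" by (intro sum_mono)
  also have "\<dots> = (c0 * (\<Sum>i\<in>UNIV. \<bar>X i\<bar>)) * (E / 2)" by (simp add: sum_distrib_right sum_distrib_left mult_ac)
  also have "\<dots> \<le> - ct * (E / 2)" using cone E0 by (intro mult_right_mono) auto
  finally show ?thesis by (simp add: E_def[symmetric] sum_negf)
qed

text \<open>The rate 1 / T over a time T costs a factor e for every T; any fixed rate would make the
  final constant depend on \<eta>.\<close>

lemma gronwall_const:
  assumes T: "T > 0" and M: "M \<ge> 0"
    and E: "\<And>t. t \<in> {0..T} \<Longrightarrow> (E has_real_derivative E' t) (at t within {0..T})"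
    and le: "\<And>t. t \<in> {0..T} \<Longrightarrow> E' t \<le> E t / T + M"
    and E0: "0 \<le> E 0" and t: "t \<in> {0..T}"
  shows "E t \<le> exp 1 * (E 0 + T * M)"
proof -
  define g where "g t = exp (- t / T) * E t - M * t" for t
  have dg: "(g has_real_derivative exp (- t / T) * (E' t - E t / T) - M) (at t within {0..T})" if "t \<in> {0..T}" for t
    unfolding g_def using T by (auto intro!: derivative_eq_intros E[OF that] simp: algebra_simps)
  have "g t \<le> g 0"
  proof (rule DERIV_nonpos_imp_decreasing_open[of 0 t g])
    show "continuous_on {0..t} g"
      by (rule continuous_on_subset[OF DERIV_continuous_on[OF dg]]) (use t in auto)
    fix s assume s: "0 < s" "s < t"
    then have sT: "s \<in> {0..T}" "s \<in> {0<..<T}" using t by auto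
    have "exp (- s / T) * (E' s - E s / T) - M \<le> exp (- s / T) * M - M"
      using le[OF sT(1)] by (intro diff_right_mono mult_left_mono) auto
    also have "\<dots> \<le> 1 * M - M" using M s T by (intro diff_right_mono mult_right_mono) auto
    finally show "\<exists>y. (g has_real_derivative y) (at s) \<and> y \<le> 0"
      using dg[OF sT(1)] sT(2) by (auto simp: at_within_Icc_at)
  qed (use t in auto)
  then have "exp (- t / T) * E t \<le> E 0 + M * t" by (simp add: g_def)
  then have "exp (t / T) * (exp (- t / T) * E t) \<le> exp (t / T) * (E 0 + M * t)" by (intro mult_left_mono) auto
  also have "exp (t / T) * (exp (- t / T) * E t) = E t" by (simp add: mult.assoc[symmetric] exp_add[symmetric])
  also have "exp (t / T) * (E 0 + M * t) \<le> exp 1 * (E 0 + M * T)"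
    using t T M E0 by (intro mult_mono add_left_mono mult_left_mono) auto
  finally show ?thesis by (simp add: mult.commute)
qed

text \<open>\<open>Z\<close> is the velocity of a wave, \<open>V\<close> its acceleration and
  \<open>D1\<close> its gradient; the wave itself never appears. The energy is localized by a cutoff
  that decreases fast enough to absorb the boundary flux, and the initial energy consists of the
  velocity part alone since the gradient starts at zero.\<close>

lemma energy_estimate:
  fixes W Z V :: "real \<Rightarrow> real^'n \<Rightarrow> real" and D1 D2 ZD :: "'n \<Rightarrow> real \<Rightarrow> real^'n \<Rightarrow> real"
  assumes T: "T > 0" and A: "A > 0" and c0: "c0 = sqrt A"
    and b: "continuous_on UNIV b" "\<And>x. 1 / A \<le> b x"
    and jc: "jointly_continuous T Z" "jointly_continuous T V"
      "\<And>i. jointly_continuous T (D1 i)" "\<And>i. jointly_continuous T (D2 i)" "\<And>i. jointly_continuous T (ZD i)"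
    and px: "\<And>i t. t \<in> {0..T} \<Longrightarrow> has_partial i (D1 i t) (D2 i t)"
      "\<And>i t. t \<in> {0..T} \<Longrightarrow> has_partial i (Z t) (ZD i t)"
    and pt: "\<And>x t. t \<in> {0..T} \<Longrightarrow> ((\<lambda>t. Z t x) has_real_derivative V t x) (at t within {0..T})"
      "\<And>i x t. t \<in> {0..T} \<Longrightarrow> ((\<lambda>t. D1 i t x) has_real_derivative ZD i t x) (at t within {0..T})"
    and init: "\<And>i x. D1 i 0 x = 0"
    and \<Xi>: "jointly_continuous T \<Xi>" "jointly_continuous T \<Xi>t" "\<And>i. jointly_continuous T (\<Xi>x i)"
      "\<And>i t. t \<in> {0..T} \<Longrightarrow> has_partial i (\<Xi> t) (\<Xi>x i t)"
      "\<And>x t. t \<in> {0..T} \<Longrightarrow> ((\<lambda>t. \<Xi> t x) has_real_derivative \<Xi>t t x) (at t within {0..T})"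
      "\<And>t x. t \<in> {0..T} \<Longrightarrow> 0 \<le> \<Xi> t x" "\<And>t x. t \<in> {0..T} \<Longrightarrow> \<Xi> t x \<le> 1"
      "\<And>t x. t \<in> {0..T} \<Longrightarrow> x \<notin> cbox l r \<Longrightarrow> \<Xi> t x = 0"
      "\<And>t x. t \<in> {0..T} \<Longrightarrow> c0 * (\<Sum>i\<in>UNIV. \<bar>\<Xi>x i t x\<bar>) \<le> - \<Xi>t t x"
    and res: "\<And>t x. t \<in> {0..T} \<Longrightarrow> x \<in> cbox l r \<Longrightarrow> \<bar>b x * V t x - (\<Sum>i\<in>UNIV. D2 i t x)\<bar> \<le> Q x"
    and Q: "continuous_on (cbox l r) Q"
    and t: "t \<in> {0..T}"
  shows "integral (cbox l r) (\<lambda>x. \<Xi> t x * (b x * (Z t x)\<^sup>2)) \<le>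
    exp 1 * (integral (cbox l r) (\<lambda>x. \<Xi> 0 x * (b x * (Z 0 x)\<^sup>2)) + T\<^sup>2 * A * integral (cbox l r) (\<lambda>x. (Q x)\<^sup>2))"
proof -
  define I :: "(real^'n \<Rightarrow> real) \<Rightarrow> real" where "I = integral (cbox l r)"
  define e where "e t x = \<Xi> t x * (b x * (Z t x)\<^sup>2 + (\<Sum>i\<in>UNIV. (D1 i t x)\<^sup>2)) / 2" for t x
  define e' where "e' t x = (\<Xi>t t x * (b x * (Z t x)\<^sup>2 + (\<Sum>i\<in>UNIV. (D1 i t x)\<^sup>2)) +
    \<Xi> t x * (b x * (2 * Z t x * V t x) + (\<Sum>i\<in>UNIV. 2 * D1 i t x * ZD i t x))) / 2" for t x
  define E where "E t = I (e t)" for t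
  note jc' = jc[unfolded jointly_continuous_def] \<Xi>(1-3)[unfolded jointly_continuous_def]
  have b2: "continuous_on S (\<lambda>p. b (snd p))" for S :: "(real \<times> (real^'n)) set"
    by (intro continuous_on_compose2[OF b(1)] continuous_intros) auto
  have b0: "b x > 0" for x using b(2)[of x] A by (metis divide_pos_pos less_le_trans zero_less_one)
  have je: "jointly_continuous T e" "jointly_continuous T e'"
    unfolding e_def e'_def jointly_continuous_def by (intro continuous_intros jc' b2; simp)+
  have cs: "continuous_on S (f t)" if "jointly_continuous T f" "t \<in> {0..T}" for f S t
    using jointly_continuous_space that by blast
  have int: "f integrable_on cbox l r" if "continuous_on UNIV f" for f :: "real^'n \<Rightarrow> real"
    by (rule integrable_continuous, rule continuous_on_subset[OF that]) auto
  have dE: "(E has_real_derivative I (e' t)) (at t within {0..T})" if t: "t \<in> {0..T}" for t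
    unfolding E_def I_def
  proof (rule leibniz_rule_field_derivative[where U = "{0..T}"])
    show "((\<lambda>t. e t x) has_real_derivative e' t x) (at t within {0..T})" if "t \<in> {0..T}" for t x
      unfolding e_def e'_def using pt[OF that] \<Xi>(5)[OF that]
      by (auto intro!: derivative_eq_intros simp: algebra_simps sum_distrib_left sum.distrib)
    show "continuous_on ({0..T} \<times> cbox l r) (\<lambda>(t, x). e' t x)"
      using je(2) unfolding jointly_continuous_def split_beta by (rule continuous_on_subset) auto
    show "e t integrable_on cbox l r" if "t \<in> {0..T}" for t by (rule int, rule cs[OF je(1) that])
  qed (use t in auto)
  define M where "M = (T * A / 2) * I (\<lambda>x. (Q x)\<^sup>2)"
  have iQ: "(\<lambda>x. (Q x)\<^sup>2) integrable_on cbox l r" by (intro integrable_continuous continuous_intros Q)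
  have M0: "M \<ge> 0" unfolding M_def I_def using T A iQ by (intro mult_nonneg_nonneg integral_nonneg) auto
  have le: "I (e' t) \<le> E t / T + M" if t: "t \<in> {0..T}" for t
  proof -
    \<comment> \<open>This is the spatial derivative of \<Xi> Z D1 in direction i. Subtracting a
      function of integral zero is the integration by parts of the energy identity.\<close>
    define g where "g i x = \<Xi>x i t x * (Z t x * D1 i t x) + \<Xi> t x * (ZD i t x * D1 i t x + Z t x * D2 i t x)" for i x
    note c = cs[OF jc(1) t] cs[OF jc(2) t] cs[OF jc(3) t] cs[OF jc(4) t] cs[OF jc(5) t] cs[OF \<Xi>(1) t] cs[OF \<Xi>(2) t] cs[OF \<Xi>(3) t]
    have cg: "continuous_on UNIV (g i)" for i unfolding g_def by (intro continuous_intros c)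
    have g0: "I (g i) = 0" for i unfolding I_def
    proof (rule integral_partial_zero)
      show "has_partial i (\<lambda>x. \<Xi> t x * (Z t x * D1 i t x)) (g i)"
        unfolding g_def by (intro has_partial_mult \<Xi>(4) px t)
      show "continuous_on UNIV (\<lambda>x. \<Xi> t x * (Z t x * D1 i t x))" by (intro continuous_intros c)
    qed (use cg \<Xi>(8)[OF t] in auto)
    have "I (e' t) = I (\<lambda>x. e' t x - (\<Sum>i\<in>UNIV. g i x))"
    proof -
      have "I (\<lambda>x. e' t x - (\<Sum>i\<in>UNIV. g i x)) = I (e' t) - I (\<lambda>x. \<Sum>i\<in>UNIV. g i x)"
        unfolding I_def by (intro Henstock_Kurzweil_Integration.integral_diff int cs[OF je(2) t] continuous_intros cg)
      also have "I (\<lambda>x. \<Sum>i\<in>UNIV. g i x) = (\<Sum>i\<in>UNIV. I (g i))"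
        unfolding I_def by (intro integral_sum int cg) auto
      finally show ?thesis using g0 by simp
    qed
    also have "\<dots> \<le> I (\<lambda>x. e t x * (1 / T) + (T * A / 2) * (Q x)\<^sup>2)"
      unfolding I_def
    proof (rule integral_le)
      show "(\<lambda>x. e' t x - (\<Sum>i\<in>UNIV. g i x)) integrable_on cbox l r"
        by (intro int continuous_intros cs[OF je(2) t] cg)
      show "(\<lambda>x. e t x * (1 / T) + (T * A / 2) * (Q x)\<^sup>2) integrable_on cbox l r"
        by (intro Henstock_Kurzweil_Integration.integrable_add integrable_on_mult_right integrable_on_mult_left iQ int cs[OF je(1) t])
      fix x assume x: "x \<in> cbox l r"
      define R where "R = b x * V t x - (\<Sum>i\<in>UNIV. D2 i t x)"
      have R: "\<bar>R\<bar> \<le> Q x" using res[OF t x] by (simp add: R_def)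
      \<comment> \<open>What is left are the terms with derivatives of the cutoff, nonpositive by
        \<open>energy_pointwise\<close>, and the residual tested with the velocity.\<close>
      have eq: "e' t x - (\<Sum>i\<in>UNIV. g i x) =
        (\<Xi>t t x * (b x * (Z t x)\<^sup>2 + (\<Sum>i\<in>UNIV. (D1 i t x)\<^sup>2)) / 2 - (\<Sum>i\<in>UNIV. \<Xi>x i t x * Z t x * D1 i t x)) + \<Xi> t x * (Z t x * R)"
      proof -
        have s1: "(\<Sum>i\<in>UNIV. 2 * D1 i t x * ZD i t x) = 2 * (\<Sum>i\<in>UNIV. ZD i t x * D1 i t x)"
          by (simp add: sum_distrib_left mult_ac)
        have s2: "(\<Sum>i\<in>UNIV. g i x) = (\<Sum>i\<in>UNIV. \<Xi>x i t x * Z t x * D1 i t x) +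
          \<Xi> t x * ((\<Sum>i\<in>UNIV. ZD i t x * D1 i t x) + Z t x * (\<Sum>i\<in>UNIV. D2 i t x))"
          by (simp add: g_def sum.distrib sum_distrib_left distrib_left mult_ac)
        show ?thesis unfolding e'_def s1 s2 R_def by (simp add: field_simps)
      qed
      have "1 \<le> c0\<^sup>2 * b x" using b(2)[of x] A by (simp add: c0 field_simps)
      then have "\<Xi>t t x * (b x * (Z t x)\<^sup>2 + (\<Sum>i\<in>UNIV. (D1 i t x)\<^sup>2)) / 2 - (\<Sum>i\<in>UNIV. \<Xi>x i t x * Z t x * D1 i t x) \<le> 0"
        using A b0[of x] by (intro energy_pointwise[of c0] \<Xi>(9)[OF t]) (auto simp: c0)
      moreover have "\<Xi> t x * (Z t x * R) \<le> e t x * (1 / T) + (T * A / 2) * (Q x)\<^sup>2"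
      proof -
        \<comment> \<open>Young's inequality with weight T A: the part quadratic in \<open>Z\<close>
          is absorbed by the energy at rate 1 / T, with \<open>1 / A \<le> b x\<close>.\<close>
        have "Z t x * R \<le> b x * (Z t x)\<^sup>2 / (2 * T) + T * A / 2 * (Q x)\<^sup>2"
        proof -
          have "0 \<le> (\<bar>Z t x\<bar> - T * A * \<bar>R\<bar>)\<^sup>2" by simp
          then have "2 * (T * A) * (\<bar>Z t x\<bar> * \<bar>R\<bar>) \<le> (Z t x)\<^sup>2 + (T * A)\<^sup>2 * R\<^sup>2"
            by (simp add: power2_diff power_mult_distrib algebra_simps)
          then have "\<bar>Z t x\<bar> * \<bar>R\<bar> \<le> (1 / A) * (Z t x)\<^sup>2 / (2 * T) + T * A / 2 * R\<^sup>2"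
            using T A by (simp add: field_simps power2_eq_square)
          moreover have "(1 / A) * (Z t x)\<^sup>2 / (2 * T) \<le> b x * (Z t x)\<^sup>2 / (2 * T)"
            using b(2)[of x] T by (intro divide_right_mono mult_right_mono) auto
          moreover have "T * A / 2 * R\<^sup>2 \<le> T * A / 2 * (Q x)\<^sup>2"
            using R T A by (intro mult_left_mono) (auto simp: abs_le_square_iff[symmetric])
          moreover have "Z t x * R \<le> \<bar>Z t x\<bar> * \<bar>R\<bar>" by (metis abs_ge_self abs_mult)
          ultimately show ?thesis by linarith
        qed
        then have "\<Xi> t x * (Z t x * R) \<le> \<Xi> t x * (b x * (Z t x)\<^sup>2 / (2 * T)) + \<Xi> t x * (T * A / 2 * (Q x)\<^sup>2)"
          using \<Xi>(6)[OF t, of x] unfolding distrib_left[symmetric] by (intro mult_left_mono)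
        also have "\<Xi> t x * (T * A / 2 * (Q x)\<^sup>2) \<le> 1 * (T * A / 2 * (Q x)\<^sup>2)"
          using \<Xi>(7)[OF t, of x] T A by (intro mult_right_mono) auto
        also have "\<Xi> t x * (b x * (Z t x)\<^sup>2 / (2 * T)) \<le> e t x * (1 / T)"
        proof -
          have "\<Xi> t x * (b x * (Z t x)\<^sup>2) \<le> \<Xi> t x * (b x * (Z t x)\<^sup>2 + (\<Sum>i\<in>UNIV. (D1 i t x)\<^sup>2))"
            using \<Xi>(6)[OF t, of x] by (intro mult_left_mono) (auto intro: sum_nonneg)
          then show ?thesis using T by (simp add: e_def field_simps)
        qed
        finally show ?thesis by simp
      qed
      ultimately show "e' t x - (\<Sum>i\<in>UNIV. g i x) \<le> e t x * (1 / T) + (T * A / 2) * (Q x)\<^sup>2" unfolding eq by linarith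
    qed
    also have "\<dots> = E t * (1 / T) + M"
      unfolding I_def E_def M_def integral_mult_left[symmetric] integral_mult_right[symmetric]
      by (intro Henstock_Kurzweil_Integration.integral_add integrable_on_mult_right integrable_on_mult_left iQ int cs[OF je(1) t])
    finally show ?thesis by simp
  qed
  have E0: "2 * E 0 = I (\<lambda>x. \<Xi> 0 x * (b x * (Z 0 x)\<^sup>2))"
    unfolding E_def I_def integral_mult_right[symmetric] by (simp add: e_def init)
  have z: "0 \<in> {0..T}" using T by simp
  have "E 0 \<ge> 0"
  proof -
    have "0 \<le> I (\<lambda>x. \<Xi> 0 x * (b x * (Z 0 x)\<^sup>2))" unfolding I_def
      using \<Xi>(6)[OF z] b0 by (intro integral_nonneg int continuous_intros cs[OF \<Xi>(1) z] cs[OF jc(1) z] b) (auto simp: less_imp_le)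
    then show ?thesis using E0 by simp
  qed
  from gronwall_const[OF T M0 dE le this t] have "E t \<le> exp 1 * (E 0 + T * M)" .
  moreover have "I (\<lambda>x. \<Xi> t x * (b x * (Z t x)\<^sup>2)) \<le> 2 * E t"
    unfolding E_def I_def integral_mult_right[symmetric]
  proof (rule integral_le)
    show "(\<lambda>x. \<Xi> t x * (b x * (Z t x)\<^sup>2)) integrable_on cbox l r"
      by (intro int continuous_intros cs[OF \<Xi>(1) t] cs[OF jc(1) t] b)
    show "(\<lambda>x. 2 * e t x) integrable_on cbox l r" by (intro integrable_on_mult_right int cs[OF je(1) t])
    show "\<Xi> t x * (b x * (Z t x)\<^sup>2) \<le> 2 * e t x" for x
      unfolding e_def using \<Xi>(6)[OF t, of x] by (simp add: mult_left_mono sum_nonneg)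
  qed
  moreover have "exp 1 * (E 0 + T * M) = exp 1 * (I (\<lambda>x. \<Xi> 0 x * (b x * (Z 0 x)\<^sup>2)) + T\<^sup>2 * A * I (\<lambda>x. (Q x)\<^sup>2)) / 2"
    unfolding E0[symmetric] M_def by (simp add: power2_eq_square algebra_simps)
  ultimately show ?thesis unfolding I_def by linarith
qed

text \<open>A product over the coordinates of a decreasing step evaluated at y + c0 t and at -y + c0
  t: both faces of each coordinate interval move inwards at speed \<open>c0\<close>. The layer
  between R - 2 \<kappa> and R - \<kappa> is the transition at time 0.\<close>

lemma cutoff_exists:
  fixes x0 :: "real^'n"
  assumes \<kappa>: "0 < \<kappa>" and c0: "0 < c0"
  shows "\<exists>\<Xi> \<Xi>t (\<Xi>x :: 'n \<Rightarrow> real \<Rightarrow> real^'n \<Rightarrow> real). jointly_continuous T \<Xi> \<and> jointly_continuous T \<Xi>t \<and> (\<forall>i. jointly_continuous T (\<Xi>x i)) \<and>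
    (\<forall>i t. has_partial i (\<Xi> t) (\<Xi>x i t)) \<and>
    (\<forall>x t S. ((\<lambda>t. \<Xi> t x) has_real_derivative \<Xi>t t x) (at t within S)) \<and>
    (\<forall>t x. 0 \<le> \<Xi> t x \<and> \<Xi> t x \<le> 1) \<and>
    (\<forall>t x. 0 \<le> t \<longrightarrow> x \<notin> micro_box x0 (R - \<kappa>) \<longrightarrow> \<Xi> t x = 0) \<and>
    (\<forall>t x. (\<forall>i. \<bar>x $ i - x0 $ i\<bar> + c0 * t \<le> R - 2 * \<kappa>) \<longrightarrow> \<Xi> t x = 1) \<and>
    (\<forall>t x. c0 * (\<Sum>i\<in>UNIV. \<bar>\<Xi>x i t x\<bar>) \<le> - \<Xi>t t x)"
proof -
  obtain S :: "real \<Rightarrow> real" where S: "smooth S" "\<And>t. 0 \<le> S t" "\<And>t. S t \<le> 1"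
    "\<And>t. t \<le> 0 \<Longrightarrow> S t = 0" "\<And>t. t \<ge> 1 \<Longrightarrow> S t = 1" "\<And>t. 0 \<le> deriv S t"
    using smooth_step_exists by metis
  define \<phi> where "\<phi> s = S ((R - \<kappa> - s) / \<kappa>)" for s
  define \<phi>' where "\<phi>' s = deriv S ((R - \<kappa> - s) / \<kappa>) * (- (1 / \<kappa>))" for s
  have d\<phi>: "(\<phi> has_real_derivative \<phi>' s) (at s)" for s
    unfolding \<phi>_def \<phi>'_def
    by (rule DERIV_chain2[OF smooth_deriv(2)[OF S(1)]]) (use \<kappa> in \<open>auto intro!: derivative_eq_intros simp: field_simps\<close>)
  have \<phi>: "0 \<le> \<phi> s" "\<phi> s \<le> 1" "\<phi>' s \<le> 0" for s
    using S(2,3,6) \<kappa> by (auto simp: \<phi>_def \<phi>'_def)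
  have \<phi>0: "\<phi> s = 0" if "R - \<kappa> \<le> s" for s
    using that \<kappa> unfolding \<phi>_def by (intro S(4)) (simp add: divide_nonpos_pos)
  have \<phi>1: "\<phi> s = 1" if "s \<le> R - 2 * \<kappa>" for s
    using that \<kappa> unfolding \<phi>_def by (intro S(5)) (simp add: pos_le_divide_eq)
  have c\<phi>: "continuous_on UNIV \<phi>" "continuous_on UNIV \<phi>'"
    unfolding \<phi>_def \<phi>'_def
    by (intro continuous_intros continuous_on_compose2[OF smooth_continuous[OF S(1), of UNIV]]
        continuous_on_compose2[OF smooth_continuous[OF smooth_deriv(1)[OF S(1)], of UNIV]]; use \<kappa> in auto)+
  define h where "h t y = \<phi> (y + c0 * t) * \<phi> (- y + c0 * t)" for t y
  define hy where "hy t y = \<phi>' (y + c0 * t) * \<phi> (- y + c0 * t) - \<phi> (y + c0 * t) * \<phi>' (- y + c0 * t)" for t y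
  define ht where "ht t y = c0 * (\<phi>' (y + c0 * t) * \<phi> (- y + c0 * t) + \<phi> (y + c0 * t) * \<phi>' (- y + c0 * t))" for t y
  have dy: "((\<lambda>y. h t y) has_real_derivative hy t y) (at y)" for t y
    unfolding h_def hy_def by (auto intro!: derivative_eq_intros DERIV_chain2[OF d\<phi>])
  have dt: "((\<lambda>t. h t y) has_real_derivative ht t y) (at t within U)" for t y U
    unfolding h_def ht_def
    by (rule has_field_derivative_at_within) (auto intro!: derivative_eq_intros DERIV_chain2[OF d\<phi>] simp: algebra_simps)
  have h: "0 \<le> h t y" "h t y \<le> 1" for t y unfolding h_def using \<phi> by (auto intro: mult_le_one)
  \<comment> \<open>\<open>hy\<close> is the difference and \<open>ht\<close> is \<open>c0\<close>
    times the sum of the same two nonpositive terms.\<close>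
  have cone: "c0 * \<bar>hy t y\<bar> \<le> - ht t y" for t y
  proof -
    have "\<phi>' (y + c0 * t) * \<phi> (- y + c0 * t) \<le> 0" "\<phi> (y + c0 * t) * \<phi>' (- y + c0 * t) \<le> 0"
      using \<phi> by (auto intro: mult_nonpos_nonneg mult_nonneg_nonpos)
    then have "\<bar>hy t y\<bar> \<le> - (\<phi>' (y + c0 * t) * \<phi> (- y + c0 * t) + \<phi> (y + c0 * t) * \<phi>' (- y + c0 * t))"
      unfolding hy_def by linarith
    then have "c0 * \<bar>hy t y\<bar> \<le> c0 * - (\<phi>' (y + c0 * t) * \<phi> (- y + c0 * t) + \<phi> (y + c0 * t) * \<phi>' (- y + c0 * t))"
      using c0 by (intro mult_left_mono) auto
    then show ?thesis by (simp add: ht_def algebra_simps)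
  qed
  define \<Xi> where "\<Xi> t x = (\<Prod>i\<in>UNIV. h t (x $ i - x0 $ i))" for t and x :: "real^'n"
  define P where "P i t x = (\<Prod>j\<in>UNIV - {i}. h t (x $ j - x0 $ j))" for i t and x :: "real^'n"
  define \<Xi>x where "\<Xi>x i t x = hy t (x $ i - x0 $ i) * P i t x" for i t x
  define \<Xi>t where "\<Xi>t t x = (\<Sum>i\<in>UNIV. ht t (x $ i - x0 $ i) * P i t x)" for t x
  have P0: "0 \<le> P i t x" for i t x unfolding P_def by (intro prod_nonneg) (auto intro: h)
  note ci = continuous_intros continuous_on_compose2[OF c\<phi>(1)] continuous_on_compose2[OF c\<phi>(2)]
  have "jointly_continuous T \<Xi>" "jointly_continuous T \<Xi>t" "jointly_continuous T (\<Xi>x i)" for i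
    unfolding jointly_continuous_def \<Xi>_def \<Xi>t_def \<Xi>x_def P_def h_def hy_def ht_def
    by (intro ci; simp)+
  moreover have "has_partial i (\<Xi> t) (\<Xi>x i t)" for i t
    unfolding has_partial_def
  proof
    fix x
    have "((\<lambda>s. \<Prod>j\<in>UNIV. h t ((x + s *\<^sub>R axis i 1) $ j - x0 $ j)) has_real_derivative
      (\<Sum>j\<in>UNIV. (if j = i then hy t (x $ i - x0 $ i) else 0) * (\<Prod>k\<in>UNIV - {j}. h t ((x + 0 *\<^sub>R axis i 1) $ k - x0 $ k)))) (at 0)"
    proof (rule has_field_derivative_prod)
      fix j
      show "((\<lambda>s. h t ((x + s *\<^sub>R axis i 1) $ j - x0 $ j)) has_real_derivative (if j = i then hy t (x $ i - x0 $ i) else 0)) (at 0)"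
      proof (cases "j = i")
        case True
        have "((\<lambda>s. h t (x $ i - x0 $ i + s)) has_real_derivative hy t (x $ i - x0 $ i)) (at 0)"
          using dy[of t "x $ i - x0 $ i"] DERIV_shift[of "h t" _ 0 "x $ i - x0 $ i"] by (simp add: add.commute)
        then show ?thesis using True by (simp add: axis_def algebra_simps)
      qed (simp add: axis_def)
    qed
    also have "(\<Sum>j\<in>UNIV. (if j = i then hy t (x $ i - x0 $ i) else 0) * (\<Prod>k\<in>UNIV - {j}. h t ((x + 0 *\<^sub>R axis i 1) $ k - x0 $ k))) = \<Xi>x i t x"
      by (simp add: \<Xi>x_def P_def if_distribR if_distrib sum.delta cong: if_cong)
    finally show "((\<lambda>s. \<Xi> t (x + s *\<^sub>R axis i 1)) has_real_derivative \<Xi>x i t x) (at 0)"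
      unfolding \<Xi>_def .
  qed
  moreover have "((\<lambda>t. \<Xi> t x) has_real_derivative \<Xi>t t x) (at t within U)" for x t U
    unfolding \<Xi>_def \<Xi>t_def P_def 
    by (rule has_field_derivative_at_within, rule has_field_derivative_prod) (rule dt)
  moreover have "0 \<le> \<Xi> t x \<and> \<Xi> t x \<le> 1" for t x
    unfolding \<Xi>_def using h by (auto intro: prod_nonneg prod_le_1)
  moreover have "\<Xi> t x = 0" if t: "0 \<le> t" and x: "x \<notin> micro_box x0 (R - \<kappa>)" for t x
  proof -
    obtain i where "\<not> (x0 $ i - (R - \<kappa>) \<le> x $ i \<and> x $ i \<le> x0 $ i + (R - \<kappa>))"
      using x by (auto simp: micro_box_def mem_box_cart)
    moreover have "0 \<le> c0 * t" using c0 t by simp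
    ultimately have "R - \<kappa> \<le> x $ i - x0 $ i + c0 * t \<or> R - \<kappa> \<le> - (x $ i - x0 $ i) + c0 * t" by linarith
    then have "h t (x $ i - x0 $ i) = 0" unfolding h_def using \<phi>0 by auto
    then show ?thesis unfolding \<Xi>_def by (meson UNIV_I finite prod_zero)
  qed
  moreover have "\<Xi> t x = 1" if "\<And>i. \<bar>x $ i - x0 $ i\<bar> + c0 * t \<le> R - 2 * \<kappa>" for t x
  proof -
    have "h t (x $ i - x0 $ i) = 1" for i
      using that[of i] unfolding h_def by (subst (1 2) \<phi>1) auto
    then show ?thesis by (simp add: \<Xi>_def)
  qed
  moreover have "c0 * (\<Sum>i\<in>UNIV. \<bar>\<Xi>x i t x\<bar>) \<le> - \<Xi>t t x" for t x
  proof -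
    have "c0 * (\<Sum>i\<in>UNIV. \<bar>\<Xi>x i t x\<bar>) = (\<Sum>i\<in>UNIV. (c0 * \<bar>hy t (x $ i - x0 $ i)\<bar>) * P i t x)"
      using P0 by (simp add: \<Xi>x_def abs_mult sum_distrib_left mult.assoc)
    also have "\<dots> \<le> (\<Sum>i\<in>UNIV. (- ht t (x $ i - x0 $ i)) * P i t x)"
      by (intro sum_mono mult_right_mono cone P0)
    also have "\<dots> = - \<Xi>t t x" by (simp add: \<Xi>t_def sum_negf)
    finally show ?thesis .
  qed
  ultimately show ?thesis by blast
qed

section \<open>Mollification\<close>

lemma partial_zero_outside:
  fixes G :: "real^'n \<Rightarrow> real"
  assumes "has_partial i G G'" "\<And>x. x \<notin> C \<Longrightarrow> G x = 0" "closed C" "x \<notin> C"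
  shows "G' x = 0"
proof -
  define U where "U = (\<lambda>s. x + s *\<^sub>R axis i (1::real)) -` (- C)"
  have "open U" unfolding U_def
    by (rule open_vimage) (auto intro!: continuous_intros simp: assms(3) open_Compl)
  moreover have "0 \<in> U" using assms(4) by (simp add: U_def)
  ultimately have "((\<lambda>s. G (x + s *\<^sub>R axis i 1)) has_real_derivative 0) (at 0)"
    by (rule has_field_derivative_transform_within_open[OF DERIV_const]) (auto simp: U_def assms(2))
  then show ?thesis using assms(1) DERIV_unique unfolding has_partial_def by blast
qed

lemma continuous_supported_bounded:
  fixes f :: "'a::euclidean_space \<Rightarrow> real"
  assumes "continuous_on UNIV f" "\<And>x. x \<notin> cbox a b \<Longrightarrow> f x = 0"
  shows "\<exists>C\<ge>0. \<forall>x. \<bar>f x\<bar> \<le> C"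
proof -
  have "bounded (f ` cbox a b)"
    by (intro compact_imp_bounded compact_continuous_image continuous_on_subset[OF assms(1)]) auto
  then obtain C where C: "\<bar>f x\<bar> \<le> C" if "x \<in> cbox a b" for x by (auto simp: bounded_iff)
  have "\<bar>f x\<bar> \<le> max C 0" for x using C[of x] assms(2)[of x] by (cases "x \<in> cbox a b") auto
  then show ?thesis by (intro exI[of _ "max C 0"]) auto
qed

lemma partial_axis:
  fixes \<phi> :: "real^'n \<Rightarrow> real"
  assumes "smooth \<phi>" "((\<lambda>s. \<phi> (y + s *\<^sub>R axis i 1)) has_real_derivative d) (at 0)"
  shows "partial (axis i 1) \<phi> y = d"
proof -
  have "(\<phi> has_derivative frechet_derivative \<phi> (at y)) (at (y + 0 *\<^sub>R axis i 1))"
    using smooth_differentiable[OF assms(1)] frechet_derivative_works[of \<phi>] by simp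
  moreover have "((\<lambda>s. y + s *\<^sub>R axis i (1::real)) has_derivative (\<lambda>s. s *\<^sub>R axis i 1)) (at 0)"
    by (auto intro!: derivative_eq_intros)
  ultimately have "((\<lambda>s. \<phi> (y + s *\<^sub>R axis i 1)) has_derivative (\<lambda>s. frechet_derivative \<phi> (at y) (s *\<^sub>R axis i 1))) (at 0)"
    by (rule has_derivative_compose[rotated])
  then have "(\<lambda>s. frechet_derivative \<phi> (at y) (s *\<^sub>R axis i 1)) = (\<lambda>s. d * s)"
    using assms(2) unfolding has_field_derivative_def by (rule has_derivative_unique)
  from fun_cong[OF this, of 1] show ?thesis by (simp add: partial_def)
qed

lemma sum_Basis_vec: "(\<Sum>b\<in>(Basis :: (real^'n) set). f b) = (\<Sum>i\<in>UNIV. f (axis i 1))"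
proof -
  have B: "(Basis :: (real^'n) set) = (\<lambda>i. axis i 1) ` UNIV" by (auto simp: Basis_vec_def)
  have inj: "inj (\<lambda>i::'n. axis i (1::real))" by (auto simp: inj_on_def axis_eq_axis)
  show ?thesis by (subst B, subst sum.reindex[OF inj]) simp
qed

lemma smooth_partial: "smooth f \<Longrightarrow> b \<in> Basis \<Longrightarrow> smooth (partial b f)"
  unfolding smooth_def by (metis Ck.simps(2))

lemma laplacian_reflected:
  fixes s :: "real^'n \<Rightarrow> real"
  assumes s: "smooth (\<lambda>y. s (x - y))"
    and D: "\<And>i. has_partial i s (D1 i)" "\<And>i. has_partial i (D1 i) (D2 i)"
  shows "laplacian (\<lambda>y. s (x - y)) y = (\<Sum>i\<in>UNIV. D2 i (x - y))"
proof -
  have refl: "((\<lambda>r. f (x - (y + r *\<^sub>R axis i 1))) has_real_derivative - f' (x - y)) (at 0)"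
    if "has_partial i f f'" for f f' i y
  proof -
    have "((\<lambda>r. f ((x - y) + (- r) *\<^sub>R axis i 1)) has_real_derivative f' ((x - y) + (- 0) *\<^sub>R axis i 1) * (-1)) (at 0)"
      by (rule DERIV_chain2[OF has_partial_at[OF that]]) (auto intro!: derivative_eq_intros)
    then show ?thesis by (simp add: algebra_simps)
  qed
  have p1: "partial (axis i 1) (\<lambda>y. s (x - y)) = (\<lambda>y. - D1 i (x - y))" for i
    by (rule ext, rule partial_axis[OF s refl[OF D(1)]])
  have "partial (axis i 1) (partial (axis i 1) (\<lambda>y. s (x - y))) y = D2 i (x - y)" for i
  proof (rule partial_axis)
    show "smooth (partial (axis i 1) (\<lambda>y. s (x - y)))"
      by (rule smooth_partial[OF s]) (auto simp: axis_in_Basis_iff)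
    show "((\<lambda>r. partial (axis i 1) (\<lambda>y. s (x - y)) (y + r *\<^sub>R axis i 1)) has_real_derivative D2 i (x - y)) (at 0)"
      unfolding p1 using DERIV_minus[OF refl[OF D(2), of i y]] by simp
  qed
  then show ?thesis by (simp add: laplacian_def sum_Basis_vec)
qed

text \<open>A product of one-dimensional bumps, which reduces derivatives and mass to one variable.
  The mass is recorded in both variables: integration in y is the normalization of averages,
  integration in x enters after Fubini.\<close>

lemma mollifier_exists:
  assumes \<delta>: "0 < \<delta>"
  shows "\<exists>(s :: real^'n \<Rightarrow> real) D1 D2. (\<forall>x. smooth (\<lambda>y. s (x - y))) \<and> continuous_on UNIV s \<and>
    (\<forall>i. continuous_on UNIV (D1 i) \<and> continuous_on UNIV (D2 i) \<and> has_partial i s (D1 i) \<and> has_partial i (D1 i) (D2 i)) \<and>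
    (\<forall>z. 0 \<le> s z) \<and> (\<forall>z. z \<notin> cbox (- (\<chi> i. \<delta>)) (\<chi> i. \<delta>) \<longrightarrow> s z = 0 \<and> (\<forall>i. D1 i z = 0 \<and> D2 i z = 0)) \<and>
    (\<forall>y. (LINT x|lborel. s (x - y)) = 1) \<and> (\<forall>x. (LINT y|lborel. s (x - y)) = 1)"
proof -
  obtain b :: "real \<Rightarrow> real" where b: "smooth b" "\<And>t. 0 \<le> b t" "\<And>t. \<bar>t\<bar> \<ge> 1 \<Longrightarrow> b t = 0"
    "integral {-1..1} b = 1" using bump_exists by metis
  define \<beta> where "\<beta> t = b (t / \<delta> + 0) * (1 / \<delta>)" for t
  have sb: "smooth \<beta>" unfolding \<beta>_def
    by (intro smooth_mult smooth_const smooth_compose_affine b bounded_linear_divide)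
  have b0: "\<beta> t = 0" if "\<bar>t\<bar> \<ge> \<delta>" for t
    using that \<delta> b(3)[of "t / \<delta>"] by (simp add: \<beta>_def abs_div le_divide_eq)
  have ib: "integrable lborel b" "integral\<^sup>L lborel b = 1"
  proof -
    have "b x = 0" if "x \<notin> cbox (-1) 1" for x using b(3)[of x] that by (auto simp: abs_if)
    from compact_support_integrable(1,2)[OF smooth_continuous[OF b(1)] this]
    show "integrable lborel b" "integral\<^sup>L lborel b = 1" using b(4) by (auto simp: box_real)
  qed
  have i\<beta>: "integrable lborel (\<lambda>t. \<beta> (c + d * t))" "(LINT t|lborel. \<beta> (c + d * t)) = 1" if "\<bar>d\<bar> = 1" for c d
  proof -
    have d: "d \<noteq> 0" using that by auto
    have e: "\<beta> (c + d * t) = b (c / \<delta> + (d / \<delta>) * t) * (1 / \<delta>)" for t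
      by (simp add: \<beta>_def add_divide_distrib)
    have "integrable lborel (\<lambda>t. b (c / \<delta> + (d / \<delta>) * t))"
      using ib(1) lborel_integrable_real_affine_iff[of "d / \<delta>" b "c / \<delta>"] d \<delta> by simp
    then show "integrable lborel (\<lambda>t. \<beta> (c + d * t))" unfolding e by (rule integrable_mult_left)
    have "(LINT t|lborel. b t) = \<bar>d / \<delta>\<bar> * (LINT t|lborel. b (c / \<delta> + (d / \<delta>) * t))"
      using lborel_integral_real_affine[of "d / \<delta>" b "c / \<delta>"] d \<delta> by simp
    then show "(LINT t|lborel. \<beta> (c + d * t)) = 1" unfolding e using ib(2) that \<delta> by (simp add: abs_div)
  qed
  define s where "s z = (\<Prod>i\<in>UNIV. \<beta> (z $ i))" for z :: "real^'n"
  define D1 where "D1 i z = deriv \<beta> (z $ i) * (\<Prod>j\<in>UNIV - {i}. \<beta> (z $ j))" for i and z :: "real^'n"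
  define D2 where "D2 i z = deriv (deriv \<beta>) (z $ i) * (\<Prod>j\<in>UNIV - {i}. \<beta> (z $ j))" for i and z :: "real^'n"
  have cb: "continuous_on UNIV \<beta>" "continuous_on UNIV (deriv \<beta>)" "continuous_on UNIV (deriv (deriv \<beta>))"
    using sb smooth_deriv(1) smooth_continuous by blast+
  have cont: "continuous_on UNIV s" "continuous_on UNIV (D1 i)" "continuous_on UNIV (D2 i)" for i
    unfolding s_def D1_def D2_def
    by (intro continuous_intros continuous_on_compose2[OF cb(1)] continuous_on_compose2[OF cb(2)] continuous_on_compose2[OF cb(3)]; simp)+
  have hp: "has_partial i (\<lambda>z. f (z $ i) * (\<Prod>j\<in>UNIV - {i}. \<beta> (z $ j))) (\<lambda>z. f' (z $ i) * (\<Prod>j\<in>UNIV - {i}. \<beta> (z $ j)))"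
    if "\<And>t. (f has_real_derivative f' t) (at t)" for i :: 'n and f f'
    unfolding has_partial_def
  proof
    fix x :: "real^'n"
    have "(\<Prod>j\<in>UNIV - {i}. \<beta> ((x + r *\<^sub>R axis i 1) $ j)) = (\<Prod>j\<in>UNIV - {i}. \<beta> (x $ j))" for r
      by (intro prod.cong) (auto simp: axis_def)
    moreover have "((\<lambda>r. f (x $ i + r) * c) has_real_derivative f' (x $ i) * c) (at 0)" for c
      using that[of "x $ i"] DERIV_shift[of f _ 0 "x $ i"] by (auto intro!: DERIV_cmult_right simp: add.commute)
    ultimately show "((\<lambda>r. f ((x + r *\<^sub>R axis i 1) $ i) * (\<Prod>j\<in>UNIV - {i}. \<beta> ((x + r *\<^sub>R axis i 1) $ j))) has_real_derivative
       f' (x $ i) * (\<Prod>j\<in>UNIV - {i}. \<beta> (x $ j))) (at 0)"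
      by (simp add: axis_def)
  qed
  have s_alt: "s = (\<lambda>z. \<beta> (z $ i) * (\<Prod>j\<in>UNIV - {i}. \<beta> (z $ j)))" for i
    unfolding s_def by (rule ext) (rule prod.remove, auto)
  have part: "has_partial i s (D1 i)" "has_partial i (D1 i) (D2 i)" for i
    using hp[OF smooth_deriv(2)[OF sb], of i] hp[OF smooth_deriv(2)[OF smooth_deriv(1)[OF sb]], of i]
    unfolding s_alt[of i] D1_def D2_def by blast+
  have s0: "s z = 0" if z: "z \<notin> cbox (- (\<chi> i. \<delta>)) (\<chi> i. \<delta>)" for z
  proof -
    obtain i where "\<not> (- \<delta> \<le> z $ i \<and> z $ i \<le> \<delta>)" using z by (auto simp: mem_box_cart)
    then have "\<beta> (z $ i) = 0" by (intro b0) auto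
    then show ?thesis unfolding s_def by (meson UNIV_I finite prod_zero)
  qed
  have d0: "D1 i z = 0" if "z \<notin> cbox (- (\<chi> i. \<delta>)) (\<chi> i. \<delta>)" for i z
    by (rule partial_zero_outside[OF part(1) s0 closed_cbox that])
  have d0': "D2 i z = 0" if "z \<notin> cbox (- (\<chi> i. \<delta>)) (\<chi> i. \<delta>)" for i z
    by (rule partial_zero_outside[OF part(2) d0 closed_cbox that])
  have sm: "smooth (\<lambda>y. s (x - y))" for x
  proof -
    have "smooth (\<lambda>y. \<Prod>i\<in>UNIV. \<beta> (- (y $ i) + x $ i))"
      by (intro smooth_prod smooth_compose_affine sb bounded_linear_minus bounded_linear_vec_nth) auto
    then show ?thesis by (simp add: s_def)
  qed
  have i1: "(LINT x|lborel. s (x - y)) = 1" for y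
  proof -
    have "(LINT x|lborel. s (x - y)) = (LINT x|lborel. (\<Prod>i\<in>UNIV. \<beta> (- (y $ i) + 1 * x $ i)))" by (simp add: s_def)
    also have "\<dots> = (\<Prod>i\<in>UNIV. (LINT t|lborel. \<beta> (- (y $ i) + 1 * t)))"
      by (rule integral_prod_vec) (rule i\<beta>(1)[OF abs_one])
    also have "\<dots> = 1" by (simp only: i\<beta>(2)[OF abs_one] prod.neutral_const)
    finally show ?thesis .
  qed
  have i2: "(LINT y|lborel. s (x - y)) = 1" for x
  proof -
    have "(LINT y|lborel. s (x - y)) = (LINT y|lborel. (\<Prod>i\<in>UNIV. \<beta> (x $ i + (- 1) * y $ i)))" by (simp add: s_def)
    also have "\<dots> = (\<Prod>i\<in>UNIV. (LINT t|lborel. \<beta> (x $ i + (- 1) * t)))"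
      by (rule integral_prod_vec) (rule i\<beta>(1), simp)
    also have "\<dots> = 1" by (simp only: i\<beta>(2)[OF abs_neg_one] prod.neutral_const)
    finally show ?thesis .
  qed
  have nn: "0 \<le> s z" for z unfolding s_def \<beta>_def using b(2) \<delta> by (intro prod_nonneg) auto
  show ?thesis using sm cont part nn s0 d0 d0' i1 i2 by blast
qed

text \<open>Convolution restricted to the box, since integrability in time and space is known only
  there; for points farther from the boundary than the width of the kernel it is the usual
  convolution. The kernel is a parameter, so derivatives of the mollifier can take its
  place.\<close>

definition mol :: "(real^'n) set \<Rightarrow> (real^'n \<Rightarrow> real) \<Rightarrow> (real^'n \<Rightarrow> real) \<Rightarrow> real^'n \<Rightarrow> real" where
  "mol B s h x = (LINT y|lebesgue_on B. s (x - y) * h y)"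

lemma measurable_reflected:
  assumes "continuous_on UNIV (s :: real^'n \<Rightarrow> real)" "B \<in> sets lebesgue"
  shows "(\<lambda>y. s (x - y)) \<in> borel_measurable (lebesgue_on B)"
  by (rule continuous_imp_measurable_on_sets_lebesgue[OF _ assms(2)])
    (intro continuous_on_compose2[OF assms(1)] continuous_intros, auto)

lemma mol_integrable:
  fixes s h :: "real^'n \<Rightarrow> real"
  assumes s: "continuous_on UNIV s" "\<And>z. \<bar>s z\<bar> \<le> C" and B: "B \<in> sets lebesgue"
    and h: "integrable (lebesgue_on B) h"
  shows "integrable (lebesgue_on B) (\<lambda>y. s (x - y) * h y)"
proof (rule Bochner_Integration.integrable_bound[of _ "\<lambda>y. C * h y"])
  show "(\<lambda>y. s (x - y) * h y) \<in> borel_measurable (lebesgue_on B)"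
    using measurable_reflected[OF s(1) B] h by (intro borel_measurable_times) auto
  have "\<bar>s (x - y)\<bar> * \<bar>h y\<bar> \<le> \<bar>C\<bar> * \<bar>h y\<bar>" for y
    using s(2)[of "x - y"] by (intro mult_right_mono) auto
  then show "AE y in lebesgue_on B. norm (s (x - y) * h y) \<le> norm (C * h y)" by (simp add: abs_mult)
qed (use h in auto)

lemma mol_bound:
  fixes s h :: "real^'n \<Rightarrow> real"
  assumes s: "continuous_on UNIV s" "\<And>z. \<bar>s z\<bar> \<le> C" and B: "B \<in> sets lebesgue"
    and h: "integrable (lebesgue_on B) h"
  shows "\<bar>mol B s h x\<bar> \<le> C * (LINT y|lebesgue_on B. \<bar>h y\<bar>)"
proof -
  have "\<bar>mol B s h x\<bar> \<le> (LINT y|lebesgue_on B. \<bar>s (x - y) * h y\<bar>)"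
    unfolding mol_def by (rule integral_abs_bound)
  also have "\<dots> \<le> (LINT y|lebesgue_on B. C * \<bar>h y\<bar>)"
    using s(2) by (intro integral_mono integrable_abs mol_integrable[OF s B h] integrable_mult_right h)
      (simp add: abs_mult mult_right_mono)
  finally show ?thesis by simp
qed

lemma mol_diff:
  fixes s h g :: "real^'n \<Rightarrow> real"
  assumes s: "continuous_on UNIV s" "\<And>z. \<bar>s z\<bar> \<le> C" and B: "B \<in> sets lebesgue"
    and h: "integrable (lebesgue_on B) h" "integrable (lebesgue_on B) g"
  shows "mol B s (\<lambda>y. h y - g y) x = mol B s h x - mol B s g x"
  unfolding mol_def right_diff_distrib
  by (rule Bochner_Integration.integral_diff) (rule mol_integrable[OF s B] h)+

lemma mol_cmult: "mol B s (\<lambda>y. c * h y) x = c * mol B s h x"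
  unfolding mol_def by (simp add: mult.left_commute)

lemma mol_sum_kernel:
  fixes h :: "real^'n \<Rightarrow> real"
  assumes s: "\<And>i. i \<in> I \<Longrightarrow> continuous_on UNIV (s i)" "\<And>i z. \<bar>s i z\<bar> \<le> C" and B: "B \<in> sets lebesgue"
    and h: "integrable (lebesgue_on B) h"
  shows "mol B (\<lambda>z. \<Sum>i\<in>I. s i z) h x = (\<Sum>i\<in>I. mol B (s i) h x)"
  unfolding mol_def sum_distrib_right
  by (rule Bochner_Integration.integral_sum) (rule mol_integrable[OF s(1) s(2) B h])

lemma mol_continuous:
  fixes s h :: "real^'n \<Rightarrow> real"
  assumes s: "continuous_on UNIV s" "\<And>z. \<bar>s z\<bar> \<le> C" and B: "B \<in> sets lebesgue"
    and h: "integrable (lebesgue_on B) h" and X: "X \<longlonglongrightarrow> x"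
  shows "(\<lambda>n. mol B s h (X n)) \<longlonglongrightarrow> mol B s h x"
  unfolding mol_def
proof (rule integral_dominated_convergence[where w = "\<lambda>y. C * \<bar>h y\<bar>"])
  show "(\<lambda>y. s (x - y) * h y) \<in> borel_measurable (lebesgue_on B)"
    "(\<lambda>y. s (X n - y) * h y) \<in> borel_measurable (lebesgue_on B)" for n
    using mol_integrable[OF s B h] by auto
  show "integrable (lebesgue_on B) (\<lambda>y. C * \<bar>h y\<bar>)" using h by simp
  show "AE y in lebesgue_on B. norm (s (X n - y) * h y) \<le> C * \<bar>h y\<bar>" for n
    using s(2) by (simp add: abs_mult mult_right_mono)
  have "(\<lambda>n. s (X n - y)) \<longlonglongrightarrow> s (x - y)" for y
    by (rule continuous_on_tendsto_compose[OF s(1)]) (auto intro!: tendsto_intros X)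
  then show "AE y in lebesgue_on B. (\<lambda>n. s (X n - y) * h y) \<longlonglongrightarrow> s (x - y) * h y"
    by (auto intro!: tendsto_intros)
qed

text \<open>Bounded kernels turn L1 continuity into uniform continuity of the mollification. Unlike
  an L2 formulation it passes to \<open>\<bar>h\<bar>\<close> and to products with \<open>b\<close>
  by one-line estimates.\<close>

definition L1_continuous :: "real set \<Rightarrow> (real^'n) set \<Rightarrow> (real \<Rightarrow> real^'n \<Rightarrow> real) \<Rightarrow> bool" where
  "L1_continuous I B h \<longleftrightarrow> (\<forall>t\<in>I. integrable (lebesgue_on B) (h t)) \<and>
    (\<forall>t\<in>I. ((\<lambda>r. LINT x|lebesgue_on B. \<bar>h r x - h t x\<bar>) \<longlongrightarrow> 0) (at t within I))"

text \<open>The increment is split: the change of \<open>h\<close> in time is small uniformly in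
  space by the L1 bound, the change of the point is handled by dominated convergence at the limit
  time.\<close>

lemma mol_jointly_continuous:
  fixes s :: "real^'n \<Rightarrow> real"
  assumes s: "continuous_on UNIV s" "\<And>z. \<bar>s z\<bar> \<le> C" and B: "B \<in> sets lebesgue"
    and h: "L1_continuous {0..T} B h"
  shows "jointly_continuous T (\<lambda>t. mol B s (h t))"
  unfolding jointly_continuous_def continuous_on_sequentially
proof (intro allI ballI impI, elim conjE)
  fix X :: "nat \<Rightarrow> real \<times> (real^'n)" and p
  assume p: "p \<in> {0..T} \<times> UNIV" and X: "\<forall>n. X n \<in> {0..T} \<times> UNIV" "X \<longlonglongrightarrow> p"
  define t where "t = fst p"
  have t: "t \<in> {0..T}" "\<And>n. fst (X n) \<in> {0..T}" using p X by (auto simp: t_def mem_Times_iff)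
  have ih: "integrable (lebesgue_on B) (h r)" if "r \<in> {0..T}" for r using h that by (auto simp: L1_continuous_def)
  define L where "L r = (LINT x|lebesgue_on B. \<bar>h r x - h t x\<bar>)" for r
  have "(L \<longlongrightarrow> L t) (at t within {0..T})"
    using h t(1) by (simp add: L1_continuous_def L_def[abs_def])
  then have "continuous (at t within {0..T}) L" by (simp add: continuous_within)
  moreover have "(\<lambda>n. fst (X n)) \<longlonglongrightarrow> t" unfolding t_def by (intro tendsto_fst X)
  ultimately have "(\<lambda>n. L (fst (X n))) \<longlonglongrightarrow> L t"
    using t by (simp add: continuous_within_sequentially o_def)
  then have L0: "(\<lambda>n. C * L (fst (X n))) \<longlonglongrightarrow> 0" by (auto intro: tendsto_eq_intros simp: L_def)
  have "(\<lambda>n. mol B s (h (fst (X n))) (snd (X n)) - mol B s (h t) (snd (X n))) \<longlonglongrightarrow> 0"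
  proof (rule Lim_null_comparison[OF _ L0], intro always_eventually allI)
    fix n
    show "norm (mol B s (h (fst (X n))) (snd (X n)) - mol B s (h t) (snd (X n))) \<le> C * L (fst (X n))"
      using mol_bound[OF s B Bochner_Integration.integrable_diff[OF ih[OF t(2)] ih[OF t(1)]], of n "snd (X n)"]
        mol_diff[OF s B ih[OF t(2)] ih[OF t(1)], of n "snd (X n)"] by (simp add: L_def)
  qed
  moreover have "(\<lambda>n. mol B s (h t) (snd (X n))) \<longlonglongrightarrow> mol B s (h t) (snd p)"
    by (intro mol_continuous[OF s B ih[OF t(1)]] tendsto_snd X)
  ultimately have "(\<lambda>n. (mol B s (h (fst (X n))) (snd (X n)) - mol B s (h t) (snd (X n))) + mol B s (h t) (snd (X n)))
     \<longlonglongrightarrow> 0 + mol B s (h t) (snd p)" by (rule tendsto_add)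
  then show "((\<lambda>p. mol B s (h (fst p)) (snd p)) \<circ> X) \<longlonglongrightarrow> mol B s (h (fst p)) (snd p)"
    by (simp add: o_def t_def)
qed

text \<open>The derivative falls on the kernel, whose difference quotients are bounded by the mean
  value theorem; \<open>h\<close> need only be integrable.\<close>

lemma mol_has_partial:
  fixes s s' h :: "real^'n \<Rightarrow> real"
  assumes s: "continuous_on UNIV s" "\<And>z. \<bar>s z\<bar> \<le> C" and s': "continuous_on UNIV s'" "\<And>z. \<bar>s' z\<bar> \<le> C'"
    and p: "has_partial i s s'" and B: "B \<in> sets lebesgue" and h: "integrable (lebesgue_on B) h"
  shows "has_partial i (mol B s h) (mol B s' h)"
  unfolding has_partial_def
proof
  fix x
  define q where "q r y = (s (x + r *\<^sub>R axis i 1 - y) - s (x - y)) / r" for r y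
  have qb: "\<bar>q r y\<bar> \<le> C'" if "r \<noteq> 0" for r y
  proof -
    have "norm (s (x - y + r *\<^sub>R axis i 1) - s (x - y + 0 *\<^sub>R axis i 1)) \<le> C' * norm (r - 0)"
      by (rule field_differentiable_bound[of UNIV "\<lambda>r. s (x - y + r *\<^sub>R axis i 1)"])
        (use has_partial_at[OF p] s'(2) in auto)
    then show ?thesis using that by (simp add: q_def abs_div pos_divide_le_eq algebra_simps)
  qed
  have im: "integrable (lebesgue_on B) (\<lambda>y. s (z - y) * h y)" for z by (rule mol_integrable[OF s B h])
  have "((\<lambda>r. (mol B s h (x + r *\<^sub>R axis i 1) - mol B s h x) / r) \<longlongrightarrow> mol B s' h x) (at 0)"
    unfolding tendsto_at_iff_sequentially
  proof (intro allI impI)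
    fix R :: "nat \<Rightarrow> real" assume R: "\<forall>n. R n \<in> UNIV - {0}" "R \<longlonglongrightarrow> 0"
    have "(\<lambda>n. LINT y|lebesgue_on B. q (R n) y * h y) \<longlonglongrightarrow> mol B s' h x"
      unfolding mol_def
    proof (rule integral_dominated_convergence[where w = "\<lambda>y. C' * \<bar>h y\<bar>"])
      show "(\<lambda>y. s' (x - y) * h y) \<in> borel_measurable (lebesgue_on B)"
        using mol_integrable[OF s' B h] by auto
      show "(\<lambda>y. q (R n) y * h y) \<in> borel_measurable (lebesgue_on B)" for n
        unfolding q_def using measurable_reflected[OF s(1) B] h by measurable
      show "integrable (lebesgue_on B) (\<lambda>y. C' * \<bar>h y\<bar>)" using h by simp
      show "AE y in lebesgue_on B. norm (q (R n) y * h y) \<le> C' * \<bar>h y\<bar>" for n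
        using qb R(1) by (simp add: abs_mult mult_right_mono)
      have "(\<lambda>n. q (R n) y) \<longlonglongrightarrow> s' (x - y)" for y
      proof -
        have "((\<lambda>r. q r y) \<longlongrightarrow> s' (x - y)) (at 0)"
          using p[unfolded has_partial_def, rule_format, of "x - y"] unfolding DERIV_def
          by (simp add: q_def algebra_simps)
        then show ?thesis using R unfolding tendsto_at_iff_sequentially by (auto simp: o_def)
      qed
      then show "AE y in lebesgue_on B. (\<lambda>n. q (R n) y * h y) \<longlonglongrightarrow> s' (x - y) * h y"
        by (auto intro!: tendsto_intros)
    qed
    moreover have "(LINT y|lebesgue_on B. q r y * h y) = (mol B s h (x + r *\<^sub>R axis i 1) - mol B s h x) / r" for r
    proof -
      have "q r y * h y = (s (x + r *\<^sub>R axis i 1 - y) * h y - s (x - y) * h y) / r" for y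
        by (simp add: q_def left_diff_distrib)
      then show ?thesis by (simp add: mol_def Bochner_Integration.integral_diff[OF im im])
    qed
    ultimately show "((\<lambda>r. (mol B s h (x + r *\<^sub>R axis i 1) - mol B s h x) / r) \<circ> R) \<longlonglongrightarrow> mol B s' h x"
      by (simp add: o_def)
  qed
  then show "((\<lambda>r. mol B s h (x + r *\<^sub>R axis i 1)) has_real_derivative mol B s' h x) (at 0)"
    by (simp add: DERIV_def)
qed

section \<open>Mollification of square integrable functions evolving in time\<close>

lemma square_integrable_add:
  assumes "square_integrable_on f B" "square_integrable_on g B"
  shows "square_integrable_on (\<lambda>x. f x + g x) B"
  unfolding square_integrable_on_def
proof
  show m: "(\<lambda>x. f x + g x) \<in> borel_measurable (lebesgue_on B)"
    using assms unfolding square_integrable_on_def by (intro borel_measurable_add) auto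
  show "integrable (lebesgue_on B) (\<lambda>x. (f x + g x)\<^sup>2)"
  proof (rule Bochner_Integration.integrable_bound[of _ "\<lambda>x. 2 * (f x)\<^sup>2 + 2 * (g x)\<^sup>2"])
    show "integrable (lebesgue_on B) (\<lambda>x. 2 * (f x)\<^sup>2 + 2 * (g x)\<^sup>2)"
      using assms unfolding square_integrable_on_def by (intro Bochner_Integration.integrable_add integrable_mult_right) auto
    show "(\<lambda>x. (f x + g x)\<^sup>2) \<in> borel_measurable (lebesgue_on B)" using m by simp
    show "AE x in lebesgue_on B. norm ((f x + g x)\<^sup>2) \<le> norm (2 * (f x)\<^sup>2 + 2 * (g x)\<^sup>2)"
    proof (rule AE_I2)
      fix x
      have "0 \<le> (f x - g x)\<^sup>2" by simp
      then have "(f x + g x)\<^sup>2 \<le> 2 * (f x)\<^sup>2 + 2 * (g x)\<^sup>2"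
        by (simp add: power2_sum power2_diff)
      also have "\<dots> \<le> \<bar>2 * (f x)\<^sup>2 + 2 * (g x)\<^sup>2\<bar>" by (rule abs_ge_self)
      finally show "norm ((f x + g x)\<^sup>2) \<le> norm (2 * (f x)\<^sup>2 + 2 * (g x)\<^sup>2)"
        by (simp only: real_norm_def abs_power2)
    qed
  qed
qed

lemma square_integrable_cmult:
  "square_integrable_on f B \<Longrightarrow> square_integrable_on (\<lambda>x. c * f x) B"
  unfolding square_integrable_on_def by (auto simp: power_mult_distrib)

lemma square_integrable_diff:
  assumes "square_integrable_on f B" "square_integrable_on g B"
  shows "square_integrable_on (\<lambda>x. f x - g x) B"
  using square_integrable_add[OF assms(1) square_integrable_cmult[OF assms(2), of "-1"]] by simp

text \<open>Proved by Young's inequality with a free weight \<open>lam\<close> instead of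
  Cauchy-Schwarz. The constant is not sharp, but it only multiplies quantities that tend to
  0.\<close>

lemma square_integrable_L1:
  fixes g :: "real^'n \<Rightarrow> real"
  assumes B: "B \<in> lmeasurable" and g: "square_integrable_on g B"
  shows "integrable (lebesgue_on B) g"
    "(LINT x|lebesgue_on B. \<bar>g x\<bar>) \<le> norm_L2_on B g * (1 + measure (lebesgue_on B) B)"
proof -
  interpret finite_measure "lebesgue_on B" by (rule finite_measure_lebesgue_on[OF B])
  have m: "g \<in> borel_measurable (lebesgue_on B)" "integrable (lebesgue_on B) (\<lambda>x. (g x)\<^sup>2)"
    using g by (auto simp: square_integrable_on_def)
  have amgm: "\<bar>y\<bar> \<le> lam / 2 * y\<^sup>2 + 1 / (2 * lam)" if "lam > 0" for y lam :: real
  proof -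
    have "0 \<le> (lam * \<bar>y\<bar> - 1)\<^sup>2" by simp
    then have "2 * lam * \<bar>y\<bar> \<le> lam\<^sup>2 * y\<^sup>2 + 1" by (simp add: power2_diff power_mult_distrib algebra_simps)
    then show ?thesis using that by (simp add: field_simps power2_eq_square)
  qed
  show I: "integrable (lebesgue_on B) g"
  proof (rule Bochner_Integration.integrable_bound[of _ "\<lambda>x. 1 / 2 * (g x)\<^sup>2 + 1 / 2"])
    show "AE x in lebesgue_on B. norm (g x) \<le> norm (1 / 2 * (g x)\<^sup>2 + 1 / 2)"
    proof (rule AE_I2)
      fix x
      have "\<bar>g x\<bar> \<le> 1 / 2 * (g x)\<^sup>2 + 1 / 2" using amgm[of 1 "g x"] by simp
      also have "\<dots> \<le> \<bar>1 / 2 * (g x)\<^sup>2 + 1 / 2\<bar>" by (rule abs_ge_self)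
      finally show "norm (g x) \<le> norm (1 / 2 * (g x)\<^sup>2 + 1 / 2)" by (simp only: real_norm_def)
    qed
  qed (use m in auto)
  define N where "N = norm_L2_on B g"
  define v where "v = measure (lebesgue_on B) B"
  have v: "v \<ge> 0" by (simp add: v_def)
  have N: "N \<ge> 0" "N\<^sup>2 = (LINT x|lebesgue_on B. (g x)\<^sup>2)" by (auto simp: N_def norm_L2_on_def)
  have le: "(LINT x|lebesgue_on B. \<bar>g x\<bar>) \<le> lam / 2 * N\<^sup>2 + v / (2 * lam)" if "lam > 0" for lam
  proof -
    have "(LINT x|lebesgue_on B. \<bar>g x\<bar>) \<le> (LINT x|lebesgue_on B. lam / 2 * (g x)\<^sup>2 + 1 / (2 * lam))"
      using I m by (intro integral_mono amgm that Bochner_Integration.integrable_add integrable_mult_right integrable_abs) auto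
    also have "\<dots> = lam / 2 * N\<^sup>2 + v / (2 * lam)"
      using m by (simp add: N(2) v_def)
    finally show ?thesis .
  qed
  show "(LINT x|lebesgue_on B. \<bar>g x\<bar>) \<le> norm_L2_on B g * (1 + measure (lebesgue_on B) B)"
  proof (cases "N = 0")
    case False
    then have "N > 0" using N by simp
    have "(LINT x|lebesgue_on B. \<bar>g x\<bar>) \<le> N / 2 + v * N / 2"
      using le[of "1 / N"] \<open>N > 0\<close> by (simp add: power2_eq_square)
    also have "\<dots> = (N * (1 + v)) / 2" by (simp add: field_simps)
    also have "\<dots> \<le> N * (1 + v)"
    proof -
      have "0 \<le> N * (1 + v)" using \<open>N > 0\<close> v by (intro mult_nonneg_nonneg) auto
      then show ?thesis by simp
    qed
    finally show ?thesis by (simp add: N_def v_def)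
  next
    \<comment> \<open>For norm zero no finite weight is optimal, so arbitrarily large ones are
      taken.\<close>
    case True
    have "(LINT x|lebesgue_on B. \<bar>g x\<bar>) \<le> 0 + e" if "e > 0" for e
    proof -
      have "(LINT x|lebesgue_on B. \<bar>g x\<bar>) \<le> v / (2 * ((v + 1) / e))" using le[of "(v + 1) / e"] True that v by simp
      also have "\<dots> = e * (v / (2 * (v + 1)))" using that v by (simp add: field_simps)
      also have "\<dots> \<le> e * 1" using that v by (intro mult_left_mono) (auto simp: field_simps)
      finally show ?thesis by simp
    qed
    then have "(LINT x|lebesgue_on B. \<bar>g x\<bar>) \<le> 0" by (rule field_le_epsilon)
    then show ?thesis using True by (simp add: N_def)
  qed
qed

lemma L2_continuous_L1:
  assumes B: "B \<in> lmeasurable" and h: "L2_continuous I B h"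
  shows "L1_continuous I B h"
  unfolding L1_continuous_def
proof (intro conjI ballI)
  have sq: "square_integrable_on (h t) B" if "t \<in> I" for t using h that by (auto simp: L2_continuous_def)
  show "integrable (lebesgue_on B) (h t)" if "t \<in> I" for t by (rule square_integrable_L1(1)[OF B sq[OF that]])
  fix t assume t: "t \<in> I"
  have "((\<lambda>s. norm_L2_on B (\<lambda>x. h s x - h t x) * (1 + measure (lebesgue_on B) B)) \<longlongrightarrow> 0 * (1 + measure (lebesgue_on B) B)) (at t within I)"
    using h t unfolding L2_continuous_def by (intro tendsto_intros) auto
  then have lim: "((\<lambda>s. norm_L2_on B (\<lambda>x. h s x - h t x) * (1 + measure (lebesgue_on B) B)) \<longlongrightarrow> 0) (at t within I)" by simp
  show "((\<lambda>r. LINT x|lebesgue_on B. \<bar>h r x - h t x\<bar>) \<longlongrightarrow> 0) (at t within I)"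
  proof (rule Lim_null_comparison[OF _ lim])
    show "\<forall>\<^sub>F r in at t within I. norm (LINT x|lebesgue_on B. \<bar>h r x - h t x\<bar>) \<le> norm_L2_on B (\<lambda>x. h r x - h t x) * (1 + measure (lebesgue_on B) B)"
      unfolding eventually_at_filter
      by (intro always_eventually allI impI)
        (use square_integrable_L1(2)[OF B square_integrable_diff[OF sq sq[OF t]]] in \<open>simp add: integral_nonneg_AE\<close>)
  qed
qed

lemma L1_continuous_mult:
  fixes b :: "real^'n \<Rightarrow> real"
  assumes B: "B \<in> sets lebesgue" and b: "continuous_on UNIV b" "\<And>x. \<bar>b x\<bar> \<le> C" and h: "L1_continuous I B h"
  shows "L1_continuous I B (\<lambda>t x. b x * h t x)"
  unfolding L1_continuous_def
proof (intro conjI ballI)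
  have ih: "integrable (lebesgue_on B) (h t)" if "t \<in> I" for t using h that by (auto simp: L1_continuous_def)
  have bm: "b \<in> borel_measurable (lebesgue_on B)"
    by (rule continuous_imp_measurable_on_sets_lebesgue[OF _ B]) (rule continuous_on_subset[OF b(1)], simp)
  have prod: "integrable (lebesgue_on B) (\<lambda>x. b x * g x)" if "integrable (lebesgue_on B) g" for g
  proof (rule Bochner_Integration.integrable_bound[of _ "\<lambda>y. C * g y"])
    show "AE y in lebesgue_on B. norm (b y * g y) \<le> norm (C * g y)"
      using order_trans[OF b(2) abs_ge_self] by (simp add: abs_mult mult_right_mono)
  qed (use that bm in auto)
  show "integrable (lebesgue_on B) (\<lambda>x. b x * h t x)" if "t \<in> I" for t by (rule prod[OF ih[OF that]])
  fix t assume t: "t \<in> I"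
  have "((\<lambda>r. C * (LINT x|lebesgue_on B. \<bar>h r x - h t x\<bar>)) \<longlongrightarrow> C * 0) (at t within I)"
    using h t unfolding L1_continuous_def by (intro tendsto_intros) auto
  then have lim: "((\<lambda>r. C * (LINT x|lebesgue_on B. \<bar>h r x - h t x\<bar>)) \<longlongrightarrow> 0) (at t within I)" by simp
  show "((\<lambda>r. LINT x|lebesgue_on B. \<bar>b x * h r x - b x * h t x\<bar>) \<longlongrightarrow> 0) (at t within I)"
  proof (rule Lim_null_comparison[OF _ lim])
    have "norm (LINT x|lebesgue_on B. \<bar>b x * h r x - b x * h t x\<bar>) \<le> C * (LINT x|lebesgue_on B. \<bar>h r x - h t x\<bar>)" if r: "r \<in> I" for r
    proof -
      have d: "integrable (lebesgue_on B) (\<lambda>x. h r x - h t x)" by (intro Bochner_Integration.integrable_diff ih r t)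
      have "(LINT x|lebesgue_on B. \<bar>b x * (h r x - h t x)\<bar>) \<le> (LINT x|lebesgue_on B. C * \<bar>h r x - h t x\<bar>)"
        using b(2) by (intro integral_mono integrable_abs prod d integrable_mult_right) (simp add: abs_mult mult_right_mono)
      then show ?thesis by (simp add: right_diff_distrib integral_nonneg_AE)
    qed
    then show "\<forall>\<^sub>F r in at t within I. norm (LINT x|lebesgue_on B. \<bar>b x * h r x - b x * h t x\<bar>) \<le> C * (LINT x|lebesgue_on B. \<bar>h r x - h t x\<bar>)"
      unfolding eventually_at_filter by (intro always_eventually) simp
  qed
qed

lemma L1_continuous_abs:
  assumes h: "L1_continuous I B h"
  shows "L1_continuous I B (\<lambda>t x. \<bar>h t x\<bar>)"
  unfolding L1_continuous_def
proof (intro conjI ballI)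
  have ih: "integrable (lebesgue_on B) (h t)" if "t \<in> I" for t using h that by (auto simp: L1_continuous_def)
  then show "integrable (lebesgue_on B) (\<lambda>x. \<bar>h t x\<bar>)" if "t \<in> I" for t using that by simp
  fix t assume t: "t \<in> I"
  show "((\<lambda>r. LINT x|lebesgue_on B. \<bar>\<bar>h r x\<bar> - \<bar>h t x\<bar>\<bar>) \<longlongrightarrow> 0) (at t within I)"
  proof (rule Lim_null_comparison)
    show "((\<lambda>r. LINT x|lebesgue_on B. \<bar>h r x - h t x\<bar>) \<longlongrightarrow> 0) (at t within I)"
      using h t by (simp add: L1_continuous_def)
    have "norm (LINT x|lebesgue_on B. \<bar>\<bar>h r x\<bar> - \<bar>h t x\<bar>\<bar>) \<le> (LINT x|lebesgue_on B. \<bar>h r x - h t x\<bar>)" if r: "r \<in> I" for r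
    proof -
      have "(LINT x|lebesgue_on B. \<bar>\<bar>h r x\<bar> - \<bar>h t x\<bar>\<bar>) \<le> (LINT x|lebesgue_on B. \<bar>h r x - h t x\<bar>)"
        by (intro integral_mono integrable_abs Bochner_Integration.integrable_diff ih r t abs_triangle_ineq3)
      then show ?thesis by (simp add: integral_nonneg_AE)
    qed
    then show "\<forall>\<^sub>F r in at t within I. norm (LINT x|lebesgue_on B. \<bar>\<bar>h r x\<bar> - \<bar>h t x\<bar>\<bar>) \<le> (LINT x|lebesgue_on B. \<bar>h r x - h t x\<bar>)"
      unfolding eventually_at_filter by (intro always_eventually) simp
  qed
qed

text \<open>Evaluation of the mollification at a point is a bounded linear functional on the square
  integrable functions, so it commutes with the strong time derivative.\<close>

lemma mol_time_derivative:
  fixes s :: "real^'n \<Rightarrow> real"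
  assumes s: "continuous_on UNIV s" "\<And>z. \<bar>s z\<bar> \<le> C" and B: "B \<in> lmeasurable"
    and UV: "has_L2_derivative I B U V" and t: "t \<in> I"
  shows "((\<lambda>t. mol B s (U t) x) has_real_derivative mol B s (V t) x) (at t within I)"
proof -
  have Bs: "B \<in> sets lebesgue" using B by (rule fmeasurableD)
  have C: "C \<ge> 0" using s(2)[of 0] by linarith
  have sq: "square_integrable_on (U r) B" "square_integrable_on (V r) B" if "r \<in> I" for r
    using UV that by (auto simp: has_L2_derivative_def)
  define v where "v = 1 + measure (lebesgue_on B) B"
  define D where "D r x = (U r x - U t x) / (r - t) - V t x" for r x
  have lim: "((\<lambda>r. C * (norm_L2_on B (D r) * v)) \<longlongrightarrow> 0) (at t within I)"
  proof -
    have "((\<lambda>r. norm_L2_on B (D r)) \<longlongrightarrow> 0) (at t within I)"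
      using UV t by (simp add: has_L2_derivative_def D_def[abs_def])
    then have "((\<lambda>r. C * (norm_L2_on B (D r) * v)) \<longlongrightarrow> C * (0 * v)) (at t within I)" by (intro tendsto_intros)
    then show ?thesis by simp
  qed
  have "((\<lambda>r. (mol B s (U r) x - mol B s (U t) x) / (r - t) - mol B s (V t) x) \<longlongrightarrow> 0) (at t within I)"
  proof (rule Lim_null_comparison[OF _ lim])
    have "norm ((mol B s (U r) x - mol B s (U t) x) / (r - t) - mol B s (V t) x) \<le> C * (norm_L2_on B (D r) * v)"
      if r: "r \<in> I" "r \<noteq> t" for r
    proof -
      have D: "D r = (\<lambda>x. (1 / (r - t)) * (U r x - U t x) - V t x)" by (simp add: D_def fun_eq_iff)
      have sd: "square_integrable_on (\<lambda>x. (1 / (r - t)) * (U r x - U t x)) B"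
        by (intro square_integrable_cmult square_integrable_diff sq r t)
      have sD: "square_integrable_on (D r) B" unfolding D by (intro square_integrable_diff sd sq t)
      note L = square_integrable_L1(1)[OF B]
      have "mol B s (D r) x = (mol B s (U r) x - mol B s (U t) x) / (r - t) - mol B s (V t) x"
        unfolding D mol_diff[OF s Bs L[OF sd] L[OF sq(2)[OF t]]] mol_cmult
          mol_diff[OF s Bs L[OF sq(1)[OF r(1)]] L[OF sq(1)[OF t]]] by simp
      then have "norm ((mol B s (U r) x - mol B s (U t) x) / (r - t) - mol B s (V t) x) \<le> C * (LINT y|lebesgue_on B. \<bar>D r y\<bar>)"
        using mol_bound[OF s Bs L[OF sD], of x] by simp
      also have "\<dots> \<le> C * (norm_L2_on B (D r) * v)"
        unfolding v_def by (intro mult_left_mono square_integrable_L1(2)[OF B sD] C)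
      finally show ?thesis .
    qed
    then show "\<forall>\<^sub>F r in at t within I. norm ((mol B s (U r) x - mol B s (U t) x) / (r - t) - mol B s (V t) x) \<le> C * (norm_L2_on B (D r) * v)"
      unfolding eventually_at_filter by (intro always_eventually) simp
  qed
  then show ?thesis unfolding has_field_derivative_iff by (rule LIM_zero_cancel)
qed

text \<open>Moves the mollifier from \<open>h\<close> to the weight \<open>k\<close>, which is once
  the indicator of a box and once a spatial kernel. The integrand is dominated by a product of an
  indicator and \<open>\<bar>h\<bar>\<close>.\<close>

lemma mol_fubini:
  fixes s :: "real^'n \<Rightarrow> real"
  assumes s: "continuous_on UNIV s" "\<And>z. \<bar>s z\<bar> \<le> C" and B: "B \<in> lmeasurable"
    and h: "integrable (lebesgue_on B) h"
    and k: "k \<in> borel_measurable borel" "\<And>x. \<bar>k x\<bar> \<le> D" "\<And>x. x \<notin> cbox p r \<Longrightarrow> k x = 0"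
  shows "(LINT x|lborel. k x * mol B s h x) = (LINT y|lebesgue_on B. h y * (LINT x|lborel. k x * s (x - y)))"
proof -
  interpret F: finite_measure "lebesgue_on B" by (rule finite_measure_lebesgue_on[OF B])
  interpret P: pair_sigma_finite "lborel :: (real^'n) measure" "lebesgue_on B" ..
  have C: "C \<ge> 0" using s(2)[of 0] by linarith
  have D: "D \<ge> 0" using k(2)[of 0] by linarith
  have idm: "(\<lambda>y. y) \<in> borel_measurable (lebesgue_on B)"
    using id_borel_measurable_lebesgue_on[of B] by (simp add: id_def)
  define f where "f = (\<lambda>(x, y). k x * (s (x - y) * h y))"
  have hm: "h \<in> borel_measurable (lebesgue_on B)" using h by auto
  have sm: "s \<in> borel_measurable borel" by (rule borel_measurable_continuous_onI[OF s(1)])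
  have fm: "f \<in> borel_measurable (lborel \<Otimes>\<^sub>M lebesgue_on B)"
  proof -
    have 1: "(\<lambda>z. k (fst z)) \<in> borel_measurable (lborel \<Otimes>\<^sub>M lebesgue_on B)"
      by (rule measurable_compose[OF measurable_fst]) (use k(1) in simp)
    have 2: "(\<lambda>z. h (snd z)) \<in> borel_measurable (lborel \<Otimes>\<^sub>M lebesgue_on B)"
      by (rule measurable_compose[OF measurable_snd hm])
    have "(\<lambda>z. fst z - snd z) \<in> borel_measurable (lborel \<Otimes>\<^sub>M lebesgue_on B)"
    proof (rule borel_measurable_diff)
      show "fst \<in> borel_measurable (lborel \<Otimes>\<^sub>M lebesgue_on B)"
        using measurable_fst[of lborel "lebesgue_on B"] by (simp add: measurable_lborel2 cong: measurable_cong_sets)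
      show "snd \<in> borel_measurable (lborel \<Otimes>\<^sub>M lebesgue_on B)"
        by (rule measurable_compose[OF measurable_snd idm])
    qed
    from measurable_compose[OF this sm] 1 2 show ?thesis unfolding f_def split_beta by (intro borel_measurable_times)
  qed
  have ib: "integrable lborel (indicator (cbox p r) :: real^'n \<Rightarrow> real)"
    using borel_integrable_compact[of "cbox p r" "\<lambda>_. 1::real"] by simp
  have "integrable (lborel \<Otimes>\<^sub>M lebesgue_on B) (\<lambda>(x, y). (D * C) * (indicator (cbox p r) x * \<bar>h y\<bar>))"
  proof (rule P.Fubini_integrable)
    show "(\<lambda>(x, y). (D * C) * (indicator (cbox p r) x * \<bar>h y\<bar>)) \<in> borel_measurable (lborel \<Otimes>\<^sub>M lebesgue_on B)"
    proof -
      have 1: "(\<lambda>z. indicator (cbox p r) (fst z) :: real) \<in> borel_measurable (lborel \<Otimes>\<^sub>M lebesgue_on B)"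
        by (rule measurable_compose[OF measurable_fst]) simp
      have 2: "(\<lambda>z. \<bar>h (snd z)\<bar>) \<in> borel_measurable (lborel \<Otimes>\<^sub>M lebesgue_on B)"
        by (rule measurable_compose[OF measurable_snd]) (use hm in simp)
      show ?thesis unfolding split_beta by (intro borel_measurable_times borel_measurable_const 1 2)
    qed
    have "integrable lborel (\<lambda>x. indicator (cbox p r) x * (D * C * (LINT y|lebesgue_on B. \<bar>h y\<bar>)))"
      by (intro integrable_mult_left ib)
    then show "integrable lborel (\<lambda>x. LINT y|lebesgue_on B. norm (case (x, y) of (x, y) \<Rightarrow> (D * C) * (indicator (cbox p r) x * \<bar>h y\<bar>)))"
      using C D by (simp add: abs_mult mult_ac)
    show "AE x in lborel. integrable (lebesgue_on B) (\<lambda>y. case (x, y) of (x, y) \<Rightarrow> (D * C) * (indicator (cbox p r) x * \<bar>h y\<bar>))"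
      using h by simp
  qed
  then have fi: "integrable (lborel \<Otimes>\<^sub>M lebesgue_on B) f"
  proof (rule Bochner_Integration.integrable_bound[OF _ fm])
    have "norm (f z) \<le> norm (case z of (x, y) \<Rightarrow> (D * C) * (indicator (cbox p r) x * \<bar>h y\<bar>))" for z
    proof (cases z)
      case (Pair x y)
      show ?thesis
      proof (cases "x \<in> cbox p r")
        case True
        have "\<bar>k x\<bar> * (\<bar>s (x - y)\<bar> * \<bar>h y\<bar>) \<le> D * (C * \<bar>h y\<bar>)"
          using k(2) s(2) C D by (intro mult_mono) auto
        then show ?thesis using True C D Pair by (simp add: f_def abs_mult mult.assoc)
      qed (simp add: f_def Pair k(3))
    qed
    then show "AE z in lborel \<Otimes>\<^sub>M lebesgue_on B. norm (f z) \<le> norm (case z of (x, y) \<Rightarrow> (D * C) * (indicator (cbox p r) x * \<bar>h y\<bar>))"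
      by simp
  qed
  have "(LINT x|lborel. k x * mol B s h x) = (LINT x|lborel. LINT y|lebesgue_on B. k x * (s (x - y) * h y))"
    by (simp add: mol_def)
  also have "\<dots> = (LINT y|lebesgue_on B. LINT x|lborel. k x * (s (x - y) * h y))"
    using P.Fubini_integral[of "\<lambda>x y. k x * (s (x - y) * h y)"] fi by (simp add: f_def)
  also have "\<dots> = (LINT y|lebesgue_on B. h y * (LINT x|lborel. k x * s (x - y)))"
  proof -
    have "(LINT x|lborel. k x * (s (x - y) * h y)) = h y * (LINT x|lborel. k x * s (x - y))" for y
    proof -
      have "(\<lambda>x. k x * (s (x - y) * h y)) = (\<lambda>x. h y * (k x * s (x - y)))" by (simp add: mult_ac)
      then show ?thesis by (simp only: integral_mult_right_zero)
    qed
    then show ?thesis by simp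
  qed
  finally show ?thesis .
qed

text \<open>The reflected mollifier centred at \<open>x\<close> is itself a test function supported
  in \<open>B\<close>, so testing the weak Laplacian with it is differentiation of the
  mollification.\<close>

lemma mol_weak_laplacian:
  fixes s :: "real^'n \<Rightarrow> real"
  assumes s: "smooth (\<lambda>y. s (x - y))" and D: "\<And>i. has_partial i s (D1 i)" "\<And>i. has_partial i (D1 i) (D2 i)"
    and B: "B \<in> sets lebesgue" and supp: "\<And>y. y \<notin> B \<Longrightarrow> s (x - y) = 0 \<and> (\<forall>i. D2 i (x - y) = 0)"
    and bd: "B \<subseteq> cbox p r"
    and w: "has_weak_laplacian f g"
  shows "mol B (\<lambda>z. \<Sum>i\<in>UNIV. D2 i z) f x = mol B s g x"
proof -
  have "test_function (\<lambda>y. s (x - y))"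
    by (rule test_functionI[OF s, of p r]) (use supp bd in blast)
  then have "(LINT y|lebesgue. f y * laplacian (\<lambda>y. s (x - y)) y) = (LINT y|lebesgue. g y * s (x - y))"
    using w by (simp add: has_weak_laplacian_def)
  moreover have "(LINT y|lebesgue. F y) = (LINT y|lebesgue_on B. F y)" if "\<And>y. y \<notin> B \<Longrightarrow> F y = 0" for F :: "real^'n \<Rightarrow> real"
  proof -
    have "(\<lambda>y. indicator B y *\<^sub>R F y) = F" by (rule ext) (use that in \<open>auto simp: indicator_def\<close>)
    then show ?thesis using integral_restrict_space[of B lebesgue F] B by simp
  qed
  ultimately show ?thesis
    using supp by (simp add: laplacian_reflected[OF s D] mol_def mult.commute)
qed

text \<open>Mollification fails to commute with the coefficient only by its oscillation \<omega> on
  the support of the kernel, small for small widths. This replaces regularity of the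
  solution.\<close>

lemma mol_commutator:
  fixes s b :: "real^'n \<Rightarrow> real"
  assumes s: "continuous_on UNIV s" "\<And>z. \<bar>s z\<bar> \<le> C" "\<And>z. 0 \<le> s z" and B: "B \<in> sets lebesgue"
    and h: "integrable (lebesgue_on B) h" "integrable (lebesgue_on B) (\<lambda>y. b y * h y)"
    and osc: "\<And>y. s (x - y) \<noteq> 0 \<Longrightarrow> \<bar>b x - b y\<bar> \<le> \<omega>"
  shows "\<bar>b x * mol B s h x - mol B s (\<lambda>y. b y * h y) x\<bar> \<le> \<omega> * mol B s (\<lambda>y. \<bar>h y\<bar>) x"
proof -
  note i = mol_integrable[OF s(1,2) B]
  have e: "b x * mol B s h x - mol B s (\<lambda>y. b y * h y) x = (LINT y|lebesgue_on B. (b x - b y) * (s (x - y) * h y))"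
  proof -
    have "b x * mol B s h x - mol B s (\<lambda>y. b y * h y) x =
        (LINT y|lebesgue_on B. b x * (s (x - y) * h y)) - (LINT y|lebesgue_on B. s (x - y) * (b y * h y))"
      by (simp add: mol_def)
    also have "\<dots> = (LINT y|lebesgue_on B. b x * (s (x - y) * h y) - s (x - y) * (b y * h y))"
      by (intro Bochner_Integration.integral_diff[symmetric] integrable_mult_right i h)
    finally show ?thesis by (simp add: algebra_simps)
  qed
  have ie: "integrable (lebesgue_on B) (\<lambda>y. (b x - b y) * (s (x - y) * h y))"
  proof -
    have "integrable (lebesgue_on B) (\<lambda>y. b x * (s (x - y) * h y) - s (x - y) * (b y * h y))"
      by (intro Bochner_Integration.integrable_diff integrable_mult_right i h)
    then show ?thesis by (simp add: algebra_simps)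
  qed
  have "\<bar>b x * mol B s h x - mol B s (\<lambda>y. b y * h y) x\<bar> \<le> (LINT y|lebesgue_on B. \<bar>(b x - b y) * (s (x - y) * h y)\<bar>)"
    unfolding e by (rule Bochner_Integration.integral_abs_bound)
  also have "\<dots> \<le> (LINT y|lebesgue_on B. \<omega> * (s (x - y) * \<bar>h y\<bar>))"
  proof (rule integral_mono)
    show "integrable (lebesgue_on B) (\<lambda>y. \<omega> * (s (x - y) * \<bar>h y\<bar>))"
      using h by (intro integrable_mult_right i) auto
    fix y
    have "\<bar>b x - b y\<bar> * (s (x - y) * \<bar>h y\<bar>) \<le> \<omega> * (s (x - y) * \<bar>h y\<bar>)"
      using osc[of y] s(3)[of "x - y"] by (cases "s (x - y) = 0") (auto intro!: mult_right_mono)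
    then show "\<bar>(b x - b y) * (s (x - y) * h y)\<bar> \<le> \<omega> * (s (x - y) * \<bar>h y\<bar>)"
      using s(3) by (simp add: abs_mult)
  qed (use ie in simp)
  also have "\<dots> = \<omega> * mol B s (\<lambda>y. \<bar>h y\<bar>) x" by (simp add: mol_def)
  finally show ?thesis .
qed

text \<open>Jensen's inequality, obtained by expanding the nonnegative integral of s (|h| - m)^2
  with m the mollified value. Mass at most 1 suffices, so it also holds near the faces of
  \<open>B\<close>.\<close>

lemma mol_abs_square_le:
  fixes s :: "real^'n \<Rightarrow> real"
  assumes s: "continuous_on UNIV s" "\<And>z. \<bar>s z\<bar> \<le> C" "\<And>z. 0 \<le> s z" and B: "B \<in> lmeasurable"
    and mass: "(LINT y|lebesgue_on B. s (x - y)) \<le> 1"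
    and h: "square_integrable_on h B"
  shows "(mol B s (\<lambda>y. \<bar>h y\<bar>) x)\<^sup>2 \<le> mol B s (\<lambda>y. (h y)\<^sup>2) x"
proof -
  interpret F: finite_measure "lebesgue_on B" by (rule finite_measure_lebesgue_on[OF B])
  have Bs: "B \<in> sets lebesgue" using B by (rule fmeasurableD)
  note i = mol_integrable[OF s(1,2) Bs]
  have h1: "integrable (lebesgue_on B) (\<lambda>y. \<bar>h y\<bar>)" using square_integrable_L1(1)[OF B h] by simp
  have h2: "integrable (lebesgue_on B) (\<lambda>y. (h y)\<^sup>2)" using h by (simp add: square_integrable_on_def)
  have i1: "integrable (lebesgue_on B) (\<lambda>y. s (x - y))" using i[of "\<lambda>_. 1" x] by simp
  define m where "m = mol B s (\<lambda>y. \<bar>h y\<bar>) x"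
  have m0: "m \<ge> 0" unfolding m_def mol_def using s(3) by (intro integral_nonneg_AE) auto
  have "0 \<le> (LINT y|lebesgue_on B. s (x - y) * (\<bar>h y\<bar> - m)\<^sup>2)"
    using s(3) by (intro integral_nonneg_AE) auto
  also have "\<dots> = (LINT y|lebesgue_on B. s (x - y) * (h y)\<^sup>2 - 2 * m * (s (x - y) * \<bar>h y\<bar>) + m\<^sup>2 * s (x - y))"
    by (simp add: power2_diff algebra_simps)
  also have "\<dots> = mol B s (\<lambda>y. (h y)\<^sup>2) x - 2 * m * m + m\<^sup>2 * (LINT y|lebesgue_on B. s (x - y))"
    using i[OF h1, of x] i[OF h2, of x] i1 by (simp add: m_def mol_def)
  also have "\<dots> \<le> mol B s (\<lambda>y. (h y)\<^sup>2) x - 2 * m * m + m\<^sup>2 * 1"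
    using mass by (intro add_left_mono mult_left_mono) auto
  finally show ?thesis by (simp add: m_def[symmetric] power2_eq_square)
qed

section \<open>Chains of time antiderivatives\<close>

text \<open>\<open>p j\<close> prescribes the value at time 0 of the antiderivative of order j > 0.
  The same recursion with differentiated data \<open>p1\<close>, \<open>g1\<close> or
  \<open>p2\<close>, \<open>g2\<close> gives the spatial derivatives of the chain.\<close>

fun chain :: "(nat \<Rightarrow> real^'n \<Rightarrow> real) \<Rightarrow> (real \<Rightarrow> real^'n \<Rightarrow> real) \<Rightarrow> nat \<Rightarrow> real \<Rightarrow> real^'n \<Rightarrow> real" where
  "chain p g 0 = g"
| "chain p g (Suc j) = (\<lambda>t x. p (Suc j) x + integral {0..t} (\<lambda>r. chain p g j r x))"

lemma jointly_continuous_integral: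
  fixes G :: "real \<Rightarrow> real^'n \<Rightarrow> real"
  assumes G: "jointly_continuous T G"
  shows "jointly_continuous T (\<lambda>t x. integral {0..t} (\<lambda>r. G r x))"
proof -
  \<comment> \<open>The substitution r = t \<sigma> fixes the interval of integration, so that
    continuity in a parameter yields joint continuity in t and x.\<close>
  have "integral {0..t} (\<lambda>r. G r x) = t * integral (cbox 0 1) (\<lambda>\<sigma>. G (t * \<sigma>) x)" if t: "t \<in> {0..T}" for t x
  proof (cases "t = 0")
    case False
    then have t0: "t > 0" using t by simp
    have "(\<lambda>r. G r x) integrable_on {0..t}"
      by (rule integrable_continuous_interval, rule continuous_on_subset[OF jointly_continuous_time[OF G]]) (use t in auto)
    then have "((\<lambda>r. G r x) has_integral integral {0..t} (\<lambda>r. G r x)) (cbox 0 t)" by (simp add: has_integral_integral)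
    from has_integral_affinity'[OF this t0, of 0] t0
    have "((\<lambda>\<sigma>. G (t * \<sigma>) x) has_integral integral {0..t} (\<lambda>r. G r x) / t) (cbox 0 1)"
      by (simp add: divide_inverse mult.commute)
    then have "integral (cbox 0 1) (\<lambda>\<sigma>. G (t * \<sigma>) x) = integral {0..t} (\<lambda>r. G r x) / t" by (rule integral_unique)
    then show ?thesis using t0 by simp
  qed simp
  note e = this
  have "continuous_on ({0..T} \<times> UNIV) (\<lambda>p. fst p * integral (cbox 0 1) (\<lambda>\<sigma>. G (fst p * \<sigma>) (snd p)))"
  proof (intro continuous_on_mult continuous_on_fst continuous_on_id integral_continuous_on_param)
    have "continuous_on (({0..T} \<times> UNIV) \<times> cbox 0 1) (\<lambda>q. (\<lambda>p. G (fst p) (snd p)) (fst (fst q) * snd q, snd (fst q)))"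
      by (rule continuous_on_compose2[OF G[unfolded jointly_continuous_def]])
        (auto intro!: continuous_intros intro: order_trans[OF mult_left_le])
    then show "continuous_on (({0..T} \<times> UNIV) \<times> cbox 0 1) (\<lambda>(p, \<sigma>). G (fst p * \<sigma>) (snd p))"
      by (simp add: split_beta)
  qed
  then show ?thesis unfolding jointly_continuous_def
    by (rule continuous_on_eq) (auto simp: e)
qed

lemma integral_time_derivative:
  assumes G: "jointly_continuous T G" and t: "t \<in> {0..T}"
  shows "((\<lambda>t. integral {0..t} (\<lambda>r. G r x)) has_real_derivative G t x) (at t within {0..T})"
  by (rule integral_has_real_derivative[OF jointly_continuous_time[OF G] t])

lemma integral_has_partial:
  fixes G :: "real \<Rightarrow> real^'n \<Rightarrow> real"
  assumes G: "jointly_continuous T G" "jointly_continuous T G'"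
    and p: "\<And>t. t \<in> {0..T} \<Longrightarrow> has_partial i (G t) (G' t)" and t: "t \<in> {0..T}"
  shows "has_partial i (\<lambda>x. integral {0..t} (\<lambda>r. G r x)) (\<lambda>x. integral {0..t} (\<lambda>r. G' r x))"
  unfolding has_partial_def
proof
  fix x
  have "((\<lambda>s. integral (cbox 0 t) (\<lambda>r. G r (x + s *\<^sub>R axis i 1))) has_real_derivative
      integral (cbox 0 t) (\<lambda>r. G' r (x + 0 *\<^sub>R axis i 1))) (at 0 within UNIV)"
  proof (rule leibniz_rule_field_derivative[where fx = "\<lambda>s r. G' r (x + s *\<^sub>R axis i 1)"])
    show "((\<lambda>s. G r (x + s *\<^sub>R axis i 1)) has_real_derivative G' r (x + s *\<^sub>R axis i 1)) (at s within UNIV)"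
      if "r \<in> cbox 0 t" for s r
      using has_partial_at[OF p[of r]] that t by auto
    show "(\<lambda>r. G r (x + s *\<^sub>R axis i 1)) integrable_on cbox 0 t" for s
      by (rule integrable_continuous, rule continuous_on_subset[OF jointly_continuous_time[OF G(1)]]) (use t in auto)
    have "continuous_on (UNIV \<times> cbox 0 t) (\<lambda>q. (\<lambda>p. G' (fst p) (snd p)) (snd q, x + fst q *\<^sub>R axis i 1))"
      by (rule continuous_on_compose2[OF G(2)[unfolded jointly_continuous_def]])
        (use t in \<open>auto intro!: continuous_intros\<close>)
    then show "continuous_on (UNIV \<times> cbox 0 t) (\<lambda>(s, r). G' r (x + s *\<^sub>R axis i 1))" by (simp add: split_beta)
  qed auto
  then show "((\<lambda>s. integral {0..t} (\<lambda>r. G r (x + s *\<^sub>R axis i 1))) has_real_derivative integral {0..t} (\<lambda>r. G' r x)) (at 0)"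
    by simp
qed

lemma jointly_continuous_add:
  "jointly_continuous T f \<Longrightarrow> jointly_continuous T g \<Longrightarrow> jointly_continuous T (\<lambda>t x. f t x + g t x)"
  unfolding jointly_continuous_def by (rule continuous_on_add)

lemma has_partial_add:
  assumes "has_partial i f f'" "has_partial i g g'"
  shows "has_partial i (\<lambda>x. f x + g x) (\<lambda>x. f' x + g' x)"
  using assms unfolding has_partial_def by (auto intro!: DERIV_add)

lemma chain_jointly_continuous:
  assumes "\<And>j. continuous_on UNIV (p j)" "jointly_continuous T g"
  shows "jointly_continuous T (chain p g j)"
  using assms
  by (induction j) (auto intro!: jointly_continuous_add jointly_continuous_const jointly_continuous_integral)

lemma chain_time_derivative:
  assumes "\<And>j. continuous_on UNIV (p j)" "jointly_continuous T g" "t \<in> {0..T}"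
  shows "((\<lambda>t. chain p g (Suc j) t x) has_real_derivative chain p g j t x) (at t within {0..T})"
  using integral_time_derivative[where x = x, OF chain_jointly_continuous[where j = j, OF assms(1,2)] assms(3)]
  by (auto intro!: derivative_eq_intros)

lemma chain_has_partial:
  assumes p: "\<And>j. continuous_on UNIV (p j)" "\<And>j. continuous_on UNIV (p' j)" "\<And>j. has_partial i (p j) (p' j)"
    and g: "jointly_continuous T g" "jointly_continuous T g'" "\<And>t. t \<in> {0..T} \<Longrightarrow> has_partial i (g t) (g' t)"
    and t: "t \<in> {0..T}"
  shows "has_partial i (chain p g j t) (chain p' g' j t)"
  using t
proof (induction j arbitrary: t)
  case (Suc j)
  then show ?case
    by (auto intro!: has_partial_add p integral_has_partial chain_jointly_continuous g)
qed (use g in auto)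

text \<open>Order j is the second time derivative of order j + 2, so this is the defect of order j +
  2 in the wave equation b \<partial>_t^2 = \<triangle>.\<close>

definition residual :: "(real^'n \<Rightarrow> real) \<Rightarrow> (nat \<Rightarrow> real^'n \<Rightarrow> real) \<Rightarrow> (real \<Rightarrow> real^'n \<Rightarrow> real) \<Rightarrow>
    ('n \<Rightarrow> nat \<Rightarrow> real^'n \<Rightarrow> real) \<Rightarrow> ('n \<Rightarrow> real \<Rightarrow> real^'n \<Rightarrow> real) \<Rightarrow> nat \<Rightarrow> real \<Rightarrow> real^'n \<Rightarrow> real" where
  "residual b p g p2 g2 j t x = b x * chain p g j t x - (\<Sum>i\<in>UNIV. chain (p2 i) (g2 i) (j + 2) t x)"

text \<open>Defects are integrated along with the chain; each integration adds the defect of the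
  initial values, which the corrector equations make small.\<close>

lemma residual_Suc:
  assumes p: "\<And>j. continuous_on UNIV (p j)" "\<And>i j. continuous_on UNIV (p2 i j)"
    and g: "jointly_continuous T g" "\<And>i. jointly_continuous T (g2 i)" and t: "t \<in> {0..T}"
  shows "residual b p g p2 g2 (Suc j) t x =
    b x * p (Suc j) x - (\<Sum>i\<in>UNIV. p2 i (j + 3) x) + integral {0..t} (\<lambda>r. residual b p g p2 g2 j r x)"
proof -
  have i1: "(\<lambda>r. chain p g j r x) integrable_on {0..t}"
    "(\<lambda>r. chain (p2 i) (g2 i) k r x) integrable_on {0..t}" for i k
    by (rule integrable_continuous_interval, rule continuous_on_subset[OF jointly_continuous_time[OF chain_jointly_continuous]];
      use p g t in auto)+
  have "integral {0..t} (\<lambda>r. residual b p g p2 g2 j r x) =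
    integral {0..t} (\<lambda>r. b x * chain p g j r x) - integral {0..t} (\<lambda>r. \<Sum>i\<in>UNIV. chain (p2 i) (g2 i) (j + 2) r x)"
    unfolding residual_def
    by (intro Henstock_Kurzweil_Integration.integral_diff integrable_on_mult_right integrable_sum i1) auto
  also have "integral {0..t} (\<lambda>r. \<Sum>i\<in>UNIV. chain (p2 i) (g2 i) (j + 2) r x) =
     (\<Sum>i\<in>UNIV. integral {0..t} (\<lambda>r. chain (p2 i) (g2 i) (j + 2) r x))"
    by (intro integral_sum i1) auto
  finally have e: "integral {0..t} (\<lambda>r. residual b p g p2 g2 j r x) =
     b x * integral {0..t} (\<lambda>r. chain p g j r x) - (\<Sum>i\<in>UNIV. integral {0..t} (\<lambda>r. chain (p2 i) (g2 i) (j + 2) r x))"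
    by simp
  have s3: "chain (p2 i) (g2 i) (Suc j + 2) t x = p2 i (j + 3) x + integral {0..t} (\<lambda>r. chain (p2 i) (g2 i) (j + 2) r x)" for i
    by (simp add: eval_nat_numeral)
  show ?thesis unfolding e unfolding residual_def s3 sum.distrib by (simp add: algebra_simps)
qed

text \<open>The first integration turns the time dependent bound N into its time integral; from then
  on the bound is uniform in time and integrations only produce powers of T. The recursive constant
  may be large, but it multiplies \<omega> and d, both chosen after it.\<close>

lemma residual_bound:
  assumes p: "\<And>j. continuous_on UNIV (p j)" "\<And>i j. continuous_on UNIV (p2 i j)"
    and g: "jointly_continuous T g" "\<And>i. jointly_continuous T (g2 i)"
    and b: "continuous_on UNIV b"
    and N: "jointly_continuous T N" "\<And>t. t \<in> {0..T} \<Longrightarrow> 0 \<le> N t x" and T: "T > 0"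
    and pos: "0 \<le> \<omega>" "0 \<le> d"
    and r0: "\<And>t. t \<in> {0..T} \<Longrightarrow> \<bar>residual b p g p2 g2 0 t x\<bar> \<le> \<omega> * N t x + d"
    and pj: "\<And>j. \<bar>b x * p (Suc j) x - (\<Sum>i\<in>UNIV. p2 i (j + 3) x)\<bar> \<le> P j * d" "\<And>j. 0 \<le> P j"
    and t: "t \<in> {0..T}"
  shows "\<bar>residual b p g p2 g2 (Suc j) t x\<bar> \<le>
    rec_nat (P 0 + 1 + T) (\<lambda>j K. P (Suc j) + T * K) j * (\<omega> * integral {0..T} (\<lambda>r. N r x) + d)"
proof -
  define K where "K = rec_nat (P 0 + 1 + T) (\<lambda>j K. P (Suc j) + T * K)"
  have K: "K 0 = P 0 + 1 + T" "K (Suc j) = P (Suc j) + T * K j" for j by (simp_all add: K_def)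
  define G where "G = integral {0..T} (\<lambda>r. N r x)"
  have iN: "(\<lambda>r. N r x) integrable_on {0..t}" if "t \<in> {0..T}" for t
    by (rule integrable_continuous_interval, rule continuous_on_subset[OF jointly_continuous_time[OF N(1)]]) (use that in auto)
  have G0: "G \<ge> 0" unfolding G_def using T by (intro integral_nonneg iN N(2)) auto
  have jcr: "continuous_on {0..T} (\<lambda>r. residual b p g p2 g2 j r x)" for j
    unfolding residual_def
    by (intro continuous_intros jointly_continuous_time[OF chain_jointly_continuous] p g)
  have ir: "(\<lambda>r. residual b p g p2 g2 j r x) integrable_on {0..t}" if "t \<in> {0..T}" for j t
    by (rule integrable_continuous_interval, rule continuous_on_subset[OF jcr]) (use that in auto)
  have "\<bar>residual b p g p2 g2 (Suc j) t x\<bar> \<le> K j * (\<omega> * G + d)"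
    using t
  proof (induction j arbitrary: t)
    case 0
    have "\<bar>integral {0..t} (\<lambda>r. residual b p g p2 g2 0 r x)\<bar> \<le> integral {0..t} (\<lambda>r. \<omega> * N r x + d)"
      using 0 by (intro integral_abs_le ir Henstock_Kurzweil_Integration.integrable_add integrable_on_mult_right iN r0) auto
    also have "\<dots> = \<omega> * integral {0..t} (\<lambda>r. N r x) + d * t"
      using 0 iN[OF 0] by (subst Henstock_Kurzweil_Integration.integral_add) (auto intro: integrable_on_mult_right)
    also have "\<dots> \<le> \<omega> * G + d * T"
      unfolding G_def using 0 pos N(2)
      by (intro add_mono mult_left_mono integral_subset_le iN) auto
    finally have "\<bar>residual b p g p2 g2 (Suc 0) t x\<bar> \<le> P 0 * d + (\<omega> * G + d * T)"
      unfolding residual_Suc[OF p g 0] using pj(1)[of 0] by linarith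
    also have "\<dots> \<le> K 0 * (\<omega> * G + d)"
    proof -
      have "0 \<le> (P 0 + T) * (\<omega> * G) + d" using pj(2)[of 0] T pos G0 by (intro add_nonneg_nonneg mult_nonneg_nonneg) auto
      then show ?thesis by (simp add: K algebra_simps)
    qed
    finally show ?case .
  next
    case (Suc j)
    have K0: "K j \<ge> 0" by (induction j) (use K pj(2) T in auto)
    have "\<bar>integral {0..t} (\<lambda>r. residual b p g p2 g2 (Suc j) r x)\<bar> \<le> integral {0..t} (\<lambda>r. K j * (\<omega> * G + d))"
      using Suc by (intro integral_abs_le ir) auto
    also have "\<dots> = t * (K j * (\<omega> * G + d))" using Suc.prems by simp
    also have "\<dots> \<le> T * (K j * (\<omega> * G + d))"
      using Suc.prems K0 G0 pos by (intro mult_right_mono mult_nonneg_nonneg) auto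
    finally have "\<bar>residual b p g p2 g2 (Suc (Suc j)) t x\<bar> \<le> P (Suc j) * d + T * (K j * (\<omega> * G + d))"
      unfolding residual_Suc[where b = b and j = "Suc j" and x = x, OF p g Suc.prems] using pj(1)[of "Suc j"] by linarith
    also have "\<dots> \<le> K (Suc j) * (\<omega> * G + d)"
    proof -
      have "0 \<le> P (Suc j) * (\<omega> * G)" using pj(2)[of "Suc j"] pos G0 by (intro mult_nonneg_nonneg) auto
      then show ?thesis by (simp add: K algebra_simps)
    qed
    finally show ?case .
  qed
  then show ?thesis by (simp add: K_def G_def)
qed

section \<open>The energy bound for antiderivatives of even order\<close>

lemma micro_box_mem: "x \<in> micro_box x0 l \<longleftrightarrow> (\<forall>i. \<bar>x $ i - x0 $ i\<bar> \<le> l)"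
proof -
  have "x0 $ i - l \<le> x $ i \<and> x $ i \<le> x0 $ i + l \<longleftrightarrow> \<bar>x $ i - x0 $ i\<bar> \<le> l" for i by linarith
  then show ?thesis by (simp add: micro_box_def mem_box_cart)
qed

lemma micro_box_mono: "l \<le> l' \<Longrightarrow> micro_box x0 l \<subseteq> micro_box x0 l'"
  by (meson micro_box_mem order_trans subsetI)

lemma measure_micro_box: "0 \<le> l \<Longrightarrow> measure lborel (micro_box (x0 :: real^'n) l) = (2 * l) ^ CARD('n)"
  unfolding micro_box_def by (subst content_cbox_cart) (auto simp: interval_ne_empty_cart)

lemma integrable_micro_box:
  "continuous_on UNIV (f :: real^'n \<Rightarrow> real) \<Longrightarrow> f integrable_on micro_box x0 l"
  unfolding micro_box_def by (rule integrable_continuous) (rule continuous_on_subset, auto)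

text \<open>Order 2 m + 2 is seen as the velocity of the wave of order 2 m + 3. The three radii
  nest: \<open>k\<close> lives where the cutoff is 1 up to time T, the cutoff lives in radius R -
  \<kappa>, and there the residual is controlled. The assumption on \<open>z\<close> says that the
  energy is at most the volume times z^2.\<close>

lemma chain_energy_estimate:
  fixes p :: "nat \<Rightarrow> real^'n \<Rightarrow> real"
  assumes T: "T > 0" and A: "A > 0" and R: "0 < \<kappa>" "\<kappa> \<le> R"
    and b: "continuous_on UNIV b" "\<And>x. 1 / A \<le> b x" "\<And>x. b x \<le> Mb"
    and p: "\<And>j. continuous_on UNIV (p j)" "\<And>i j. continuous_on UNIV (p1 i j)" "\<And>i j. continuous_on UNIV (p2 i j)"
      "\<And>i j. has_partial i (p j) (p1 i j)" "\<And>i j. has_partial i (p1 i j) (p2 i j)"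
    and odd: "\<And>i j x. odd j \<Longrightarrow> p1 i j x = 0"
    and g: "jointly_continuous T g" "\<And>i. jointly_continuous T (g1 i)" "\<And>i. jointly_continuous T (g2 i)"
      "\<And>i t. t \<in> {0..T} \<Longrightarrow> has_partial i (g t) (g1 i t)" "\<And>i t. t \<in> {0..T} \<Longrightarrow> has_partial i (g1 i t) (g2 i t)"
    and Q: "continuous_on UNIV Q" "\<And>t x. t \<in> {0..T} \<Longrightarrow> x \<in> micro_box x0 (R - \<kappa>) \<Longrightarrow> \<bar>residual b p g p2 g2 (2 * m + 1) t x\<bar> \<le> Q x"
    and init: "\<And>x. \<bar>p (2 * m + 2) x\<bar> \<le> y"
    and k: "continuous_on UNIV k" "\<And>x. \<bar>k x\<bar> \<le> k0"
      "\<And>x. x \<notin> micro_box x0 (R - 2 * \<kappa> - sqrt A * T) \<Longrightarrow> k x = 0"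
    and z: "z > 0" "exp 1 * ((2 * R) ^ CARD('n) * (Mb * y\<^sup>2) + T\<^sup>2 * A * integral (micro_box x0 (R - \<kappa>)) (\<lambda>x. (Q x)\<^sup>2)) \<le> (2 * R) ^ CARD('n) * z\<^sup>2"
    and t: "t \<in> {0..T}"
  shows "\<bar>integral (micro_box x0 (R - \<kappa>)) (\<lambda>x. k x * chain p g (2 * m + 2) t x)\<bar> \<le> k0 * (2 * R) ^ CARD('n) * (1 + A) / 2 * z"
proof -
  define c0 where "c0 = sqrt A"
  have c0: "c0 > 0" using A by (simp add: c0_def)
  obtain \<Xi> \<Xi>t and \<Xi>x :: "'n \<Rightarrow> real \<Rightarrow> real^'n \<Rightarrow> real" where H:
    "jointly_continuous T \<Xi> \<and> jointly_continuous T \<Xi>t \<and> (\<forall>i. jointly_continuous T (\<Xi>x i)) \<and>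
    (\<forall>i t. has_partial i (\<Xi> t) (\<Xi>x i t)) \<and>
    (\<forall>x t S. ((\<lambda>t. \<Xi> t x) has_real_derivative \<Xi>t t x) (at t within S)) \<and>
    (\<forall>t x. 0 \<le> \<Xi> t x \<and> \<Xi> t x \<le> 1) \<and>
    (\<forall>t x. 0 \<le> t \<longrightarrow> x \<notin> micro_box x0 (R - \<kappa>) \<longrightarrow> \<Xi> t x = 0) \<and>
    (\<forall>t x. (\<forall>i. \<bar>x $ i - x0 $ i\<bar> + c0 * t \<le> R - 2 * \<kappa>) \<longrightarrow> \<Xi> t x = 1) \<and>
    (\<forall>t x. c0 * (\<Sum>i\<in>UNIV. \<bar>\<Xi>x i t x\<bar>) \<le> - \<Xi>t t x)"
    using cutoff_exists[OF R(1) c0, of T x0 R] by (elim exE) (rule that)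
  have \<Xi>: "jointly_continuous T \<Xi>" "jointly_continuous T \<Xi>t" "\<And>i. jointly_continuous T (\<Xi>x i)"
    "\<And>i t. has_partial i (\<Xi> t) (\<Xi>x i t)"
    "\<And>x t S. ((\<lambda>t. \<Xi> t x) has_real_derivative \<Xi>t t x) (at t within S)"
    "\<And>t x. 0 \<le> \<Xi> t x" "\<And>t x. \<Xi> t x \<le> 1"
    "\<And>t x. 0 \<le> t \<Longrightarrow> x \<notin> micro_box x0 (R - \<kappa>) \<Longrightarrow> \<Xi> t x = 0"
    "\<And>t x. (\<And>i. \<bar>x $ i - x0 $ i\<bar> + c0 * t \<le> R - 2 * \<kappa>) \<Longrightarrow> \<Xi> t x = 1"
    "\<And>t x. c0 * (\<Sum>i\<in>UNIV. \<bar>\<Xi>x i t x\<bar>) \<le> - \<Xi>t t x"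
    using H by (elim conjE, blast)+
  define D where "D = micro_box x0 (R - \<kappa>)"
  define l where "l = x0 - (\<chi> i. R - \<kappa>)"
  define r where "r = x0 + (\<chi> i. R - \<kappa>)"
  have D: "D = cbox l r" by (simp add: D_def l_def r_def micro_box_def)
  define Z where "Z = chain p g (2 * m + 2)"
  define vol where "vol = (2 * R) ^ CARD('n)"
  have R0: "R > 0" using R by linarith
  have vol: "vol > 0" using R0 by (simp add: vol_def)
  have iD: "f integrable_on D" if "continuous_on UNIV f" for f :: "real^'n \<Rightarrow> real"
    unfolding D_def by (rule integrable_micro_box[OF that])
  have volD: "integral D (\<lambda>x. c) \<le> c * vol" if "c \<ge> 0" for c
  proof -
    have "measure lborel D \<le> vol"
    proof -
      have "measure lborel D = (2 * (R - \<kappa>)) ^ CARD('n)" unfolding D_def using R by (intro measure_micro_box) simp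
      also have "\<dots> \<le> vol" unfolding vol_def by (rule power_mono) (use R in auto)
      finally show ?thesis .
    qed
    then show ?thesis unfolding D integral_const using that mult_left_mono[of "measure lborel (cbox l r)" vol c] by (simp add: D mult.commute)
  qed
  have jc: "jointly_continuous T (chain p g j)" "jointly_continuous T (chain (p1 i) (g1 i) j)" "jointly_continuous T (chain (p2 i) (g2 i) j)" for i j
    by (intro chain_jointly_continuous p g)+
  have cZ: "continuous_on UNIV (Z t)" "continuous_on UNIV (\<Xi> t)" if "t \<in> {0..T}" for t
    unfolding Z_def by (rule jointly_continuous_space[OF jc(1) that] jointly_continuous_space[OF \<Xi>(1) that])+
  have "integral (cbox l r) (\<lambda>x. \<Xi> t x * (b x * (Z t x)\<^sup>2)) \<le>
    exp 1 * (integral (cbox l r) (\<lambda>x. \<Xi> 0 x * (b x * (Z 0 x)\<^sup>2)) + T\<^sup>2 * A * integral (cbox l r) (\<lambda>x. (Q x)\<^sup>2))"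
  proof (rule energy_estimate[where V = "chain p g (2 * m + 1)" and ?D1.0 = "\<lambda>i. chain (p1 i) (g1 i) (2 * m + 3)"
        and ?D2.0 = "\<lambda>i. chain (p2 i) (g2 i) (2 * m + 3)" and ZD = "\<lambda>i. chain (p1 i) (g1 i) (2 * m + 2)" and \<Xi>t = \<Xi>t and \<Xi>x = \<Xi>x])
    show "c0 = sqrt A" by (rule c0_def)
    show "jointly_continuous T Z" unfolding Z_def by (rule jc)
    show "has_partial i (chain (p1 i) (g1 i) (2 * m + 3) t) (chain (p2 i) (g2 i) (2 * m + 3) t)" if "t \<in> {0..T}" for i t
      by (rule chain_has_partial[OF p(2,3,5) g(2,3,5) that])
    show "has_partial i (Z t) (chain (p1 i) (g1 i) (2 * m + 2) t)" if "t \<in> {0..T}" for i t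
      unfolding Z_def by (rule chain_has_partial[OF p(1,2,4) g(1,2,4) that])
    show "((\<lambda>t. Z t x) has_real_derivative chain p g (2 * m + 1) t x) (at t within {0..T})" if "t \<in> {0..T}" for t x
      using chain_time_derivative[where j = "2 * m + 1" and x = x, OF p(1) g(1) that] by (simp add: Z_def)
    show "((\<lambda>t. chain (p1 i) (g1 i) (2 * m + 3) t x) has_real_derivative chain (p1 i) (g1 i) (2 * m + 2) t x) (at t within {0..T})"
      if "t \<in> {0..T}" for i t x
      using chain_time_derivative[where j = "2 * m + 2" and x = x, OF p(2) g(2) that] by (simp add: eval_nat_numeral)
    \<comment> \<open>The order is odd, so the initial value has no gradient and the initial energy
      comes from \<open>p (2 * m + 2)\<close> alone.\<close>
    show "chain (p1 i) (g1 i) (2 * m + 3) 0 x = 0" for i x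
    proof -
      have "p1 i (2 * m + 3) x = 0" by (rule odd) presburger
      then show ?thesis by (simp add: eval_nat_numeral)
    qed
    show "\<bar>b x * chain p g (2 * m + 1) t x - (\<Sum>i\<in>UNIV. chain (p2 i) (g2 i) (2 * m + 3) t x)\<bar> \<le> Q x"
      if "t \<in> {0..T}" "x \<in> cbox l r" for t x
      using Q(2)[OF that(1), of x] that(2) by (simp add: D[symmetric] D_def residual_def eval_nat_numeral)
    show "continuous_on (cbox l r) Q" by (rule continuous_on_subset[OF Q(1)]) simp
    show "\<Xi> t x = 0" if "t \<in> {0..T}" "x \<notin> cbox l r" for t x
      using \<Xi>(8)[of t x] that by (simp add: D[symmetric] D_def)
  qed (use T A b \<Xi> t in \<open>auto intro: jc simp del: chain.simps\<close>)
  also have "\<dots> \<le> exp 1 * (vol * (Mb * y\<^sup>2) + T\<^sup>2 * A * integral D (\<lambda>x. (Q x)\<^sup>2))"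
  proof (intro mult_left_mono add_mono)
    have T0: "0 \<in> {0..T}" using T by simp
    have y0: "y \<ge> 0" using init[of 0] by linarith
    have b0: "0 \<le> b x" for x using b(2)[of x] A by (metis divide_nonneg_pos order_trans zero_le_one)
    have Mb0: "Mb \<ge> 0" using b0 b(3) order_trans by blast
    have "integral D (\<lambda>x. \<Xi> 0 x * (b x * (Z 0 x)\<^sup>2)) \<le> integral D (\<lambda>x. 1 * (Mb * y\<^sup>2))"
    proof (rule integral_le)
      show "(\<lambda>x. \<Xi> 0 x * (b x * (Z 0 x)\<^sup>2)) integrable_on D" by (intro iD continuous_intros cZ T0 b)
      show "(\<lambda>x. 1 * (Mb * y\<^sup>2)) integrable_on D" by (intro iD continuous_intros)
      fix x
      have "\<bar>Z 0 x\<bar> \<le> \<bar>y\<bar>" using init[of x] by (simp add: Z_def eval_nat_numeral)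
      then have "(Z 0 x)\<^sup>2 \<le> y\<^sup>2" by (simp add: abs_le_square_iff)
      then have "b x * (Z 0 x)\<^sup>2 \<le> Mb * y\<^sup>2" by (intro mult_mono b(3) Mb0) simp_all
      then show "\<Xi> 0 x * (b x * (Z 0 x)\<^sup>2) \<le> 1 * (Mb * y\<^sup>2)"
        by (rule mult_mono[OF \<Xi>(7)]) (simp_all add: b0)
    qed
    also have "\<dots> \<le> Mb * y\<^sup>2 * vol" using volD[of "Mb * y\<^sup>2"] Mb0 by simp
    finally show "integral (cbox l r) (\<lambda>x. \<Xi> 0 x * (b x * (Z 0 x)\<^sup>2)) \<le> vol * (Mb * y\<^sup>2)" by (simp add: D mult_ac)
  qed (use A in \<open>auto simp: D\<close>)
  also have "\<dots> \<le> vol * z\<^sup>2" using z(2) by (simp add: vol_def D_def)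
  finally have en: "integral D (\<lambda>x. \<Xi> t x * (b x * (Z t x)\<^sup>2)) \<le> vol * z\<^sup>2" by (simp add: D)
  have k00: "k0 \<ge> 0" using k(2)[of 0] by linarith
  \<comment> \<open>Young's inequality with weight z balances the two terms: the energy bound vol
    z^2 divided by z and the constant term are both linear in z.\<close>
  have "\<bar>integral D (\<lambda>x. k x * Z t x)\<bar> \<le> integral D (\<lambda>x. k0 / (2 * z) * (\<Xi> t x * (b x * (Z t x)\<^sup>2)) + k0 * A * z / 2)"
  proof (rule integral_abs_le)
    show "(\<lambda>x. k x * Z t x) integrable_on D" by (intro iD continuous_intros cZ t k)
    show "(\<lambda>x. k0 / (2 * z) * (\<Xi> t x * (b x * (Z t x)\<^sup>2)) + k0 * A * z / 2) integrable_on D"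
      by (intro iD continuous_intros cZ t b)
    fix x
    show "\<bar>k x * Z t x\<bar> \<le> k0 / (2 * z) * (\<Xi> t x * (b x * (Z t x)\<^sup>2)) + k0 * A * z / 2"
    proof (cases "x \<in> micro_box x0 (R - 2 * \<kappa> - sqrt A * T)")
      case True
      have le: "c0 * t \<le> c0 * T" using t c0 by (intro mult_left_mono) auto
      have "\<bar>x $ i - x0 $ i\<bar> + c0 * t \<le> R - 2 * \<kappa>" for i
      proof -
        have "\<bar>x $ i - x0 $ i\<bar> \<le> R - 2 * \<kappa> - c0 * T" using True by (simp add: micro_box_mem c0_def)
        with le show ?thesis by linarith
      qed
      then have one: "\<Xi> t x = 1" by (rule \<Xi>(9))
      have "0 \<le> (\<bar>Z t x\<bar> - A * z)\<^sup>2" by simp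
      then have "2 * (A * z) * \<bar>Z t x\<bar> \<le> (Z t x)\<^sup>2 + (A * z)\<^sup>2" by (simp add: power2_diff algebra_simps)
      then have "\<bar>Z t x\<bar> \<le> 1 / (2 * z) * (1 / A * (Z t x)\<^sup>2) + A * z / 2"
        using A z(1) by (simp add: field_simps power2_eq_square)
      also have "1 / A * (Z t x)\<^sup>2 \<le> b x * (Z t x)\<^sup>2" using b(2)[of x] by (intro mult_right_mono) auto
      finally have "\<bar>Z t x\<bar> \<le> 1 / (2 * z) * (b x * (Z t x)\<^sup>2) + A * z / 2" using z(1) by (simp add: divide_right_mono)
      then have "\<bar>k x\<bar> * \<bar>Z t x\<bar> \<le> k0 * (1 / (2 * z) * (b x * (Z t x)\<^sup>2) + A * z / 2)"
        using k(2) k00 by (intro mult_mono) auto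
      then show ?thesis by (simp add: one abs_mult algebra_simps)
    next
      case False
      have "0 \<le> b x" using b(2)[of x] A by (metis divide_nonneg_pos order_trans zero_le_one)
      then have "0 \<le> k0 / (2 * z) * (\<Xi> t x * (b x * (Z t x)\<^sup>2)) + k0 * A * z / 2"
        using k00 z(1) A \<Xi>(6)[of t x] by (intro add_nonneg_nonneg mult_nonneg_nonneg divide_nonneg_pos) auto
      then show ?thesis using k(3)[OF False] by simp
    qed
  qed
  also have "\<dots> = k0 / (2 * z) * integral D (\<lambda>x. \<Xi> t x * (b x * (Z t x)\<^sup>2)) + integral D (\<lambda>x. k0 * A * z / 2)"
    unfolding integral_mult_right[symmetric]
    by (intro Henstock_Kurzweil_Integration.integral_add iD continuous_intros cZ t b)
  also have "\<dots> \<le> k0 / (2 * z) * (vol * z\<^sup>2) + k0 * A * z / 2 * vol"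
    using en k00 z(1) A by (intro add_mono mult_left_mono volD) auto
  also have "\<dots> = k0 * vol * (1 + A) / 2 * z" using z(1) by (simp add: field_simps power2_eq_square)
  finally show ?thesis by (simp add: D_def Z_def vol_def)
qed

section \<open>The mollified micro problem\<close>

lemma has_partial_reflected:
  assumes "has_partial i f f'"
  shows "has_partial i (\<lambda>y. f (x - y)) (\<lambda>y. - f' (x - y))"
  unfolding has_partial_def
proof
  fix y
  have "((\<lambda>r. f ((x - y) + (- r) *\<^sub>R axis i 1)) has_real_derivative f' ((x - y) + (- 0) *\<^sub>R axis i 1) * (-1)) (at 0)"
    by (rule DERIV_chain2[OF has_partial_at[OF assms]]) (auto intro!: derivative_eq_intros)
  then show "((\<lambda>r. f (x - (y + r *\<^sub>R axis i 1))) has_real_derivative - f' (x - y)) (at 0)"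
    by (simp add: algebra_simps)
qed

lemma has_partialI:
  assumes "\<And>x. (f has_derivative f' x) (at x)"
  shows "has_partial i f (\<lambda>x. f' x (axis i 1))"
  unfolding has_partial_def
proof
  fix x
  have "(f has_derivative f' x) (at (x + 0 *\<^sub>R axis i 1))" using assms by simp
  moreover have "((\<lambda>s. x + s *\<^sub>R axis i (1::real)) has_derivative (\<lambda>s. s *\<^sub>R axis i 1)) (at 0)"
    by (auto intro!: derivative_eq_intros)
  ultimately have "((\<lambda>s. f (x + s *\<^sub>R axis i 1)) has_derivative (\<lambda>s. f' x (s *\<^sub>R axis i 1))) (at 0)"
    by (rule has_derivative_compose[rotated])
  moreover have "f' x (s *\<^sub>R axis i 1) = f' x (axis i 1) * s" for s
    using linear_scale[OF has_derivative_linear[OF assms[of x]], of s] by simp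
  ultimately show "((\<lambda>s. f (x + s *\<^sub>R axis i 1)) has_real_derivative f' x (axis i 1)) (at 0)"
    by (simp add: has_field_derivative_def)
qed

lemma quadratic_polynomial_partials:
  assumes "quadratic_polynomial (f :: real^'n \<Rightarrow> real)"
  shows "\<exists>c F1 d. laplacian f = (\<lambda>x. c) \<and> continuous_on UNIV f \<and> c = (\<Sum>i\<in>UNIV. d i) \<and>
    (\<forall>i. continuous_on UNIV (F1 i) \<and> has_partial i f (F1 i) \<and> has_partial i (F1 i) (\<lambda>x. d i))"
proof -
  obtain c0 b and M :: "real^'n^'n" where f: "\<And>x. f x = c0 + b \<bullet> x + x \<bullet> (M *v x)"
    using assms unfolding quadratic_polynomial_def by blast
  have M: "bounded_linear ((*v) M)" by (rule matrix_vector_mul_bounded_linear)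
  have dM: "((*v) M has_derivative (*v) M) (at x)" for x by (rule bounded_linear_imp_has_derivative[OF M])
  define F where "F x h = b \<bullet> h + (h \<bullet> (M *v x) + x \<bullet> (M *v h))" for x h
  define G where "G e h = h \<bullet> (M *v e) + e \<bullet> (M *v h)" for e h :: "real^'n"
  have d1: "(f has_derivative F x) (at x)" for x
    unfolding f[abs_def] F_def by (auto intro!: derivative_eq_intros dM simp: algebra_simps)
  have d2: "((\<lambda>x. F x e) has_derivative G e) (at x)" for x e
    unfolding F_def G_def by (auto intro!: derivative_eq_intros dM simp: algebra_simps)
  have p1: "partial e f = (\<lambda>x. F x e)" for e by (rule ext) (rule partial_eq[OF d1])
  have "laplacian f x = (\<Sum>i\<in>UNIV. G (axis i 1) (axis i 1))" for x
    unfolding laplacian_def sum_Basis_vec by (intro sum.cong refl) (simp add: p1 partial_eq[OF d2])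
  moreover have "continuous_on UNIV f" by (rule has_derivative_continuous_on) (rule d1)
  moreover have "continuous_on UNIV (\<lambda>x. F x e)" for e by (rule has_derivative_continuous_on) (rule d2)
  moreover have "has_partial i f (\<lambda>x. F x (axis i 1))" for i by (rule has_partialI[OF d1])
  moreover have "has_partial i (\<lambda>x. F x (axis i 1)) (\<lambda>x. G (axis i 1) (axis i 1))" for i by (rule has_partialI[OF d2])
  ultimately show ?thesis
    by (intro exI[of _ "\<Sum>i\<in>UNIV. G (axis i 1) (axis i 1)"] exI[of _ "\<lambda>i x. F x (axis i 1)"] exI[of _ "\<lambda>i. G (axis i 1) (axis i 1)"]) auto
qed

text \<open>Compactness of the time interval without a normed space of functions: closeness to w t
  in L2 bounds the squared norm by 2 \<open>h t\<close> + 2, and bisection joins these local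
  bounds.\<close>

lemma L2_continuous_bounded:
  fixes w :: "real \<Rightarrow> real^'n \<Rightarrow> real"
  assumes w: "L2_continuous {0..T} B w" and T: "0 \<le> T"
  shows "\<exists>W\<ge>0. \<forall>t\<in>{0..T}. (LINT x|lebesgue_on B. (w t x)\<^sup>2) \<le> W"
proof -
  define h where "h t = (LINT x|lebesgue_on B. (w t x)\<^sup>2)" for t
  have sq: "square_integrable_on (w t) B" if "t \<in> {0..T}" for t using w that by (auto simp: L2_continuous_def)
  have step: "h s \<le> 2 * h t + 2" if "s \<in> {0..T}" "t \<in> {0..T}" "norm_L2_on B (\<lambda>x. w s x - w t x) < 1" for s t
  proof -
    have sd: "square_integrable_on (\<lambda>x. w s x - w t x) B" by (intro square_integrable_diff sq that)
    define D where "D = (LINT x|lebesgue_on B. (w s x - w t x)\<^sup>2)"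
    have "D \<le> 1" using that(3) unfolding norm_L2_on_def D_def[symmetric] by (simp add: real_sqrt_less_iff)
    have "h s \<le> (LINT x|lebesgue_on B. 2 * (w t x)\<^sup>2 + 2 * (w s x - w t x)\<^sup>2)"
      unfolding h_def
    proof (rule integral_mono)
      show "integrable (lebesgue_on B) (\<lambda>x. (w s x)\<^sup>2)" using sq[OF that(1)] by (simp add: square_integrable_on_def)
      show "integrable (lebesgue_on B) (\<lambda>x. 2 * (w t x)\<^sup>2 + 2 * (w s x - w t x)\<^sup>2)"
        using sq[OF that(2)] sd by (auto simp: square_integrable_on_def)
      fix x
      have "0 \<le> (2 * w t x - w s x)\<^sup>2" by simp
      then show "(w s x)\<^sup>2 \<le> 2 * (w t x)\<^sup>2 + 2 * (w s x - w t x)\<^sup>2" by (simp add: power2_diff algebra_simps)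
    qed
    also have "\<dots> = 2 * h t + 2 * D"
      using sq[OF that(2)] sd by (simp add: h_def D_def square_integrable_on_def)
    finally show ?thesis using \<open>D \<le> 1\<close> by simp
  qed
  define P where "P a b = (\<exists>W. \<forall>t\<in>{0..T}. a \<le> t \<and> t \<le> b \<longrightarrow> h t \<le> W)" for a b
  have "P 0 T"
  proof (rule Bolzano[OF T])
    fix a b c assume "P a b" "P b c" "a \<le> b" "b \<le> c"
    then obtain W1 W2 where W: "\<forall>t\<in>{0..T}. a \<le> t \<and> t \<le> b \<longrightarrow> h t \<le> W1" "\<forall>t\<in>{0..T}. b \<le> t \<and> t \<le> c \<longrightarrow> h t \<le> W2"
      unfolding P_def by blast
    have "\<forall>t\<in>{0..T}. a \<le> t \<and> t \<le> c \<longrightarrow> h t \<le> max W1 W2"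
    proof (intro ballI impI)
      fix t assume "t \<in> {0..T}" "a \<le> t \<and> t \<le> c"
      then show "h t \<le> max W1 W2" using W by (cases "t \<le> b") (auto simp: le_max_iff_disj)
    qed
    then show "P a c" unfolding P_def by blast
  next
    fix t assume "0 \<le> t" "t \<le> T"
    then have t: "t \<in> {0..T}" by simp
    have "((\<lambda>s. norm_L2_on B (\<lambda>x. w s x - w t x)) \<longlongrightarrow> 0) (at t within {0..T})"
      using w t by (auto simp: L2_continuous_def)
    then have "\<forall>\<^sub>F s in at t within {0..T}. norm_L2_on B (\<lambda>x. w s x - w t x) < 1"
      by (rule order_tendstoD) simp
    then obtain e where e: "e > 0" "\<And>s. s \<in> {0..T} \<Longrightarrow> s \<noteq> t \<Longrightarrow> dist s t < e \<Longrightarrow> norm_L2_on B (\<lambda>x. w s x - w t x) < 1"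
      unfolding eventually_at by auto
    have "P a b" if "a \<le> t" "t \<le> b" "b - a < e" for a b
      unfolding P_def
    proof (intro exI ballI impI)
      fix s assume s: "s \<in> {0..T}" "a \<le> s \<and> s \<le> b"
      have h0: "h t \<ge> 0" unfolding h_def by (intro integral_nonneg_AE) auto
      show "h s \<le> 2 * h t + 2"
      proof (cases "s = t")
        case False
        have "dist s t < e" using s that by (auto simp: dist_real_def)
        then show ?thesis using step[OF s(1) t e(2)[OF s(1) False]] by simp
      qed (use h0 in simp)
    qed
    then show "\<exists>d>0. \<forall>a b. a \<le> t \<and> t \<le> b \<and> b - a < d \<longrightarrow> P a b" using e(1) by blast
  qed
  then obtain W where "\<forall>t\<in>{0..T}. h t \<le> W" unfolding P_def by auto
  then show ?thesis by (intro exI[of _ "max W 0"]) (auto simp: h_def le_max_iff_disj)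
qed

section \<open>Mollification away from the faces of the box\<close>

locale mollifier =
  fixes s :: "real^'n \<Rightarrow> real" and D1 D2 :: "'n \<Rightarrow> real^'n \<Rightarrow> real" and \<delta> :: real
  assumes smooth_s: "smooth (\<lambda>y. s (x - y))" and cont_s: "continuous_on UNIV s"
    and cont_D: "continuous_on UNIV (D1 i)" "continuous_on UNIV (D2 i)"
    and partial_s: "has_partial i s (D1 i)" "has_partial i (D1 i) (D2 i)"
    and nonneg_s: "0 \<le> s z"
    and supp: "z \<notin> cbox (- (\<chi> i. \<delta>)) (\<chi> i. \<delta>) \<Longrightarrow> s z = 0" "z \<notin> cbox (- (\<chi> i. \<delta>)) (\<chi> i. \<delta>) \<Longrightarrow> D1 i z = 0"
      "z \<notin> cbox (- (\<chi> i. \<delta>)) (\<chi> i. \<delta>) \<Longrightarrow> D2 i z = 0"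
    and mass: "(LINT x|lborel. s (x - y)) = 1" "(LINT y|lborel. s (x - y)) = 1"
begin

lemma bounds: "\<exists>C\<ge>0. \<forall>z. \<bar>s z\<bar> \<le> C" "\<exists>C\<ge>0. \<forall>i z. \<bar>D1 i z\<bar> \<le> C" "\<exists>C\<ge>0. \<forall>i z. \<bar>D2 i z\<bar> \<le> C"
proof -
  show "\<exists>C\<ge>0. \<forall>z. \<bar>s z\<bar> \<le> C" by (rule continuous_supported_bounded[OF cont_s supp(1)])
  have *: "\<exists>C\<ge>0. \<forall>i z. \<bar>D i z\<bar> \<le> C" if "\<And>i. continuous_on UNIV (D i)"
    "\<And>i z. z \<notin> cbox (- (\<chi> i. \<delta>)) (\<chi> i. \<delta>) \<Longrightarrow> D i z = 0" for D :: "'n \<Rightarrow> real^'n \<Rightarrow> real"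
  proof -
    have "\<forall>i. \<exists>C\<ge>0. \<forall>z. \<bar>D i z\<bar> \<le> C" using continuous_supported_bounded[OF that(1,2)] by blast
    then obtain C where C: "\<And>i. C i \<ge> 0" "\<And>i z. \<bar>D i z\<bar> \<le> C i" by metis
    have "C i \<le> (\<Sum>i\<in>UNIV. C i)" for i by (rule member_le_sum) (auto intro: C)
    then have "\<bar>D i z\<bar> \<le> (\<Sum>i\<in>UNIV. C i)" for i z using C(2) order_trans by blast
    then show ?thesis using sum_nonneg[of UNIV C] C(1) by blast
  qed
  show "\<exists>C\<ge>0. \<forall>i z. \<bar>D1 i z\<bar> \<le> C" by (rule *[OF cont_D(1) supp(2)])
  show "\<exists>C\<ge>0. \<forall>i z. \<bar>D2 i z\<bar> \<le> C" by (rule *[OF cont_D(2) supp(3)])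
qed

lemma near:
  assumes "s (x - y) \<noteq> 0 \<or> D1 i (x - y) \<noteq> 0 \<or> D2 i (x - y) \<noteq> 0"
  shows "\<bar>x $ j - y $ j\<bar> \<le> \<delta>"
proof -
  have "x - y \<in> cbox (- (\<chi> i. \<delta>)) (\<chi> i. \<delta>)" using assms supp by blast
  then have "- \<delta> \<le> (x - y) $ j \<and> (x - y) $ j \<le> \<delta>" by (simp add: mem_box_cart)
  then show ?thesis by auto
qed

lemma inside:
  assumes x: "x \<in> micro_box x0 (l - \<delta>)" and y: "y \<notin> micro_box x0 l"
  shows "s (x - y) = 0" "D1 i (x - y) = 0" "D2 i (x - y) = 0"
proof -
  obtain j where "\<bar>y $ j - x0 $ j\<bar> > l" using y by (auto simp: micro_box_mem not_le)
  moreover have "\<bar>x $ j - x0 $ j\<bar> \<le> l - \<delta>" using x by (simp add: micro_box_mem)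
  ultimately have "\<not> \<bar>x $ j - y $ j\<bar> \<le> \<delta>" by linarith
  then show "s (x - y) = 0" "D1 i (x - y) = 0" "D2 i (x - y) = 0" using near[of x y i j] by blast+
qed

lemma integrable_reflected: "integrable lborel (\<lambda>y. s (x - y))" "integrable lebesgue (\<lambda>y. s (x - y))"
proof -
  have c: "continuous_on UNIV (\<lambda>y. s (x - y))"
    by (intro continuous_on_compose2[OF cont_s] continuous_intros) auto
  have "s (x - y) = 0" if "y \<notin> cbox (x - (\<chi> i. \<delta>)) (x + (\<chi> i. \<delta>))" for y
  proof (rule ccontr)
    assume "s (x - y) \<noteq> 0"
    then have n: "\<bar>x $ j - y $ j\<bar> \<le> \<delta>" for j using near by blast
    have "x $ j - \<delta> \<le> y $ j \<and> y $ j \<le> x $ j + \<delta>" for j using n[of j] by linarith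
    then show False using that by (simp add: mem_box_cart)
  qed
  from compact_support_integrable[OF c this]
  show "integrable lborel (\<lambda>y. s (x - y))" "integrable lebesgue (\<lambda>y. s (x - y))" by auto
qed

lemma mass_on: "B \<in> sets lebesgue \<Longrightarrow> (LINT y|lebesgue_on B. s (x - y)) \<le> 1"
proof -
  assume B: "B \<in> sets lebesgue"
  have "(LINT y|lebesgue_on B. s (x - y)) = (LINT y|lebesgue. indicator B y *\<^sub>R s (x - y))"
    using B by (simp add: integral_restrict_space)
  also have "\<dots> \<le> (LINT y|lebesgue. s (x - y))"
  proof (rule integral_mono)
    show "integrable lebesgue (\<lambda>y. indicator B y *\<^sub>R s (x - y))"
      using B integrable_reflected(2) by (rule integrable_mult_indicator)
  qed (use integrable_reflected nonneg_s in \<open>auto simp: indicator_def\<close>)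
  also have "\<dots> = (LINT y|lborel. s (x - y))"
    using integrable_reflected(1)[of x] by (intro integral_completion) auto
  finally show ?thesis using mass(2) by simp
qed

lemma mass_inside:
  assumes x: "x \<in> micro_box x0 (l - \<delta>)"
  shows "integral (micro_box x0 l) (\<lambda>y. s (x - y)) = 1"
proof -
  have c: "continuous_on UNIV (\<lambda>y. s (x - y))"
    by (intro continuous_on_compose2[OF cont_s] continuous_intros) auto
  show ?thesis
    using compact_support_integrable(2)[OF c inside(1)[OF x, unfolded micro_box_def]] mass(2) by (simp add: micro_box_def)
qed

lemma mol_continuous_function:
  assumes h: "continuous_on UNIV h" and k: "continuous_on UNIV k"
  shows "mol (micro_box x0 l) k h x = integral (micro_box x0 l) (\<lambda>y. k (x - y) * h y)"
proof -
  have c: "continuous_on UNIV (\<lambda>y. k (x - y) * h y)"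
    by (intro continuous_intros h continuous_on_compose2[OF k]) auto
  have si: "integrable lborel (\<lambda>y. indicator (micro_box x0 l) y *\<^sub>R (k (x - y) * h y))"
    unfolding micro_box_def
    by (rule borel_integrable_compact) (auto intro: continuous_on_subset[OF c])
  then have "integrable lebesgue (\<lambda>y. indicator (micro_box x0 l) y *\<^sub>R (k (x - y) * h y))"
    using integrable_completion[OF borel_measurable_integrable[OF si]] by simp
  then have "integrable (lebesgue_on (micro_box x0 l)) (\<lambda>y. k (x - y) * h y)"
    by (subst integrable_restrict_space) (simp_all add: micro_box_def)
  then show ?thesis unfolding mol_def by (rule lebesgue_integral_eq_integral) (simp add: micro_box_def)
qed

text \<open>Two integrations by parts move both derivatives from the kernel to \<open>f\<close>.
  There are no boundary terms since the kernel centred at \<open>x\<close> vanishes outside the box,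
  and the constant second derivative then meets mass one.\<close>

lemma mol_quadratic:
  assumes f: "continuous_on UNIV f" "\<And>i. continuous_on UNIV (F1 i)" "\<And>i. has_partial i f (F1 i)" "\<And>i. has_partial i (F1 i) (\<lambda>x. d i)"
    and x: "x \<in> micro_box x0 (l - \<delta>)"
  shows "mol (micro_box x0 l) (D2 i) f x = d i"
proof -
  define I where "I = (integral (micro_box x0 l) :: (real^'n \<Rightarrow> real) \<Rightarrow> real)"
  have cr: "continuous_on UNIV (\<lambda>y. k (x - y))" if "continuous_on UNIV k" for k :: "real^'n \<Rightarrow> real"
    by (intro continuous_intros continuous_on_compose2[OF that]) auto
  note c = cr[OF cont_s] cr[OF cont_D(1)] cr[OF cont_D(2)]
  note int = integrable_micro_box[of _ x0 l]
  have z1: "I (\<lambda>y. F1 i y * D1 i (x - y) + f y * (- D2 i (x - y))) = 0"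
    unfolding I_def micro_box_def
  proof (rule integral_partial_zero)
    show "has_partial i (\<lambda>y. f y * D1 i (x - y)) (\<lambda>y. F1 i y * D1 i (x - y) + f y * (- D2 i (x - y)))"
      by (intro has_partial_mult f has_partial_reflected partial_s)
  qed (use inside(2)[OF x] in \<open>auto intro!: continuous_intros f c simp: micro_box_def\<close>)
  have z2: "I (\<lambda>y. d i * s (x - y) + F1 i y * (- D1 i (x - y))) = 0"
    unfolding I_def micro_box_def
  proof (rule integral_partial_zero)
    show "has_partial i (\<lambda>y. F1 i y * s (x - y)) (\<lambda>y. d i * s (x - y) + F1 i y * (- D1 i (x - y)))"
      by (intro has_partial_mult f has_partial_reflected partial_s)
  qed (use inside(1)[OF x] in \<open>auto intro!: continuous_intros f c simp: micro_box_def\<close>)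
  define G1 where "G1 y = F1 i y * D1 i (x - y) + f y * (- D2 i (x - y))" for y
  define G2 where "G2 y = d i * s (x - y) + F1 i y * (- D1 i (x - y))" for y
  have cG: "continuous_on UNIV G1" "continuous_on UNIV G2" "continuous_on UNIV (\<lambda>y. d i * s (x - y))"
    unfolding G1_def G2_def by (intro continuous_intros f c)+
  have "I (\<lambda>y. D2 i (x - y) * f y) = I (\<lambda>y. d i * s (x - y) - G2 y - G1 y)"
    by (simp add: algebra_simps G1_def G2_def)
  also have "\<dots> = I (\<lambda>y. d i * s (x - y) - G2 y) - I G1"
    unfolding I_def by (intro Henstock_Kurzweil_Integration.integral_diff int continuous_on_diff cG)
  also have "I (\<lambda>y. d i * s (x - y) - G2 y) = I (\<lambda>y. d i * s (x - y)) - I G2"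
    unfolding I_def by (intro Henstock_Kurzweil_Integration.integral_diff int cG)
  also have "I G1 = 0" using z1 by (simp add: G1_def[abs_def])
  also have "I G2 = 0" using z2 by (simp add: G2_def[abs_def])
  also have "I (\<lambda>y. d i * s (x - y)) - 0 - 0 = d i * I (\<lambda>y. s (x - y))" by (simp add: I_def)
  finally show ?thesis
    using mass_inside[OF x] mol_continuous_function[OF f(1) cont_D(2)] by (simp add: I_def)
qed

end

text \<open>In the application b is 1 / a(x / \<epsilon>), T = \<eta> / 2, and R is the radius of
  the kernel's support plus the distance travelled at speed sqrt A. The equation is stored divided
  by \<open>a\<close>, so that the Laplacian is bare and the coefficient multiplies w. By \<delta>
  \<le> \<kappa> and R \<le> l, kernels centred in \<open>D\<close> see only
  \<open>B\<close>.\<close>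

locale micro = mollifier s D1 D2 \<delta>
  for s :: "real^'n \<Rightarrow> real" and D1 D2 :: "'n \<Rightarrow> real^'n \<Rightarrow> real" and \<delta> :: real +
  fixes b :: "real^'n \<Rightarrow> real" and T A R l c a0 Mb \<omega> W :: real and x0 :: "real^'n"
    and u v w :: "real \<Rightarrow> real^'n \<Rightarrow> real" and uhat :: "real^'n \<Rightarrow> real"
    and U1 :: "'n \<Rightarrow> real^'n \<Rightarrow> real" and d :: "'n \<Rightarrow> real" and \<kappa> :: real
  assumes T: "T > 0" and A: "A > 0" and R: "0 < \<delta>" "\<delta> \<le> \<kappa>" "\<kappa> \<le> R" "R \<le> l"
    and b: "continuous_on UNIV b" "1 / A \<le> b x" "b x \<le> Mb"
    and uv: "has_L2_derivative {0..T} (micro_box x0 l) u v"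
    and vw: "has_L2_derivative {0..T} (micro_box x0 l) v w"
    and w: "L2_continuous {0..T} (micro_box x0 l) w"
    and lap: "t \<in> {0<..T} \<Longrightarrow> \<exists>g. has_weak_laplacian (u t) g \<and> (AE x in lebesgue_on (micro_box x0 l). g x = b x * w t x)"
    and u0: "AE x in lebesgue_on (micro_box x0 l). u 0 x = uhat x"
    and v0: "AE x in lebesgue_on (micro_box x0 l). v 0 x = 0"
    and uhat: "continuous_on UNIV uhat" "continuous_on UNIV (U1 i)" "has_partial i uhat (U1 i)"
      "has_partial i (U1 i) (\<lambda>x. d i)" "c = (\<Sum>i\<in>UNIV. d i)"
    and osc: "x \<in> micro_box x0 l \<Longrightarrow> y \<in> micro_box x0 l \<Longrightarrow> (\<And>i. \<bar>x $ i - y $ i\<bar> \<le> \<delta>) \<Longrightarrow> \<bar>b x - b y\<bar> \<le> \<omega>"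
    and \<omega>: "0 \<le> \<omega>"
    and W: "t \<in> {0..T} \<Longrightarrow> (LINT x|lebesgue_on (micro_box x0 l). (w t x)\<^sup>2) \<le> W"
begin

abbreviation "B \<equiv> micro_box x0 l"
abbreviation "D \<equiv> micro_box x0 (R - \<kappa>)"

lemma B: "B \<in> lmeasurable" "B \<in> sets lebesgue"
  by (simp_all add: micro_box_def)

lemma D_subset: "x \<in> D \<Longrightarrow> x \<in> micro_box x0 (l - \<delta>)" "x \<in> D \<Longrightarrow> x \<in> B"
  using micro_box_mono[of "R - \<kappa>" "l - \<delta>" x0] micro_box_mono[of "R - \<kappa>" l x0] R by auto

lemma square_integrable: "t \<in> {0..T} \<Longrightarrow> square_integrable_on (w t) B"
  "t \<in> {0..T} \<Longrightarrow> square_integrable_on (v t) B" "t \<in> {0..T} \<Longrightarrow> square_integrable_on (u t) B"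
  using vw uv by (auto simp: has_L2_derivative_def)

lemma integrable_w: "t \<in> {0..T} \<Longrightarrow> integrable (lebesgue_on B) (w t)"
  by (rule square_integrable_L1(1)[OF B(1) square_integrable(1)])

lemma b_bounded: "\<bar>b x\<bar> \<le> Mb" "0 < b x"
proof -
  show "0 < b x" using b(2)[of x] A by (metis divide_pos_pos less_le_trans zero_less_one)
  then show "\<bar>b x\<bar> \<le> Mb" using b(3)[of x] by simp
qed

lemma L1_w: "L1_continuous {0..T} B w" "L1_continuous {0..T} B (\<lambda>t x. b x * w t x)" "L1_continuous {0..T} B (\<lambda>t x. \<bar>w t x\<bar>)"
proof -
  show 1: "L1_continuous {0..T} B w" by (rule L2_continuous_L1[OF B(1) w])
  show "L1_continuous {0..T} B (\<lambda>t x. b x * w t x)" by (rule L1_continuous_mult[OF B(2) b(1) b_bounded(1) 1])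
  show "L1_continuous {0..T} B (\<lambda>t x. \<bar>w t x\<bar>)" by (rule L1_continuous_abs[OF 1])
qed

text \<open>The mollified error integrand, order 0 of the chain. The constant is subtracted
  unmollified: it has no spatial derivatives, so \<open>g1\<close> and \<open>g2\<close> mollify
  \<open>w\<close> alone.\<close>

definition g :: "real \<Rightarrow> real^'n \<Rightarrow> real" where "g t x = mol B s (w t) x - a0 * c"
definition g1 :: "'n \<Rightarrow> real \<Rightarrow> real^'n \<Rightarrow> real" where "g1 i t = mol B (D1 i) (w t)"
definition g2 :: "'n \<Rightarrow> real \<Rightarrow> real^'n \<Rightarrow> real" where "g2 i t = mol B (D2 i) (w t)"
definition N :: "real \<Rightarrow> real^'n \<Rightarrow> real" where "N t = mol B s (\<lambda>y. \<bar>w t y\<bar>)"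

lemma jc: "jointly_continuous T g" "jointly_continuous T (g1 i)" "jointly_continuous T (g2 i)" "jointly_continuous T N"
proof -
  obtain C where C: "\<And>z. \<bar>s z\<bar> \<le> C" using bounds(1) by blast
  obtain C1 where C1: "\<And>i z. \<bar>D1 i z\<bar> \<le> C1" using bounds(2) by blast
  obtain C2 where C2: "\<And>i z. \<bar>D2 i z\<bar> \<le> C2" using bounds(3) by blast
  have "jointly_continuous T (\<lambda>t x. mol B s (w t) x + (\<lambda>t x. - (a0 * c)) t x)"
    by (intro jointly_continuous_add mol_jointly_continuous[OF cont_s C B(2) L1_w(1)] jointly_continuous_const continuous_on_const)
  then show "jointly_continuous T g" by (simp add: g_def[abs_def])
  show "jointly_continuous T (g1 i)" unfolding g1_def[abs_def] by (rule mol_jointly_continuous[OF cont_D(1) C1 B(2) L1_w(1)])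
  show "jointly_continuous T (g2 i)" unfolding g2_def[abs_def] by (rule mol_jointly_continuous[OF cont_D(2) C2 B(2) L1_w(1)])
  show "jointly_continuous T N" unfolding N_def[abs_def] by (rule mol_jointly_continuous[OF cont_s C B(2) L1_w(3)])
qed

lemma partials: "t \<in> {0..T} \<Longrightarrow> has_partial i (g t) (g1 i t)" "t \<in> {0..T} \<Longrightarrow> has_partial i (g1 i t) (g2 i t)"
proof -
  obtain C where C: "\<And>z. \<bar>s z\<bar> \<le> C" using bounds(1) by blast
  obtain C1 where C1: "\<And>i z. \<bar>D1 i z\<bar> \<le> C1" using bounds(2) by blast
  obtain C2 where C2: "\<And>i z. \<bar>D2 i z\<bar> \<le> C2" using bounds(3) by blast
  assume t: "t \<in> {0..T}"
  have "has_partial i (mol B s (w t)) (g1 i t)"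
    unfolding g1_def by (rule mol_has_partial[OF cont_s C cont_D(1) C1 partial_s(1) B(2) integrable_w[OF t]])
  then show "has_partial i (g t) (g1 i t)"
    unfolding g_def[abs_def] has_partial_def by (auto intro!: derivative_eq_intros)
  show "has_partial i (g1 i t) (g2 i t)"
    unfolding g1_def g2_def by (rule mol_has_partial[OF cont_D(1) C1 cont_D(2) C2 partial_s(2) B(2) integrable_w[OF t]])
qed

lemma mol_cong_AE:
  assumes "AE x in lebesgue_on B. f x = h x" "integrable (lebesgue_on B) f" "h \<in> borel_measurable (lebesgue_on B)"
    "continuous_on UNIV k"
  shows "mol B k f x = mol B k h x"
  unfolding mol_def
proof (rule integral_cong_AE)
  show "(\<lambda>y. k (x - y) * f y) \<in> borel_measurable (lebesgue_on B)" "(\<lambda>y. k (x - y) * h y) \<in> borel_measurable (lebesgue_on B)"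
    using measurable_reflected[OF assms(4) B(2)] assms(2,3) by (auto intro!: borel_measurable_times)
qed (use assms(1) in \<open>auto elim!: eventually_mono\<close>)

text \<open>The equation is available for positive times only; at time 0 the Laplacian is read off
  from the polynomial.\<close>

lemma mol_laplacian_initial:
  assumes x: "x \<in> D"
  shows "(\<Sum>i\<in>UNIV. mol B (D2 i) (u 0) x) = c"
proof -
  have 0: "0 \<in> {0..T}" using T by simp
  have "uhat \<in> borel_measurable (lebesgue_on B)"
    by (rule continuous_imp_measurable_on_sets_lebesgue[OF continuous_on_subset[OF uhat(1)] B(2)]) simp
  then have "mol B (D2 i) (u 0) x = mol B (D2 i) uhat x" for i
    using mol_cong_AE[OF u0 square_integrable_L1(1)[OF B(1) square_integrable(3)[OF 0]] _ cont_D(2)] by blast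
  then show ?thesis using mol_quadratic[OF uhat(1-4) D_subset(1)[OF x]] uhat(5) by simp
qed

lemma mol_laplacian:
  assumes x: "x \<in> D" and t: "t \<in> {0<..T}"
  shows "(\<Sum>i\<in>UNIV. mol B (D2 i) (u t) x) = mol B s (\<lambda>y. b y * w t y) x"
proof -
  have t': "t \<in> {0..T}" using t by auto
  obtain C2 where C2: "\<And>i z. \<bar>D2 i z\<bar> \<le> C2" using bounds(3) by blast
  obtain gl where gl: "has_weak_laplacian (u t) gl" "AE x in lebesgue_on B. gl x = b x * w t x" using lap[OF t] by blast
  have "(\<Sum>i\<in>UNIV. mol B (D2 i) (u t) x) = mol B (\<lambda>z. \<Sum>i\<in>UNIV. D2 i z) (u t) x"
    by (rule mol_sum_kernel[symmetric, OF cont_D(2) C2 B(2) square_integrable_L1(1)[OF B(1) square_integrable(3)[OF t']]])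
  also have "\<dots> = mol B s gl x"
    by (rule mol_weak_laplacian[OF smooth_s partial_s B(2) _ _ gl(1)])
      (use inside[OF D_subset(1)[OF x]] in \<open>auto simp: micro_box_def\<close>)
  also have "\<dots> = mol B s (\<lambda>y. b y * w t y) x"
  proof (rule mol_cong_AE[OF gl(2) _ _ cont_s])
    have "set_integrable lebesgue B gl"
      using gl(1) by (simp add: has_weak_laplacian_def locally_integrable_def micro_box_def)
    then show "integrable (lebesgue_on B) gl"
      by (subst integrable_restrict_space) (simp_all add: set_integrable_def micro_box_def)
    show "(\<lambda>x. b x * w t x) \<in> borel_measurable (lebesgue_on B)"
      using L1_w(2) t' by (auto simp: L1_continuous_def)
  qed
  finally show ?thesis .
qed

text \<open>Two time integrations of \<open>w\<close> lead back to \<open>u\<close>, with v 0 = 0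
  removing the linear term. The second derivatives stay on the mollifier throughout.\<close>

lemma second_integral:
  assumes t: "t \<in> {0..T}" and p: "p2 i (Suc 0) x = 0"
  shows "chain (p2 i) (g2 i) 2 t x = p2 i 2 x + mol B (D2 i) (u t) x - mol B (D2 i) (u 0) x"
proof -
  obtain C2 where C2: "\<And>i z. \<bar>D2 i z\<bar> \<le> C2" using bounds(3) by blast
  have 0: "0 \<in> {0..T}" using T by simp
  have v00: "mol B (D2 i) (v 0) x = 0"
    using mol_cong_AE[OF v0 square_integrable_L1(1)[OF B(1) square_integrable(2)[OF 0]] _ cont_D(2), of i x] by (simp add: mol_def)
  have inner: "integral {0..r} (\<lambda>q. g2 i q x) = mol B (D2 i) (v r) x" if r: "r \<in> {0..T}" for r
  proof -
    have "((\<lambda>q. g2 i q x) has_integral mol B (D2 i) (v r) x - mol B (D2 i) (v 0) x) {0..r}"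
    proof (rule fundamental_theorem_of_calculus)
      fix q assume q: "q \<in> {0..r}"
      have "((\<lambda>q. mol B (D2 i) (v q) x) has_real_derivative g2 i q x) (at q within {0..T})"
        unfolding g2_def by (rule mol_time_derivative[OF cont_D(2) C2 B(1) vw]) (use q r in auto)
      then have "((\<lambda>q. mol B (D2 i) (v q) x) has_real_derivative g2 i q x) (at q within {0..r})"
        by (rule DERIV_subset) (use r in auto)
      then show "((\<lambda>q. mol B (D2 i) (v q) x) has_vector_derivative g2 i q x) (at q within {0..r})"
        by (simp add: has_real_derivative_iff_has_vector_derivative)
    qed (use r in auto)
    then show ?thesis using v00 by (simp add: integral_unique)
  qed
  have "((\<lambda>r. mol B (D2 i) (v r) x) has_integral mol B (D2 i) (u t) x - mol B (D2 i) (u 0) x) {0..t}"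
  proof (rule fundamental_theorem_of_calculus)
    fix q assume q: "q \<in> {0..t}"
    have "((\<lambda>q. mol B (D2 i) (u q) x) has_real_derivative mol B (D2 i) (v q) x) (at q within {0..T})"
      by (rule mol_time_derivative[OF cont_D(2) C2 B(1) uv]) (use q t in auto)
    then have "((\<lambda>q. mol B (D2 i) (u q) x) has_real_derivative mol B (D2 i) (v q) x) (at q within {0..t})"
      by (rule DERIV_subset) (use t in auto)
    then show "((\<lambda>q. mol B (D2 i) (u q) x) has_vector_derivative mol B (D2 i) (v q) x) (at q within {0..t})"
      by (simp add: has_real_derivative_iff_has_vector_derivative)
  qed (use t in auto)
  then have o: "integral {0..t} (\<lambda>r. mol B (D2 i) (v r) x) = mol B (D2 i) (u t) x - mol B (D2 i) (u 0) x"
    by (rule integral_unique)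
  have "integral {0..t} (\<lambda>r. integral {0..r} (\<lambda>q. g2 i q x)) = integral {0..t} (\<lambda>r. mol B (D2 i) (v r) x)"
    by (rule integral_cong) (use inner t in auto)
  then show ?thesis using o p by (simp add: numeral_2_eq_2)
qed

text \<open>By \<open>second_integral\<close> and the equation, the residual of order 0 is the
  commutator of mollification with \<open>b\<close> plus the defect of the first cell problem; the
  Laplacian c of the initial value combines with a0 c from \<open>g\<close> into
  \<open>c * (1 - a0 * b x)\<close>.\<close>

lemma residual_initial:
  assumes p: "\<And>j. continuous_on UNIV (p j)" "\<And>i j. continuous_on UNIV (p2 i j)" "\<And>i x. p2 i (Suc 0) x = 0"
    and e: "\<And>x. \<bar>c * (1 - a0 * b x) - (\<Sum>i\<in>UNIV. p2 i 2 x)\<bar> \<le> e"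
    and x: "x \<in> D" and t: "t \<in> {0..T}"
  shows "\<bar>residual b p g p2 g2 0 t x\<bar> \<le> \<omega> * N t x + e"
proof -
  obtain C where C: "\<And>z. \<bar>s z\<bar> \<le> C" using bounds(1) by blast
  have pos: "\<bar>residual b p g p2 g2 0 t x\<bar> \<le> \<omega> * N t x + e" if t: "t \<in> {0<..T}" for t
  proof -
    have t': "t \<in> {0..T}" using t by auto
    have "(\<Sum>i\<in>UNIV. chain (p2 i) (g2 i) 2 t x) =
        (\<Sum>i\<in>UNIV. p2 i 2 x) + (\<Sum>i\<in>UNIV. mol B (D2 i) (u t) x) - (\<Sum>i\<in>UNIV. mol B (D2 i) (u 0) x)"
      by (simp only: second_integral[where ?p2.0 = p2, OF t' p(3)] sum.distrib sum_subtractf)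
    also have "\<dots> = (\<Sum>i\<in>UNIV. p2 i 2 x) + mol B s (\<lambda>y. b y * w t y) x - c"
      by (simp only: mol_laplacian_initial[OF x] mol_laplacian[OF x t])
    finally have r: "residual b p g p2 g2 0 t x =
      (b x * mol B s (w t) x - mol B s (\<lambda>y. b y * w t y) x) + (c * (1 - a0 * b x) - (\<Sum>i\<in>UNIV. p2 i 2 x))"
      by (simp add: residual_def g_def numeral_2_eq_2 algebra_simps del: chain.simps(2))
    have bw: "integrable (lebesgue_on B) (\<lambda>y. b y * w t y)" using L1_w(2) t' by (auto simp: L1_continuous_def)
    have "\<bar>b x * mol B s (w t) x - mol B s (\<lambda>y. b y * w t y) x\<bar> \<le> \<omega> * N t x"
      unfolding N_def
    proof (rule mol_commutator[OF cont_s C nonneg_s B(2) integrable_w[OF t'] bw])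
      fix y assume n: "s (x - y) \<noteq> 0"
      then have "y \<in> B" using inside(1)[OF D_subset(1)[OF x]] by blast
      then show "\<bar>b x - b y\<bar> \<le> \<omega>" using osc[OF D_subset(2)[OF x]] near n by blast
    qed
    then show ?thesis using e[of x] unfolding r by linarith
  qed
  show ?thesis
  proof (cases "t = 0")
    case True
    \<comment> \<open>The bound at time 0 is the limit of the bounds at positive times.\<close>
    define F where "F r = \<omega> * N r x + e - \<bar>residual b p g p2 g2 0 r x\<bar>" for r
    have "continuous_on {0..T} F"
      unfolding F_def residual_def
      by (intro continuous_intros jointly_continuous_time[OF jc(4)] jointly_continuous_time[OF chain_jointly_continuous] p jc)
    then have "(F \<longlongrightarrow> F 0) (at 0 within {0..T})" using T by (simp add: continuous_on)
    then have lim: "(F \<longlongrightarrow> F 0) (at_right 0)" using T by (simp add: at_within_Icc_at_right)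
    have "eventually (\<lambda>r. 0 \<le> F r) (at_right 0)"
      unfolding eventually_at_right_field using pos T by (intro exI[of _ T]) (auto simp: F_def)
    then have "0 \<le> F 0" using tendsto_lowerbound[OF lim] by auto
    then show ?thesis using True by (simp add: F_def)
  qed (use pos t in auto)
qed

lemma N_nonneg: "0 \<le> N t x"
  unfolding N_def mol_def using nonneg_s by (intro integral_nonneg_AE) auto

text \<open>Mollification does not increase the L2 norm: Jensen pointwise, then Fubini, where
  integrating the kernel over \<open>D\<close> gives at most 1. The bound W is free of \<delta>,
  which is chosen later.\<close>

lemma N_square: "t \<in> {0..T} \<Longrightarrow> integral D (\<lambda>x. (N t x)\<^sup>2) \<le> W"
proof -
  assume t: "t \<in> {0..T}"
  obtain C where C: "\<And>z. \<bar>s z\<bar> \<le> C" using bounds(1) by blast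
  have h2: "integrable (lebesgue_on B) (\<lambda>y. (w t y)\<^sup>2)" using square_integrable(1)[OF t] by (simp add: square_integrable_on_def)
  define S where "S = mol B s (\<lambda>y. (w t y)\<^sup>2)"
  \<comment> \<open>A function constant in time, on a degenerate time interval, borrows continuity
    in space from the joint statement.\<close>
  have "L1_continuous {0..0} B (\<lambda>_. (\<lambda>y. (w t y)\<^sup>2))" using h2 by (simp add: L1_continuous_def)
  from mol_jointly_continuous[OF cont_s C B(2) this] have cS: "continuous_on UNIV S"
    unfolding S_def by (rule jointly_continuous_space) simp
  have cN: "continuous_on UNIV (N t)" by (rule jointly_continuous_space[OF jc(4) t])
  have "integral D (\<lambda>x. (N t x)\<^sup>2) \<le> integral D S"
    unfolding N_def S_def
    by (intro integral_le integrable_micro_box continuous_intros cN[unfolded N_def] cS[unfolded S_def]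
        mol_abs_square_le[OF cont_s C nonneg_s B(1) mass_on[OF B(2)] square_integrable(1)[OF t]])
  also have "\<dots> = (LINT x|lborel. indicator D x * S x)"
  proof -
    have "set_integrable lborel D S"
      unfolding set_integrable_def micro_box_def by (rule borel_integrable_compact) (auto intro: continuous_on_subset[OF cS])
    from set_borel_integral_eq_integral(2)[OF this] show ?thesis by (simp add: set_lebesgue_integral_def)
  qed
  also have "\<dots> = (LINT y|lebesgue_on B. (w t y)\<^sup>2 * (LINT x|lborel. indicator D x * s (x - y)))"
    unfolding S_def
    by (rule mol_fubini[OF cont_s C B(1) h2, of _ 1 "x0 - (\<chi> i. R - \<kappa>)" "x0 + (\<chi> i. R - \<kappa>)"])
      (auto simp: micro_box_def indicator_def)
  also have "\<dots> \<le> (LINT y|lebesgue_on B. (w t y)\<^sup>2 * 1)"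
  proof (rule integral_mono')
    show "integrable (lebesgue_on B) (\<lambda>y. (w t y)\<^sup>2 * 1)" using h2 by simp
    fix y
    have "s (x - y) = 0" if "x \<notin> cbox (y - (\<chi> i. \<delta>)) (y + (\<chi> i. \<delta>))" for x
    proof (rule ccontr)
      assume "s (x - y) \<noteq> 0"
      then have n: "\<bar>x $ j - y $ j\<bar> \<le> \<delta>" for j using near by blast
      have "y $ j - \<delta> \<le> x $ j \<and> x $ j \<le> y $ j + \<delta>" for j using n[of j] by linarith
      then show False using that by (simp add: mem_box_cart)
    qed
    then have ir: "integrable lborel (\<lambda>x. s (x - y))"
      by (intro compact_support_integrable(1)[of _ "y - (\<chi> i. \<delta>)" "y + (\<chi> i. \<delta>)"] continuous_on_compose2[OF cont_s] continuous_intros) auto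
    have "(LINT x|lborel. indicator D x * s (x - y)) \<le> (LINT x|lborel. s (x - y))"
      by (rule integral_mono'[OF ir]) (use nonneg_s in \<open>auto simp: indicator_def\<close>)
    then show "(w t y)\<^sup>2 * (LINT x|lborel. indicator D x * s (x - y)) \<le> (w t y)\<^sup>2 * 1"
      using mass(1) by (intro mult_left_mono) auto
  qed simp
  also have "\<dots> \<le> W" using W[OF t] by simp
  finally show ?thesis .
qed

text \<open>Cauchy-Schwarz in time, obtained from the integral of (N - k)^2 with k the time average,
  followed by an exchange of the integrals in time and space.\<close>

lemma time_integral_N_square: "integral D (\<lambda>x. (integral {0..T} (\<lambda>r. N r x))\<^sup>2) \<le> T\<^sup>2 * W"
proof -
  define G where "G x = integral {0..T} (\<lambda>r. N r x)" for x
  have jN2: "jointly_continuous T (\<lambda>t x. (N t x)\<^sup>2)" using jc(4) unfolding jointly_continuous_def by (intro continuous_intros)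
  have T0: "T \<in> {0..T}" using T by simp
  have cG: "continuous_on UNIV G" unfolding G_def by (rule jointly_continuous_space[OF jointly_continuous_integral[OF jc(4)] T0])
  have cH: "continuous_on UNIV (\<lambda>x. integral {0..T} (\<lambda>r. (N r x)\<^sup>2))"
    by (rule jointly_continuous_space[OF jointly_continuous_integral[OF jN2] T0])
  have "(G x)\<^sup>2 \<le> T * integral {0..T} (\<lambda>r. (N r x)\<^sup>2)" for x
  proof -
    have iN: "(\<lambda>r. N r x) integrable_on {0..T}" "(\<lambda>r. (N r x)\<^sup>2) integrable_on {0..T}"
      by (intro integrable_continuous_interval continuous_intros jointly_continuous_time[OF jc(4)])+
    define k where "k = G x / T"
    have "0 \<le> integral {0..T} (\<lambda>r. (N r x - k)\<^sup>2)"
      by (intro integral_nonneg integrable_continuous_interval continuous_intros jointly_continuous_time[OF jc(4)]) simp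
    also have "\<dots> = integral {0..T} (\<lambda>r. ((N r x)\<^sup>2 - (2 * k) * N r x) + k\<^sup>2)" by (simp add: power2_diff algebra_simps)
    also have "\<dots> = integral {0..T} (\<lambda>r. (N r x)\<^sup>2 - (2 * k) * N r x) + integral {0..T} (\<lambda>r. k\<^sup>2)"
      by (intro Henstock_Kurzweil_Integration.integral_add Henstock_Kurzweil_Integration.integrable_diff iN integrable_on_mult_right integrable_const_ivl)
    also have "integral {0..T} (\<lambda>r. (N r x)\<^sup>2 - (2 * k) * N r x) = integral {0..T} (\<lambda>r. (N r x)\<^sup>2) - (2 * k) * G x"
      unfolding G_def integral_mult_right[symmetric]
      by (intro Henstock_Kurzweil_Integration.integral_diff iN integrable_on_mult_right)
    finally have "0 \<le> integral {0..T} (\<lambda>r. (N r x)\<^sup>2) - 2 * k * G x + T * k\<^sup>2" using T by simp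
    then show ?thesis using T by (simp add: k_def field_simps power2_eq_square)
  qed
  then have "integral D (\<lambda>x. (G x)\<^sup>2) \<le> integral D (\<lambda>x. T * integral {0..T} (\<lambda>r. (N r x)\<^sup>2))"
    by (intro integral_le integrable_micro_box continuous_intros cG cH)
  also have "\<dots> = T * integral D (\<lambda>x. integral {0..T} (\<lambda>r. (N r x)\<^sup>2))" by (rule integral_mult_right)
  also have "integral D (\<lambda>x. integral {0..T} (\<lambda>r. (N r x)\<^sup>2)) = integral {0..T} (\<lambda>r. integral D (\<lambda>x. (N r x)\<^sup>2))"
    unfolding micro_box_def box_real(2)[symmetric]
  proof (rule integral_swap_continuous)
    define X where "X = cbox (x0 - (\<chi> i. R - \<kappa>), 0) (x0 + (\<chi> i. R - \<kappa>), T)"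
    have "continuous_on X (\<lambda>q. (\<lambda>p. (N (fst p) (snd p))\<^sup>2) (snd q, fst q))"
      by (rule continuous_on_compose2[OF jN2[unfolded jointly_continuous_def]])
        (auto intro!: continuous_intros simp: X_def cbox_Pair_eq)
    then show "continuous_on (cbox (x0 - (\<chi> i. R - \<kappa>), 0) (x0 + (\<chi> i. R - \<kappa>), T)) (\<lambda>(x, r). (N r x)\<^sup>2)"
      by (simp add: split_beta X_def)
  qed
  also have "T * integral {0..T} (\<lambda>r. integral D (\<lambda>x. (N r x)\<^sup>2)) \<le> T * integral {0..T} (\<lambda>r. W)"
  proof (rule mult_left_mono[OF integral_le])
    have "continuous_on {0..T} (\<lambda>r. integral (cbox (x0 - (\<chi> i. R - \<kappa>)) (x0 + (\<chi> i. R - \<kappa>))) (\<lambda>x. (N r x)\<^sup>2))"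
    proof (rule integral_continuous_on_param)
      show "continuous_on ({0..T} \<times> cbox (x0 - (\<chi> i. R - \<kappa>)) (x0 + (\<chi> i. R - \<kappa>))) (\<lambda>(r, x). (N r x)\<^sup>2)"
        unfolding split_beta by (rule continuous_on_subset[OF jN2[unfolded jointly_continuous_def]]) auto
    qed
    then show "(\<lambda>r. integral D (\<lambda>x. (N r x)\<^sup>2)) integrable_on {0..T}"
      unfolding micro_box_def by (rule integrable_continuous_interval)
  qed (use T N_square in auto)
  also have "\<dots> = T\<^sup>2 * W" using T by (simp add: power2_eq_square)
  finally show ?thesis by (simp add: G_def)
qed

end

text \<open>Landau's inequality: a first-order expansion over a step h bounds the middle derivative
  by its neighbours. The step goes forward or backward, whichever stays in [0, T], and this is
  possible because h \<le> T / 2.\<close>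

lemma landau_interpolation:
  assumes f: "\<And>t. t \<in> {0..T} \<Longrightarrow> (f has_real_derivative f1 t) (at t within {0..T})"
    "\<And>t. t \<in> {0..T} \<Longrightarrow> (f1 has_real_derivative f0 t) (at t within {0..T})"
    and b: "\<And>t. t \<in> {0..T} \<Longrightarrow> \<bar>f t\<bar> \<le> H2" "\<And>t. t \<in> {0..T} \<Longrightarrow> \<bar>f0 t\<bar> \<le> H0"
    and h: "0 < h" "h \<le> T / 2" and t: "t \<in> {0..T}"
  shows "\<bar>f1 t\<bar> \<le> 2 * H2 / h + h * H0"
proof -
  define t' where "t' = (if t + h \<le> T then t + h else t - h)"
  have t': "t' \<in> {0..T}" "\<bar>t' - t\<bar> = h" using t h by (auto simp: t'_def)
  define S where "S = {min t t'..max t t'}"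
  have S: "S \<subseteq> {0..T}" "t \<in> S" "t' \<in> S" "convex S" using t t' by (auto simp: S_def)
  have near: "\<bar>r - t\<bar> \<le> h" if "r \<in> S" for r using that t'(2) by (auto simp: S_def)
  have H0: "H0 \<ge> 0" using b(2)[OF t] by linarith
  have d1: "\<bar>f1 r - f1 t\<bar> \<le> H0 * h" if "r \<in> S" for r
  proof -
    have "norm (f1 r - f1 t) \<le> H0 * norm (r - t)"
    proof (rule field_differentiable_bound[OF S(4)])
      show "(f1 has_real_derivative f0 z) (at z within S)" if "z \<in> S" for z
        using DERIV_subset[OF f(2) S(1)] that S(1) by blast
    qed (use b(2) S that in auto)
    also have "\<dots> \<le> H0 * h" using near[OF that] H0 by (intro mult_left_mono) auto
    finally show ?thesis by simp
  qed
  have "norm ((f t' - f1 t * t') - (f t - f1 t * t)) \<le> (H0 * h) * norm (t' - t)"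
  proof (rule field_differentiable_bound[OF S(4), of "\<lambda>r. f r - f1 t * r" "\<lambda>r. f1 r - f1 t"])
    show "((\<lambda>r. f r - f1 t * r) has_real_derivative f1 z - f1 t) (at z within S)" if "z \<in> S" for z
      using DERIV_subset[OF f(1) S(1), of z] that S(1) by (auto intro!: derivative_eq_intros)
  qed (use d1 S in auto)
  then have "\<bar>(f t' - f t) - f1 t * (t' - t)\<bar> \<le> H0 * h * h" using t'(2) by (simp add: algebra_simps)
  moreover have "\<bar>f1 t * (t' - t)\<bar> = \<bar>f1 t\<bar> * h" using t'(2) by (simp add: abs_mult)
  ultimately have "\<bar>f1 t\<bar> * h \<le> 2 * H2 + H0 * h * h" using b(1)[OF t] b(1)[OF t'(1)] by linarith
  then show ?thesis using h(1) by (simp add: field_simps)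
qed

section \<open>Antiderivatives tested with the averaging kernel in space\<close>

context micro
begin

text \<open>Testing in space turns the chain of functions into a chain of numbers depending on time,
  the input of \<open>kernel_space_time_average\<close>.\<close>

definition pairing :: "(nat \<Rightarrow> real^'n \<Rightarrow> real) \<Rightarrow> (real^'n \<Rightarrow> real) \<Rightarrow> nat \<Rightarrow> real \<Rightarrow> real" where
  "pairing p k j t = integral D (\<lambda>x. k x * chain p g j t x)"

lemma pairing_continuous:
  assumes "\<And>j. continuous_on UNIV (p j)" "continuous_on UNIV k"
  shows "continuous_on {0..T} (pairing p k j)"
  unfolding pairing_def micro_box_def
proof (rule integral_continuous_on_param)
  show "continuous_on ({0..T} \<times> cbox (x0 - (\<chi> i. R - \<kappa>)) (x0 + (\<chi> i. R - \<kappa>))) (\<lambda>(t, x). k x * chain p g j t x)"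
    unfolding split_beta
    by (intro continuous_on_mult continuous_on_compose2[OF assms(2)] continuous_intros
        continuous_on_subset[OF chain_jointly_continuous[OF assms(1) jc(1), unfolded jointly_continuous_def]]) auto
qed

lemma pairing_derivative:
  assumes p: "\<And>j. continuous_on UNIV (p j)" and k: "continuous_on UNIV k" and t: "t \<in> {0..T}"
  shows "(pairing p k (Suc j) has_real_derivative pairing p k j t) (at t within {0..T})"
  unfolding pairing_def micro_box_def
proof (rule leibniz_rule_field_derivative[where U = "{0..T}" and fx = "\<lambda>t x. k x * chain p g j t x"])
  show "((\<lambda>t. k x * chain p g (Suc j) t x) has_real_derivative k x * chain p g j t x) (at t within {0..T})" if "t \<in> {0..T}" for t x
    by (intro DERIV_cmult chain_time_derivative[OF p jc(1) that])
  show "(\<lambda>x. k x * chain p g (Suc j) t x) integrable_on cbox (x0 - (\<chi> i. R - \<kappa>)) (x0 + (\<chi> i. R - \<kappa>))" if "t \<in> {0..T}" for t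
    by (intro integrable_continuous continuous_on_mult continuous_on_subset[OF k]
        jointly_continuous_space[OF chain_jointly_continuous[OF p jc(1)] that]) auto
  show "continuous_on ({0..T} \<times> cbox (x0 - (\<chi> i. R - \<kappa>)) (x0 + (\<chi> i. R - \<kappa>))) (\<lambda>(t, x). k x * chain p g j t x)"
    unfolding split_beta
    by (intro continuous_on_mult continuous_on_compose2[OF k] continuous_intros
        continuous_on_subset[OF chain_jointly_continuous[OF p jc(1), unfolded jointly_continuous_def]]) auto
qed (use t in auto)

lemma pairing_initial:
  assumes "\<And>x. p j x = 0" "0 < j"
  shows "pairing p k j 0 = 0"
  using assms by (cases j) (auto simp: pairing_def)

text \<open>\<zeta> gathers everything due to approximation, the commutator and the inexact
  correctors; the remaining term is the initial value y of this order, where the power of \<epsilon>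
  sits.\<close>

lemma even_bound:
  assumes p: "\<And>j. continuous_on UNIV (p j)" "\<And>i j. continuous_on UNIV (p1 i j)" "\<And>i j. continuous_on UNIV (p2 i j)"
      "\<And>i j. has_partial i (p j) (p1 i j)" "\<And>i j. has_partial i (p1 i j) (p2 i j)"
    and odd: "\<And>i j x. odd j \<Longrightarrow> p1 i j x = 0" "\<And>i x. p2 i (Suc 0) x = 0"
    and e: "\<And>x. \<bar>c * (1 - a0 * b x) - (\<Sum>i\<in>UNIV. p2 i 2 x)\<bar> \<le> e"
    and P: "\<And>j x. \<bar>b x * p (Suc j) x - (\<Sum>i\<in>UNIV. p2 i (j + 3) x)\<bar> \<le> P j * e" "\<And>j. 0 \<le> P j"
    and init: "\<And>x. \<bar>p (2 * m + 2) x\<bar> \<le> y"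
    and k: "continuous_on UNIV k" "\<And>x. \<bar>k x\<bar> \<le> k0"
      "\<And>x. x \<notin> micro_box x0 (R - 2 * \<kappa> - sqrt A * T) \<Longrightarrow> k x = 0"
    and \<zeta>: "0 < \<zeta>" "exp 1 * (T\<^sup>2 * A * (2 * (rec_nat (P 0 + 1 + T) (\<lambda>j K. P (Suc j) + T * K) (2 * m))\<^sup>2 *
        (\<omega>\<^sup>2 * (T\<^sup>2 * W) + e\<^sup>2 * (2 * R) ^ CARD('n)))) \<le> (2 * R) ^ CARD('n) * \<zeta>\<^sup>2"
    and t: "t \<in> {0..T}"
  shows "\<bar>pairing p k (2 * m + 2) t\<bar> \<le> k0 * (2 * R) ^ CARD('n) * (1 + A) / 2 * (sqrt (exp 1 * Mb) * y + \<zeta>)"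
proof -
  define Kr where "Kr = rec_nat (P 0 + 1 + T) (\<lambda>j K. P (Suc j) + T * K) (2 * m)"
  define vol where "vol = (2 * R) ^ CARD('n)"
  define G where "G x = integral {0..T} (\<lambda>r. N r x)" for x
  have T0: "T \<in> {0..T}" using T by simp
  have cG: "continuous_on UNIV G" unfolding G_def by (rule jointly_continuous_space[OF jointly_continuous_integral[OF jc(4)] T0])
  have e0: "e \<ge> 0" using e[of 0] by linarith
  have y0: "y \<ge> 0" using init[of 0] by linarith
  have R0: "R > 0" using R by linarith
  have vol: "vol > 0" using R0 by (simp add: vol_def)
  have Mb0: "Mb \<ge> 0" using b_bounded(1)[of 0] by linarith
  define Q where "Q x = Kr * (\<omega> * G x + e)" for x
  have cQ: "continuous_on UNIV Q" unfolding Q_def by (intro continuous_intros cG)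
  have res: "\<bar>residual b p g p2 g2 (2 * m + 1) t x\<bar> \<le> Q x" if t: "t \<in> {0..T}" and x: "x \<in> D" for t x
  proof -
    have "\<bar>residual b p g p2 g2 (Suc (2 * m)) t x\<bar> \<le> Kr * (\<omega> * integral {0..T} (\<lambda>r. N r x) + e)"
      unfolding Kr_def
      by (rule residual_bound[where N = N and P = P])
        (use p jc b N_nonneg T \<omega> e0 P t x in \<open>auto intro!: residual_initial odd e\<close>)
    then show ?thesis by (simp add: Q_def G_def)
  qed
  have IQ: "integral D (\<lambda>x. (Q x)\<^sup>2) \<le> 2 * Kr\<^sup>2 * (\<omega>\<^sup>2 * (T\<^sup>2 * W) + e\<^sup>2 * vol)"
  proof -
    have "integral D (\<lambda>x. (Q x)\<^sup>2) \<le> integral D (\<lambda>x. (2 * Kr\<^sup>2 * \<omega>\<^sup>2) * (G x)\<^sup>2 + 2 * Kr\<^sup>2 * e\<^sup>2)"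
    proof (rule integral_le)
      show "(\<lambda>x. (Q x)\<^sup>2) integrable_on D" "(\<lambda>x. (2 * Kr\<^sup>2 * \<omega>\<^sup>2) * (G x)\<^sup>2 + 2 * Kr\<^sup>2 * e\<^sup>2) integrable_on D"
        by (intro integrable_micro_box continuous_intros cG cQ)+
      fix x
      have "0 \<le> (\<omega> * G x - e)\<^sup>2" by simp
      then have "(\<omega> * G x + e)\<^sup>2 \<le> 2 * (\<omega> * G x)\<^sup>2 + 2 * e\<^sup>2" by (simp add: power2_sum power2_diff)
      then have "Kr\<^sup>2 * (\<omega> * G x + e)\<^sup>2 \<le> Kr\<^sup>2 * (2 * (\<omega> * G x)\<^sup>2 + 2 * e\<^sup>2)" by (intro mult_left_mono) auto
      also have "Kr\<^sup>2 * (\<omega> * G x + e)\<^sup>2 = (Q x)\<^sup>2" by (simp only: Q_def power_mult_distrib)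
      also have "Kr\<^sup>2 * (2 * (\<omega> * G x)\<^sup>2 + 2 * e\<^sup>2) = (2 * Kr\<^sup>2 * \<omega>\<^sup>2) * (G x)\<^sup>2 + 2 * Kr\<^sup>2 * e\<^sup>2"
        by (simp add: power_mult_distrib algebra_simps)
      finally show "(Q x)\<^sup>2 \<le> (2 * Kr\<^sup>2 * \<omega>\<^sup>2) * (G x)\<^sup>2 + 2 * Kr\<^sup>2 * e\<^sup>2" .
    qed
    also have "\<dots> = (2 * Kr\<^sup>2 * \<omega>\<^sup>2) * integral D (\<lambda>x. (G x)\<^sup>2) + integral D (\<lambda>x. 2 * Kr\<^sup>2 * e\<^sup>2)"
      unfolding integral_mult_right[symmetric]
      by (intro Henstock_Kurzweil_Integration.integral_add integrable_micro_box continuous_intros cG)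
    also have "\<dots> \<le> (2 * Kr\<^sup>2 * \<omega>\<^sup>2) * (T\<^sup>2 * W) + 2 * Kr\<^sup>2 * e\<^sup>2 * vol"
    proof (intro add_mono mult_left_mono)
      show "integral D (\<lambda>x. (G x)\<^sup>2) \<le> T\<^sup>2 * W" using time_integral_N_square by (simp add: G_def)
      have "measure lborel D = (2 * (R - \<kappa>)) ^ CARD('n)" using R by (intro measure_micro_box) simp
      also have "\<dots> \<le> vol" unfolding vol_def by (rule power_mono) (use R in auto)
      finally have "2 * Kr\<^sup>2 * e\<^sup>2 * measure lborel D \<le> 2 * Kr\<^sup>2 * e\<^sup>2 * vol" by (intro mult_left_mono) auto
      then show "integral D (\<lambda>x. 2 * Kr\<^sup>2 * e\<^sup>2) \<le> 2 * Kr\<^sup>2 * e\<^sup>2 * vol"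
        unfolding micro_box_def integral_const by (simp add: mult.commute)
    qed auto
    finally show ?thesis by (simp add: algebra_simps)
  qed
  \<comment> \<open>The square of a sum of nonnegative terms is at least the sum of the squares, so
    this z majorizes both contributions to the energy.\<close>
  define z where "z = sqrt (exp 1 * Mb) * y + \<zeta>"
  have z0: "z > 0" unfolding z_def using \<zeta>(1) y0 Mb0 by (intro add_nonneg_pos mult_nonneg_nonneg) auto
  have z2: "exp 1 * (Mb * y\<^sup>2) + \<zeta>\<^sup>2 \<le> z\<^sup>2"
  proof -
    have "(sqrt (exp 1 * Mb) * y)\<^sup>2 = exp 1 * (Mb * y\<^sup>2)" using Mb0 by (simp add: power_mult_distrib)
    moreover have "0 \<le> 2 * (sqrt (exp 1 * Mb) * y) * \<zeta>" using \<zeta>(1) y0 Mb0 by (intro mult_nonneg_nonneg) auto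
    ultimately show ?thesis by (simp add: z_def power2_sum)
  qed
  have "\<bar>integral D (\<lambda>x. k x * chain p g (2 * m + 2) t x)\<bar> \<le> k0 * (2 * R) ^ CARD('n) * (1 + A) / 2 * z"
  proof (rule chain_energy_estimate[where b = b and Mb = Mb and ?p1.0 = p1 and ?p2.0 = p2 and ?g1.0 = g1 and ?g2.0 = g2 and Q = Q and y = y])
    have "exp 1 * (T\<^sup>2 * A * integral D (\<lambda>x. (Q x)\<^sup>2)) \<le> exp 1 * (T\<^sup>2 * A * (2 * Kr\<^sup>2 * (\<omega>\<^sup>2 * (T\<^sup>2 * W) + e\<^sup>2 * vol)))"
      using IQ A by (intro mult_left_mono) auto
    also have "\<dots> \<le> vol * \<zeta>\<^sup>2" using \<zeta>(2) by (simp add: Kr_def vol_def)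
    finally have "exp 1 * (vol * (Mb * y\<^sup>2) + T\<^sup>2 * A * integral D (\<lambda>x. (Q x)\<^sup>2)) \<le> vol * (exp 1 * (Mb * y\<^sup>2) + \<zeta>\<^sup>2)"
      by (simp add: algebra_simps)
    also have "\<dots> \<le> vol * z\<^sup>2" using z2 vol by (intro mult_left_mono) auto
    finally show "exp 1 * ((2 * R) ^ CARD('n) * (Mb * y\<^sup>2) + T\<^sup>2 * A * integral D (\<lambda>x. (Q x)\<^sup>2)) \<le> (2 * R) ^ CARD('n) * z\<^sup>2"
      by (simp add: vol_def)
  qed (use T A R b p odd jc partials cQ res init k z0 t in \<open>auto simp del: chain.simps\<close>)
  then show ?thesis by (simp add: pairing_def z_def)
qed

text \<open>Undoes both approximations at order 0. Fubini moves the mollifier from w to k; k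
  mollified is within e2 of k, and k is within e1 of the true kernel kk. The kernel k is not
  renormalized, which accounts for the last term.\<close>

lemma pairing_initial_compare:
  assumes k: "continuous_on UNIV k" "\<And>x. x \<notin> D \<Longrightarrow> k x = 0" and kk: "continuous_on UNIV kk"
    and near: "\<And>x. \<bar>k x - kk x\<bar> \<le> e1" "\<And>x y. (\<And>i. \<bar>x $ i - y $ i\<bar> \<le> \<delta>) \<Longrightarrow> \<bar>k x - k y\<bar> \<le> e2"
    and one: "integral B kk = 1" and t: "t \<in> {0..T}"
  shows "\<bar>pairing p k 0 t - ((LINT x|lebesgue_on B. kk x * w t x) - a0 * c)\<bar> \<le>
    (e1 + e2) * (sqrt W * (1 + measure (lebesgue_on B) B)) + \<bar>a0 * c\<bar> * (e1 * measure lborel B)"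
proof -
  obtain C where C: "\<And>z. \<bar>s z\<bar> \<le> C" using bounds(1) by blast
  have e1: "e1 \<ge> 0" using near(1)[of 0] by linarith
  have e2: "e2 \<ge> 0" using near(2)[of 0 0] R by (simp add: less_imp_le)
  have cm: "continuous_on UNIV (mol B s (w t))" by (rule jointly_continuous_space[OF mol_jointly_continuous[OF cont_s C B(2) L1_w(1)] t])
  have k': "\<And>x. x \<notin> cbox (x0 - (\<chi> i. R - \<kappa>)) (x0 + (\<chi> i. R - \<kappa>)) \<Longrightarrow> k x = 0" using k(2) by (simp add: micro_box_def)
  obtain K0 where K0: "\<And>x. \<bar>k x\<bar> \<le> K0" using continuous_supported_bounded[OF k(1) k'] by blast
  have p1: "pairing p k 0 t = integral D (\<lambda>x. k x * mol B s (w t) x) - a0 * c * integral D k"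
  proof -
    have "pairing p k 0 t = integral D (\<lambda>x. k x * mol B s (w t) x - a0 * c * k x)"
      by (simp add: pairing_def g_def algebra_simps)
    also have "\<dots> = integral D (\<lambda>x. k x * mol B s (w t) x) - integral D (\<lambda>x. a0 * c * k x)"
      by (intro Henstock_Kurzweil_Integration.integral_diff integrable_micro_box continuous_intros k cm)
    finally show ?thesis by simp
  qed
  have "integral D (\<lambda>x. k x * mol B s (w t) x) = (LINT x|lborel. k x * mol B s (w t) x)"
    unfolding micro_box_def
    by (rule compact_support_integrable(2)[symmetric]) (use k' in \<open>auto intro!: continuous_intros k cm[unfolded micro_box_def]\<close>)
  also have "\<dots> = (LINT y|lebesgue_on B. w t y * (LINT x|lborel. k x * s (x - y)))"
    by (rule mol_fubini[OF cont_s C B(1) integrable_w[OF t] borel_measurable_continuous_onI[OF k(1)] K0 k'])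
  finally have p2: "integral D (\<lambda>x. k x * mol B s (w t) x) = (LINT y|lebesgue_on B. w t y * (LINT x|lborel. k x * s (x - y)))" .
  define M where "M y = (LINT x|lborel. k x * s (x - y))" for y
  have ir: "integrable lborel (\<lambda>x. s (x - y))" for y
  proof (rule compact_support_integrable(1)[of _ "y - (\<chi> i. \<delta>)" "y + (\<chi> i. \<delta>)"])
    show "continuous_on UNIV (\<lambda>x. s (x - y))" by (intro continuous_on_compose2[OF cont_s] continuous_intros) auto
    fix x assume x: "x \<notin> cbox (y - (\<chi> i. \<delta>)) (y + (\<chi> i. \<delta>))"
    show "s (x - y) = 0"
    proof (rule ccontr)
      assume "s (x - y) \<noteq> 0"
      then have n: "\<bar>x $ j - y $ j\<bar> \<le> \<delta>" for j using mollifier.near[OF mollifier_axioms] by blast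
      have "y $ j - \<delta> \<le> x $ j \<and> x $ j \<le> y $ j + \<delta>" for j using n[of j] by linarith
      then show False using x by (simp add: mem_box_cart)
    qed
  qed
  have cks: "continuous_on UNIV (\<lambda>x. k x * s (x - y))" for y
    by (intro continuous_intros k continuous_on_compose2[OF cont_s]) auto
  have iks: "integrable lborel (\<lambda>x. k x * s (x - y))" "M y = integral D (\<lambda>x. k x * s (x - y))" for y
  proof -
    have "k x * s (x - y) = 0" if "x \<notin> cbox (x0 - (\<chi> i. R - \<kappa>)) (x0 + (\<chi> i. R - \<kappa>))" for x
      using k'[OF that] by simp
    from compact_support_integrable(1,2)[OF cks[of y] this]
    show "integrable lborel (\<lambda>x. k x * s (x - y))" "M y = integral D (\<lambda>x. k x * s (x - y))"
      by (auto simp: M_def micro_box_def)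
  qed
  have cM: "continuous_on UNIV M"
  proof -
    have "continuous_on UNIV (\<lambda>y. integral (cbox (x0 - (\<chi> i. R - \<kappa>)) (x0 + (\<chi> i. R - \<kappa>))) (\<lambda>x. k x * s (x - y)))"
    proof (rule integral_continuous_on_param)
      show "continuous_on (UNIV \<times> cbox (x0 - (\<chi> i. R - \<kappa>)) (x0 + (\<chi> i. R - \<kappa>))) (\<lambda>(y, x). k x * s (x - y))"
        unfolding split_beta by (intro continuous_on_mult continuous_on_compose2[OF k(1)] continuous_on_compose2[OF cont_s] continuous_intros) auto
    qed
    then show ?thesis using iks(2) by (simp add: micro_box_def cong: continuous_on_cong)
  qed
  have Mk: "\<bar>M y - kk y\<bar> \<le> e1 + e2" for y
  proof -
    have "M y - k y = (LINT x|lborel. k x * s (x - y)) - (LINT x|lborel. k y * s (x - y))" using mass(1) by (simp add: M_def)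
    also have "\<dots> = (LINT x|lborel. k x * s (x - y) - k y * s (x - y))"
      by (intro Bochner_Integration.integral_diff[symmetric] iks integrable_mult_right ir)
    also have "\<bar>\<dots>\<bar> \<le> (LINT x|lborel. \<bar>k x * s (x - y) - k y * s (x - y)\<bar>)" by (rule Bochner_Integration.integral_abs_bound)
    also have "\<dots> \<le> (LINT x|lborel. e2 * s (x - y))"
    proof (rule integral_mono)
      show "integrable lborel (\<lambda>x. \<bar>k x * s (x - y) - k y * s (x - y)\<bar>)"
        by (intro integrable_abs Bochner_Integration.integrable_diff iks integrable_mult_right ir)
      fix x
      show "\<bar>k x * s (x - y) - k y * s (x - y)\<bar> \<le> e2 * s (x - y)"
      proof (cases "s (x - y) = 0")
        case False
        then have "\<bar>x $ i - y $ i\<bar> \<le> \<delta>" for i using mollifier.near[OF mollifier_axioms] by blast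
        then have "\<bar>k x - k y\<bar> \<le> e2" by (rule near(2))
        then have "\<bar>k x - k y\<bar> * s (x - y) \<le> e2 * s (x - y)" by (rule mult_right_mono) (rule nonneg_s)
        then show ?thesis using nonneg_s[of "x - y"] by (simp add: abs_mult flip: left_diff_distrib)
      qed simp
    qed (intro integrable_mult_right ir)
    also have "\<dots> = e2" using mass(1) by simp
    finally show ?thesis using near(1)[of y] by linarith
  qed
  have wint: "integrable (lebesgue_on B) (\<lambda>y. w t y * h y)" if "continuous_on UNIV h" for h
  proof -
    have "bounded (h ` B)"
      unfolding micro_box_def by (intro compact_imp_bounded compact_continuous_image continuous_on_subset[OF that]) auto
    then obtain H where H: "\<And>y. y \<in> B \<Longrightarrow> \<bar>h y\<bar> \<le> H" by (auto simp: bounded_iff)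
    show ?thesis
    proof (rule Bochner_Integration.integrable_bound[of _ "\<lambda>y. H * w t y"])
      show "(\<lambda>y. w t y * h y) \<in> borel_measurable (lebesgue_on B)"
        using integrable_w[OF t] continuous_imp_measurable_on_sets_lebesgue[OF continuous_on_subset[OF that] B(2)]
        by (intro borel_measurable_times) auto
      show "AE y in lebesgue_on B. norm (w t y * h y) \<le> norm (H * w t y)"
      proof (rule AE_I2)
        fix y assume "y \<in> space (lebesgue_on B)"
        then have "\<bar>h y\<bar> \<le> \<bar>H\<bar>" using H[of y] by simp
        then have "\<bar>w t y\<bar> * \<bar>h y\<bar> \<le> \<bar>w t y\<bar> * \<bar>H\<bar>" by (intro mult_left_mono) auto
        then show "norm (w t y * h y) \<le> norm (H * w t y)" by (simp add: abs_mult mult.commute)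
      qed
    qed (use integrable_w[OF t] in simp)
  qed
  have "\<bar>(LINT y|lebesgue_on B. w t y * M y) - (LINT y|lebesgue_on B. w t y * kk y)\<bar> \<le> (LINT y|lebesgue_on B. (e1 + e2) * \<bar>w t y\<bar>)"
  proof -
    have "(LINT y|lebesgue_on B. w t y * M y) - (LINT y|lebesgue_on B. w t y * kk y) = (LINT y|lebesgue_on B. w t y * M y - w t y * kk y)"
      by (intro Bochner_Integration.integral_diff[symmetric] wint cM kk)
    also have "\<bar>\<dots>\<bar> \<le> (LINT y|lebesgue_on B. \<bar>w t y * M y - w t y * kk y\<bar>)" by (rule Bochner_Integration.integral_abs_bound)
    also have "\<dots> \<le> (LINT y|lebesgue_on B. (e1 + e2) * \<bar>w t y\<bar>)"
    proof (rule integral_mono)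
      show "integrable (lebesgue_on B) (\<lambda>y. \<bar>w t y * M y - w t y * kk y\<bar>)"
        by (intro integrable_abs Bochner_Integration.integrable_diff wint cM kk)
      show "integrable (lebesgue_on B) (\<lambda>y. (e1 + e2) * \<bar>w t y\<bar>)" using integrable_w[OF t] by simp
      show "\<bar>w t y * M y - w t y * kk y\<bar> \<le> (e1 + e2) * \<bar>w t y\<bar>" for y
      proof -
        have "w t y * M y - w t y * kk y = w t y * (M y - kk y)" by (simp add: right_diff_distrib)
        then show ?thesis using mult_left_mono[OF Mk[of y], of "\<bar>w t y\<bar>"] by (simp only: abs_mult mult.commute abs_ge_zero)
      qed
    qed
    finally show ?thesis .
  qed
  also have "\<dots> = (e1 + e2) * (LINT y|lebesgue_on B. \<bar>w t y\<bar>)" by simp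
  also have "\<dots> \<le> (e1 + e2) * (sqrt W * (1 + measure (lebesgue_on B) B))"
  proof (rule mult_left_mono)
    have "(LINT y|lebesgue_on B. \<bar>w t y\<bar>) \<le> norm_L2_on B (w t) * (1 + measure (lebesgue_on B) B)"
      by (rule square_integrable_L1(2)[OF B(1) square_integrable(1)[OF t]])
    also have "\<dots> \<le> sqrt W * (1 + measure (lebesgue_on B) B)"
      using W[OF t] by (intro mult_right_mono) (auto simp: norm_L2_on_def)
    finally show "(LINT y|lebesgue_on B. \<bar>w t y\<bar>) \<le> sqrt W * (1 + measure (lebesgue_on B) B)" .
  qed (use e1 e2 in simp)
  finally have A1: "\<bar>(LINT y|lebesgue_on B. w t y * M y) - (LINT y|lebesgue_on B. kk y * w t y)\<bar> \<le> (e1 + e2) * (sqrt W * (1 + measure (lebesgue_on B) B))"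
    by (simp add: mult.commute)
  have "integral D k = integral B k"
    by (rule integral_zero_outside) (use k(2) D_subset(2) in auto)
  moreover have "\<bar>integral B (\<lambda>x. k x - kk x)\<bar> \<le> integral B (\<lambda>x. e1)"
    by (intro integral_abs_le integrable_micro_box continuous_intros k kk near)
  moreover have "integral B (\<lambda>x. k x - kk x) = integral B k - integral B kk"
    by (intro Henstock_Kurzweil_Integration.integral_diff integrable_micro_box k kk)
  moreover have "integral B (\<lambda>x. e1) = e1 * measure lborel B" unfolding micro_box_def integral_const by (simp add: mult.commute)
  ultimately have A2: "\<bar>integral D k - 1\<bar> \<le> e1 * measure lborel B" using one by simp
  have "pairing p k 0 t - ((LINT x|lebesgue_on B. kk x * w t x) - a0 * c) =
     ((LINT y|lebesgue_on B. w t y * M y) - (LINT y|lebesgue_on B. kk y * w t y)) - (a0 * c) * (integral D k - 1)"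
    by (simp add: p1 p2 M_def algebra_simps)
  also have "\<bar>\<dots>\<bar> \<le> \<bar>(LINT y|lebesgue_on B. w t y * M y) - (LINT y|lebesgue_on B. kk y * w t y)\<bar> + \<bar>a0 * c\<bar> * \<bar>integral D k - 1\<bar>"
    by (simp only: abs_mult[symmetric] abs_triangle_ineq4)
  also have "\<dots> \<le> (e1 + e2) * (sqrt W * (1 + measure (lebesgue_on B) B)) + \<bar>a0 * c\<bar> * (e1 * measure lborel B)"
    by (intro add_mono A1 mult_left_mono A2) auto
  finally show ?thesis .
qed

end

section \<open>The upscaled quantity\<close>

lemma uniform_modulus_cbox:
  fixes f :: "real^'n \<Rightarrow> real"
  assumes f: "continuous_on (cbox p r) f" and e: "0 < e"
  shows "\<exists>d>0. \<forall>x\<in>cbox p r. \<forall>y\<in>cbox p r. (\<forall>i. \<bar>x $ i - y $ i\<bar> \<le> d) \<longrightarrow> \<bar>f x - f y\<bar> \<le> e"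
proof -
  have "uniformly_continuous_on (cbox p r) f" by (rule compact_uniformly_continuous[OF f compact_cbox])
  then obtain d where d: "d > 0" "\<And>x y. x \<in> cbox p r \<Longrightarrow> y \<in> cbox p r \<Longrightarrow> dist y x < d \<Longrightarrow> dist (f y) (f x) < e"
    using e unfolding uniformly_continuous_on_def by metis
  define d' where "d' = d / (2 * CARD('n))"
  have d': "d' > 0" using d(1) by (simp add: d'_def)
  have "\<bar>f x - f y\<bar> \<le> e" if "x \<in> cbox p r" "y \<in> cbox p r" "\<And>i. \<bar>x $ i - y $ i\<bar> \<le> d'" for x y
  proof -
    have "dist x y \<le> (\<Sum>i\<in>UNIV. \<bar>(x - y) $ i\<bar>)" unfolding dist_norm by (rule norm_le_l1_cart)
    also have "\<dots> \<le> (\<Sum>i\<in>(UNIV :: 'n set). d')" by (rule sum_mono) (use that(3) in simp)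
    also have "\<dots> < d" using d(1) by (simp add: d'_def)
    finally show ?thesis using d(2)[OF that(2,1)] by (simp add: dist_real_def)
  qed
  then show ?thesis using d' by blast
qed

lemma uniform_modulus:
  fixes f :: "real^'n \<Rightarrow> real"
  assumes f: "continuous_on UNIV f" "\<And>x. x \<notin> micro_box x0 l \<Longrightarrow> f x = 0" and e: "0 < e"
  shows "\<exists>d>0. \<forall>x y. (\<forall>i. \<bar>x $ i - y $ i\<bar> \<le> d) \<longrightarrow> \<bar>f x - f y\<bar> \<le> e"
proof -
  have "continuous_on (micro_box x0 (l + 1)) f" by (rule continuous_on_subset[OF f(1)]) simp
  then obtain d where d: "d > 0" "\<And>x y. x \<in> micro_box x0 (l + 1) \<Longrightarrow> y \<in> micro_box x0 (l + 1) \<Longrightarrow> (\<And>i. \<bar>x $ i - y $ i\<bar> \<le> d) \<Longrightarrow> \<bar>f x - f y\<bar> \<le> e"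
    using uniform_modulus_cbox[OF _ e] unfolding micro_box_def by meson
  define d' where "d' = min d 1"
  have "\<bar>f x - f y\<bar> \<le> e" if n: "\<And>i. \<bar>x $ i - y $ i\<bar> \<le> d'" for x y
  proof -
    have n1: "\<bar>x $ i - y $ i\<bar> \<le> 1" "\<bar>x $ i - y $ i\<bar> \<le> d" for i using n[of i] by (auto simp: d'_def)
    consider "x \<in> micro_box x0 l \<or> y \<in> micro_box x0 l" | "x \<notin> micro_box x0 l" "y \<notin> micro_box x0 l" by blast
    then show ?thesis
    proof cases
      case 1
      have "\<bar>x $ i - x0 $ i\<bar> \<le> l + 1 \<and> \<bar>y $ i - x0 $ i\<bar> \<le> l + 1" for i
      proof -
        have "\<bar>x $ i - x0 $ i\<bar> \<le> l \<or> \<bar>y $ i - x0 $ i\<bar> \<le> l" using 1 by (auto simp: micro_box_mem)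
        then show ?thesis using n1(1)[of i] by linarith
      qed
      then show ?thesis by (intro d(2) n1) (auto simp: micro_box_mem)
    qed (use f(2) e in simp)
  qed
  moreover have "d' > 0" using d(1) by (simp add: d'_def)
  ultimately show ?thesis by blast
qed

lemma has_partial_rescale:
  fixes f :: "real^'n \<Rightarrow> real"
  assumes "has_partial i f f'" 
  shows "has_partial i (\<lambda>x. k * f (x /\<^sub>R \<epsilon>)) (\<lambda>x. k * inverse \<epsilon> * f' (x /\<^sub>R \<epsilon>))"
  unfolding has_partial_def
proof
  fix x :: "real^'n"
  have "((\<lambda>s. f (x /\<^sub>R \<epsilon> + (inverse \<epsilon> * s) *\<^sub>R axis i 1)) has_real_derivative f' (x /\<^sub>R \<epsilon> + (inverse \<epsilon> * 0) *\<^sub>R axis i 1) * inverse \<epsilon>) (at 0)"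
    by (rule DERIV_chain2[OF has_partial_at[OF assms]]) (auto intro!: derivative_eq_intros)
  then have "((\<lambda>s. k * f (x /\<^sub>R \<epsilon> + (inverse \<epsilon> * s) *\<^sub>R axis i 1)) has_real_derivative k * (f' (x /\<^sub>R \<epsilon> + (inverse \<epsilon> * 0) *\<^sub>R axis i 1) * inverse \<epsilon>)) (at 0)"
    by (rule DERIV_cmult)
  then show "((\<lambda>s. k * f ((x + s *\<^sub>R axis i 1) /\<^sub>R \<epsilon>)) has_real_derivative k * inverse \<epsilon> * f' (x /\<^sub>R \<epsilon>)) (at 0)"
    by (simp add: scaleR_add_right mult_ac)
qed

lemma continuous_rescale:
  fixes f :: "real^'n \<Rightarrow> real"
  shows "continuous_on UNIV f \<Longrightarrow> continuous_on UNIV (\<lambda>x. f (x /\<^sub>R \<epsilon>))"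
  by (rule continuous_on_compose2[of UNIV f]) (auto intro!: continuous_intros)

lemma scaled_kernel_vec_props:
  fixes x :: "real^'n"
  assumes K: "continuous_on UNIV K" "\<And>t. 1/2 < \<bar>t\<bar> \<Longrightarrow> K t = 0" "\<And>t. \<bar>K t\<bar> \<le> Km" and \<eta>: "0 < \<eta>"
  shows "continuous_on UNIV (scaled_kernel_vec K \<eta> :: real^'n \<Rightarrow> real)"
    "\<bar>scaled_kernel_vec K \<eta> x\<bar> \<le> (Km / \<eta>) ^ CARD('n)"
    "x \<notin> micro_box 0 (\<eta> / 2) \<Longrightarrow> scaled_kernel_vec K \<eta> x = 0"
proof -
  show "continuous_on UNIV (scaled_kernel_vec K \<eta> :: real^'n \<Rightarrow> real)"
    unfolding scaled_kernel_vec_def[abs_def] scaled_kernel_def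
    by (intro continuous_intros continuous_on_compose2[OF K(1)]) (use \<eta> in auto)
  have "\<bar>scaled_kernel K \<eta> t\<bar> \<le> Km / \<eta>" for t
    using K(3)[of "t / \<eta>"] \<eta> by (simp add: scaled_kernel_def abs_mult abs_div divide_right_mono)
  then have "(\<Prod>i\<in>UNIV. \<bar>scaled_kernel K \<eta> (x $ i)\<bar>) \<le> (\<Prod>i\<in>(UNIV :: 'n set). Km / \<eta>)"
    by (intro prod_mono) auto
  then show "\<bar>scaled_kernel_vec K \<eta> x\<bar> \<le> (Km / \<eta>) ^ CARD('n)" by (simp add: scaled_kernel_vec_def abs_prod)
  assume "x \<notin> micro_box 0 (\<eta> / 2)"
  then obtain i where "\<bar>x $ i\<bar> > \<eta> / 2" by (auto simp: micro_box_mem not_le)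
  then have "scaled_kernel K \<eta> (x $ i) = 0"
    using \<eta> by (auto simp: scaled_kernel_def abs_div less_divide_eq intro!: K(2))
  then show "scaled_kernel_vec K \<eta> x = 0" unfolding scaled_kernel_vec_def by (meson UNIV_I finite prod_zero)
qed

lemma scaled_kernel_vec_integral:
  fixes x0 :: "real^'n"
  assumes K: "continuous_on UNIV K" "\<And>t. 1/2 < \<bar>t\<bar> \<Longrightarrow> K t = 0" "integral {-1/2..1/2} K = 1" and \<eta>: "0 < \<eta>" "\<eta> / 2 \<le> l"
  shows "integral (micro_box x0 l) (\<lambda>x. scaled_kernel_vec K \<eta> (x - x0)) = 1"
proof -
  have Kz: "K t = 0" if "t \<notin> cbox (-1/2) (1/2)" for t using K(2)[of t] that by (auto simp: abs_if)
  have iK: "integrable lborel K" "integral\<^sup>L lborel K = 1"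
    using compact_support_integrable(1,2)[OF K(1), of "-1/2" "1/2", OF Kz] K(3) by (simp_all add: box_real)
  have g: "integrable lborel (\<lambda>t. scaled_kernel K \<eta> (t - y))" "(LINT t|lborel. scaled_kernel K \<eta> (t - y)) = 1" for y
  proof -
    have e: "scaled_kernel K \<eta> (t - y) = (1 / \<eta>) * K (- y / \<eta> + (1 / \<eta>) * t)" for t
      by (simp add: scaled_kernel_def diff_divide_distrib)
    have "integrable lborel (\<lambda>t. K (- y / \<eta> + (1 / \<eta>) * t))"
      using iK(1) lborel_integrable_real_affine_iff[of "1 / \<eta>" K "- y / \<eta>"] \<eta> by simp
    then show "integrable lborel (\<lambda>t. scaled_kernel K \<eta> (t - y))" unfolding e by (rule integrable_mult_right)
    have "(LINT t|lborel. K t) = \<bar>1 / \<eta>\<bar> * (LINT t|lborel. K (- y / \<eta> + (1 / \<eta>) * t))"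
      using lborel_integral_real_affine[of "1 / \<eta>" K "- y / \<eta>"] \<eta> by simp
    then show "(LINT t|lborel. scaled_kernel K \<eta> (t - y)) = 1" unfolding e using iK(2) \<eta> by simp
  qed
  have "(LINT x|lborel. scaled_kernel_vec K \<eta> (x - x0)) = (LINT x|lborel. (\<Prod>i\<in>UNIV. scaled_kernel K \<eta> (x $ i - x0 $ i)))"
    by (simp add: scaled_kernel_vec_def)
  also have "\<dots> = (\<Prod>i\<in>UNIV. (LINT t|lborel. scaled_kernel K \<eta> (t - x0 $ i)))"
    by (rule integral_prod_vec) (rule g)
  also have "\<dots> = 1" by (simp only: g(2) prod.neutral_const)
  finally have one: "(LINT x|lborel. scaled_kernel_vec K \<eta> (x - x0)) = 1" .
  obtain Km where Km: "\<And>t. \<bar>K t\<bar> \<le> Km"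
    using continuous_supported_bounded[OF K(1), of "-1/2" "1/2"] K(2) by (force simp: abs_if)
  note props = scaled_kernel_vec_props[OF K(1,2) Km \<eta>(1), where 'n = 'n]
  have c: "continuous_on UNIV (\<lambda>x. scaled_kernel_vec K \<eta> (x - x0))"
    by (intro continuous_on_compose2[OF props(1)] continuous_intros) auto
  have z: "scaled_kernel_vec K \<eta> (x - x0) = 0" if x: "x \<notin> cbox (x0 - (\<chi> i. l)) (x0 + (\<chi> i. l))" for x
  proof (rule props(3))
    have "x \<notin> micro_box x0 l" using x by (simp add: micro_box_def)
    then obtain i where "l < \<bar>x $ i - x0 $ i\<bar>" by (auto simp: micro_box_mem not_le)
    then have "\<not> \<bar>(x - x0) $ i - 0 $ i\<bar> \<le> \<eta> / 2" using \<eta> by simp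
    then show "x - x0 \<notin> micro_box 0 (\<eta> / 2)" unfolding micro_box_mem by blast
  qed
  show ?thesis using compact_support_integrable(2)[OF c z] one by (simp add: micro_box_def)
qed

text \<open>Creates the margin 2 \<kappa> inside the support of the kernel by a dilation with factor
  q slightly above 1. The sup bound is preserved, and uniform continuity keeps the dilated kernel
  close to the original.\<close>

lemma shrunk_kernel_exists:
  fixes x0 :: "real^'n"
  assumes K: "continuous_on UNIV K" "\<And>t. 1/2 < \<bar>t\<bar> \<Longrightarrow> K t = 0" "\<And>t. \<bar>K t\<bar> \<le> Km" and \<eta>: "0 < \<eta>" and e: "0 < e"
  shows "\<exists>k \<kappa>. continuous_on UNIV k \<and> 0 < \<kappa> \<and> \<kappa> \<le> \<eta> / 2 \<and> (\<forall>x. \<bar>k x\<bar> \<le> (Km / \<eta>) ^ CARD('n)) \<and>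
    (\<forall>x. x \<notin> micro_box x0 (\<eta> / 2 - 2 * \<kappa>) \<longrightarrow> k x = 0) \<and> (\<forall>x. \<bar>k x - scaled_kernel_vec K \<eta> (x - x0)\<bar> \<le> e)"
proof -
  note props = scaled_kernel_vec_props[OF K \<eta>, where 'n = 'n]
  define f where "f = (scaled_kernel_vec K \<eta> :: real^'n \<Rightarrow> real)"
  obtain d where d: "d > 0" "\<And>x y. (\<And>i. \<bar>x $ i - y $ i\<bar> \<le> d) \<Longrightarrow> \<bar>f x - f y\<bar> \<le> e"
    using uniform_modulus[OF props(1,3) e] unfolding f_def by meson
  \<comment> \<open>Within distance \<eta> of the centre the dilation displaces a point by at most
    (q - 1) \<eta> = d; farther out both kernels vanish. The number \<kappa> is such that \<eta> / 2
    - 2 \<kappa> = \<eta> / (2 q).\<close>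
  define q where "q = 1 + d / \<eta>"
  have q: "q > 1" using d(1) \<eta> by (simp add: q_def)
  define k where "k x = f (q *\<^sub>R (x - x0))" for x
  define \<kappa> where "\<kappa> = \<eta> / 4 * (1 - 1 / q)"
  have iq: "0 < 1 / q" "1 / q < 1" using q by auto
  have "continuous_on UNIV k"
    unfolding k_def by (intro continuous_on_compose2[OF props(1)[folded f_def]] continuous_intros) auto
  moreover have "0 < \<kappa>" unfolding \<kappa>_def using \<eta> iq by (intro mult_pos_pos) auto
  moreover have "\<kappa> \<le> \<eta> / 2"
  proof -
    have "\<kappa> \<le> \<eta> / 4 * 1" unfolding \<kappa>_def using \<eta> iq by (intro mult_left_mono) auto
    then show ?thesis using \<eta> by simp
  qed
  moreover have "\<bar>k x\<bar> \<le> (Km / \<eta>) ^ CARD('n)" for x unfolding k_def f_def by (rule props(2))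
  moreover have "k x = 0" if x: "x \<notin> micro_box x0 (\<eta> / 2 - 2 * \<kappa>)" for x
    unfolding k_def f_def
  proof (rule props(3))
    obtain i where i: "\<eta> / 2 - 2 * \<kappa> < \<bar>x $ i - x0 $ i\<bar>" using x by (auto simp: micro_box_mem not_le)
    have "\<eta> / 2 - 2 * \<kappa> = \<eta> / 2 * (1 / q)" using q by (simp add: \<kappa>_def field_simps)
    then have "q * (\<eta> / 2 * (1 / q)) < q * \<bar>x $ i - x0 $ i\<bar>" using i q by (intro mult_strict_left_mono) auto
    then have "\<eta> / 2 < \<bar>q * (x $ i - x0 $ i)\<bar>" using q by (simp add: abs_mult)
    then have "\<not> \<bar>(q *\<^sub>R (x - x0)) $ i - 0 $ i\<bar> \<le> \<eta> / 2" by simp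
    then show "q *\<^sub>R (x - x0) \<notin> micro_box 0 (\<eta> / 2)" unfolding micro_box_mem by blast
  qed
  moreover have "\<bar>k x - f (x - x0)\<bar> \<le> e" for x
  proof (cases "x - x0 \<in> micro_box 0 \<eta>")
    case True
    show ?thesis unfolding k_def
    proof (rule d(2))
      fix i
      have "\<bar>(x - x0) $ i\<bar> \<le> \<eta>" using True by (simp add: micro_box_mem)
      then have "d / \<eta> * \<bar>(x - x0) $ i\<bar> \<le> d / \<eta> * \<eta>" using d(1) \<eta> by (intro mult_left_mono) auto
      moreover have "(q *\<^sub>R (x - x0)) $ i - (x - x0) $ i = d / \<eta> * (x - x0) $ i" by (simp add: q_def algebra_simps)
      ultimately show "\<bar>(q *\<^sub>R (x - x0)) $ i - (x - x0) $ i\<bar> \<le> d" using d(1) \<eta> by (simp only: abs_mult) simp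
    qed
  next
    case False
    then obtain i where i: "\<eta> < \<bar>(x - x0) $ i\<bar>" by (auto simp: micro_box_mem not_le)
    have "f (x - x0) = 0" unfolding f_def
    proof (rule props(3))
      have "\<not> \<bar>(x - x0) $ i - 0 $ i\<bar> \<le> \<eta> / 2" using i \<eta> by simp
      then show "x - x0 \<notin> micro_box 0 (\<eta> / 2)" unfolding micro_box_mem by blast
    qed
    moreover have "k x = 0" unfolding k_def f_def
    proof (rule props(3))
      have "1 * \<bar>(x - x0) $ i\<bar> \<le> q * \<bar>(x - x0) $ i\<bar>" using q by (intro mult_right_mono) auto
      then have "\<eta> < \<bar>q * (x - x0) $ i\<bar>" using i q by (simp add: abs_mult)
      then have "\<not> \<bar>(q *\<^sub>R (x - x0)) $ i - 0 $ i\<bar> \<le> \<eta> / 2" using \<eta> by simp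
      then show "q *\<^sub>R (x - x0) \<notin> micro_box 0 (\<eta> / 2)" unfolding micro_box_mem by blast
    qed
    ultimately show ?thesis using e by simp
  qed
  ultimately show ?thesis unfolding f_def by blast
qed

section \<open>The upscaled quantity as a time average\<close>

lemma time_integral_rescale:
  fixes F :: "real \<Rightarrow> real"
  assumes F: "continuous_on {-\<tau>/2..\<tau>/2} F" and \<tau>: "0 < \<tau>"
  shows "integral {-\<tau>/2..\<tau>/2} F = \<tau> * integral {-1/2..1/2} (\<lambda>\<sigma>. F (\<tau> * \<sigma>))"
proof -
  define J where "J = integral {-\<tau>/2..\<tau>/2} F"
  have "(F has_integral J) (cbox (-\<tau>/2) (\<tau>/2))"
    unfolding J_def box_real(2) by (rule integrable_integral[OF integrable_continuous_interval[OF F]])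
  note h = has_integral_affinity'[OF this \<tau>, of 0]
  have e: "(-\<tau>/2 - 0) /\<^sub>R \<tau> = -1/2" "(\<tau>/2 - 0) /\<^sub>R \<tau> = 1/2" using \<tau> by simp_all
  have "integral {-1/2..1/2} (\<lambda>\<sigma>. F (\<tau> * \<sigma>)) = J /\<^sub>R \<tau>"
    using integral_unique[OF h] unfolding e by (simp only: box_real real_scaleR_def add_0_right DIM_real power_one_right)
  then have "\<tau> * integral {-1/2..1/2} (\<lambda>\<sigma>. F (\<tau> * \<sigma>)) = J" using \<tau> by (simp only: real_scaleR_def) simp
  then show ?thesis by (simp only: J_def)
qed

text \<open>Measurability of \<open>g\<close> follows from completeness of Lebesgue measure, so the
  representative chosen by \<open>weak_laplacian\<close> need not be inspected.\<close>

lemma lebesgue_on_integral_cong_AE: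
  fixes f g :: "real^'n \<Rightarrow> real"
  assumes B: "B \<in> sets lebesgue" and f: "f \<in> borel_measurable (lebesgue_on B)"
    and ae: "AE x in lebesgue_on B. f x = g x"
  shows "(LINT x|lebesgue_on B. f x) = (LINT x|lebesgue_on B. g x)"
proof -
  have ae': "AE x in lebesgue. indicator B x *\<^sub>R f x = indicator B x *\<^sub>R g x"
    using ae B by (subst (asm) AE_restrict_space_iff) (auto elim!: eventually_mono simp: indicator_def)
  have m: "(\<lambda>x. indicator B x *\<^sub>R f x) \<in> borel_measurable lebesgue"
    using f B by (simp add: borel_measurable_restrict_space_iff)
  have "(LINT x|lebesgue. indicator B x *\<^sub>R f x) = (LINT x|lebesgue. indicator B x *\<^sub>R g x)"
    by (rule integral_cong_AE[OF m borel_measurable_AE[OF m ae'] ae'])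
  then show ?thesis using B by (simp add: integral_restrict_space)
qed

lemma upscaled_eq:
  fixes a :: "real^'n \<Rightarrow> real"
  assumes K: "continuous_on UNIV K" and \<tau>: "0 < \<tau>"
    and w: "\<And>t. t \<in> {0<..\<tau>/2} \<Longrightarrow> AE x in lebesgue_on (micro_box x0 l). w t x = a (x /\<^sub>R \<epsilon>) * weak_laplacian (u t) x"
    and m: "\<And>t. t \<in> {0..\<tau>/2} \<Longrightarrow> w t \<in> borel_measurable (lebesgue_on (micro_box x0 l))"
    and kk: "continuous_on UNIV kk" "\<And>x. kk x = scaled_kernel_vec K \<eta> (x - x0)"
    and \<Phi>: "\<And>t. \<Phi> t = (LINT x|lebesgue_on (micro_box x0 l). kk x * w t x)" "continuous_on {0..\<tau>/2} \<Phi>"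
  shows "upscaled K a \<epsilon> \<eta> \<tau> l x0 u = integral {-1/2..1/2} (\<lambda>\<sigma>. K \<sigma> * \<Phi> (\<tau> * \<bar>\<sigma>\<bar>))"
proof -
  define B where "B = micro_box x0 l"
  have B: "B \<in> sets lebesgue" by (simp add: B_def micro_box_def)
  define I where "I = {-\<tau>/2..\<tau>/2}"
  define F where "F t = (LINT x|lebesgue_on B. scaled_kernel_vec K \<eta> (x - x0) * scaled_kernel K \<tau> t *
        a (x /\<^sub>R \<epsilon>) * weak_laplacian (even_extension u t) x)" for t
  define G where "G t = scaled_kernel K \<tau> t * \<Phi> \<bar>t\<bar>" for t
  have km: "kk \<in> borel_measurable (lebesgue_on B)"
    by (rule continuous_imp_measurable_on_sets_lebesgue[OF continuous_on_subset[OF kk(1)] B]) simp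
  have FG: "F t = G t" if t: "t \<in> I" "t \<noteq> 0" for t
  proof -
    have t': "\<bar>t\<bar> \<in> {0<..\<tau>/2}" "\<bar>t\<bar> \<in> {0..\<tau>/2}" using t by (auto simp: I_def)
    have "AE x in lebesgue_on B. scaled_kernel K \<tau> t * (kk x * w \<bar>t\<bar> x) =
      scaled_kernel_vec K \<eta> (x - x0) * scaled_kernel K \<tau> t * a (x /\<^sub>R \<epsilon>) * weak_laplacian (even_extension u t) x"
      using w[OF t'(1)] unfolding B_def[symmetric] by eventually_elim (simp add: kk(2) even_extension_def mult_ac)
    moreover have "(\<lambda>x. scaled_kernel K \<tau> t * (kk x * w \<bar>t\<bar> x)) \<in> borel_measurable (lebesgue_on B)"
      using km m[OF t'(2)] unfolding B_def[symmetric] by (intro borel_measurable_times borel_measurable_const)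
    ultimately have "F t = (LINT x|lebesgue_on B. scaled_kernel K \<tau> t * (kk x * w \<bar>t\<bar> x))"
      unfolding F_def by (intro lebesgue_on_integral_cong_AE[OF B, symmetric])
    then show ?thesis by (simp add: G_def \<Phi>(1) B_def)
  qed
  have cG: "continuous_on I G"
    unfolding G_def scaled_kernel_def I_def
    by (intro continuous_intros continuous_on_compose2[OF K] continuous_on_compose2[OF \<Phi>(2)]) (use \<tau> in auto)
  have "upscaled K a \<epsilon> \<eta> \<tau> l x0 u = (LINT t|lebesgue_on I. F t)"
    by (simp add: upscaled_def F_def I_def B_def)
  also have "\<dots> = (LINT t|lebesgue. indicator I t *\<^sub>R F t)"
    by (rule integral_restrict_space) (simp add: I_def)
  also have "\<dots> = (LINT t|lebesgue. indicator I t *\<^sub>R G t)"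
    by (rule integral_discrete_difference[where X = "{0}"]) (auto simp: FG indicator_def)
  also have "\<dots> = integral I G"
  proof -
    have si: "integrable lborel (\<lambda>t. indicator I t *\<^sub>R G t)"
      unfolding I_def by (rule borel_integrable_compact) (use cG in \<open>auto simp: I_def\<close>)
    then have "(LINT t|lebesgue. indicator I t *\<^sub>R G t) = (LINT t|lborel. indicator I t *\<^sub>R G t)"
      by (intro integral_completion borel_measurable_integrable)
    also have "\<dots> = integral I G"
      using set_borel_integral_eq_integral(2)[of I G] si by (simp add: set_lebesgue_integral_def set_integrable_def)
    finally show ?thesis .
  qed
  also have "\<dots> = \<tau> * integral {-1/2..1/2} (\<lambda>\<sigma>. G (\<tau> * \<sigma>))"
    unfolding I_def by (rule time_integral_rescale[OF cG[unfolded I_def] \<tau>])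
  also have "(\<lambda>\<sigma>. G (\<tau> * \<sigma>)) = (\<lambda>\<sigma>. (1 / \<tau>) * (K \<sigma> * \<Phi> (\<tau> * \<bar>\<sigma>\<bar>)))"
    using \<tau> by (simp add: G_def scaled_kernel_def abs_mult fun_eq_iff)
  also have "\<tau> * integral {-1/2..1/2} (\<lambda>\<sigma>. (1 / \<tau>) * (K \<sigma> * \<Phi> (\<tau> * \<bar>\<sigma>\<bar>))) = integral {-1/2..1/2} (\<lambda>\<sigma>. K \<sigma> * \<Phi> (\<tau> * \<bar>\<sigma>\<bar>))"
    unfolding integral_mult_right using \<tau> by simp
  finally show ?thesis .
qed

text \<open>Parameters are chosen in the order of their dependence: first k and \<kappa> from
  \<zeta>, then the smallness \<omega> from the constants of the chain, then the correctors of
  accuracy \<omega>, and last the width \<delta> of the mollifier from the moduli of k and b. The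
  factor in front of \<epsilon>^(q + 2) involves none of these choices, so \<zeta> may tend to 0
  afterwards.\<close>

lemma chain_approximation:
  fixes a uhat :: "real^'n \<Rightarrow> real" and u v w :: "real \<Rightarrow> real^'n \<Rightarrow> real" and x0 :: "real^'n"
  assumes K: "continuous_on UNIV K" "\<And>t. 1/2 < \<bar>t\<bar> \<Longrightarrow> K t = 0" "\<And>t. \<bar>K t\<bar> \<le> Km" "integral {-1/2..1/2} K = 1"
    and a: "continuous_on UNIV a" "\<And>x. m \<le> a x" "0 < m" "\<And>x. a x \<le> A"
    and cor: "\<forall>d. 0 < d \<longrightarrow> d \<le> 1 \<longrightarrow> (\<exists>\<psi> D1 D2. \<psi> 0 = (\<lambda>x. a x - a0) \<and>
      (\<forall>j. continuous_on UNIV (\<psi> j) \<and> (\<forall>x. \<bar>\<psi> j x\<bar> \<le> C j) \<and>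
        (\<forall>i. continuous_on UNIV (D1 (Suc j) i) \<and> continuous_on UNIV (D2 (Suc j) i) \<and>
          has_partial i (\<psi> (Suc j)) (D1 (Suc j) i) \<and> has_partial i (D1 (Suc j) i) (D2 (Suc j) i)) \<and>
        (\<forall>x. \<bar>(\<Sum>i\<in>UNIV. D2 (Suc j) i x) - \<psi> j x / a x\<bar> \<le> d)))"
    and par: "0 < \<epsilon>" "\<epsilon> < \<eta>" "\<eta> / 2 + \<eta> / 2 * sqrt A \<le> l"
    and uv: "has_L2_derivative {0..\<eta>/2} (micro_box x0 l) u v"
    and vw: "has_L2_derivative {0..\<eta>/2} (micro_box x0 l) v w"
    and w: "L2_continuous {0..\<eta>/2} (micro_box x0 l) w"
    and lap: "\<And>t. t \<in> {0<..\<eta>/2} \<Longrightarrow> \<exists>g. has_weak_laplacian (u t) g \<and> (AE x in lebesgue_on (micro_box x0 l). w t x = a (x /\<^sub>R \<epsilon>) * g x)"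
    and u0: "AE x in lebesgue_on (micro_box x0 l). u 0 x = uhat x"
    and v0: "AE x in lebesgue_on (micro_box x0 l). v 0 x = 0"
    and uhat: "continuous_on UNIV uhat" "\<And>i. continuous_on UNIV (U1 i)" "\<And>i. has_partial i uhat (U1 i)"
      "\<And>i. has_partial i (U1 i) (\<lambda>x. dd i)" "c = (\<Sum>i\<in>UNIV. dd i)"
    and \<zeta>: "0 < \<zeta>"
  shows "\<exists>f. continuous_on {0..\<eta>/2} (f 0) \<and>
    (\<forall>j. \<forall>t\<in>{0..\<eta>/2}. (f (Suc j) has_real_derivative f j t) (at t within {0..\<eta>/2})) \<and>
    (\<forall>j. odd j \<longrightarrow> f j 0 = (0::real)) \<and>
    (\<forall>t\<in>{0..\<eta>/2}. \<bar>f (q + 2) t\<bar> \<le> (Km * (1 + sqrt A)) ^ CARD('n) * (1 + A) / 2 *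
       (sqrt (exp 1 * (1 / m)) * (9 * C (q div 2 + 1) + 9 * C (q div 2 + 2))) * \<bar>c\<bar> * \<epsilon> ^ (q + 2) + \<zeta>) \<and>
    (\<forall>t\<in>{0..\<eta>/2}. \<bar>f 0 t - ((LINT x|lebesgue_on (micro_box x0 l). scaled_kernel_vec K \<eta> (x - x0) * w t x) - a0 * c)\<bar> \<le> \<zeta>)"
proof -
  have \<eta>: "0 < \<eta>" using par by simp
  have ap: "0 < a x" for x using a(2)[of x] a(3) by simp
  have A: "0 < A" using ap[of 0] a(4)[of 0] by linarith
  define T where "T = \<eta> / 2"
  have T: "T > 0" using \<eta> by (simp add: T_def)
  \<comment> \<open>The base of the backward cone with exactly the support of the kernel on top;
    \<open>par(3)\<close> puts it inside the box.\<close>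
  define R where "R = \<eta> / 2 + sqrt A * T"
  have sA: "sqrt A \<ge> 0" using A by simp
  have Rl: "\<eta> / 2 \<le> R" "R \<le> l" using par(3) T A by (auto simp: R_def T_def mult.commute)
  define vol where "vol = (2 * R) ^ CARD('n)"
  have vol: "vol > 0" using Rl \<eta> by (simp add: vol_def)
  have Km: "Km \<ge> 0" using K(3)[of 0] by linarith
  define k0 where "k0 = (Km / \<eta>) ^ CARD('n)"
  \<comment> \<open>Scale invariance: the base has side \<eta> (1 + sqrt A), which cancels \<eta> in
    the sup bound of the kernel.\<close>
  have k0vol: "k0 * vol = (Km * (1 + sqrt A)) ^ CARD('n)"
  proof -
    have "2 * R = \<eta> * (1 + sqrt A)" by (simp add: R_def T_def algebra_simps)
    then have "Km / \<eta> * (2 * R) = Km * (1 + sqrt A)" using \<eta> by simp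
    then show ?thesis unfolding k0_def vol_def power_mult_distrib[symmetric] by (rule arg_cong)
  qed
  define S where "S = k0 * vol * (1 + A) / 2"
  have S0: "S \<ge> 0" using Km \<eta> vol A by (auto simp: S_def k0_def)
  define s0 where "s0 = sqrt (exp 1 * (1 / m))"
  have s0: "s0 \<ge> 0" using a(3) by (simp add: s0_def)
  obtain W where W: "W \<ge> 0" "\<And>t. t \<in> {0..T} \<Longrightarrow> (LINT x|lebesgue_on (micro_box x0 l). (w t x)\<^sup>2) \<le> W"
    using L2_continuous_bounded[OF w] T unfolding T_def by auto
  define L where "L = sqrt W * (1 + measure (lebesgue_on (micro_box x0 l)) (micro_box x0 l))"
  define V where "V = measure lborel (micro_box x0 l)"
  have LV: "L \<ge> 0" "V \<ge> 0" using W(1) by (auto simp: L_def V_def)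
  \<comment> \<open>The denominator is the total factor with which e' enters
    \<open>pairing_initial_compare\<close>, plus 1 to make it positive.\<close>
  define e' where "e' = \<zeta> / (2 * L + \<bar>a0 * c\<bar> * V + 1)"
  have den: "2 * L + \<bar>a0 * c\<bar> * V + 1 > 0" using LV by (intro add_nonneg_pos add_nonneg_nonneg mult_nonneg_nonneg) auto
  have e': "e' > 0" unfolding e'_def using \<zeta> den by (rule divide_pos_pos)
  define kk where "kk x = scaled_kernel_vec K \<eta> (x - x0)" for x
  have ckk: "continuous_on UNIV kk"
    unfolding kk_def by (intro continuous_on_compose2[OF scaled_kernel_vec_props(1)[OF K(1-3) \<eta>]] continuous_intros) auto
  obtain k \<kappa> where k: "continuous_on UNIV k" "0 < \<kappa>" "\<kappa> \<le> \<eta> / 2" "\<And>x. \<bar>k x\<bar> \<le> k0"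
    "\<And>x. x \<notin> micro_box x0 (\<eta> / 2 - 2 * \<kappa>) \<Longrightarrow> k x = 0" "\<And>x. \<bar>k x - kk x\<bar> \<le> e'"
    using shrunk_kernel_exists[OF K(1-3) \<eta> e', of x0] unfolding kk_def k0_def by blast
  obtain \<delta>1 where \<delta>1: "\<delta>1 > 0" "\<And>x y. (\<And>i. \<bar>x $ i - y $ i\<bar> \<le> \<delta>1) \<Longrightarrow> \<bar>k x - k y\<bar> \<le> e'"
    using uniform_modulus[OF k(1,5) e'] by meson
  define b where "b x = 1 / a (x /\<^sub>R \<epsilon>)" for x
  have b: "continuous_on UNIV b" "1 / A \<le> b x" "b x \<le> 1 / m" for x
  proof -
    have "a x \<noteq> 0" for x using ap[of x] by simp
    then show "continuous_on UNIV b" unfolding b_def by (intro continuous_intros continuous_rescale a) auto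
    show "1 / A \<le> b x" "b x \<le> 1 / m" unfolding b_def using a(2-4) ap by (auto intro!: frac_le)
  qed
  \<comment> \<open>The size of the initial defect: p of order j + 1 carries \<epsilon>^(j + 1), and
    p2 of order j + 3 loses two powers to two derivatives.\<close>
  define P where "P j = \<epsilon> ^ (j + 1)" for j
  have P0: "0 \<le> P j" for j using par(1) by (simp add: P_def)
  define Kr where "Kr n = rec_nat (P 0 + 1 + T) (\<lambda>j K. P (Suc j) + T * K) (2 * n)" for n
  \<comment> \<open>Order q + 2 is 2 j0 + 2 for even q; for odd q it lies between the even orders 2
    j0 + 2 = q + 1 and 2 j0 + 4 = q + 3, so the bounds are prepared for j0 and its
    successor.\<close>
  define j0 where "j0 = q div 2"
  \<comment> \<open>8 / \<epsilon> and \<epsilon> / 4 are the weights of Landau interpolation with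
    step \<epsilon> / 4; the 1 covers even q, where no interpolation takes place.\<close>
  define \<zeta>e where "\<zeta>e = \<zeta> / (S * (8 / \<epsilon> + \<epsilon> / 4 + 1) + 1)"
  have den2: "S * (8 / \<epsilon> + \<epsilon> / 4 + 1) + 1 > 0" using S0 par(1) by (intro add_nonneg_pos mult_nonneg_nonneg) auto
  have \<zeta>e: "\<zeta>e > 0" unfolding \<zeta>e_def using \<zeta> den2 by (rule divide_pos_pos)
  define X where "X = exp 1 * (T\<^sup>2 * A * (2 * ((Kr j0)\<^sup>2 + (Kr (Suc j0))\<^sup>2)))"
  define Y where "Y = T\<^sup>2 * W + c\<^sup>2 * vol"
  have XY: "X \<ge> 0" "Y \<ge> 0" using A W(1) vol by (auto simp: X_def Y_def)
  define \<mu> where "\<mu> = vol * \<zeta>e\<^sup>2 / (X * Y + 1)"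
  have XY1: "X * Y + 1 > 0" using XY by (intro add_nonneg_pos mult_nonneg_nonneg) auto
  have \<mu>: "\<mu> > 0" unfolding \<mu>_def using vol \<zeta>e XY1 by (intro divide_pos_pos mult_pos_pos) auto
  \<comment> \<open>One number bounds both the oscillation of b and the error in the corrector
    equations. Both enter the energy quadratically, so only the square has to be below
    \<mu>.\<close>
  define \<omega> where "\<omega> = min 1 (sqrt \<mu>)"
  have \<omega>: "0 < \<omega>" "\<omega> \<le> 1" "\<omega>\<^sup>2 \<le> \<mu>"
  proof -
    show "0 < \<omega>" "\<omega> \<le> 1" using \<mu> by (auto simp: \<omega>_def)
    then have "\<omega>\<^sup>2 \<le> (sqrt \<mu>)\<^sup>2" by (intro power_mono) (auto simp: \<omega>_def)
    then show "\<omega>\<^sup>2 \<le> \<mu>" using \<mu> by simp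
  qed
  have small: "exp 1 * (T\<^sup>2 * A * (2 * (Kr n)\<^sup>2 * (\<omega>\<^sup>2 * (T\<^sup>2 * W) + (\<bar>c\<bar> * \<omega>)\<^sup>2 * vol))) \<le> vol * \<zeta>e\<^sup>2"
    if n: "n = j0 \<or> n = Suc j0" for n
  proof -
    have "exp 1 * (T\<^sup>2 * A * (2 * (Kr n)\<^sup>2 * (\<omega>\<^sup>2 * (T\<^sup>2 * W) + (\<bar>c\<bar> * \<omega>)\<^sup>2 * vol))) =
        exp 1 * (T\<^sup>2 * A * (2 * (Kr n)\<^sup>2)) * (\<omega>\<^sup>2 * Y)"
      by (simp add: Y_def power_mult_distrib algebra_simps)
    also have "\<dots> \<le> X * (\<mu> * Y)"
    proof (intro mult_mono)
      have "(Kr n)\<^sup>2 \<le> (Kr j0)\<^sup>2 + (Kr (Suc j0))\<^sup>2" using n by auto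
      then show "exp 1 * (T\<^sup>2 * A * (2 * (Kr n)\<^sup>2)) \<le> X" unfolding X_def using A by (intro mult_left_mono) auto
    qed (use \<omega> XY \<mu> in auto)
    also have "\<dots> = vol * \<zeta>e\<^sup>2 * (X * Y / (X * Y + 1))" by (simp add: \<mu>_def)
    also have "\<dots> \<le> vol * \<zeta>e\<^sup>2 * 1"
      using XY1 XY vol by (intro mult_left_mono) (auto simp: divide_le_eq)
    finally show ?thesis by simp
  qed
  obtain \<psi> P1 P2 where \<psi>0: "\<psi> 0 = (\<lambda>x. a x - a0)" and \<psi>: "\<And>j. continuous_on UNIV (\<psi> j)" "\<And>j x. \<bar>\<psi> j x\<bar> \<le> C j"
      "\<And>j i. continuous_on UNIV (P1 (Suc j) i)" "\<And>j i. continuous_on UNIV (P2 (Suc j) i)"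
      "\<And>j i. has_partial i (\<psi> (Suc j)) (P1 (Suc j) i)" "\<And>j i. has_partial i (P1 (Suc j) i) (P2 (Suc j) i)"
      "\<And>j x. \<bar>(\<Sum>i\<in>UNIV. P2 (Suc j) i x) - \<psi> j x / a x\<bar> \<le> \<omega>"
    using cor[rule_format, OF \<omega>(1,2)] by blast
  have C0: "0 \<le> C j" for j using \<psi>(2)[of j 0] by linarith
  obtain \<delta>2 where \<delta>2: "\<delta>2 > 0" "\<And>x y. x \<in> micro_box x0 l \<Longrightarrow> y \<in> micro_box x0 l \<Longrightarrow> (\<And>i. \<bar>x $ i - y $ i\<bar> \<le> \<delta>2) \<Longrightarrow> \<bar>b x - b y\<bar> \<le> \<omega>"
    using uniform_modulus_cbox[OF continuous_on_subset[OF b(1) subset_UNIV] \<omega>(1)] unfolding micro_box_def by meson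
  define \<delta> where "\<delta> = min (min \<delta>1 \<delta>2) \<kappa>"
  have \<delta>: "0 < \<delta>" "\<delta> \<le> \<delta>1" "\<delta> \<le> \<delta>2" "\<delta> \<le> \<kappa>" using \<delta>1(1) \<delta>2(1) k(2) by (auto simp: \<delta>_def)
  obtain s :: "real^'n \<Rightarrow> real" and D1 D2 where s: "\<forall>x. smooth (\<lambda>y. s (x - y))" "continuous_on UNIV s"
    "\<forall>i. continuous_on UNIV (D1 i) \<and> continuous_on UNIV (D2 i) \<and> has_partial i s (D1 i) \<and> has_partial i (D1 i) (D2 i)"
    "\<forall>z. 0 \<le> s z" "\<forall>z. z \<notin> cbox (- (\<chi> i. \<delta>)) (\<chi> i. \<delta>) \<longrightarrow> s z = 0 \<and> (\<forall>i. D1 i z = 0 \<and> D2 i z = 0)"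
    "\<forall>y. (LINT x|lborel. s (x - y)) = 1" "\<forall>x. (LINT y|lborel. s (x - y)) = 1"
    using mollifier_exists[OF \<delta>(1), where 'n = 'n] by (elim exE conjE) (rule that)
  have lap': "\<exists>g. has_weak_laplacian (u t) g \<and> (AE x in lebesgue_on (micro_box x0 l). g x = b x * w t x)" if t: "t \<in> {0<..T}" for t
  proof -
    obtain g where g: "has_weak_laplacian (u t) g" "AE x in lebesgue_on (micro_box x0 l). w t x = a (x /\<^sub>R \<epsilon>) * g x"
      using lap t unfolding T_def by blast
    have "AE x in lebesgue_on (micro_box x0 l). g x = b x * w t x"
      using g(2)
    proof eventually_elim
      case (elim x)
      then show ?case using ap[of "x /\<^sub>R \<epsilon>"] by (simp add: b_def)
    qed
    with g(1) show ?thesis by blast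
  qed
  interpret micro s D1 D2 \<delta> b T A R l c a0 "1 / m" \<omega> W x0 u v w uhat U1 dd \<kappa>
  proof (unfold_locales, goal_cases)
    case (33 x y)
    show ?case by (rule \<delta>2(2)[OF 33(1,2)]) (use 33(3) \<delta>(3) order_trans in blast)
  qed (use s T A \<delta> k(3) Rl b uv vw w lap' u0 v0 uhat \<omega> W in \<open>auto simp: T_def[symmetric]\<close>)
  \<comment> \<open>Correctors sit at the even orders from 2 on. The factor c appears because the
    first cell problem is driven by c (1 - a0 b), and \<epsilon>^j undoes the scaling of j spatial
    derivatives.\<close>
  define p where "p j x = (if even j \<and> 2 \<le> j then (c * \<epsilon> ^ j) * \<psi> (j div 2) (x /\<^sub>R \<epsilon>) else 0)" for j x
  define p1 where "p1 i j x = (if even j \<and> 2 \<le> j then (c * \<epsilon> ^ j * inverse \<epsilon>) * P1 (j div 2) i (x /\<^sub>R \<epsilon>) else 0)" for i j x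
  define p2 where "p2 i j x = (if even j \<and> 2 \<le> j then (c * \<epsilon> ^ j * inverse \<epsilon> * inverse \<epsilon>) * P2 (j div 2) i (x /\<^sub>R \<epsilon>) else 0)" for i j x
  have ex: "\<exists>n. j div 2 = Suc n" if "even j \<and> 2 \<le> j" for j :: nat
    using that by (intro exI[of _ "j div 2 - 1"]) auto
  have p: "continuous_on UNIV (p j)" "continuous_on UNIV (p1 i j)" "continuous_on UNIV (p2 i j)"
    "has_partial i (p j) (p1 i j)" "has_partial i (p1 i j) (p2 i j)" for i j
  proof -
    have z: "has_partial i (\<lambda>x. 0) (\<lambda>x. 0)" by (simp add: has_partial_def)
    show "continuous_on UNIV (p j)" "continuous_on UNIV (p1 i j)" "continuous_on UNIV (p2 i j)"
      "has_partial i (p j) (p1 i j)" "has_partial i (p1 i j) (p2 i j)"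
      using ex[of j] z unfolding p_def[abs_def] p1_def[abs_def] p2_def[abs_def]
      by (cases "even j \<and> 2 \<le> j"; auto intro!: continuous_intros continuous_rescale has_partial_rescale \<psi>)+
  qed
  have odd: "p1 i j x = 0" "p j x = 0" if "odd j" for i j x using that by (auto simp: p_def p1_def)
  have odd2: "p2 i (Suc 0) x = 0" for i x by (simp add: p2_def)
  have canc: "c * \<epsilon> ^ (n + 2) * inverse \<epsilon> * inverse \<epsilon> = c * \<epsilon> ^ n" for n
    using par(1) by (simp add: power_add power2_eq_square field_simps)
  have e2: "\<bar>c * (1 - a0 * b x) - (\<Sum>i\<in>UNIV. p2 i 2 x)\<bar> \<le> \<bar>c\<bar> * \<omega>" for x
  proof -
    define y where "y = x /\<^sub>R \<epsilon>"
    have "p2 i 2 x = c * P2 (Suc 0) i y" for i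
    proof -
      have "p2 i 2 x = (c * \<epsilon> ^ (0 + 2) * inverse \<epsilon> * inverse \<epsilon>) * P2 (Suc 0) i y"
        by (simp add: p2_def y_def power2_eq_square)
      then show ?thesis unfolding canc by simp
    qed
    then have "(\<Sum>i\<in>UNIV. p2 i 2 x) = c * (\<Sum>i\<in>UNIV. P2 (Suc 0) i y)"
      by (simp add: sum_distrib_left)
    moreover have "1 - a0 * b x = \<psi> 0 y / a y"
      using ap[of y] by (simp add: \<psi>0 b_def y_def field_simps)
    then have "c * (1 - a0 * b x) = c * (\<psi> 0 y / a y)" by (rule arg_cong)
    ultimately have "c * (1 - a0 * b x) - (\<Sum>i\<in>UNIV. p2 i 2 x) = - c * ((\<Sum>i\<in>UNIV. P2 (Suc 0) i y) - \<psi> 0 y / a y)"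
      by (simp add: algebra_simps)
    then have "\<bar>c * (1 - a0 * b x) - (\<Sum>i\<in>UNIV. p2 i 2 x)\<bar> = \<bar>c\<bar> * \<bar>(\<Sum>i\<in>UNIV. P2 (Suc 0) i y) - \<psi> 0 y / a y\<bar>"
      by (simp only: abs_mult abs_minus_cancel)
    also have "\<dots> \<le> \<bar>c\<bar> * \<omega>" by (intro mult_left_mono \<psi>(7)) auto
    finally show ?thesis .
  qed
  have Pj: "\<bar>b x * p (Suc j) x - (\<Sum>i\<in>UNIV. p2 i (j + 3) x)\<bar> \<le> P j * (\<bar>c\<bar> * \<omega>)" for j x
  proof (cases "odd j")
    case False
    then show ?thesis using P0[of j] \<omega> by (simp add: p_def p2_def)
  next
    case True
    then obtain n where n: "j = 2 * n + 1" by (rule oddE)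
    define y where "y = x /\<^sub>R \<epsilon>"
    have "p2 i (j + 3) x = (c * \<epsilon> ^ (j + 1)) * P2 (Suc (Suc n)) i y" for i
    proof -
      have "(j + 3) div 2 = Suc (Suc n)" "even (j + 3)" "2 \<le> j + 3" by (simp_all add: n)
      then have "p2 i (j + 3) x = (c * \<epsilon> ^ (j + 3) * inverse \<epsilon> * inverse \<epsilon>) * P2 (Suc (Suc n)) i y"
        unfolding p2_def y_def by (simp only: if_True simp_thms)
      also have "\<epsilon> ^ (j + 3) = \<epsilon> ^ ((j + 1) + 2)" by (rule arg_cong[where f = "\<lambda>n. \<epsilon> ^ n"]) simp
      finally show ?thesis unfolding canc .
    qed
    then have s2: "(\<Sum>i\<in>UNIV. p2 i (j + 3) x) = (c * \<epsilon> ^ (j + 1)) * (\<Sum>i\<in>UNIV. P2 (Suc (Suc n)) i y)"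
      by (simp add: sum_distrib_left)
    have "b x * p (Suc j) x = (c * \<epsilon> ^ (j + 1)) * (\<psi> (Suc n) y / a y)"
      by (simp add: p_def b_def n y_def)
    then have "b x * p (Suc j) x - (\<Sum>i\<in>UNIV. p2 i (j + 3) x) =
        (c * \<epsilon> ^ (j + 1)) * - ((\<Sum>i\<in>UNIV. P2 (Suc (Suc n)) i y) - \<psi> (Suc n) y / a y)"
      unfolding s2 by (simp add: algebra_simps)
    then have "\<bar>b x * p (Suc j) x - (\<Sum>i\<in>UNIV. p2 i (j + 3) x)\<bar> =
        (\<bar>c\<bar> * \<epsilon> ^ (j + 1)) * \<bar>(\<Sum>i\<in>UNIV. P2 (Suc (Suc n)) i y) - \<psi> (Suc n) y / a y\<bar>"
      using par(1) by (simp only: abs_mult abs_minus_cancel power_abs abs_of_pos)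
    also have "\<dots> \<le> (\<bar>c\<bar> * \<epsilon> ^ (j + 1)) * \<omega>" using par(1) by (intro mult_left_mono \<psi>(7)) auto
    finally show ?thesis by (simp add: P_def mult_ac)
  qed
  have even: "\<bar>pairing p k (2 * n + 2) t\<bar> \<le> S * (s0 * (\<bar>c\<bar> * \<epsilon> ^ (2 * n + 2) * C (n + 1)) + \<zeta>e)"
    if n: "n = j0 \<or> n = Suc j0" and t: "t \<in> {0..T}" for n t
    unfolding S_def s0_def vol_def
  proof (rule even_bound[where e = "\<bar>c\<bar> * \<omega>" and P = P and ?p1.0 = p1 and ?p2.0 = p2])
    show "exp 1 * (T\<^sup>2 * A * (2 * (rec_nat (P 0 + 1 + T) (\<lambda>j K. P (Suc j) + T * K) (2 * n))\<^sup>2 *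
        (\<omega>\<^sup>2 * (T\<^sup>2 * W) + (\<bar>c\<bar> * \<omega>)\<^sup>2 * (2 * R) ^ CARD('n)))) \<le> (2 * R) ^ CARD('n) * \<zeta>e\<^sup>2"
      using small[OF n] unfolding Kr_def vol_def .
    show "\<bar>p (2 * n + 2) x\<bar> \<le> \<bar>c\<bar> * \<epsilon> ^ (2 * n + 2) * C (n + 1)" for x
      using mult_left_mono[OF \<psi>(2)[of "n + 1" "x /\<^sub>R \<epsilon>"], of "\<bar>c\<bar> * \<epsilon> ^ (2 * n + 2)"] par(1)
      by (simp add: p_def abs_mult)
    show "k x = 0" if "x \<notin> micro_box x0 (R - 2 * \<kappa> - sqrt A * T)" for x
      using k(5)[of x] that by (simp add: R_def)
  qed (use p odd odd2 e2 Pj P0 k \<zeta>e t in auto)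
  have C\<epsilon>: "0 \<le> \<bar>c\<bar> * \<epsilon> ^ (q + 2) * C j" for j using C0 par(1) by auto
  have main: "\<bar>pairing p k (q + 2) t\<bar> \<le> S * (s0 * (9 * C (j0 + 1) + 9 * C (j0 + 2))) * \<bar>c\<bar> * \<epsilon> ^ (q + 2) + \<zeta>"
    if t: "t \<in> {0..T}" for t
  proof -
    define E where "E = \<bar>c\<bar> * \<epsilon> ^ (q + 2)"
    have E0: "E \<ge> 0" using par(1) by (simp add: E_def)
    have le\<zeta>: "S * (8 / \<epsilon> + \<epsilon> / 4 + 1) * \<zeta>e \<le> \<zeta>"
    proof -
      have "S * (8 / \<epsilon> + \<epsilon> / 4 + 1) * \<zeta>e \<le> (S * (8 / \<epsilon> + \<epsilon> / 4 + 1) + 1) * \<zeta>e" using \<zeta>e by (simp add: algebra_simps)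
      also have "\<dots> = \<zeta>" using den2 by (simp add: \<zeta>e_def)
      finally show ?thesis .
    qed
    \<comment> \<open>The 9 rounds up the interpolation weights 8 and 1/4, so that both parities of
      q share one constant.\<close>
    have "\<bar>pairing p k (q + 2) t\<bar> \<le> S * (s0 * (E * (9 * C (j0 + 1) + 9 * C (j0 + 2)))) + S * (8 / \<epsilon> + \<epsilon> / 4 + 1) * \<zeta>e"
    proof (cases "even q")
      case True
      then have q: "q + 2 = 2 * j0 + 2" by (auto simp: j0_def)
      have "\<bar>pairing p k (q + 2) t\<bar> \<le> S * (s0 * (E * C (j0 + 1)) + \<zeta>e)"
        using even[OF disjI1[OF refl] t] by (simp only: q[symmetric] E_def)
      also have "\<dots> \<le> S * (s0 * (E * (9 * C (j0 + 1) + 9 * C (j0 + 2))) + (8 / \<epsilon> + \<epsilon> / 4 + 1) * \<zeta>e)"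
      proof (intro mult_left_mono[OF add_mono] mult_left_mono S0 s0 E0)
        show "C (j0 + 1) \<le> 9 * C (j0 + 1) + 9 * C (j0 + 2)" using C0[of "j0+1"] C0[of "j0+2"] by linarith
        have "1 * \<zeta>e \<le> (8 / \<epsilon> + \<epsilon> / 4 + 1) * \<zeta>e" using \<zeta>e par(1) by (intro mult_right_mono) auto
        then show "\<zeta>e \<le> (8 / \<epsilon> + \<epsilon> / 4 + 1) * \<zeta>e" by simp
      qed
      finally show ?thesis by (simp only: distrib_left[of S "s0 * (E * (9 * C (j0 + 1) + 9 * C (j0 + 2)))"] mult.assoc)
    next
      case False
      then have q: "q = 2 * j0 + 1" by (simp add: j0_def)
      define H2 where "H2 = S * (s0 * (E * \<epsilon> * C (j0 + 2)) + \<zeta>e)"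
      define H0 where "H0 = S * (s0 * (E / \<epsilon> * C (j0 + 1)) + \<zeta>e)"
      have b2: "\<bar>pairing p k (q + 3) r\<bar> \<le> H2" if r: "r \<in> {0..T}" for r
      proof -
        have i: "2 * Suc j0 + 2 = q + 3" "Suc j0 + 1 = j0 + 2" by (simp_all add: q)
        have "\<bar>c\<bar> * \<epsilon> ^ (q + 3) = E * \<epsilon>" by (simp add: E_def power_add power2_eq_square power3_eq_cube)
        then show ?thesis using even[OF disjI2[OF refl] r] unfolding i H2_def by (simp only:)
      qed
      have b0: "\<bar>pairing p k (q + 1) r\<bar> \<le> H0" if r: "r \<in> {0..T}" for r
      proof -
        have i: "2 * j0 + 2 = q + 1" by (simp add: q)
        have "\<bar>c\<bar> * \<epsilon> ^ (q + 1) = E / \<epsilon>" using par(1) by (simp add: E_def power_add power2_eq_square)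
        then show ?thesis using even[OF disjI1[OF refl] r] unfolding i H0_def by (simp only:)
      qed
      \<comment> \<open>A step proportional to \<epsilon> balances the neighbours of sizes
        \<epsilon>^(q + 3) and \<epsilon>^(q + 1). It is admissible since \<epsilon> < \<eta> gives
        \<epsilon> / 4 \<le> T / 2.\<close>
      have "\<bar>pairing p k (q + 2) t\<bar> \<le> 2 * H2 / (\<epsilon> / 4) + \<epsilon> / 4 * H0"
      proof (rule landau_interpolation[OF _ _ b2 b0 _ _ t])
        show "(pairing p k (q + 3) has_real_derivative pairing p k (q + 2) r) (at r within {0..T})" if "r \<in> {0..T}" for r
          using pairing_derivative[where j = "q + 2", OF p(1) k(1) that] by (simp add: numeral_eq_Suc)
        show "(pairing p k (q + 2) has_real_derivative pairing p k (q + 1) r) (at r within {0..T})" if "r \<in> {0..T}" for r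
          using pairing_derivative[where j = "q + 1", OF p(1) k(1) that] by (simp add: numeral_eq_Suc)
        show "\<epsilon> / 4 \<le> T / 2" using par by (simp add: T_def)
      qed (use par in auto)
      also have "\<dots> = S * (s0 * (E * (8 * C (j0 + 2) + C (j0 + 1) / 4))) + S * (8 / \<epsilon> + \<epsilon> / 4) * \<zeta>e"
        using par(1) by (simp add: H2_def H0_def field_simps)
      also have "\<dots> \<le> S * (s0 * (E * (9 * C (j0 + 1) + 9 * C (j0 + 2)))) + S * (8 / \<epsilon> + \<epsilon> / 4 + 1) * \<zeta>e"
      proof (rule add_mono)
        have "8 * C (j0 + 2) + C (j0 + 1) / 4 \<le> 9 * C (j0 + 1) + 9 * C (j0 + 2)" using C0[of "j0+1"] C0[of "j0+2"] by linarith
        then show "S * (s0 * (E * (8 * C (j0 + 2) + C (j0 + 1) / 4))) \<le> S * (s0 * (E * (9 * C (j0 + 1) + 9 * C (j0 + 2))))"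
          by (intro mult_left_mono S0 s0 E0)
        have "8 / \<epsilon> + \<epsilon> / 4 \<le> 8 / \<epsilon> + \<epsilon> / 4 + 1" by simp
        then show "S * (8 / \<epsilon> + \<epsilon> / 4) * \<zeta>e \<le> S * (8 / \<epsilon> + \<epsilon> / 4 + 1) * \<zeta>e"
          using \<zeta>e S0 by (intro mult_right_mono mult_left_mono) simp_all
      qed
      finally show ?thesis .
    qed
    also have "\<dots> \<le> S * (s0 * (E * (9 * C (j0 + 1) + 9 * C (j0 + 2)))) + \<zeta>" using le\<zeta> by simp
    also have "S * (s0 * (E * (9 * C (j0 + 1) + 9 * C (j0 + 2)))) = S * (s0 * (9 * C (j0 + 1) + 9 * C (j0 + 2))) * \<bar>c\<bar> * \<epsilon> ^ (q + 2)"
      unfolding E_def by (simp only: mult_ac)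
    finally show ?thesis .
  qed
  have kD: "k x = 0" if "x \<notin> micro_box x0 (R - \<kappa>)" for x
  proof (rule k(5))
    have "micro_box x0 (\<eta> / 2 - 2 * \<kappa>) \<subseteq> micro_box x0 (R - \<kappa>)" using Rl k(2) by (intro micro_box_mono) auto
    then show "x \<notin> micro_box x0 (\<eta> / 2 - 2 * \<kappa>)" using that by blast
  qed
  have one: "integral (micro_box x0 l) kk = 1"
    unfolding kk_def by (rule scaled_kernel_vec_integral[OF K(1,2,4) \<eta> order_trans[OF Rl]])
  have cmp: "\<bar>pairing p k 0 t - ((LINT x|lebesgue_on (micro_box x0 l). kk x * w t x) - a0 * c)\<bar> \<le> \<zeta>" if t: "t \<in> {0..T}" for t
  proof -
    have "\<bar>pairing p k 0 t - ((LINT x|lebesgue_on (micro_box x0 l). kk x * w t x) - a0 * c)\<bar> \<le> (e' + e') * L + \<bar>a0 * c\<bar> * (e' * V)"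
      unfolding L_def V_def
    proof (rule pairing_initial_compare[OF k(1) kD ckk k(6) _ one t])
      show "\<bar>k x - k y\<bar> \<le> e'" if n: "\<And>i. \<bar>x $ i - y $ i\<bar> \<le> \<delta>" for x y
        by (rule \<delta>1(2)) (use n \<delta>(2) order_trans in blast)
    qed
    also have "\<dots> = e' * (2 * L + \<bar>a0 * c\<bar> * V)" by (simp add: algebra_simps)
    also have "\<dots> \<le> e' * (2 * L + \<bar>a0 * c\<bar> * V + 1)" using e' by (intro mult_left_mono) auto
    also have "\<dots> = \<zeta>" using den by (simp add: e'_def)
    finally show ?thesis .
  qed
  have "continuous_on {0..T} (pairing p k 0)" by (rule pairing_continuous[OF p(1) k(1)])
  moreover have "(pairing p k (Suc j) has_real_derivative pairing p k j t) (at t within {0..T})" if "t \<in> {0..T}" for j t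
    by (rule pairing_derivative[OF p(1) k(1) that])
  moreover have "pairing p k j 0 = 0" if "odd j" for j
    using odd(2)[OF that] that by (intro pairing_initial) (auto intro: Nat.gr0I)
  ultimately show ?thesis
    using main cmp unfolding T_def[symmetric] S_def k0vol s0_def j0_def kk_def
    by (intro exI[of _ "pairing p k"]) simp
qed

lemma lebesgue_on_integral_continuous:
  fixes f :: "'a::euclidean_space \<Rightarrow> real"
  assumes "continuous_on (cbox p r) f"
  shows "(LINT x|lebesgue_on (cbox p r). f x) = integral (cbox p r) f"
proof (rule lebesgue_integral_eq_integral)
  show "integrable (lebesgue_on (cbox p r)) f"
    using absolutely_integrable_continuous[OF assms] unfolding set_integrable_def
    by (subst integrable_restrict_space) simp_all
qed simp

text \<open>Time is rescaled to the support of \<open>K\<close>, where the averaging bound applies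
  to the approximate chain. Its order 0 and the true error integrand differ by at most \<zeta>,
  which then tends to 0 for fixed \<epsilon>, \<eta> and u.\<close>

lemma upscaled_error:
  fixes a uhat :: "real^'n \<Rightarrow> real" and u :: "real \<Rightarrow> real^'n \<Rightarrow> real" and x0 :: "real^'n"
  assumes K: "continuous_on UNIV K" "\<And>t. 1/2 < \<bar>t\<bar> \<Longrightarrow> K t = 0" "\<And>t. \<bar>K t\<bar> \<le> Km" "integral {-1/2..1/2} K = 1"
    and BK: "0 \<le> BK" "\<forall>f H. continuous_on {0..1/2} (f 0) \<longrightarrow>
      (\<forall>j t. j < q + 2 \<longrightarrow> t \<in> {0..1/2} \<longrightarrow> (f (Suc j) has_real_derivative f j t) (at t within {0..1/2})) \<longrightarrow>
      (\<forall>j. odd j \<longrightarrow> f j 0 = 0) \<longrightarrow> (\<forall>t. t \<in> {0..1/2} \<longrightarrow> \<bar>f (q + 2) t\<bar> \<le> H) \<longrightarrow>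
      \<bar>integral {-1/2..1/2} (\<lambda>t. K t * f 0 \<bar>t\<bar>)\<bar> \<le> BK * H"
    and a: "continuous_on UNIV a" "\<And>x. m \<le> a x" "0 < m" "\<And>x. a x \<le> A"
    and cor: "\<forall>d. 0 < d \<longrightarrow> d \<le> 1 \<longrightarrow> (\<exists>\<psi> D1 D2. \<psi> 0 = (\<lambda>x. a x - a0) \<and>
      (\<forall>j. continuous_on UNIV (\<psi> j) \<and> (\<forall>x. \<bar>\<psi> j x\<bar> \<le> C j) \<and>
        (\<forall>i. continuous_on UNIV (D1 (Suc j) i) \<and> continuous_on UNIV (D2 (Suc j) i) \<and>
          has_partial i (\<psi> (Suc j)) (D1 (Suc j) i) \<and> has_partial i (D1 (Suc j) i) (D2 (Suc j) i)) \<and>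
        (\<forall>x. \<bar>(\<Sum>i\<in>UNIV. D2 (Suc j) i x) - \<psi> j x / a x\<bar> \<le> d)))"
    and par: "0 < \<epsilon>" "\<epsilon> < \<eta>" "\<eta> / 2 + \<eta> / 2 * sqrt A \<le> l"
    and u: "solves_micro a \<epsilon> \<eta> l x0 uhat u"
    and uhat: "continuous_on UNIV uhat" "\<And>i. continuous_on UNIV (U1 i)" "\<And>i. has_partial i uhat (U1 i)"
      "\<And>i. has_partial i (U1 i) (\<lambda>x. dd i)" "c = (\<Sum>i\<in>UNIV. dd i)"
  shows "\<bar>upscaled K a \<epsilon> \<eta> \<eta> l x0 u - a0 * c\<bar> \<le> BK * ((Km * (1 + sqrt A)) ^ CARD('n) * (1 + A) / 2 *
       (sqrt (exp 1 * (1 / m)) * (9 * C (q div 2 + 1) + 9 * C (q div 2 + 2)))) * (\<epsilon> / \<eta>) ^ (q + 2) * \<bar>c\<bar>"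
    (is "_ \<le> BK * ?G * _ * _")
proof -
  have \<eta>: "0 < \<eta>" using par by simp
  have Km: "Km \<ge> 0" using K(3)[of 0] by linarith
  define B where "B = micro_box x0 l"
  have B: "B \<in> lmeasurable" "B \<in> sets lebesgue" by (simp_all add: B_def micro_box_def)
  obtain v w where vw': "has_L2_derivative {0..\<eta>/2} (micro_box x0 l) u v \<and>
        has_L2_derivative {0..\<eta>/2} (micro_box x0 l) v w \<and>
        L2_continuous {0..\<eta>/2} (micro_box x0 l) w \<and>
        (\<forall>t\<in>{0..\<eta>/2}. periodic_with (2 * l) (\<lambda>x. u t x - uhat x)) \<and>
        (\<forall>t\<in>{0..\<eta>/2}. \<exists>g. has_weak_laplacian (u t) g) \<and>
        (\<forall>t\<in>{0<..\<eta>/2}. AE x in lebesgue_on (micro_box x0 l). w t x = a (x /\<^sub>R \<epsilon>) * weak_laplacian (u t) x) \<and>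
        (AE x in lebesgue_on (micro_box x0 l). u 0 x = uhat x) \<and>
        (AE x in lebesgue_on (micro_box x0 l). v 0 x = 0)"
    using u[unfolded solves_micro_def] by (elim exE) (rule that)
  note uv = conjunct1[OF vw'] and vw2 = conjunct2[OF vw']
  note vw = conjunct1[OF vw2] and vw3 = conjunct2[OF vw2]
  note w = conjunct1[OF vw3] and vw5 = conjunct2[OF conjunct2[OF vw3]]
  note ex = conjunct1[OF vw5] and vw6 = conjunct2[OF vw5]
  note eq = conjunct1[OF vw6] and u0 = conjunct1[OF conjunct2[OF vw6]] and v0 = conjunct2[OF conjunct2[OF vw6]]
  have lap: "\<exists>g. has_weak_laplacian (u t) g \<and> (AE x in lebesgue_on (micro_box x0 l). w t x = a (x /\<^sub>R \<epsilon>) * g x)"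
    if "t \<in> {0<..\<eta>/2}" for t
  proof -
    have "has_weak_laplacian (u t) (weak_laplacian (u t))"
      unfolding weak_laplacian_def by (rule someI_ex[of "has_weak_laplacian (u t)"]) (use ex that in auto)
    then show ?thesis using eq that by blast
  qed
  define kk where "kk x = scaled_kernel_vec K \<eta> (x - x0)" for x
  define \<Phi> where "\<Phi> t = (LINT x|lebesgue_on (micro_box x0 l). kk x * w t x)" for t
  note props = scaled_kernel_vec_props[OF K(1-3) \<eta>, where 'n = 'n]
  have ckk: "continuous_on UNIV kk"
    unfolding kk_def by (intro continuous_on_compose2[OF props(1)] continuous_intros) auto
  \<comment> \<open>\<open>\<Phi> t\<close> is the value at \<open>x0\<close> of \<open>w t\<close>
    mollified with the reflected averaging kernel, so continuity in time is already known.\<close>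
  have c\<Phi>: "continuous_on {0..\<eta>/2} \<Phi>"
  proof -
    have "continuous_on UNIV (\<lambda>z :: real^'n. scaled_kernel_vec K \<eta> (- z))"
      by (intro continuous_on_compose2[OF props(1)] continuous_intros) auto
    then have "jointly_continuous (\<eta>/2) (\<lambda>t. mol B (\<lambda>z. scaled_kernel_vec K \<eta> (- z)) (w t))"
      using L2_continuous_L1[OF B(1) w[folded B_def]] by (intro mol_jointly_continuous[OF _ props(2) B(2)])
    from jointly_continuous_time[OF this, of x0] show ?thesis
      by (simp add: mol_def \<Phi>_def[abs_def] kk_def B_def)
  qed
  have ups: "upscaled K a \<epsilon> \<eta> \<eta> l x0 u = integral {-1/2..1/2} (\<lambda>\<sigma>. K \<sigma> * \<Phi> (\<eta> * \<bar>\<sigma>\<bar>))"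
  proof (rule upscaled_eq[OF K(1) \<eta> _ _ ckk kk_def \<Phi>_def c\<Phi>])
    show "AE x in lebesgue_on (micro_box x0 l). w t x = a (x /\<^sub>R \<epsilon>) * weak_laplacian (u t) x" if "t \<in> {0<..\<eta>/2}" for t
      using eq that by blast
    show "w t \<in> borel_measurable (lebesgue_on (micro_box x0 l))" if "t \<in> {0..\<eta>/2}" for t
      using w that by (auto simp: L2_continuous_def square_integrable_on_def)
  qed
  have in_range: "\<eta> * \<bar>\<sigma>\<bar> \<in> {0..\<eta>/2}" if "\<sigma> \<in> {-1/2..1/2}" for \<sigma>
  proof -
    have "\<bar>\<sigma>\<bar> \<le> 1/2" using that by auto
    then have "\<eta> * \<bar>\<sigma>\<bar> \<le> \<eta> * (1/2)" using \<eta> by (intro mult_left_mono) auto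
    then show ?thesis using \<eta> by simp
  qed
  have comp: "continuous_on {-1/2..1/2} (\<lambda>\<sigma>. K \<sigma> * h (\<eta> * \<bar>\<sigma>\<bar>))" if "continuous_on {0..\<eta>/2} h" for h
    by (intro continuous_intros continuous_on_subset[OF K(1)] continuous_on_compose2[OF that]) (use in_range in auto)
  have approx: "\<bar>upscaled K a \<epsilon> \<eta> \<eta> l x0 u - a0 * c\<bar> \<le> BK * ((?G * \<bar>c\<bar> * \<epsilon> ^ (q + 2) + \<zeta>) / \<eta> ^ (q + 2)) + \<zeta> * Km"
    if \<zeta>: "0 < \<zeta>" for \<zeta>
  proof -
    obtain f where f: "continuous_on {0..\<eta>/2} (f 0)"
      "\<And>j t. t \<in> {0..\<eta>/2} \<Longrightarrow> (f (Suc j) has_real_derivative f j t) (at t within {0..\<eta>/2})"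
      "\<And>j. odd j \<Longrightarrow> f j 0 = (0::real)"
      "\<And>t. t \<in> {0..\<eta>/2} \<Longrightarrow> \<bar>f (q + 2) t\<bar> \<le> ?G * \<bar>c\<bar> * \<epsilon> ^ (q + 2) + \<zeta>"
      "\<And>t. t \<in> {0..\<eta>/2} \<Longrightarrow> \<bar>f 0 t - (\<Phi> t - a0 * c)\<bar> \<le> \<zeta>"
      using chain_approximation[OF K a cor par uv vw w lap u0 v0 uhat \<zeta>, of q] unfolding \<Phi>_def kk_def by blast
    \<comment> \<open>Each antiderivative on the rescaled interval gains a factor 1 / \<eta>; order
      q + 2 turns \<epsilon>^(q + 2) into (\<epsilon> / \<eta>)^(q + 2).\<close>
    define F where "F j \<sigma> = f j (\<eta> * \<sigma>) / \<eta> ^ j" for j \<sigma>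
    have r: "\<eta> * \<sigma> \<in> {0..\<eta>/2}" if "\<sigma> \<in> {0..1/2}" for \<sigma>
      using in_range[of \<sigma>] that by simp
    have main: "\<bar>integral {-1/2..1/2} (\<lambda>\<sigma>. K \<sigma> * F 0 \<bar>\<sigma>\<bar>)\<bar> \<le> BK * ((?G * \<bar>c\<bar> * \<epsilon> ^ (q + 2) + \<zeta>) / \<eta> ^ (q + 2))"
    proof (intro BK(2)[rule_format])
      show "continuous_on {0..1/2} (F 0)" unfolding F_def
        by (intro continuous_intros continuous_on_compose2[OF f(1)]) (use r in auto)
      show "(F (Suc j) has_real_derivative F j \<sigma>) (at \<sigma> within {0..1/2})" if s: "\<sigma> \<in> {0..1/2}" for j \<sigma>
      proof -
        have "((\<lambda>\<sigma>. f (Suc j) (\<eta> * \<sigma>)) has_real_derivative f j (\<eta> * \<sigma>) * \<eta>) (at \<sigma> within {0..1/2})"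
        proof -
          have "(f (Suc j) has_real_derivative f j (\<eta> * \<sigma>)) (at (\<eta> * \<sigma>) within (\<lambda>\<sigma>. \<eta> * \<sigma>) ` {0..1/2})"
            by (rule DERIV_subset[OF f(2)[OF r[OF s]]]) (use r in auto)
          then show ?thesis
            by (rule DERIV_image_chain[unfolded o_def]) (auto intro!: derivative_eq_intros)
        qed
        then have "((\<lambda>\<sigma>. f (Suc j) (\<eta> * \<sigma>) / \<eta> ^ Suc j) has_real_derivative f j (\<eta> * \<sigma>) * \<eta> / \<eta> ^ Suc j) (at \<sigma> within {0..1/2})"
          by (rule DERIV_cdivide)
        then show ?thesis using \<eta> by (simp add: F_def[abs_def])
      qed
      show "F j 0 = 0" if "odd j" for j using f(3)[OF that] by (simp add: F_def)
      show "\<bar>F (q + 2) \<sigma>\<bar> \<le> (?G * \<bar>c\<bar> * \<epsilon> ^ (q + 2) + \<zeta>) / \<eta> ^ (q + 2)" if "\<sigma> \<in> {0..1/2}" for \<sigma>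
      proof -
        have "\<bar>F (q + 2) \<sigma>\<bar> = \<bar>f (q + 2) (\<eta> * \<sigma>)\<bar> / \<eta> ^ (q + 2)"
          using \<eta> by (simp only: F_def abs_divide power_abs abs_of_pos)
        then show ?thesis using f(4)[OF r[OF that]] \<eta> by (simp only:) (intro divide_right_mono, auto)
      qed
    qed
    have c1: "continuous_on {-1/2..1/2} (\<lambda>\<sigma>. K \<sigma> * \<Phi> (\<eta> * \<bar>\<sigma>\<bar>))" by (rule comp[OF c\<Phi>])
    have c2: "continuous_on {-1/2..1/2} (\<lambda>\<sigma>. K \<sigma> * f 0 (\<eta> * \<bar>\<sigma>\<bar>))" by (rule comp[OF f(1)])
    have c3: "continuous_on {-1/2..1/2} (\<lambda>\<sigma>. K \<sigma> * (a0 * c))" by (rule comp) auto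
    have "integral {-1/2..1/2} (\<lambda>\<sigma>. K \<sigma> * \<Phi> (\<eta> * \<bar>\<sigma>\<bar>)) - a0 * c - integral {-1/2..1/2} (\<lambda>\<sigma>. K \<sigma> * f 0 (\<eta> * \<bar>\<sigma>\<bar>)) =
        integral {-1/2..1/2} (\<lambda>\<sigma>. K \<sigma> * \<Phi> (\<eta> * \<bar>\<sigma>\<bar>) - K \<sigma> * (a0 * c) - K \<sigma> * f 0 (\<eta> * \<bar>\<sigma>\<bar>))"
    proof -
      have "integral {-1/2..1/2} (\<lambda>\<sigma>. K \<sigma> * (a0 * c)) = a0 * c" using K(4) by simp
      then show ?thesis
        by (simp only: Henstock_Kurzweil_Integration.integral_diff
          integrable_continuous_interval[OF c1] integrable_continuous_interval[OF c2] integrable_continuous_interval[OF c3]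
          integrable_continuous_interval[OF continuous_on_diff[OF c1 c3]])
    qed
    also have "\<bar>\<dots>\<bar> \<le> \<zeta> * Km"
    proof -
      have "norm (integral {-1/2..1/2} (\<lambda>\<sigma>. K \<sigma> * \<Phi> (\<eta> * \<bar>\<sigma>\<bar>) - K \<sigma> * (a0 * c) - K \<sigma> * f 0 (\<eta> * \<bar>\<sigma>\<bar>))) \<le> (\<zeta> * Km) * (1/2 - -1/2)"
      proof (rule integral_bound)
        show "continuous_on {-1/2..1/2} (\<lambda>\<sigma>. K \<sigma> * \<Phi> (\<eta> * \<bar>\<sigma>\<bar>) - K \<sigma> * (a0 * c) - K \<sigma> * f 0 (\<eta> * \<bar>\<sigma>\<bar>))"
          by (intro continuous_on_diff c1 c2 c3)
        show "norm (K \<sigma> * \<Phi> (\<eta> * \<bar>\<sigma>\<bar>) - K \<sigma> * (a0 * c) - K \<sigma> * f 0 (\<eta> * \<bar>\<sigma>\<bar>)) \<le> \<zeta> * Km" if s: "\<sigma> \<in> {-1/2..1/2}" for \<sigma>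
        proof -
          have "K \<sigma> * \<Phi> (\<eta> * \<bar>\<sigma>\<bar>) - K \<sigma> * (a0 * c) - K \<sigma> * f 0 (\<eta> * \<bar>\<sigma>\<bar>) =
              - ((f 0 (\<eta> * \<bar>\<sigma>\<bar>) - (\<Phi> (\<eta> * \<bar>\<sigma>\<bar>) - a0 * c)) * K \<sigma>)"
            by (simp add: algebra_simps)
          then have "norm (K \<sigma> * \<Phi> (\<eta> * \<bar>\<sigma>\<bar>) - K \<sigma> * (a0 * c) - K \<sigma> * f 0 (\<eta> * \<bar>\<sigma>\<bar>)) =
              \<bar>f 0 (\<eta> * \<bar>\<sigma>\<bar>) - (\<Phi> (\<eta> * \<bar>\<sigma>\<bar>) - a0 * c)\<bar> * \<bar>K \<sigma>\<bar>"
            by (simp only: real_norm_def abs_minus_cancel abs_mult)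
          also have "\<dots> \<le> \<zeta> * Km" using f(5)[OF in_range[OF s]] K(3)[of \<sigma>] \<zeta> by (intro mult_mono) auto
          finally show ?thesis .
        qed
      qed simp
      then show ?thesis by simp
    qed
    finally show ?thesis using main unfolding ups F_def power_0 div_by_1 by linarith
  qed
  define G where "G = ?G"
  show ?thesis
  proof (rule field_le_epsilon)
    fix e :: real assume e: "0 < e"
    \<comment> \<open>M - 1 is the total factor of \<zeta> in \<open>approx\<close>, so \<zeta> = e
      / M contributes less than e.\<close>
    define M where "M = BK / \<eta> ^ (q + 2) + Km + 1"
    have M: "M > 0" unfolding M_def using BK(1) Km \<eta> by (intro add_nonneg_pos add_nonneg_nonneg) auto
    have "\<bar>upscaled K a \<epsilon> \<eta> \<eta> l x0 u - a0 * c\<bar> \<le> BK * ((G * \<bar>c\<bar> * \<epsilon> ^ (q + 2) + e / M) / \<eta> ^ (q + 2)) + e / M * Km"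
      unfolding G_def by (rule approx) (use e M in simp)
    also have "\<dots> = BK * G * (\<epsilon> / \<eta>) ^ (q + 2) * \<bar>c\<bar> + e / M * (M - 1)"
      unfolding M_def power_divide by (simp add: algebra_simps add_divide_distrib)
    also have "\<dots> \<le> BK * G * (\<epsilon> / \<eta>) ^ (q + 2) * \<bar>c\<bar> + e"
      using e M by (simp add: field_simps)
    finally show "\<bar>upscaled K a \<epsilon> \<eta> \<eta> l x0 u - a0 * c\<bar> \<le> BK * ?G * (\<epsilon> / \<eta>) ^ (q + 2) * \<bar>c\<bar> + e" unfolding G_def .
  qed
qed

theorem theorem2:
  fixes a :: "real^'n \<Rightarrow> real" and K :: "real \<Rightarrow> real" and p q :: nat
  assumes "CARD('n) \<in> {1, 2, 3}"
    and "K \<in> kernel_space p q"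
    and "smooth a" and "periodic_with 1 a" and "\<forall>x. 0 < a x" and "bounded (range a)"
  shows "\<exists>C::real. \<forall>L \<epsilon> \<eta> \<tau> l :: real. \<forall>uhat. \<forall>u :: real^'n \<Rightarrow> real \<Rightarrow> real^'n \<Rightarrow> real.
    0 < L \<and> 0 < \<epsilon> \<and> \<epsilon> < \<eta> \<and> \<tau> = \<eta> \<and>
    \<eta> / 2 + \<tau> / 2 * sqrt (sup_norm a) \<le> l \<and>
    quadratic_polynomial uhat \<and>
    (\<forall>x0\<in>closure (cube L). solves_micro a \<epsilon> \<tau> l x0 uhat (u x0)) \<longrightarrow>
    (SUP x0\<in>closure (cube L).
       ereal \<bar>upscaled K a \<epsilon> \<eta> \<tau> l x0 (u x0) - homogenized a x0 uhat\<bar>)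
      \<le> ereal (C * (\<epsilon> / \<eta>) ^ (q + 2) * sup_norm (laplacian uhat))"
proof -
  have K1: "continuous_on UNIV K" using kernel_space_continuous[OF assms(2), of 0 UNIV] by simp
  have K2: "K t = 0" if "1/2 < \<bar>t\<bar>" for t using kernel_space_supp(1)[OF assms(2) that] .
  have Kz: "K t = 0" if "t \<notin> cbox (-1/2) (1/2)" for t using K2[of t] that by (auto simp: abs_if)
  obtain Km where K3: "\<And>t. \<bar>K t\<bar> \<le> Km" using continuous_supported_bounded[OF K1 Kz] by blast
  have K4: "integral {-1/2..1/2} K = 1"
    using compact_support_integrable(3)[OF K1, of "-1/2" "1/2", OF Kz] assms(2) by (simp add: kernel_space_def)
  obtain BK where BK: "0 \<le> BK" "\<forall>f H. continuous_on {0..1/2} (f 0) \<longrightarrow>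
      (\<forall>j t. j < q + 2 \<longrightarrow> t \<in> {0..1/2} \<longrightarrow> (f (Suc j) has_real_derivative f j t) (at t within {0..1/2})) \<longrightarrow>
      (\<forall>j. odd j \<longrightarrow> f j 0 = 0) \<longrightarrow> (\<forall>t. t \<in> {0..1/2} \<longrightarrow> \<bar>f (q + 2) t\<bar> \<le> H) \<longrightarrow>
      \<bar>integral {-1/2..1/2} (\<lambda>t. K t * f 0 \<bar>t\<bar>)\<bar> \<le> BK * H"
    using kernel_space_time_average[OF assms(2)] by (elim exE conjE) (rule that)
  have ca: "continuous_on UNIV a" by (rule smooth_continuous[OF assms(3)])
  have aA: "a x \<le> sup_norm a" for x
  proof -
    have "bdd_above (range (\<lambda>x. \<bar>a x\<bar>))"
      using assms(6) unfolding bounded_iff by (auto intro: bdd_aboveI)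
    then have "\<bar>a x\<bar> \<le> sup_norm a" unfolding sup_norm_def by (rule cSUP_upper2) auto
    then show ?thesis by simp
  qed
  \<comment> \<open>Positivity becomes uniform: the minimum is attained on the unit cube, and
    periodicity reduces every point to the cube.\<close>
  obtain m where m: "0 < m" "\<And>x. m \<le> a x"
  proof -
    have "(0 :: real^'n) \<in> cube 1" by (simp add: cube_mem)
    then obtain y where y: "y \<in> cube 1" "\<And>z. z \<in> cube 1 \<Longrightarrow> a y \<le> a z"
      using continuous_attains_inf[of "cube 1" a] continuous_on_subset[OF ca] unfolding cube_def
      by (metis compact_cbox empty_iff subset_UNIV)
    show thesis
    proof
      show "0 < a y" using assms(5) by blast
      show "a y \<le> a x" for x
      proof -
        obtain z where z: "z \<in> cube 1" "torus_map z = torus_map x" using torus_map_cube by blast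
        then show ?thesis using y(2)[OF z(1)] torus_map_eqD[OF assms(4) z(2)] by simp
      qed
    qed
  qed
  define a0 where "a0 = inverse (integral (cube 1) (\<lambda>x. 1 / a x))"
  have hom: "homogenized_coeff a = a0"
  proof -
    have "a x \<noteq> 0" for x using assms(5) by (metis less_irrefl)
    then have "continuous_on UNIV (\<lambda>x. 1 / a x)" by (intro continuous_intros ca) auto
    then show ?thesis unfolding homogenized_coeff_def a0_def cube_def
      by (subst lebesgue_on_integral_continuous) (auto intro: continuous_on_subset)
  qed
  have dim: "CARD('n) \<le> 3" using assms(1) by auto
  \<comment> \<open>The last ingredient of the final constant. All of them, \<open>BK\<close>,
    \<open>Km\<close>, \<open>m\<close>, \<open>sup_norm a\<close> and \<open>C\<close>, are fixed
    before \<epsilon>, \<eta>, the polynomial and the solutions.\<close>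
  obtain C where cor: "\<forall>d. 0 < d \<longrightarrow> d \<le> 1 \<longrightarrow> (\<exists>\<psi> D1 D2. \<psi> 0 = (\<lambda>x. a x - a0) \<and>
      (\<forall>j. continuous_on UNIV (\<psi> j) \<and> (\<forall>x. \<bar>\<psi> j x\<bar> \<le> C j) \<and>
        (\<forall>i. continuous_on UNIV (D1 (Suc j) i) \<and> continuous_on UNIV (D2 (Suc j) i) \<and>
          has_partial i (\<psi> (Suc j)) (D1 (Suc j) i) \<and> has_partial i (D1 (Suc j) i) (D2 (Suc j) i)) \<and>
        (\<forall>x. \<bar>(\<Sum>i\<in>UNIV. D2 (Suc j) i x) - \<psi> j x / a x\<bar> \<le> d)))"
    using corrector_chain[OF dim ca assms(4) m(2,1) aA a0_def] by (elim exE) (rule that)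
  show ?thesis
  proof (intro exI allI impI, elim conjE)
    fix L \<epsilon> \<eta> \<tau> l uhat and u :: "real^'n \<Rightarrow> real \<Rightarrow> real^'n \<Rightarrow> real"
    assume par: "0 < \<epsilon>" "\<epsilon> < \<eta>" and \<tau>: "\<tau> = \<eta>" and l: "\<eta> / 2 + \<tau> / 2 * sqrt (sup_norm a) \<le> l"
      and uhat: "quadratic_polynomial uhat" and u: "\<forall>x0\<in>closure (cube L). solves_micro a \<epsilon> \<tau> l x0 uhat (u x0)"
    obtain c U1 dd where c: "laplacian uhat = (\<lambda>x. c)" and U: "continuous_on UNIV uhat" "\<And>i. continuous_on UNIV (U1 i)"
      "\<And>i. has_partial i uhat (U1 i)" "\<And>i. has_partial i (U1 i) (\<lambda>x. dd i)" "c = (\<Sum>i\<in>UNIV. dd i)"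
      using quadratic_polynomial_partials[OF uhat] by blast
    have sup: "sup_norm (laplacian uhat) = \<bar>c\<bar>" by (simp add: c sup_norm_def)
    show "(SUP x0\<in>closure (cube L). ereal \<bar>upscaled K a \<epsilon> \<eta> \<tau> l x0 (u x0) - homogenized a x0 uhat\<bar>)
      \<le> ereal (BK * ((Km * (1 + sqrt (sup_norm a))) ^ CARD('n) * (1 + sup_norm a) / 2 *
       (sqrt (exp 1 * (1 / m)) * (9 * C (q div 2 + 1) + 9 * C (q div 2 + 2)))) * (\<epsilon> / \<eta>) ^ (q + 2) * sup_norm (laplacian uhat))"
    proof (rule SUP_least)
      fix x0 :: "real^'n" assume "x0 \<in> closure (cube L)"
      then have s: "solves_micro a \<epsilon> \<eta> l x0 uhat (u x0)" using u \<tau> by blast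
      have "homogenized a x0 uhat = a0 * c" by (simp add: homogenized_def hom c)
      then show "ereal \<bar>upscaled K a \<epsilon> \<eta> \<tau> l x0 (u x0) - homogenized a x0 uhat\<bar>
        \<le> ereal (BK * ((Km * (1 + sqrt (sup_norm a))) ^ CARD('n) * (1 + sup_norm a) / 2 *
         (sqrt (exp 1 * (1 / m)) * (9 * C (q div 2 + 1) + 9 * C (q div 2 + 2)))) * (\<epsilon> / \<eta>) ^ (q + 2) * sup_norm (laplacian uhat))"
        unfolding sup \<tau> ereal_less_eq(3)
        using upscaled_error[where ?U1.0 = U1 and dd = dd and C = C and q = q, OF K1 K2 K3 K4 BK ca m(2,1) aA cor par l[unfolded \<tau>] s U] by simp
    qed
  qed
qed

end
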